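(* Assume that $X$ is complete and supports a $(1,p)$-Poincar\'e inequality, that $\mu$ is doubling and that $p>1$. Let $E\subset X$ be arbitrary. Then $$N^{1,p}_0(E)=N^{1,p}_0(\operatorname{fine-int}E),$$ where $\operatorname{fine-int}E$ is the fine interior of $E$.
   Context: $1\le p<\infty$ and $X=(X,d,\mu)$ is a metric space with a Borel regular measure $\mu$ (defined on the completion of the Borel $\sigma$-algebra) such that $0<\mu(B)<\infty$ for all balls $B=B(x,r)=\{y:d(x,y)<r\}$; $\lambda B=B(x,\lambda r)$. $\mu$ is doubling if $\mu(2B)\le C\mu(B)$ for all balls $B$ with a fixed $C$. Curves are nonconstant, compact and rectifiable, parameterized by arc length as $\gamma:[0,l_\gamma]\to X$. A property holds for $p$-almost every curve if the family $\Gamma$ of curves for which it fails has zero $p$-modulus, i.e. there is a nonnegative Borel $\rho\in L^p(X)$ with $\int_\gamma\rho\,ds=\infty$ for every $\gamma\in\Gamma$. A nonnegative Borel function $g$ is an upper gradient of $u:X\to[-\infty,\infty]$ if $|u(\gamma(0))-u(\gamma(l_\gamma))|\le\int_\gamma g\,ds$ for all curves $\gamma$ (the left-hand side is $\infty$ whenever both terms are infinite); a nonnegative measurable $g$ is a $p$-weak upper gradient if this holds for $p$-almost every curve. If $u$ has an upper gradient in $L^p_{\rm loc}(X)$ (local: each point has a ball on which the property holds), its minimal $p$-weak upper gradient $g_u\in L^p_{\rm loc}(X)$ is the (a.e. unique) $p$-weak upper gradient satisfying $g_u\le g$ a.e. for every $p$-weak upper gradient $g\in L^p_{\rm loc}(X)$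 of $u$. $N^{1,p}(X)$ is the set of everywhere defined measurable $u:X\to[-\infty,\infty]$ having an upper gradient in $L^p_{\rm loc}(X)$ with $\|u\|_{N^{1,p}(X)}=(\int_X|u|^p\,d\mu+\int_X g_u^p\,d\mu)^{1/p}<\infty$. $D^p_{\rm loc}(X)$: everywhere defined measurable functions which near each point (on some ball) have an upper gradient in $L^p$. $X$ supports a $(1,p)$-Poincar\'e inequality if there are $C>0$, $\lambda\ge1$ such that for all balls $B$ and all integrable $u\in D^p_{\rm loc}(X)$, $\frac1{\mu(B)}\int_B|u-u_B|\,d\mu\le C(\mathrm{diam}\,B)\bigl(\frac1{\mu(\lambda B)}\int_{\lambda B}g_u^p\,d\mu\bigr)^{1/p}$, where $u_B=\frac1{\mu(B)}\int_B u\,d\mu$. The capacity of $A\subset X$ is $C_p(A)=\inf\|u\|_{N^{1,p}(X)}^p$ over all $u\in N^{1,p}(X)$ with $u=1$ on $A$; q.e. means outside a set of $C_p$-capacity zero. For any $E\subset X$ (not necessarily measurable), $N^{1,p}_0(E)=\{h|_E: h\in N^{1,p}(X),\ h=0 \text{ on } X\setminus E\}$. Convention: functions in $N^{1,p}_0(E)$ are extended by zero q.e. in $X\setminus E$; thus the equality in the claim means that the functions $h\in N^{1,p}(X)$ vanishing q.e. in $X\setminus E$ are exactly the functions in $N^{1,p}(X)$ vanishing q.e. in $X\setminus\operatorname{fine-int}E$. For a nonempty bounded $G\subset X$ and $A\subset G$, the variational capacity is $\mathrm{cap}_p(A,G)=\inf\int_X g_u^p\,d\mu$ over all $u\in N^{1,p}_0(G)$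 (extended by $0$) with $u\ge1$ on $A$. A set $A$ is thin at $x$ if $$\int_0^1\Bigl(\frac{\mathrm{cap}_p(A\cap B(x,r),B(x,2r))}{\mathrm{cap}_p(B(x,r),B(x,2r))}\Bigr)^{1/(p-1)}\frac{dr}{r}<\infty ,$$ where the integrand is $1$ (by convention) whenever $\mathrm{cap}_p(B(x,r),B(x,2r))=0$. A set $U$ is finely open if $X\setminus U$ is thin at every $x\in U$; finely open sets form a topology. The fine interior of $E$ is the largest finely open set contained in $E$. *)

theory Defs
  imports "HOL-Analysis.Analysis"
begin

(* The metric space X is the universe of a type of class metric_space. Nonnegative extended
   functions (upper gradients) take values in ennreal, functions u : X -> [-infinity, infinity]
   take values in ereal. Integrals, norms and capacities are computed in ennreal,
   where the infimum of the empty set is infinity. *)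

(* Borel regular, on the completion of the Borel sigma-algebra: mu is the completion of its
   restriction to the Borel sets. Hence "measurable" below is measurability with respect to mu. *)
definition borel_regular :: "'a::metric_space measure \<Rightarrow> bool" where
  "borel_regular \<mu> \<longleftrightarrow> (\<exists>\<nu>. sets \<nu> = sets borel \<and> \<mu> = completion \<nu>)"

definition metric_measure_space :: "'a::metric_space measure \<Rightarrow> bool" where
  "metric_measure_space \<mu> \<longleftrightarrow> borel_regular \<mu> \<and>
     (\<forall>x r. r > 0 \<longrightarrow> 0 < emeasure \<mu> (ball x r) \<and> emeasure \<mu> (ball x r) < \<infinity>)"

definition doubling :: "'a::metric_space measure \<Rightarrow> bool" where
  "doubling \<mu> \<longleftrightarrow>
     (\<exists>C::real. \<forall>x r. r > 0 \<longrightarrow> emeasure \<mu> (ball x (2 * r)) \<le> ennreal C * emeasure \<mu> (ball x r))"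

(* Only used with exponents a > 0. *)
definition ennpowr :: "ennreal \<Rightarrow> real \<Rightarrow> ennreal" where
  "ennpowr x a = (if x = \<infinity> then \<infinity> else ennreal (enn2real x powr a))"

definition Lp_loc :: "real \<Rightarrow> 'a::metric_space measure \<Rightarrow> ('a \<Rightarrow> ennreal) set" where
  "Lp_loc p \<mu> = {g \<in> borel_measurable \<mu>.
     \<forall>x. \<exists>r>0. (\<integral>\<^sup>+y\<in>ball x r. ennpowr (g y) p \<partial>\<mu>) < \<infinity>}"

definition curve_length :: "(real \<Rightarrow> 'a::metric_space) \<Rightarrow> real \<Rightarrow> real \<Rightarrow> ennreal" where
  "curve_length \<gamma> a b = (SUP ts \<in> {ts. sorted ts \<and> set ts \<subseteq> {a..b}}.
     \<Sum>i<length ts - 1. ennreal (dist (\<gamma> (ts ! i)) (\<gamma> (ts ! Suc i))))"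

(* The nonconstant compact rectifiable curves, parameterized by arc length on [0,l]. The length
   condition makes gamma 1-Lipschitz, hence continuous, on [0,l], and nonconstant as l > 0.
   Values of gamma outside [0,l] are irrelevant. *)
definition arclength_curve :: "(real \<Rightarrow> 'a::metric_space) \<Rightarrow> real \<Rightarrow> bool" where
  "arclength_curve \<gamma> l \<longleftrightarrow> l > 0 \<and>
     (\<forall>s t. 0 \<le> s \<and> s \<le> t \<and> t \<le> l \<longrightarrow> curve_length \<gamma> s t = ennreal (t - s))"

(* If g is only mu-measurable, the composition with gamma is Lebesgue measurable for p-almost every
   curve; on the other curves this is a lower integral. *)
definition line_integral :: "('a \<Rightarrow> ennreal) \<Rightarrow> (real \<Rightarrow> 'a::metric_space) \<Rightarrow> real \<Rightarrow> ennreal" where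
  "line_integral g \<gamma> l = (\<integral>\<^sup>+t\<in>{0..l}. g (\<gamma> t) \<partial>lebesgue)"

definition p_almost_every_curve ::
  "real \<Rightarrow> 'a::metric_space measure \<Rightarrow> ((real \<Rightarrow> 'a) \<Rightarrow> real \<Rightarrow> bool) \<Rightarrow> bool" where
  "p_almost_every_curve p \<mu> P \<longleftrightarrow>
     (\<exists>\<rho> \<in> borel_measurable borel. (\<integral>\<^sup>+x. ennpowr (\<rho> x) p \<partial>\<mu>) < \<infinity> \<and>
        (\<forall>\<gamma> l. arclength_curve \<gamma> l \<and> \<not> P \<gamma> l \<longrightarrow> line_integral \<rho> \<gamma> l = \<infinity>))"

definition ext_diff :: "ereal \<Rightarrow> ereal \<Rightarrow> ennreal" where
  "ext_diff a b = (if \<bar>a\<bar> = \<infinity> \<and> \<bar>b\<bar> = \<infinity> then \<infinity> else e2ennreal \<bar>a - b\<bar>)"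

(* Upper gradients of the restriction of u to S; only used for open S (balls and the whole space),
   so that a Borel function on S extends by 0 to a Borel function on the space. *)
definition upper_gradient_on ::
  "'a::metric_space set \<Rightarrow> ('a \<Rightarrow> ereal) \<Rightarrow> ('a \<Rightarrow> ennreal) \<Rightarrow> bool" where
  "upper_gradient_on S u g \<longleftrightarrow> g \<in> borel_measurable borel \<and>
     (\<forall>\<gamma> l. arclength_curve \<gamma> l \<and> \<gamma> ` {0..l} \<subseteq> S \<longrightarrow>
        ext_diff (u (\<gamma> 0)) (u (\<gamma> l)) \<le> line_integral g \<gamma> l)"

abbreviation upper_gradient :: "('a::metric_space \<Rightarrow> ereal) \<Rightarrow> ('a \<Rightarrow> ennreal) \<Rightarrow> bool" where
  "upper_gradient \<equiv> upper_gradient_on UNIV"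

definition weak_upper_gradient ::
  "real \<Rightarrow> 'a::metric_space measure \<Rightarrow> ('a \<Rightarrow> ereal) \<Rightarrow> ('a \<Rightarrow> ennreal) \<Rightarrow> bool" where
  "weak_upper_gradient p \<mu> u g \<longleftrightarrow> g \<in> borel_measurable \<mu> \<and>
     p_almost_every_curve p \<mu> (\<lambda>\<gamma> l. ext_diff (u (\<gamma> 0)) (u (\<gamma> l)) \<le> line_integral g \<gamma> l)"

definition is_min_weak_upper_gradient ::
  "real \<Rightarrow> 'a::metric_space measure \<Rightarrow> ('a \<Rightarrow> ereal) \<Rightarrow> ('a \<Rightarrow> ennreal) \<Rightarrow> bool" where
  "is_min_weak_upper_gradient p \<mu> u g \<longleftrightarrow>
     weak_upper_gradient p \<mu> u g \<and> g \<in> Lp_loc p \<mu> \<and>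
     (\<forall>g'. weak_upper_gradient p \<mu> u g' \<and> g' \<in> Lp_loc p \<mu> \<longrightarrow> (AE x in \<mu>. g x \<le> g' x))"

(* A representative of g_u, which is unique up to sets of measure zero. It is only used for functions
   in the Newtonian space and in D^p_loc, for which it exists. *)
definition min_weak_upper_gradient ::
  "real \<Rightarrow> 'a::metric_space measure \<Rightarrow> ('a \<Rightarrow> ereal) \<Rightarrow> 'a \<Rightarrow> ennreal" where
  "min_weak_upper_gradient p \<mu> u = (SOME g. is_min_weak_upper_gradient p \<mu> u g)"

definition newtonian_norm :: "real \<Rightarrow> 'a::metric_space measure \<Rightarrow> ('a \<Rightarrow> ereal) \<Rightarrow> ennreal" where
  "newtonian_norm p \<mu> u =
     ennpowr ((\<integral>\<^sup>+x. ennpowr (e2ennreal \<bar>u x\<bar>) p \<partial>\<mu>)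
       + (\<integral>\<^sup>+x. ennpowr (min_weak_upper_gradient p \<mu> u x) p \<partial>\<mu>)) (1 / p)"

definition newtonian :: "real \<Rightarrow> 'a::metric_space measure \<Rightarrow> ('a \<Rightarrow> ereal) set" where
  "newtonian p \<mu> = {u \<in> borel_measurable \<mu>.
     (\<exists>g \<in> Lp_loc p \<mu>. upper_gradient u g) \<and> newtonian_norm p \<mu> u < \<infinity>}"

definition Dp_loc :: "real \<Rightarrow> 'a::metric_space measure \<Rightarrow> ('a \<Rightarrow> ereal) set" where
  "Dp_loc p \<mu> = {u \<in> borel_measurable \<mu>.
     \<forall>x. \<exists>r>0. \<exists>g. upper_gradient_on (ball x r) u g \<and>
       (\<integral>\<^sup>+y\<in>ball x r. ennpowr (g y) p \<partial>\<mu>) < \<infinity>}"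

(* Mean value over B; applied to integrable u, which are finite almost everywhere. *)
definition mean_value :: "'a::metric_space measure \<Rightarrow> ('a \<Rightarrow> ereal) \<Rightarrow> 'a set \<Rightarrow> real" where
  "mean_value \<mu> u B = (LINT x:B|\<mu>. real_of_ereal (u x)) / measure \<mu> B"

definition supports_poincare :: "real \<Rightarrow> 'a::metric_space measure \<Rightarrow> bool" where
  "supports_poincare p \<mu> \<longleftrightarrow> (\<exists>C::real. \<exists>\<Lambda>::real. C > 0 \<and> \<Lambda> \<ge> 1 \<and>
     (\<forall>z r u. r > 0 \<and> u \<in> Dp_loc p \<mu> \<and> (\<integral>\<^sup>+x. e2ennreal \<bar>u x\<bar> \<partial>\<mu>) < \<infinity> \<longrightarrow>
        (\<integral>\<^sup>+x\<in>ball z r. e2ennreal \<bar>u x - ereal (mean_value \<mu> u (ball z r))\<bar> \<partial>\<mu>)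
            / emeasure \<mu> (ball z r)
        \<le> ennreal (C * diameter (ball z r)) *
           ennpowr ((\<integral>\<^sup>+x\<in>ball z (\<Lambda> * r). ennpowr (min_weak_upper_gradient p \<mu> u x) p \<partial>\<mu>)
             / emeasure \<mu> (ball z (\<Lambda> * r))) (1 / p)))"

definition sobolev_capacity :: "real \<Rightarrow> 'a::metric_space measure \<Rightarrow> 'a set \<Rightarrow> ennreal" where
  "sobolev_capacity p \<mu> A =
     (INF u \<in> {u \<in> newtonian p \<mu>. \<forall>x\<in>A. u x = 1}. ennpowr (newtonian_norm p \<mu> u) p)"

definition quasieverywhere :: "real \<Rightarrow> 'a::metric_space measure \<Rightarrow> ('a \<Rightarrow> bool) \<Rightarrow> bool" where
  "quasieverywhere p \<mu> P \<longleftrightarrow> sobolev_capacity p \<mu> {x. \<not> P x} = 0"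

(* N^{1,p}_0(E), each element being identified with its extension by zero to the whole space. *)
definition newtonian0 :: "real \<Rightarrow> 'a::metric_space measure \<Rightarrow> 'a set \<Rightarrow> ('a \<Rightarrow> ereal) set" where
  "newtonian0 p \<mu> E = {h \<in> newtonian p \<mu>. \<forall>x. x \<notin> E \<longrightarrow> h x = 0}"

(* N^{1,p}_0(E) under the convention that its elements are extended by zero only q.e. outside E. This
   is what makes spaces for different sets E comparable. *)
definition newtonian0_qe :: "real \<Rightarrow> 'a::metric_space measure \<Rightarrow> 'a set \<Rightarrow> ('a \<Rightarrow> ereal) set" where
  "newtonian0_qe p \<mu> E =
     {h \<in> newtonian p \<mu>. quasieverywhere p \<mu> (\<lambda>x. x \<notin> E \<longrightarrow> h x = 0)}"

(* Meaningful for A a subset of the nonempty bounded set G. *)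
definition variational_capacity ::
  "real \<Rightarrow> 'a::metric_space measure \<Rightarrow> 'a set \<Rightarrow> 'a set \<Rightarrow> ennreal" where
  "variational_capacity p \<mu> A G =
     (INF u \<in> {u \<in> newtonian0 p \<mu> G. \<forall>x\<in>A. u x \<ge> 1}.
        \<integral>\<^sup>+x. ennpowr (min_weak_upper_gradient p \<mu> u x) p \<partial>\<mu>)"

(* The convention "the integrand is 1" concerns the integrand with respect to dr, i.e. it includes
   the factor 1/r. If the space has at least two points, it is relevant only for r bounded away from
   0, where omitting the factor makes no difference. In a one-point space, where all the capacities
   in the denominator vanish, it makes every set thin, so that every set is finely open. *)
definition thin_at :: "real \<Rightarrow> 'a::metric_space measure \<Rightarrow> 'a set \<Rightarrow> 'a \<Rightarrow> bool" where
  "thin_at p \<mu> A x \<longleftrightarrow>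
     (\<integral>\<^sup>+r\<in>{0<..<1}.
        (if variational_capacity p \<mu> (ball x r) (ball x (2 * r)) = 0 then 1
         else ennpowr (variational_capacity p \<mu> (A \<inter> ball x r) (ball x (2 * r))
                       / variational_capacity p \<mu> (ball x r) (ball x (2 * r))) (1 / (p - 1))
              / ennreal r) \<partial>lebesgue) < \<infinity>"

definition finely_open :: "real \<Rightarrow> 'a::metric_space measure \<Rightarrow> 'a set \<Rightarrow> bool" where
  "finely_open p \<mu> U \<longleftrightarrow> (\<forall>x\<in>U. thin_at p \<mu> (- U) x)"

definition fine_interior :: "real \<Rightarrow> 'a::metric_space measure \<Rightarrow> 'a set \<Rightarrow> 'a set" where
  "fine_interior p \<mu> E = \<Union>{U. finely_open p \<mu> U \<and> U \<subseteq> E}"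

end

(* Let h be a Newtonian function vanishing q.e. outside E. Up to a set of zero capacity, {h ~= 0} is finely
   open: where u = min 1 (n |h|) is mostly large on B(x,r), the relative capacity of {h = 0} in B(x,r) is at
   most a constant times r^p times the mean of g_u^p over a larger ball, and the dyadic sums of the
   1/(p-1)-th powers of these numbers form a Wolff potential, which is finite q.e. At quasievery point of {u = 1},
   u is mostly large on small balls: approximate u by Lipschitz functions, and bound the capacity of the set
   of points where a set of small capacity has positive density, by a De Giorgi iteration for the capacitary
   minimizer of that set. *)

theory Submission
  imports Defs
begin

section \<open>Powers of extended nonnegative numbers\<close>

text \<open>A function vanishing q.e. outside the fine interior vanishes q.e. outside the larger set
  \<open>E\<close>, so one inclusion is immediate. For the other one, thinness only sees capacities,
  so a set of capacity zero may be moved into the complement of \<open>{h ~= 0}\<close>. Every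
  exceptional set therefore must have capacity zero, and this is the obstacle: Lebesgue's theorem
  only discards sets of measure zero. A capacity bound needs a competitor that equals 1 at every
  point of the set. A minimizer that is bounded below almost everywhere on an open set supplies one,
  after a modification on that set which almost no curve notices. The Wolff potential comes from the
  exponent \<open>1 / (p - 1)\<close> in thinness. At small scales the capacity of
  \<open>B(x,r)\<close> in \<open>B(x,2r)\<close> is at least a constant times the measure of
  \<open>B(x,r)\<close> divided by \<open>r ^ p\<close>, so the capacity quotient raised to that
  exponent is bounded by a dyadic Wolff term of the energy measure. The truncations for all
  \<open>n\<close> are used together, because a point with \<open>h ~= 0\<close> needs one that
  equals 1 there.\<close>

lemma ennpowr_ennreal: "0 <= x ==> ennpowr (ennreal x) a = ennreal (x powr a)" by (simp add: ennpowr_def)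

lemma ennpowr_top [simp]: "ennpowr top a = top" by (simp add: ennpowr_def)

lemma ennpowr_0 [simp]: "ennpowr 0 a = 0" by (simp add: ennpowr_def)

lemma ennpowr_1 [simp]: "ennpowr 1 a = 1" by (simp add: ennpowr_def)

lemma ennpowr_eq_top_iff [simp]: "ennpowr x a = top \<longleftrightarrow> x = top" by (simp add: ennpowr_def)

lemma ennpowr_less_top_iff [simp]: "ennpowr x a < top \<longleftrightarrow> x < top"
  using ennpowr_eq_top_iff[of x a] by (metis less_top)

lemma ennpowr_eq_0_iff [simp]: "ennpowr x a = 0 \<longleftrightarrow> x = 0" by (cases x) (auto simp: ennpowr_ennreal)

lemma ennpowr_mono: "x <= y ==> 0 <= a ==> ennpowr x a <= ennpowr y a"
  by (cases x; cases y) (auto simp: ennpowr_ennreal powr_mono2 top_unique)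

lemma ennpowr_ennpowr: "ennpowr (ennpowr x a) b = ennpowr x (a * b)" by (cases x) (auto simp: ennpowr_ennreal powr_powr)

lemma ennpowr_one_exp [simp]: "ennpowr x 1 = x" by (cases x) (auto simp: ennpowr_ennreal)

lemma ennpowr_cmult:
  assumes "0 <= c" shows "ennpowr (ennreal c * x) a = ennreal (c powr a) * ennpowr x a" using assms by (cases x; cases "c = 0")
    (auto simp: ennpowr_ennreal powr_mult ennreal_mult ennreal_mult_top
        simp flip: ennreal_mult)

lemma ennpowr_measurable [measurable]: "(%x. ennpowr x a) \<in> borel_measurable borel" unfolding ennpowr_def by measurable


lemma ennpowr_inverse: "0 < a ==> ennpowr (ennpowr x a) (1 / a) = x" by (simp add: ennpowr_ennpowr)

lemma ennpowr_add_le: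
  assumes "0 <= a"
  shows "ennpowr (x + y) a <= ennreal (2 powr a) * (ennpowr x a + ennpowr y a)"
proof -
  have "x + y <= ennreal 2 * max x y" by (simp add: mult_2) (intro add_mono, auto)
  hence "ennpowr (x + y) a <= ennpowr (ennreal 2 * max x y) a" using assms by (rule ennpowr_mono)
  also have "... = ennreal (2 powr a) * ennpowr (max x y) a" by (simp only: ennpowr_cmult zero_le_numeral)
  also have "... <= ennreal (2 powr a) * (ennpowr x a + ennpowr y a)" by (intro mult_left_mono) (auto simp: max_def)
  finally show ?thesis .
qed

lemma ennpowr_SUP_le:
  assumes "0 < a" shows "ennpowr (SUP i\<in>I. f i) a <= (SUP i\<in>I. ennpowr (f i) a)"
proof -
  define T where "T = (SUP i\<in>I. ennpowr (f i) a)"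
  have "f i <= ennpowr T (1 / a)" if "i \<in> I" for i
  proof -
    have "ennpowr (ennpowr (f i) a) (1 / a) <= ennpowr T (1 / a)"
      using assms that by (intro ennpowr_mono) (auto simp: T_def intro: SUP_upper)
    thus ?thesis using ennpowr_inverse[OF assms] by simp
  qed
  hence "(SUP i\<in>I. f i) <= ennpowr T (1 / a)" by (rule SUP_least)
  hence "ennpowr (SUP i\<in>I. f i) a <= ennpowr (ennpowr T (1 / a)) a" using assms by (intro ennpowr_mono) auto
  also have "... = T" using assms by (simp add: ennpowr_ennpowr)
  finally show ?thesis by (simp add: T_def)
qed

lemma SUP_le_suminf_ennreal: "(SUP i. f i) <= (\<Sum>i. f i :: ennreal)"
  by (rule SUP_least) (use sum_le_suminf[of f "{i}" for i] in auto)

text \<open>The maximum of the numbers \<open>2 ^ (i + 1) * f i\<close> dominates their average with weights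
  \<open>2 ^ - (i + 1)\<close>.\<close>

lemma ennpowr_suminf_le:
  assumes "0 < a"
  shows "ennpowr (\<Sum>i. f i) a <= (\<Sum>i. ennreal ((2 powr a) ^ Suc i) * ennpowr (f i) a)"
proof -
  define T where "T = (SUP i. ennreal (2 ^ Suc i) * f i)"
  have 1: "f i <= ennreal ((1/2) ^ Suc i) * T" for i
  proof -
    have "f i = ennreal ((1/2) ^ Suc i) * (ennreal (2 ^ Suc i) * f i)"
      by (simp add: mult.assoc[symmetric] power_mult_distrib[symmetric] flip: ennreal_mult del: power_Suc)
    also have "... <= ennreal ((1/2) ^ Suc i) * T" unfolding T_def by (intro mult_left_mono SUP_upper) auto
    finally show ?thesis .
  qed
  have "(\<Sum>i. f i) <= (\<Sum>i. ennreal ((1/2) ^ Suc i) * T)" by (intro suminf_le 1) auto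
  also have "... = (\<Sum>i. ennreal ((1/2) ^ Suc i)) * T" by simp
  also have "(\<Sum>i. ennreal ((1/2) ^ Suc i)) = ennreal 1" using power_half_series by (intro suminf_ennreal_eq) auto
  finally have "(\<Sum>i. f i) <= T" by simp
  hence "ennpowr (\<Sum>i. f i) a <= ennpowr T a" using assms by (intro ennpowr_mono) auto
  also have "... <= (SUP i. ennpowr (ennreal (2 ^ Suc i) * f i) a)" unfolding T_def by (rule ennpowr_SUP_le) fact
  also have "... <= (\<Sum>i. ennpowr (ennreal (2 ^ Suc i) * f i) a)" by (rule SUP_le_suminf_ennreal)
  also have "... = (\<Sum>i. ennreal ((2 powr a) ^ Suc i) * ennpowr (f i) a)"
  proof (rule suminf_cong)
    fix i
    have "((2::real) ^ Suc i) powr a = (2 powr a) ^ Suc i" by (simp add: powr_realpow[symmetric] powr_powr mult.commute del: power_Suc)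
    thus "ennpowr (ennreal (2 ^ Suc i) * f i) a = ennreal ((2 powr a) ^ Suc i) * ennpowr (f i) a" by (subst ennpowr_cmult) auto
  qed
  finally show ?thesis .
qed

section \<open>Greedy selection of disjoint sets\<close>

text \<open>An index is selected unless it meets a selected index that comes earlier in the
  lexicographic order of \<open>gen\<close> and an arbitrary well-order. This order is well-founded,
  so the rule is a legitimate recursion for families of any cardinality, and whatever blocks an
  index has at most its \<open>gen\<close>.\<close>

lemma greedy_selection:
  fixes gen :: "'i => nat" and meets :: "'i => 'i => bool"
  assumes sym: "!!i j. meets i j ==> meets j i"
  obtains D where "D \<subseteq> I" "!!i j. i \<in> D ==> j \<in> D ==> i ~= j ==> \<not> meets i j"
    "!!i. i \<in> I ==> \<exists>j\<in>D. gen j <= gen i \<and> (meets i j \<or> i = j)"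
proof -
  obtain r :: "('i \<times> 'i) set" where r: "well_order_on UNIV r" using well_order_on by blast
  define R where "R = inv_image (less_than <*lex*> (r - Id)) (%i. (gen i, i))"
  have wfR: "wf R" unfolding R_def using r by (intro wf_inv_image wf_lex_prod) (auto simp: well_order_on_def)
  have R_iff: "(i, j) \<in> R \<longleftrightarrow> gen i < gen j \<or> gen i = gen j \<and> (i, j) \<in> r \<and> i ~= j" for i j
    by (auto simp: R_def)
  have tot: "(i, j) \<in> R \<or> (j, i) \<in> R" if "i ~= j" for i j
    using r that unfolding R_iff well_order_on_def linear_order_on_def total_on_def by force
  define F where "F = (%f i. \<forall>j\<in>I. (j, i) \<in> R --> f j --> \<not> meets i j)"
  define sel where "sel = wfrec R F"
  have sel: "sel i \<longleftrightarrow> (\<forall>j\<in>I. (j, i) \<in> R --> sel j --> \<not> meets i j)" for i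
  proof -
    have "sel i = F (cut sel R i) i" unfolding sel_def by (rule wfrec[OF wfR])
    thus ?thesis by (simp add: F_def cut_def)
  qed
  define D where "D = {i \<in> I. sel i}"
  show thesis
  proof
    show "D \<subseteq> I" by (auto simp: D_def)
    show "\<not> meets i j" if "i \<in> D" "j \<in> D" "i ~= j" for i j
      using that tot[of i j] sel[of i] sel[of j] sym by (auto simp: D_def)
    show "\<exists>j\<in>D. gen j <= gen i \<and> (meets i j \<or> i = j)" if "i \<in> I" for i
    proof (cases "sel i")
      case True
      thus ?thesis using that by (auto simp: D_def)
    next
      case False
      then obtain j where "j \<in> I" "(j, i) \<in> R" "sel j" "meets i j" using sel[of i] by auto
      thus ?thesis by (auto simp: D_def R_iff)
    qed
  qed
qed

lemma ball_meet_subset: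
  fixes x y :: "'a::metric_space"
  assumes "ball x r \<inter> ball y s ~= {}" "r <= s"
  shows "ball x r \<subseteq> ball y (3 * s)"
proof
  fix z assume z: "z \<in> ball x r"
  obtain w where "dist x w < r" "dist y w < s" using assms by auto
  moreover have "dist y z <= dist y w + dist x w + dist x z"
    by (metis add.commute add.left_commute dist_commute dist_triangle2 dist_triangle dual_order.trans add_le_cancel_left add.assoc)
  ultimately show "z \<in> ball y (3 * s)" using z assms(2) by auto
qed

text \<open>With radii \<open>R / 2 ^ j\<close> the exponent serves as \<open>gen\<close>, so larger
  balls are chosen first. A rejected ball meets a chosen one that is at least as large, and the
  enlargement factor 3 suffices.\<close>

lemma vitali_dyadic:
  fixes I :: "('a::metric_space \<times> nat) set"
  assumes "0 < R"
  obtains D where "D \<subseteq> I" "disjoint_family_on (%(x, j). ball x (R / 2 ^ j)) D"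
    "(\<Union>(x, j)\<in>I. ball x (R / 2 ^ j)) \<subseteq> (\<Union>(x, j)\<in>D. ball x (3 * (R / 2 ^ j)))"
proof -
  let ?B = "%(x::'a, j::nat). ball x (R / 2 ^ j)"
  obtain D where D: "D \<subseteq> I" "!!i j. i \<in> D ==> j \<in> D ==> i ~= j ==> \<not> (?B i \<inter> ?B j ~= {})"
    "!!i. i \<in> I ==> \<exists>j\<in>D. snd j <= snd i \<and> (?B i \<inter> ?B j ~= {} \<or> i = j)"
    by (rule greedy_selection[of "%i j. ?B i \<inter> ?B j ~= {}" I snd]) blast+
  show thesis
  proof
    show "D \<subseteq> I" by fact
    show "disjoint_family_on ?B D" using D(2) unfolding disjoint_family_on_def by blast
    show "(\<Union>(x, j)\<in>I. ball x (R / 2 ^ j)) \<subseteq> (\<Union>(x, j)\<in>D. ball x (3 * (R / 2 ^ j)))"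
    proof (clarify)
      fix z x and i :: nat assume xi: "(x, i) \<in> I" and z: "z \<in> ball x (R / 2 ^ i)"
      obtain y j where yj: "(y, j) \<in> D" "j <= i" "ball x (R / 2 ^ i) \<inter> ball y (R / 2 ^ j) ~= {} \<or> (x, i) = (y, j)"
        using D(3)[OF xi] by fastforce
      have "R / 2 ^ i <= R / 2 ^ j" using assms yj(2) by (intro divide_left_mono) (auto intro: power_increasing)
      moreover have "ball x (R / 2 ^ i) \<inter> ball y (R / 2 ^ j) ~= {}" using yj(3) z by auto
      ultimately have "z \<in> ball y (3 * (R / 2 ^ j))" using ball_meet_subset z by blast
      thus "z \<in> (\<Union>(x, j)\<in>D. ball x (3 * (R / 2 ^ j)))" using yj(1) by blast
    qed
  qed
qed

lemma add_less_le_mono_ennreal: "(a::ennreal) < b ==> c <= d ==> c < top ==> a + c < b + d"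
proof -
  assume *: "a < b" "c <= d" "c < top"
  hence "c + a < c + b" by (simp add: ennreal_add_left_cancel_less)
  also have "... <= d + b" using * by (intro add_right_mono)
  finally show ?thesis by (simp add: add.commute)
qed

section \<open>Functions with a gradient along an interval\<close>

definition seg :: "(real => ennreal) => real => real => ennreal" where
  "seg G s t = (\<integral>\<^sup>+\<tau>\<in>{s..t}. G \<tau> \<partial>lborel)"

text \<open>Absolute continuity with gradient \<open>G\<close>. The bound on all subintervals, not
  only on \<open>{0..l}\<close>, is what minima and locality need, and the finite integral makes
  \<open>f\<close> continuous.\<close>

definition acp :: "(real => real) => (real => ennreal) => real => bool" where
  "acp f G l \<longleftrightarrow> G \<in> borel_measurable borel \<and> seg G 0 l < \<infinity> \<and>
     (\<forall>s t. 0 <= s --> s <= t --> t <= l --> ennreal \<bar>f s - f t\<bar> <= seg G s t)"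

lemma seg_mono: "(!!\<tau>. s <= \<tau> ==> \<tau> <= t ==> G \<tau> <= H \<tau>) ==> seg G s t <= seg H s t"
  unfolding seg_def by (intro nn_integral_mono) (auto split: split_indicator)

lemma seg_cong: "(!!\<tau>. s <= \<tau> ==> \<tau> <= t ==> G \<tau> = H \<tau>) ==> seg G s t = seg H s t"
  unfolding seg_def by (intro nn_integral_cong) (auto split: split_indicator)

lemma seg_mono_AE:
  "AE \<tau> in lborel. s <= \<tau> --> \<tau> <= t --> G \<tau> <= H \<tau> ==> seg G s t <= seg H s t"
  unfolding seg_def by (intro nn_integral_mono_AE) (auto split: split_indicator elim!: eventually_mono)

lemma seg_subset: "s' <= s ==> t <= t' ==> seg G s t <= seg G s' t'"
  unfolding seg_def by (intro nn_integral_mono) (auto split: split_indicator)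

lemma seg_split:
  assumes [measurable]: "G \<in> borel_measurable borel" and "s <= t" "t <= w"
  shows "seg G s w = seg G s t + seg G t w"
proof -
  have "AE \<tau> in lborel. \<tau> ~= t" by (rule AE_lborel_singleton)
  hence "seg G s w = (\<integral>\<^sup>+\<tau>. G \<tau> * indicator {s..t} \<tau> + G \<tau> * indicator {t..w} \<tau> \<partial>lborel)"
    unfolding seg_def using assms(2,3) by (intro nn_integral_cong_AE) (auto split: split_indicator elim!: eventually_mono)
  also have "... = seg G s t + seg G t w" unfolding seg_def by (rule nn_integral_add) measurable
  finally show ?thesis .
qed

lemma seg_add:
  assumes [measurable]: "G \<in> borel_measurable borel" "H \<in> borel_measurable borel"
  shows "seg (%\<tau>. G \<tau> + H \<tau>) s t = seg G s t + seg H s t"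
  unfolding seg_def by (subst nn_integral_add[symmetric]) (auto intro!: nn_integral_cong simp: distrib_right)

lemma seg_small:
  assumes [measurable]: "G \<in> borel_measurable borel" and fin: "seg G 0 l < \<infinity>" and "0 < e"
  obtains \<delta> where "0 < \<delta>" "!!s t. 0 <= s ==> t <= l ==> s <= t ==> t - s < \<delta> ==> seg G s t < ennreal e"
proof -
  \<comment> \<open>\<open>F n\<close> is the part of \<open>G\<close> above height
    \<open>n\<close>. Its integral tends to 0 by monotone convergence, and what lies below height
    \<open>n\<close> contributes at most \<open>n * (t - s)\<close>. So \<open>n\<close> is chosen
    first and the length of the interval afterwards.\<close>
  define F where "F = (%(n::nat) t. (G t - min (G t) (of_nat n)) * indicator {0..l} t)"
  have m: "F n \<in> borel_measurable lborel" for n unfolding F_def by measurable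
  have "(INF n. \<integral>\<^sup>+t. F n t \<partial>lborel) = (\<integral>\<^sup>+t. (INF n. F n t) \<partial>lborel)"
  proof (rule nn_integral_monotone_convergence_INF_decseq[symmetric])
    show "decseq F" unfolding F_def
      by (intro decseq_SucI le_funI mult_right_mono ennreal_minus_mono min.mono order_refl of_nat_mono) auto
    show "F i \<in> borel_measurable lborel" for i by (rule m)
    have "(\<integral>\<^sup>+t. F 0 t \<partial>lborel) <= seg G 0 l"
      unfolding seg_def F_def by (intro nn_integral_mono) (auto split: split_indicator)
    thus "(\<integral>\<^sup>+t. F 0 t \<partial>lborel) < \<infinity>" using fin by auto
  qed
  also have "(\<integral>\<^sup>+t. (INF n. F n t) \<partial>lborel) = (\<integral>\<^sup>+t. 0 \<partial>(lborel :: real measure))"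
  proof (rule nn_integral_cong_AE)
    have "AE t in lborel. G t * indicator {0..l} t ~= \<infinity>"
      using fin unfolding seg_def by (intro nn_integral_noteq_infinite) auto
    thus "AE t in lborel. (INF n. F n t) = 0"
    proof (eventually_elim)
      case (elim t)
      show ?case
      proof (cases "t \<in> {0..l}")
        case True
        hence "G t < top" using elim by (auto simp: less_top)
        then obtain n :: nat where "G t <= of_nat n" using ennreal_Ex_less_of_nat[of "G t"] by (auto dest: less_imp_le)
        hence "G t - min (G t) (of_nat n) = 0" using \<open>G t < top\<close> by (simp add: min_absorb1 diff_eq_0_iff_ennreal)
        hence "F n t = 0" by (simp add: F_def)
        thus ?thesis by (metis INF_lower UNIV_I le_zero_eq)
      qed (auto simp: F_def)
    qed
  qed
  also have "... = 0" by simp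
  finally have inf0: "(INF n. \<integral>\<^sup>+t. F n t \<partial>lborel) < ennreal (e/2)" using \<open>0 < e\<close> by simp
  then obtain n where n: "(\<integral>\<^sup>+t. F n t \<partial>lborel) < ennreal (e/2)" by (auto simp: INF_less_iff)
  show thesis
  proof
    show "0 < e / (2 * (real n + 1))" using \<open>0 < e\<close> by simp
    fix s t assume st: "0 <= s" "t <= l" "s <= t" "t - s < e / (2 * (real n + 1))"
    have "seg G s t <= (\<integral>\<^sup>+\<tau>. F n \<tau> + of_nat n * indicator {s..t} \<tau> \<partial>lborel)" unfolding seg_def
    proof (rule nn_integral_mono)
      fix \<tau>
      show "G \<tau> * indicator {s..t} \<tau> <= F n \<tau> + of_nat n * indicator {s..t} \<tau>"
      proof (cases "\<tau> \<in> {s..t}")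
        case True
        have "G \<tau> = (G \<tau> - min (G \<tau>) (of_nat n)) + min (G \<tau>) (of_nat n)"
          by (rule diff_add_cancel_ennreal[symmetric]) simp
        also have "... <= (G \<tau> - min (G \<tau>) (of_nat n)) + of_nat n" by (intro add_left_mono) simp
        finally show ?thesis using True st by (simp add: F_def)
      qed simp
    qed
    also have "... = (\<integral>\<^sup>+\<tau>. F n \<tau> \<partial>lborel) + of_nat n * ennreal (t - s)"
      using st m by (subst nn_integral_add) (auto simp: nn_integral_cmult_indicator)
    also have "... < ennreal (e/2) + ennreal (e/2)"
    proof -
      have "real n * (t - s) <= (real n + 1) * (e / (2 * (real n + 1)))" using st by (intro mult_mono) auto
      also have "... = e / 2" by (simp add: field_simps)
      finally have "ennreal (real n * (t - s)) <= ennreal (e / 2)" by (rule ennreal_leI)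
      hence "of_nat n * ennreal (t - s) <= ennreal (e / 2)" by (simp add: ennreal_mult' ennreal_of_nat_eq_real_of_nat)
      thus "(\<integral>\<^sup>+\<tau>. F n \<tau> \<partial>lborel) + of_nat n * ennreal (t - s) < ennreal (e/2) + ennreal (e/2)"
        by (rule add_less_le_mono_ennreal[OF n]) (simp add: ennreal_mult_less_top of_nat_less_top)
    qed
    also have "... = ennreal e" using \<open>0 < e\<close> by (simp flip: ennreal_plus)
    finally show "seg G s t < ennreal e" .
  qed
qed


lemma acpD:
  assumes "acp f G l"
  shows "G \<in> borel_measurable borel" "seg G 0 l < \<infinity>"
    "!!s t. 0 <= s ==> s <= t ==> t <= l ==> ennreal \<bar>f s - f t\<bar> <= seg G s t" using assms by (auto simp: acp_def)

lemma acp_continuous: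
  assumes "acp f G l"
  shows "continuous_on {0..l} f"
proof (rule continuous_onI)
  fix x e :: real assume x: "x \<in> {0..l}" and e: "0 < e"
  obtain \<delta> where d: "0 < \<delta>"
    "!!s t. 0 <= s ==> t <= l ==> s <= t ==> t - s < \<delta> ==> seg G s t < ennreal e"
    using seg_small[OF acpD(1,2)[OF assms] e] by blast
  have *: "\<bar>f s - f t\<bar> < e" if "0 <= s" "t <= l" "s <= t" "t - s < \<delta>" for s t
  proof -
    have "ennreal \<bar>f s - f t\<bar> < ennreal e" using acpD(3)[OF assms, of s t] d(2)[of s t] that by (auto intro: le_less_trans)
    thus ?thesis by (auto simp: ennreal_less_iff)
  qed
  show "\<exists>d>0. \<forall>x'\<in>{0..l}. dist x' x < d --> dist (f x') (f x) <= e"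
  proof (intro exI conjI ballI impI)
    fix x' assume "x' \<in> {0..l}" "dist x' x < \<delta>"
    thus "dist (f x') (f x) <= e" using *[of x' x] *[of x x'] x by (cases "x' <= x") (auto simp: dist_real_def abs_minus_commute)
  qed fact
qed

text \<open>Every short interval lies in one of the open sets \<open>U\<close>, \<open>V\<close> approximating the sets where
  \<open>G1 <= G2\<close> and where \<open>G2 < G1\<close>, so the better of the two bounds may be used on it.\<close>

lemma acp_min:
  assumes 1: "acp f G1 l" and 2: "acp f G2 l"
  shows "acp f (%t. min (G1 t) (G2 t)) l"
proof -
  note [measurable] = acpD(1)[OF 1] acpD(1)[OF 2]
  let ?m = "%t. min (G1 t) (G2 t)"
  have fin: "seg ?m 0 l < \<infinity>" using seg_mono[of 0 l ?m G1] acpD(2)[OF 1] by (auto intro: le_less_trans)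
  have "ennreal \<bar>f s - f t\<bar> <= seg ?m s t" if st: "0 <= s" "s <= t" "t <= l" for s t
  proof (rule ennreal_le_epsilon)
    fix e :: real assume e: "0 < e"
    \<comment> \<open>\<open>M\<close> will be the finite measure with density
      \<open>G1 + G2\<close> on \<open>{0..l}\<close>. By its outer regularity, enlarging
      \<open>F1\<close> and \<open>F2\<close> to open sets costs less than \<open>e/2\<close> each,
      since on the enlargements either gradient is at most \<open>K\<close>.\<close>
    define K where "K = (%t. (G1 t + G2 t) * indicator {0..l} t)"
    define M where "M = density lborel K"
    have K[measurable]: "K \<in> borel_measurable borel" unfolding K_def by measurable
    have spM: "space M = UNIV" "sets M = sets borel" by (simp_all add: M_def)
    have emM: "emeasure M A = (\<integral>\<^sup>+\<tau>. K \<tau> * indicator A \<tau> \<partial>lborel)" if "A \<in> sets borel" for A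
      using that unfolding M_def by (subst emeasure_density) auto
    have "emeasure M UNIV = seg G1 0 l + seg G2 0 l"
      unfolding seg_add[OF acpD(1)[OF 1] acpD(1)[OF 2], symmetric] by (subst emM) (auto simp: seg_def K_def)
    hence finM: "finite_measure M" using acpD(2)[OF 1] acpD(2)[OF 2] spM by (intro finite_measureI) auto
    have appr: "\<exists>U. F \<subseteq> U \<and> open U \<and> emeasure M (U - F) < ennreal (e/2)" if F: "F \<in> sets borel" for F
    proof -
      interpret finite_measure M by fact
      have "emeasure M F = (INF U\<in>{U. F \<subseteq> U \<and> open U}. emeasure M U)"
        by (rule outer_regular) (use F emeasure_finite spM in auto)
      hence "(INF U\<in>{U. F \<subseteq> U \<and> open U}. emeasure M U) < emeasure M F + ennreal (e/2)"
      proof -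
        have "emeasure M F + 0 < emeasure M F + ennreal (e/2)"
          using e emeasure_finite[of F] by (subst ennreal_add_left_cancel_less) (auto simp: less_top)
        thus ?thesis
          using \<open>emeasure M F = (INF U\<in>{U. F \<subseteq> U \<and> open U}. emeasure M U)\<close> by (metis add_0_right)
      qed
      then obtain U where U: "F \<subseteq> U" "open U" "emeasure M U < emeasure M F + ennreal (e/2)" by (auto simp: INF_less_iff)
      have "emeasure M (U - F) + emeasure M F = emeasure M U"
        using F U by (subst plus_emeasure) (auto simp: M_def Un_absorb2 Un_absorb1 Un_commute)
      hence "emeasure M (U - F) < ennreal (e/2)" using U(3) by (metis add.commute ennreal_add_left_cancel_less)
      thus ?thesis using U by blast
    qed
    define F1 where "F1 = {t. G1 t <= G2 t}"
    define F2 where "F2 = {t. G2 t < G1 t}"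
    have [measurable]: "F1 \<in> sets borel" "F2 \<in> sets borel" unfolding F1_def F2_def by measurable
    obtain U where U: "F1 \<subseteq> U" "open U" "emeasure M (U - F1) < ennreal (e/2)" using appr[of F1] by auto
    obtain V where V: "F2 \<subseteq> V" "open V" "emeasure M (V - F2) < ennreal (e/2)" using appr[of F2] by auto
    have [measurable]: "U \<in> sets borel" "V \<in> sets borel" using U V by auto
    define H1 where "H1 = (%\<tau>. K \<tau> * indicator (U - F1) \<tau>)"
    define H2 where "H2 = (%\<tau>. K \<tau> * indicator (V - F2) \<tau>)"
    define H where "H = (%\<tau>. ?m \<tau> + (H1 \<tau> + H2 \<tau>))"
    have [measurable]: "H1 \<in> borel_measurable borel" "H2 \<in> borel_measurable borel" unfolding H1_def H2_def by measurable
    have [measurable]: "H \<in> borel_measurable borel" unfolding H_def by measurable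
    have "s <= a ==> b <= t ==> ennreal \<bar>f a - f b\<bar> <= seg H a b" if "a = s" "b = t" for a b
    proof (rule Bolzano[where P="%a b. s <= a --> b <= t --> ennreal \<bar>f a - f b\<bar> <= seg H a b", rule_format])
      show "a <= b" using that st by simp
      fix x assume "a <= x" "x <= b"
      have *: "\<exists>d>0. ball x d \<subseteq> U \<or> ball x d \<subseteq> V"
      proof (cases "G1 x <= G2 x")
        case True
        thus ?thesis using U open_contains_ball_eq[of U x] by (auto simp: F1_def)
      next
        case False
        hence "x \<in> V" using V by (auto simp: F2_def)
        thus ?thesis using V open_contains_ball_eq[of V x] by auto
      qed
      then obtain d where d: "0 < d" "ball x d \<subseteq> U \<or> ball x d \<subseteq> V" by blast
      show "\<exists>d>0. \<forall>a b. a <= x \<and> x <= b \<and> b - a < d --> s <= a --> b <= t -->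
          ennreal \<bar>f a - f b\<bar> <= seg H a b"
      proof (intro exI conjI allI impI)
        show "0 < d" by fact
        fix a b assume ab: "a <= x \<and> x <= b \<and> b - a < d" "s <= a" "b <= t"
        have sub: "{a..b} \<subseteq> ball x d" using ab by (auto simp: dist_real_def)
        have le1: "G1 \<tau> <= H \<tau>" if "\<tau> \<in> U" "a <= \<tau>" "\<tau> <= b" for \<tau>
        proof (cases "\<tau> \<in> F1")
          case True
          hence "min (G1 \<tau>) (G2 \<tau>) = G1 \<tau>" by (simp add: F1_def min_def)
          thus ?thesis by (simp add: H_def)
        next
          case False
          hence "H1 \<tau> = G1 \<tau> + G2 \<tau>" using that st ab by (simp add: H1_def K_def)
          hence "G1 \<tau> <= H1 \<tau>" by simp
          also have "... <= H \<tau>" unfolding H_def by (simp add: add_increasing add_increasing2)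
          finally show ?thesis .
        qed
        have le2: "G2 \<tau> <= H \<tau>" if "\<tau> \<in> V" "a <= \<tau>" "\<tau> <= b" for \<tau>
        proof (cases "\<tau> \<in> F2")
          case True
          hence "min (G1 \<tau>) (G2 \<tau>) = G2 \<tau>" by (simp add: F2_def min_absorb2 less_imp_le)
          thus ?thesis by (simp add: H_def)
        next
          case False
          hence "H2 \<tau> = G1 \<tau> + G2 \<tau>" using that st ab by (simp add: H2_def K_def)
          hence "G2 \<tau> <= H2 \<tau>" by simp
          also have "... <= H \<tau>" unfolding H_def by (simp add: add_increasing add_increasing2)
          finally show ?thesis .
        qed
        from d(2) show "ennreal \<bar>f a - f b\<bar> <= seg H a b"
        proof
          assume "ball x d \<subseteq> U"
          hence "seg G1 a b <= seg H a b" using sub by (intro seg_mono le1) auto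
          thus ?thesis using acpD(3)[OF 1, of a b] ab st by auto
        next
          assume "ball x d \<subseteq> V"
          hence "seg G2 a b <= seg H a b" using sub by (intro seg_mono le2) auto
          thus ?thesis using acpD(3)[OF 2, of a b] ab st by auto
        qed
      qed
    next
      fix a b c :: real
      assume le: "a <= b" "b <= c"
        and IH: "s <= a ==> b <= t ==> ennreal \<bar>f a - f b\<bar> <= seg H a b"
                "s <= b ==> c <= t ==> ennreal \<bar>f b - f c\<bar> <= seg H b c"
        and ac: "s <= a" "c <= t"
      have "ennreal \<bar>f a - f c\<bar> <= ennreal (\<bar>f a - f b\<bar> + \<bar>f b - f c\<bar>)" by (intro ennreal_leI) auto
      also have "... = ennreal \<bar>f a - f b\<bar> + ennreal \<bar>f b - f c\<bar>" by simp
      also have "... <= seg H a b + seg H b c" using le ac by (intro add_mono IH) auto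
      also have "... = seg H a c" using le by (subst seg_split[of H a b c]) auto
      finally show "ennreal \<bar>f a - f c\<bar> <= seg H a c" .
    qed (use that in auto)
    hence "ennreal \<bar>f s - f t\<bar> <= seg H s t" by blast
    also have "... = seg ?m s t + (seg H1 s t + seg H2 s t)" unfolding H_def by (simp add: seg_add)
    also have "seg H1 s t <= ennreal (e/2)"
    proof -
      have "seg H1 s t <= emeasure M (U - F1)"
        by (subst emM) (auto simp: seg_def H1_def intro!: nn_integral_mono split: split_indicator)
      thus ?thesis using U(3) by auto
    qed
    also have "seg H2 s t <= ennreal (e/2)"
    proof -
      have "seg H2 s t <= emeasure M (V - F2)"
        by (subst emM) (auto simp: seg_def H2_def intro!: nn_integral_mono split: split_indicator)
      thus ?thesis using V(3) by auto
    qed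
    also have "ennreal (e/2) + ennreal (e/2) = ennreal e" using e by (simp flip: ennreal_plus)
    finally show "ennreal \<bar>f s - f t\<bar> <= seg ?m s t + ennreal e" by (simp add: add_left_mono)
  qed
  thus ?thesis using fin by (auto simp: acp_def)
qed

text \<open>Between the first and the last time in \<open>{s..t}\<close> at which
  \<open>f = c\<close> the increment of \<open>f\<close> is zero, so this stretch costs nothing.
  Before and after it \<open>f\<close> avoids \<open>c\<close>, and there \<open>G <= H\<close>
  almost everywhere.\<close>

lemma acp_locality:
  assumes f: "acp f G l" and [measurable]: "H \<in> borel_measurable borel"
    and le: "AE t in lborel. 0 <= t --> t <= l --> f t ~= c --> G t <= H t"
    and HG: "!!t. 0 <= t ==> t <= l ==> H t <= G t"
  shows "acp f H l"
proof -
  have fin: "seg H 0 l < \<infinity>" using seg_mono[of 0 l H G] HG acpD(2)[OF f] by (auto intro: le_less_trans)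
  have "ennreal \<bar>f s - f t\<bar> <= seg H s t" if st: "0 <= s" "s <= t" "t <= l" for s t
  proof -
    have nz: "seg G a b <= seg H a b" if "0 <= a" "b <= l" "AE \<tau> in lborel. a <= \<tau> --> \<tau> <= b --> f \<tau> ~= c" for a b
      using that(3) le by (intro seg_mono_AE, eventually_elim) (use that in auto)
    define Z where "Z = {s..t} \<inter> f -` {c}"
    show ?thesis
    proof (cases "Z = {}")
      case True
      hence "seg G s t <= seg H s t" using st by (intro nz AE_I2) (auto simp: Z_def)
      thus ?thesis using acpD(3)[OF f, of s t] st by auto
    next
      case False
      have "closed Z" unfolding Z_def using acp_continuous[OF f] st
        by (intro continuous_closed_preimage) (auto intro: continuous_on_subset)
      moreover have "bounded Z" unfolding Z_def by (rule bounded_Int) auto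
      ultimately have Z: "compact Z" by (simp add: compact_eq_bounded_closed)
      obtain t1 where t1: "t1 \<in> Z" "!!\<tau>. \<tau> \<in> Z ==> t1 <= \<tau>" using compact_attains_inf[OF Z False] by auto
      obtain t2 where t2: "t2 \<in> Z" "!!\<tau>. \<tau> \<in> Z ==> \<tau> <= t2" using compact_attains_sup[OF Z False] by auto
      have ord: "s <= t1" "t1 <= t2" "t2 <= t" and c: "f t1 = c" "f t2 = c" using t1 t2 by (auto simp: Z_def)
      have "AE \<tau> in lborel. \<tau> ~= t1" by (rule AE_lborel_singleton)
      hence "AE \<tau> in lborel. s <= \<tau> --> \<tau> <= t1 --> f \<tau> ~= c"
      proof eventually_elim
        case (elim \<tau>)
        show ?case
        proof (intro impI notI)
          assume "s <= \<tau>" "\<tau> <= t1" "f \<tau> = c"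
          hence "\<tau> \<in> Z" using ord by (simp add: Z_def)
          thus False using t1(2)[of \<tau>] elim \<open>s <= \<tau>\<close> \<open>\<tau> <= t1\<close> by simp
        qed
      qed
      hence A: "seg G s t1 <= seg H s t1" using st ord by (intro nz) auto
      have "AE \<tau> in lborel. \<tau> ~= t2" by (rule AE_lborel_singleton)
      hence "AE \<tau> in lborel. t2 <= \<tau> --> \<tau> <= t --> f \<tau> ~= c"
      proof eventually_elim
        case (elim \<tau>)
        show ?case
        proof (intro impI notI)
          assume "t2 <= \<tau>" "\<tau> <= t" "f \<tau> = c"
          hence "\<tau> \<in> Z" using ord by (simp add: Z_def)
          thus False using t2(2)[of \<tau>] elim \<open>t2 <= \<tau>\<close> \<open>\<tau> <= t\<close> by simp
        qed
      qed
      hence B: "seg G t2 t <= seg H t2 t" using st ord by (intro nz) auto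
      have "ennreal \<bar>f s - f t\<bar> <= ennreal (\<bar>f s - f t1\<bar> + \<bar>f t2 - f t\<bar>)"
        using c by (intro ennreal_leI) auto
      also have "... = ennreal \<bar>f s - f t1\<bar> + ennreal \<bar>f t2 - f t\<bar>" by simp
      also have "... <= seg H s t1 + seg H t2 t" using acpD(3)[OF f, of s t1] acpD(3)[OF f, of t2 t] A B ord st by (intro add_mono) auto
      also have "... <= seg H s t1 + (seg H t1 t2 + seg H t2 t)" by (intro add_left_mono) auto
      also have "... = seg H s t" using ord by (simp add: seg_split[of H s t1 t] seg_split[of H t1 t2 t])
      finally show ?thesis .
    qed
  qed
  thus ?thesis using fin by (simp add: acp_def)
qed

lemma acp_decseq:
  assumes f: "!!n. acp f (G n) l" and dec: "!!n t. G (Suc n) t <= G n t"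
  shows "acp f (%t. INF n. G n t) l"
proof -
  have [measurable]: "G n \<in> borel_measurable borel" for n using acpD(1)[OF f] .
  have "seg (%t. INF n. G n t) 0 l <= seg (G 0) 0 l" by (intro seg_mono) (auto intro: INF_lower)
  hence fin: "seg (%t. INF n. G n t) 0 l < \<infinity>" using acpD(2)[OF f, of 0] by (auto intro: le_less_trans)
  have "ennreal \<bar>f s - f t\<bar> <= seg (%t. INF n. G n t) s t" if st: "0 <= s" "s <= t" "t <= l" for s t
  proof -
    have "seg (%t. INF n. G n t) s t = (\<integral>\<^sup>+\<tau>. (INF n. G n \<tau> * indicator {s..t} \<tau>) \<partial>lborel)"
      unfolding seg_def by (intro nn_integral_cong) (auto split: split_indicator)
    also have "... = (INF n. \<integral>\<^sup>+\<tau>. G n \<tau> * indicator {s..t} \<tau> \<partial>lborel)"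
    proof (rule nn_integral_monotone_convergence_INF_decseq)
      show "decseq (%n \<tau>. G n \<tau> * indicator {s..t} \<tau>)" by (intro decseq_SucI le_funI mult_right_mono dec) auto
      have "seg (G 0) s t <= seg (G 0) 0 l" using st by (intro seg_subset)
      thus "(\<integral>\<^sup>+\<tau>. G 0 \<tau> * indicator {s..t} \<tau> \<partial>lborel) < \<infinity>"
        using acpD(2)[OF f, of 0] by (auto simp: seg_def intro: le_less_trans)
    qed auto
    also have "ennreal \<bar>f s - f t\<bar> <= ..." using acpD(3)[OF f, of s t] st by (intro INF_greatest) (auto simp: seg_def)
    finally show ?thesis .
  qed
  thus ?thesis using fin by (simp add: acp_def)
qed

section \<open>Curves and exceptional families\<close>

lemma arclength_curve_dist:
  assumes "arclength_curve \<gamma> l" "0 <= s" "s <= t" "t <= l"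
  shows "dist (\<gamma> s) (\<gamma> t) <= t - s"
proof -
  have "ennreal (dist (\<gamma> s) (\<gamma> t)) = (\<Sum>i<length [s, t] - 1. ennreal (dist (\<gamma> ([s, t] ! i)) (\<gamma> ([s, t] ! Suc i))))"
    by simp
  also have "... <= curve_length \<gamma> s t" unfolding curve_length_def using assms by (intro SUP_upper) auto
  also have "... = ennreal (t - s)" using assms by (auto simp: arclength_curve_def)
  finally show ?thesis using assms by (simp add: ennreal_le_iff)
qed

lemma curve_length_shift_le:
  "curve_length (%\<tau>. \<gamma> (s + \<tau>)) a b <= curve_length \<gamma> (s + a) (s + b)" unfolding curve_length_def
proof (rule SUP_least)
  fix ts :: "real list" assume ts: "ts \<in> {ts. sorted ts \<and> set ts \<subseteq> {a..b}}"
  define us where "us = map ((+) s) ts"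
  have us: "us \<in> {ts. sorted ts \<and> set ts \<subseteq> {s + a..s + b}}"
    using ts by (auto simp: us_def sorted_map subset_eq intro!: sorted_wrt_mono_rel[of ts "(<=)"])
  have "(\<Sum>i<length ts - 1. ennreal (dist (\<gamma> (s + ts ! i)) (\<gamma> (s + ts ! Suc i))))
      = (\<Sum>i<length us - 1. ennreal (dist (\<gamma> (us ! i)) (\<gamma> (us ! Suc i))))" by (intro sum.cong) (auto simp: us_def)
  also have "... <= (SUP ts\<in>{ts. sorted ts \<and> set ts \<subseteq> {s + a..s + b}}.
      \<Sum>i<length ts - 1. ennreal (dist (\<gamma> (ts ! i)) (\<gamma> (ts ! Suc i))))" using us by (intro SUP_upper)
  finally show "(\<Sum>i<length ts - 1. ennreal (dist (\<gamma> (s + ts ! i)) (\<gamma> (s + ts ! Suc i)))) <= ..." .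
qed

lemma curve_length_shift:
  "curve_length (%\<tau>. \<gamma> (s + \<tau>)) a b = curve_length \<gamma> (s + a) (s + b)"
  using curve_length_shift_le[of \<gamma> s a b]
    curve_length_shift_le[of "%\<tau>. \<gamma> (s + \<tau>)" "- s" "s + a" "s + b"] by (simp add: antisym)

lemma arclength_curve_sub:
  assumes "arclength_curve \<gamma> l" "0 <= s" "s < t" "t <= l"
  shows "arclength_curve (%\<tau>. \<gamma> (s + \<tau>)) (t - s)" using assms by (auto simp: arclength_curve_def curve_length_shift)

text \<open>Values of a curve outside \<open>{0..l}\<close> are arbitrary. Extending it by its end
  points gives a continuous map on the whole line, so that compositions with Borel functions are
  Borel.\<close>

definition ext_curve :: "(real => 'a) => real => real => 'a" where
  "ext_curve \<gamma> l t = \<gamma> (max 0 (min l t))"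

lemma ext_curve_eq [simp]: "0 <= t ==> t <= l ==> ext_curve \<gamma> l t = \<gamma> t" by (simp add: ext_curve_def)

lemma ext_curve_continuous:
  assumes "arclength_curve \<gamma> l" shows "continuous_on UNIV (ext_curve \<gamma> l)"
proof (rule continuous_onI)
  fix x e :: real assume "0 < e"
  have l: "0 < l" using assms by (simp add: arclength_curve_def)
  have *: "dist (ext_curve \<gamma> l s) (ext_curve \<gamma> l t) <= t - s" if "s <= t" for s t unfolding ext_curve_def
    using arclength_curve_dist[OF assms, of "max 0 (min l s)" "max 0 (min l t)"] that l by linarith
  show "\<exists>d>0. \<forall>x'\<in>UNIV. dist x' x < d --> dist (ext_curve \<gamma> l x') (ext_curve \<gamma> l x) <= e"
  proof (intro exI conjI ballI impI)
    fix x' assume "dist x' x < e"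
    thus "dist (ext_curve \<gamma> l x') (ext_curve \<gamma> l x) <= e"
      using *[of x x'] *[of x' x] by (auto simp: dist_real_def dist_commute abs_if split: if_splits)
  qed fact
qed

lemma ext_curve_measurable:
  assumes "arclength_curve \<gamma> l" shows "ext_curve \<gamma> l \<in> borel_measurable borel"
  using ext_curve_continuous[OF assms] by (rule borel_measurable_continuous_onI)

lemma measurable_along:
  assumes "arclength_curve \<gamma> l" "g \<in> borel_measurable borel"
  shows "(%t. g (ext_curve \<gamma> l t)) \<in> borel_measurable borel"
  using measurable_compose[OF ext_curve_measurable[OF assms(1)] assms(2)] .

lemma line_integral_eq_seg: "line_integral g \<gamma> l = seg (%t. g (\<gamma> t)) 0 l"
  by (simp add: line_integral_def seg_def nn_integral_completion)

lemma seg_ext_curve: "0 <= s ==> t <= l ==> seg (%\<tau>. g (ext_curve \<gamma> l \<tau>)) s t = seg (%\<tau>. g (\<gamma> \<tau>)) s t"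
  by (rule seg_cong) simp

lemma line_integral_sub:
  assumes "arclength_curve \<gamma> l" "g \<in> borel_measurable borel" "0 <= s" "s <= t" "t <= l"
  shows "line_integral g (%\<tau>. \<gamma> (s + \<tau>)) (t - s) = seg (%\<tau>. g (\<gamma> \<tau>)) s t"
proof -
  note [measurable] = measurable_along[OF assms(1,2)]
  have "seg (%\<tau>. g (\<gamma> \<tau>)) s t = seg (%\<tau>. g (ext_curve \<gamma> l \<tau>)) s t"
    using assms by (intro seg_cong) auto
  also have "... = (\<integral>\<^sup>+\<tau>. g (ext_curve \<gamma> l (s + 1 * \<tau>)) * indicator {s..t} (s + 1 * \<tau>) \<partial>lborel)"
    unfolding seg_def by (subst nn_integral_real_affine[where c=1 and t=s]) auto
  also have "... = line_integral g (%\<tau>. \<gamma> (s + \<tau>)) (t - s)" unfolding line_integral_eq_seg seg_def using assms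
    by (intro nn_integral_cong) (auto split: split_indicator)
  finally show ?thesis by simp
qed

section \<open>Measure spaces: Borel representatives, sigma-finiteness, the Lindelof
  property\<close>

locale newtonian_space =
  fixes p :: real and \<mu> :: "'a::metric_space measure"
  assumes p1: "1 < p" and mms: "metric_measure_space \<mu>"
begin

abbreviation bmeas :: "('a => 'b::topological_space) set" where "bmeas \<equiv> borel_measurable \<mu>"

abbreviation vcap :: "'a set => 'a set => ennreal" where "vcap \<equiv> variational_capacity p \<mu>"

abbreviation lev :: "('a => real) => real => 'a => real => real" where
  "lev u k x r \<equiv> measure \<mu> ({y. u y < k} \<inter> ball x r)"

lemma p0: "0 < p" "0 <= p" using p1 by auto

lemma ball_pos: "0 < r ==> 0 < emeasure \<mu> (ball x r)" using mms by (simp add: metric_measure_space_def)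

lemma ball_finite: "emeasure \<mu> (ball x r) < \<infinity>"
proof (cases "0 < r")
  case True
  thus ?thesis using mms by (simp add: metric_measure_space_def)
next
  case False
  hence "ball x r = {}" by auto
  thus ?thesis by (simp only: emeasure_empty) simp
qed

lemma ex_completion: "\<exists>\<nu>. sets \<nu> = sets borel \<and> \<mu> = completion \<nu>"
  using mms by (auto simp: metric_measure_space_def borel_regular_def)

lemma space_mu [simp]: "space \<mu> = UNIV" using ex_completion by (metis space_borel sets_eq_imp_space_eq space_completion)

lemma borel_sets: "A \<in> sets borel ==> A \<in> sets \<mu>" using ex_completion by (metis sets_completionI_sets)

lemma ball_borel [measurable, simp]: "ball x r \<in> sets (borel :: 'b::metric_space measure)" by (intro borel_open open_ball)

lemma ball_sets [simp]: "ball x r \<in> sets \<mu>" by (intro borel_sets borel_open open_ball)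

lemma meas_mu: "f \<in> measurable borel N ==> f \<in> measurable \<mu> N" unfolding measurable_def by (auto intro: borel_sets)

lemma AE_borel_null:
  assumes "AE x in \<mu>. P x"
  obtains N where "N \<in> sets borel" "emeasure \<mu> N = 0" "!!x. x \<notin> N ==> P x"
proof -
  obtain \<nu> where \<nu>: "sets \<nu> = sets borel" "\<mu> = completion \<nu>" using ex_completion by blast
  from assms have "AE x in \<nu>. P x" unfolding \<nu>(2) AE_completion_iff .
  then obtain N where "{x \<in> space \<nu>. \<not> P x} \<subseteq> N" "emeasure \<nu> N = 0" "N \<in> sets \<nu>" by (rule AE_E)
  moreover have "space \<nu> = UNIV" using \<nu> by (metis space_completion space_mu)
  ultimately show thesis using that[of N] \<nu> by auto
qed

lemma ex_borel:
  fixes f :: "'a => ennreal"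
  assumes "f \<in> bmeas"
  obtains f' where "f' \<in> borel_measurable borel" "AE x in \<mu>. f' x = f x"
proof -
  obtain \<nu> where \<nu>: "sets \<nu> = sets borel" "\<mu> = completion \<nu>" using ex_completion by blast
  have "f \<in> borel_measurable (completion \<nu>)" using assms unfolding \<nu>(2) .
  then obtain f' where f': "f' \<in> borel_measurable \<nu>" "AE x in \<nu>. f x = f' x"
    using completion_ex_borel_measurable[of f \<nu>] by blast
  have "f' \<in> borel_measurable borel" using f'(1) unfolding measurable_cong_sets[OF \<nu>(1) refl] .
  thus thesis using that[of f'] f'(2) unfolding \<nu>(2) AE_completion_iff by (simp add: eq_commute)
qed

lemma ex_borel_set:
  assumes "A \<in> sets \<mu>"
  obtains S where "S \<in> sets borel" "AE x in \<mu>. x \<in> S \<longleftrightarrow> x \<in> A"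
proof -
  obtain f :: "'a => ennreal" where f: "f \<in> borel_measurable borel" "AE x in \<mu>. f x = indicator A x"
    by (rule ex_borel[of "indicator A"]) (use assms in auto)
  show thesis
  proof
    show "f -` {1} \<in> sets borel" using measurable_sets_borel[OF f(1), of "{1}"] by simp
    show "AE x in \<mu>. x \<in> f -` {1} \<longleftrightarrow> x \<in> A" using f(2) by eventually_elim (simp add: indicator_def)
  qed
qed

sublocale sigma_finite_measure \<mu>
proof
  fix x0 :: 'a
  show "\<exists>A. countable A \<and> A \<subseteq> sets \<mu> \<and> \<Union> A = space \<mu> \<and> (\<forall>a\<in>A. emeasure \<mu> a ~= \<infinity>)"
  proof (intro exI conjI)
    show "countable (range (%n::nat. ball x0 (real n)))" by simp
    show "\<Union> (range (%n::nat. ball x0 (real n))) = space \<mu>" by (auto simp: reals_Archimedean2)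
  qed (use ball_finite[of x0] in \<open>auto simp: less_top\<close>)
qed

text \<open>In a ball of finite measure the members of the family have summable measures, so only
  countably many of them are charged there. Countably many balls exhaust the space, and each member
  has positive measure.\<close>

lemma countable_disjoint_family:
  assumes "disjoint_family_on B D" "!!i. i \<in> D ==> B i \<in> sets \<mu>" "!!i. i \<in> D ==> 0 < emeasure \<mu> (B i)"
  shows "countable D"
proof -
  fix x0 :: 'a
  define f where "f = (%n i. measure \<mu> (B i \<inter> ball x0 (real n)))"
  have fn: "0 <= f n i" for n i by (simp add: f_def)
  have fm: "emeasure \<mu> (B i \<inter> ball x0 (real n)) = ennreal (f n i)" for n i
  proof -
    have "emeasure \<mu> (B i \<inter> ball x0 (real n)) <= emeasure \<mu> (ball x0 (real n))"
      by (intro emeasure_mono Int_lower2 borel_sets borel_open open_ball)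
    also have "... < top" using ball_finite by simp
    finally show ?thesis unfolding f_def by (intro emeasure_eq_ennreal_measure) simp
  qed
  have "countable {i \<in> D. f n i ~= 0}" for n
  proof -
    have bd: "sum (f n) F <= measure \<mu> (ball x0 (real n))" if F: "finite F" "F \<subseteq> D" for F
    proof -
      have "ennreal (sum (f n) F) = (\<Sum>i\<in>F. emeasure \<mu> (B i \<inter> ball x0 (real n)))"
        unfolding fm by (rule sum_ennreal[OF fn, symmetric])
      also have "... = emeasure \<mu> (\<Union>i\<in>F. B i \<inter> ball x0 (real n))"
      proof (rule sum_emeasure)
        show "(%i. B i \<inter> ball x0 (real n)) ` F \<subseteq> sets \<mu>"
          by (intro image_subsetI sets.Int ball_sets assms(2)) (rule subsetD[OF F(2)])
        show "disjoint_family_on (%i. B i \<inter> ball x0 (real n)) F" using F(2) assms(1) unfolding disjoint_family_on_def by blast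
      qed fact
      also have "... <= emeasure \<mu> (ball x0 (real n))" by (intro emeasure_mono ball_sets) blast
      also have "... = ennreal (measure \<mu> (ball x0 (real n)))"
        using ball_finite[of x0 "real n"] by (intro emeasure_eq_ennreal_measure) simp
      finally show ?thesis by (simp add: ennreal_le_iff)
    qed
    have "(f n) summable_on D"
    proof (rule nonneg_bdd_above_summable_on)
      show "bdd_above (sum (f n) ` {F. F \<subseteq> D \<and> finite F})" using bd by (intro bdd_aboveI2) blast
    qed (rule fn)
    thus ?thesis by (rule summable_countable_real)
  qed
  moreover have "D \<subseteq> (\<Union>n. {i \<in> D. f n i ~= 0})"
  proof
    fix i assume i: "i \<in> D"
    have "\<exists>n. f n i ~= 0"
    proof (rule ccontr)
      assume "\<not> (\<exists>n. f n i ~= 0)"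
      hence "emeasure \<mu> (\<Union>n. B i \<inter> ball x0 (real n)) = 0"
        using assms(2)[OF i] fm by (intro emeasure_UN_eq_0) (simp_all add: sets.Int image_subset_iff)
      moreover have "(\<Union>n. B i \<inter> ball x0 (real n)) = B i" by (auto simp: reals_Archimedean2)
      ultimately show False using assms(3)[OF i] by simp
    qed
    thus "i \<in> (\<Union>n. {i \<in> D. f n i ~= 0})" using i by auto
  qed
  moreover have "countable (\<Union>n. {i \<in> D. f n i ~= 0})"
    using \<open>!!n. countable {i \<in> D. f n i ~= 0}\<close> by (intro countable_UN) simp_all
  ultimately show ?thesis using countable_subset by blast
qed

text \<open>The Lindelof property, derived from the measure: for points whose radius exceeds
  \<open>1 / (n + 1)\<close>, a maximal family of disjoint balls of half that size is countable
  because each of its balls has positive measure, and the balls of radius \<open>r x\<close> about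
  its centres cover those points.\<close>

lemma countable_cover_balls:
  fixes r :: "'a => real"
  assumes "!!x. 0 < r x"
  obtains C where "countable C" "(\<Union>x\<in>C. ball x (r x)) = UNIV"
proof -
  define X where "X = (%n::nat. {x. 1 / real (Suc n) < r x})"
  have "\<exists>D\<subseteq>X n. countable D \<and> X n \<subseteq> (\<Union>x\<in>D. ball x (r x))" for n
  proof -
    let ?e = "1 / (2 * real (Suc n))"
    obtain D where D: "D \<subseteq> X n" "!!x y. x \<in> D ==> y \<in> D ==> x ~= y ==> \<not> (ball x ?e \<inter> ball y ?e ~= {})"
      "!!x. x \<in> X n ==> \<exists>y\<in>D. (0::nat) <= 0 \<and> (ball x ?e \<inter> ball y ?e ~= {} \<or> x = y)"
      by (rule greedy_selection[of "%x y. ball x ?e \<inter> ball y ?e ~= {}" "X n" "%_. 0"]) blast+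
    have "countable D"
    proof (rule countable_disjoint_family)
      show "disjoint_family_on (%x. ball x ?e) D" using D(2) by (auto simp: disjoint_family_on_def)
    qed (auto intro!: ball_pos)
    moreover have "X n \<subseteq> (\<Union>x\<in>D. ball x (r x))"
    proof
      fix x assume x: "x \<in> X n"
      then obtain y where y: "y \<in> D" "ball x ?e \<inter> ball y ?e ~= {} \<or> x = y" using D(3) by blast
      have "dist y x < r y"
      proof (cases "x = y")
        case False
        then obtain z where "dist x z < ?e" "dist y z < ?e" using y by auto
        hence "dist y x < ?e + ?e" by (smt (verit) dist_commute dist_triangle)
        also have "... = 1 / real (Suc n)" by (simp add: field_simps)
        finally show ?thesis using y(1) D(1) by (auto simp: X_def)
      qed (use assms in auto)
      thus "x \<in> (\<Union>x\<in>D. ball x (r x))" using y(1) by auto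
    qed
    ultimately show ?thesis using D(1) by blast
  qed
  then obtain D where D: "!!n. countable (D n)" "!!n. X n \<subseteq> (\<Union>x\<in>D n. ball x (r x))" by metis
  show thesis
  proof
    show "countable (\<Union>n. D n)" using D(1) by auto
    show "(\<Union>x\<in>(\<Union>n. D n). ball x (r x)) = UNIV"
    proof (intro set_eqI iffI UNIV_I)
      fix x
      obtain n where "1 / real (Suc n) < r x" using assms[of x] nat_approx_posE by blast
      hence "x \<in> X n" by (simp add: X_def)
      thus "x \<in> (\<Union>x\<in>(\<Union>n. D n). ball x (r x))" using D(2)[of n] by blast
    qed
  qed
qed

section \<open>Energies and families of curves of zero modulus\<close>

abbreviation pae :: "((real => 'a) => real => bool) => bool" where
  "pae \<equiv> p_almost_every_curve p \<mu>"

definition En :: "('a => ennreal) => ennreal" where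
  "En g = (\<integral>\<^sup>+x. ennpowr (g x) p \<partial>\<mu>)"

lemma ennpowr_mu [measurable]: "g \<in> bmeas ==> (%x. ennpowr (g x) a) \<in> bmeas"
  by (rule measurable_compose[OF _ ennpowr_measurable])

lemma En_mono_AE: "AE x in \<mu>. g x <= h x ==> En g <= En h"
  unfolding En_def using p0 by (intro nn_integral_mono_AE) (auto elim!: eventually_mono intro: ennpowr_mono)

lemma En_mono: "(!!x. g x <= h x) ==> En g <= En h" by (rule En_mono_AE) auto

lemma En_cong_AE: "AE x in \<mu>. g x = h x ==> En g = En h"
  unfolding En_def by (intro nn_integral_cong_AE) (auto elim!: eventually_mono)

lemma En_cmult: "0 <= c ==> g \<in> bmeas ==> En (%x. ennreal c * g x) = ennreal (c powr p) * En g"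
  unfolding En_def by (simp add: ennpowr_cmult nn_integral_cmult)

lemma En_add_le:
  assumes [measurable]: "g \<in> bmeas" "h \<in> bmeas"
  shows "En (%x. g x + h x) <= ennreal (2 powr p) * (En g + En h)"
proof -
  have "En (%x. g x + h x) <= (\<integral>\<^sup>+x. ennreal (2 powr p) * (ennpowr (g x) p + ennpowr (h x) p) \<partial>\<mu>)"
    unfolding En_def using p0 by (intro nn_integral_mono ennpowr_add_le)
  also have "... = ennreal (2 powr p) * (En g + En h)" unfolding En_def by (simp add: nn_integral_cmult nn_integral_add)
  finally show ?thesis .
qed

text \<open>Suprema satisfy this without a constant, because the power of a supremum is at most the
  supremum of the powers. Countable sums carry growing weights in \<open>En_suminf_le\<close>, which
  is why competitors for capacities are combined by suprema.\<close>

lemma En_SUP_le: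
  fixes g :: "nat => 'a => ennreal"
  assumes [measurable]: "!!n. g n \<in> bmeas"
  shows "En (%x. SUP n. g n x) <= (\<Sum>n. En (g n))"
proof -
  have "En (%x. SUP n. g n x) <= (\<integral>\<^sup>+x. (\<Sum>n. ennpowr (g n x) p) \<partial>\<mu>)" unfolding En_def using p0
    by (intro nn_integral_mono order_trans[OF ennpowr_SUP_le SUP_le_suminf_ennreal]) auto
  also have "... = (\<Sum>n. En (g n))" unfolding En_def by (rule nn_integral_suminf) measurable
  finally show ?thesis .
qed

lemma En_suminf_le:
  fixes g :: "nat => 'a => ennreal"
  assumes [measurable]: "!!n. g n \<in> bmeas"
  shows "En (%x. \<Sum>n. g n x) <= (\<Sum>n. ennreal ((2 powr p) ^ Suc n) * En (g n))"
proof -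
  have "En (%x. \<Sum>n. g n x) <= (\<integral>\<^sup>+x. (\<Sum>n. ennreal ((2 powr p) ^ Suc n) * ennpowr (g n x) p) \<partial>\<mu>)"
    unfolding En_def using p0 by (intro nn_integral_mono ennpowr_suminf_le) auto
  also have "... = (\<Sum>n. ennreal ((2 powr p) ^ Suc n) * En (g n))"
    unfolding En_def by (subst nn_integral_suminf) (auto simp: nn_integral_cmult)
  finally show ?thesis .
qed

lemma paeI:
  assumes "\<rho> \<in> borel_measurable borel" "En \<rho> < \<infinity>"
    "!!\<gamma> l. arclength_curve \<gamma> l ==> \<not> P \<gamma> l ==> line_integral \<rho> \<gamma> l = \<infinity>"
  shows "pae P" using assms unfolding p_almost_every_curve_def En_def by blast

lemma paeE:
  assumes "pae P"
  obtains \<rho> where "\<rho> \<in> borel_measurable borel" "En \<rho> < \<infinity>"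
    "!!\<gamma> l. arclength_curve \<gamma> l ==> \<not> P \<gamma> l ==> line_integral \<rho> \<gamma> l = \<infinity>"
  using assms unfolding p_almost_every_curve_def En_def by blast

lemma pae_mono:
  assumes "pae P" "!!\<gamma> l. arclength_curve \<gamma> l ==> P \<gamma> l ==> Q \<gamma> l"
  shows "pae Q" by (rule paeE[OF assms(1)], rule paeI) (use assms(2) in blast)+

lemma pae_Lp:
  assumes "g \<in> borel_measurable borel" "En g < \<infinity>"
  shows "pae (%\<gamma> l. line_integral g \<gamma> l < \<infinity>)" using assms by (intro paeI[of g]) (auto simp: less_top[symmetric])

lemma line_integral_mono: "(!!x. g x <= h x) ==> line_integral g \<gamma> l <= line_integral h \<gamma> l"
  unfolding line_integral_def by (intro nn_integral_mono mult_right_mono) auto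

lemma line_integral_cmult:
  assumes "arclength_curve \<gamma> l" "g \<in> borel_measurable borel"
  shows "line_integral (%x. c * g x) \<gamma> l = c * line_integral g \<gamma> l"
proof -
  note [measurable] = measurable_along[OF assms]
  have "line_integral (%x. c * g x) \<gamma> l = (\<integral>\<^sup>+\<tau>. c * (g (ext_curve \<gamma> l \<tau>) * indicator {0..l} \<tau>) \<partial>lborel)"
    unfolding line_integral_eq_seg seg_def by (intro nn_integral_cong) (auto split: split_indicator)
  also have "... = c * (\<integral>\<^sup>+\<tau>. g (ext_curve \<gamma> l \<tau>) * indicator {0..l} \<tau> \<partial>lborel)"
    by (rule nn_integral_cmult) measurable
  also have "... = c * line_integral g \<gamma> l" unfolding line_integral_eq_seg seg_def
    by (intro arg_cong[where f="times c"] nn_integral_cong) (auto split: split_indicator)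
  finally show ?thesis .
qed

text \<open>The factors \<open>e n\<close> absorb the growing weights of
  \<open>En_suminf_le\<close>: they make the \<open>n\<close>-th term of the series at most
  \<open>(1/2) ^ n\<close>.\<close>

lemma small_multiples:
  fixes c :: "nat => ennreal"
  assumes "!!n. c n < \<infinity>"
  obtains e :: "nat => real" where "!!n. 0 < e n"
    "(\<Sum>n. ennreal ((2 powr p) ^ Suc n) * (ennreal (e n powr p) * c n)) < \<infinity>"
proof -
  define e where "e = (%n. ((1/2)^n / ((2 powr p) ^ Suc n * (1 + enn2real (c n)))) powr (1 / p))"
  have pos: "0 < (2 powr p) ^ Suc n * (1 + enn2real (c n))" for n by (intro mult_pos_pos) (auto simp: add_pos_nonneg)
  have "ennreal ((2 powr p) ^ Suc n) * (ennreal (e n powr p) * c n) <= ennreal ((1/2)^n)" for n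
  proof -
    have ep: "e n powr p = (1/2)^n / ((2 powr p) ^ Suc n * (1 + enn2real (c n)))" using p0 pos[of n] by (simp add: e_def powr_powr)
    have "c n = ennreal (enn2real (c n))" using assms[of n] by simp
    hence "ennreal ((2 powr p) ^ Suc n) * (ennreal (e n powr p) * c n)
      = ennreal ((2 powr p) ^ Suc n * (e n powr p * enn2real (c n)))"
      by (metis ennreal_mult' ennreal_mult enn2real_nonneg powr_ge_zero zero_le_power mult_nonneg_nonneg)
    also have "(2 powr p) ^ Suc n * (e n powr p * enn2real (c n)) <= (1/2)^n"
    proof -
      define A where "A = (2 powr p) ^ Suc n"
      define k where "k = enn2real (c n)"
      have "0 < A" "0 <= k" "1 + k ~= 0" by (simp_all add: A_def k_def add_nonneg_eq_0_iff)
      hence "A * ((1/2)^n / (A * (1 + k)) * k) = (1/2)^n * (k / (1 + k))" by simp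
      also have "... <= (1/2)^n * 1" using \<open>0 <= k\<close> by (intro mult_left_mono) (auto simp: divide_le_eq_1)
      finally show ?thesis unfolding ep by (simp add: A_def k_def)
    qed
    finally show ?thesis by (simp add: ennreal_leI)
  qed
  hence "(\<Sum>n. ennreal ((2 powr p) ^ Suc n) * (ennreal (e n powr p) * c n)) <= (\<Sum>n. ennreal ((1/2)^n))"
    by (intro suminf_le) auto
  also have "... = ennreal (\<Sum>n. (1/2)^n)" by (intro suminf_ennreal2) auto
  also have "... < \<infinity>" by simp
  finally have "(\<Sum>n. ennreal ((2 powr p) ^ Suc n) * (ennreal (e n powr p) * c n)) < \<infinity>" .
  moreover have "0 < e n" for n using pos[of n] by (simp add: e_def add_nonneg_eq_0_iff)
  ultimately show thesis using that by blast
qed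

text \<open>A sum of positive multiples of the witnesses is a witness for all the families at once:
  it dominates a positive multiple of each of them, and the multiples can be chosen small enough to
  keep its energy finite.\<close>

lemma pae_countable:
  fixes P :: "nat => _"
  assumes "!!n. pae (P n)"
  shows "pae (%\<gamma> l. \<forall>n. P n \<gamma> l)"
proof -
  have "\<forall>n. \<exists>\<rho>. \<rho> \<in> borel_measurable borel \<and> En \<rho> < \<infinity> \<and>
      (\<forall>\<gamma> l. arclength_curve \<gamma> l --> \<not> P n \<gamma> l --> line_integral \<rho> \<gamma> l = \<infinity>)"
  proof
    fix n show "\<exists>\<rho>. \<rho> \<in> borel_measurable borel \<and> En \<rho> < \<infinity> \<and>
      (\<forall>\<gamma> l. arclength_curve \<gamma> l --> \<not> P n \<gamma> l --> line_integral \<rho> \<gamma> l = \<infinity>)"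
      by (rule paeE[OF assms[of n]]) blast
  qed
  from choice[OF this] obtain \<rho> where R: "\<forall>n. \<rho> n \<in> borel_measurable borel \<and> En (\<rho> n) < \<infinity> \<and>
      (\<forall>\<gamma> l. arclength_curve \<gamma> l --> \<not> P n \<gamma> l --> line_integral (\<rho> n) \<gamma> l = \<infinity>)" ..
  hence \<rho>[measurable]: "!!n. \<rho> n \<in> borel_measurable borel" and fin: "!!n. En (\<rho> n) < \<infinity>"
    and inf: "!!n \<gamma> l. arclength_curve \<gamma> l ==> \<not> P n \<gamma> l ==> line_integral (\<rho> n) \<gamma> l = \<infinity>"
    by blast+
  obtain e where e: "!!n. 0 < e n"
    "(\<Sum>n. ennreal ((2 powr p) ^ Suc n) * (ennreal (e n powr p) * En (\<rho> n))) < \<infinity>"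
    by (rule small_multiples[of "%n. En (\<rho> n)", OF fin]) blast
  show ?thesis
  proof (rule paeI)
    show "(%x. \<Sum>n. ennreal (e n) * \<rho> n x) \<in> borel_measurable borel" by measurable
    have [measurable]: "\<rho> n \<in> bmeas" for n by (rule meas_mu) measurable
    have "En (%x. \<Sum>n. ennreal (e n) * \<rho> n x) <= (\<Sum>n. ennreal ((2 powr p) ^ Suc n) * En (%x. ennreal (e n) * \<rho> n x))"
      by (rule En_suminf_le) measurable
    also have "... = (\<Sum>n. ennreal ((2 powr p) ^ Suc n) * (ennreal (e n powr p) * En (\<rho> n)))"
      using e(1) by (simp add: En_cmult less_imp_le)
    also note e(2)
    finally show "En (%x. \<Sum>n. ennreal (e n) * \<rho> n x) < \<infinity>" .
    fix \<gamma> l assume \<gamma>: "arclength_curve \<gamma> l" "\<not> (\<forall>n. P n \<gamma> l)"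
    then obtain n where n: "line_integral (\<rho> n) \<gamma> l = \<infinity>" using inf by blast
    have "line_integral (%x. ennreal (e n) * \<rho> n x) \<gamma> l = \<infinity>"
      using e(1)[of n] n by (subst line_integral_cmult[OF \<gamma>(1)]) (auto simp: ennreal_mult_top)
    moreover have "ennreal (e n) * \<rho> n x <= (\<Sum>n. ennreal (e n) * \<rho> n x)" for x
      using sum_le_suminf[of "%n. ennreal (e n) * \<rho> n x" "{n}"] by auto
    ultimately show "line_integral (%x. \<Sum>n. ennreal (e n) * \<rho> n x) \<gamma> l = \<infinity>"
      using line_integral_mono[of "%x. ennreal (e n) * \<rho> n x" "%x. \<Sum>n. ennreal (e n) * \<rho> n x" \<gamma> l]
      by (simp add: top_unique)
  qed
qed

lemma pae_conj:
  assumes "pae P" "pae Q" shows "pae (%\<gamma> l. P \<gamma> l \<and> Q \<gamma> l)"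
proof (rule pae_mono)
  show "pae (%\<gamma> l. \<forall>n::nat. (if n = 0 then P else Q) \<gamma> l)" using assms by (intro pae_countable) auto
qed (metis one_neq_zero)

text \<open>A Borel null set \<open>N\<close> weighted by infinity has zero energy, while a curve
  that spends positive time in \<open>N\<close> has infinite integral against it.\<close>

lemma pae_null:
  assumes "AE x in \<mu>. P x"
  shows "pae (%\<gamma> l. AE t in lborel. 0 <= t --> t <= l --> P (\<gamma> t))"
proof -
  obtain N where N: "N \<in> sets borel" "emeasure \<mu> N = 0" "!!x. x \<notin> N ==> P x" using AE_borel_null[OF assms] by blast
  show ?thesis
  proof (rule paeI)
    show [measurable]: "(%x. \<infinity> * indicator N x :: ennreal) \<in> borel_measurable borel" using N by measurable
    have "En (%x. \<infinity> * indicator N x) = En (%x. 0)"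
      using N by (intro En_cong_AE AE_I[of _ _ N]) (auto intro: borel_sets split: split_indicator_asm)
    thus "En (%x. \<infinity> * indicator N x) < \<infinity>" by (simp add: En_def)
    fix \<gamma> l assume \<gamma>: "arclength_curve \<gamma> l" and nP: "\<not> (AE t in lborel. 0 <= t --> t <= l --> P (\<gamma> t))"
    note [measurable] = ext_curve_measurable[OF \<gamma>] N(1)
    define F where "F = (%\<tau>. indicator N (ext_curve \<gamma> l \<tau>) * indicator {0..l} \<tau> :: ennreal)"
    have [measurable]: "F \<in> borel_measurable borel" unfolding F_def by measurable
    have "\<not> (AE t in lborel. F t = 0)"
    proof
      assume "AE t in lborel. F t = 0"
      hence "AE t in lborel. 0 <= t --> t <= l --> P (\<gamma> t)"
        by eventually_elim (use N in \<open>auto simp: F_def split: split_indicator_asm\<close>)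
      thus False using nP by blast
    qed
    hence "(\<integral>\<^sup>+t. F t \<partial>lborel) ~= 0" by (subst nn_integral_0_iff_AE) auto
    hence "(\<integral>\<^sup>+t. \<infinity> * F t \<partial>lborel) = \<infinity>"
      by (subst nn_integral_cmult) (auto simp: ennreal_top_mult)
    also have "(\<integral>\<^sup>+t. \<infinity> * F t \<partial>lborel) = line_integral (%x. \<infinity> * indicator N x) \<gamma> l"
      unfolding line_integral_eq_seg seg_def F_def by (intro nn_integral_cong) (auto split: split_indicator)
    finally show "line_integral (%x. \<infinity> * indicator N x) \<gamma> l = \<infinity>" .
  qed
qed

text \<open>The integral over a subcurve is at most the integral over the curve, so a witness for
  the bad subcurves also detects the curves that contain them.\<close>

lemma pae_sub:
  assumes "pae P"
  shows "pae (%\<gamma> l. \<forall>s t. 0 <= s --> s < t --> t <= l --> P (%\<tau>. \<gamma> (s + \<tau>)) (t - s))" using assms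
proof (rule paeE)
  fix \<rho> assume \<rho>: "\<rho> \<in> borel_measurable borel" "En \<rho> < \<infinity>"
    "!!\<gamma> l. arclength_curve \<gamma> l ==> \<not> P \<gamma> l ==> line_integral \<rho> \<gamma> l = \<infinity>"
  show ?thesis
  proof (rule paeI[OF \<rho>(1,2)])
    fix \<gamma> l assume \<gamma>: "arclength_curve \<gamma> l"
      and "\<not> (\<forall>s t. 0 <= s --> s < t --> t <= l --> P (%\<tau>. \<gamma> (s + \<tau>)) (t - s))"
    then obtain s t where st: "0 <= s" "s < t" "t <= l" "\<not> P (%\<tau>. \<gamma> (s + \<tau>)) (t - s)" by blast
    hence "seg (%\<tau>. \<rho> (\<gamma> \<tau>)) s t = \<infinity>"
      using \<rho>(3)[OF arclength_curve_sub[OF \<gamma>, of s t]] line_integral_sub[OF \<gamma> \<rho>(1), of s t] by simp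
    thus "line_integral \<rho> \<gamma> l = \<infinity>"
      unfolding line_integral_eq_seg using seg_subset[of 0 s t l "%\<tau>. \<rho> (\<gamma> \<tau>)"] st by (simp add: top_unique)
  qed
qed

text \<open>Countably many balls on which \<open>g\<close> has finite energy cover the space. Almost
  every curve has finite integral over each piece of \<open>g\<close>, and by compactness a curve
  needs only finitely many pieces.\<close>

lemma pae_Lp_loc:
  assumes g[measurable]: "g \<in> borel_measurable borel" and loc: "g \<in> Lp_loc p \<mu>"
  shows "pae (%\<gamma> l. line_integral g \<gamma> l < \<infinity>)"
proof -
  have "\<forall>x. \<exists>r>0. (\<integral>\<^sup>+y\<in>ball x r. ennpowr (g y) p \<partial>\<mu>) < \<infinity>"
    using loc by (simp add: Lp_loc_def)
  then obtain r where r: "!!x. 0 < r x" "!!x. (\<integral>\<^sup>+y\<in>ball x (r x). ennpowr (g y) p \<partial>\<mu>) < \<infinity>"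
    by metis
  obtain C where C: "countable C" "(\<Union>x\<in>C. ball x (r x)) = UNIV" by (rule countable_cover_balls[of r, OF r(1)]) blast
  have ne: "C ~= {}" using C(2) by auto
  define c where "c = from_nat_into C"
  have cC: "range c = C" unfolding c_def using range_from_nat_into[OF ne C(1)] .
  define G where "G = (%n x. g x * indicator (ball (c n) (r (c n))) x)"
  have [measurable]: "G n \<in> borel_measurable borel" for n unfolding G_def by measurable
  have "En (G n) = (\<integral>\<^sup>+y\<in>ball (c n) (r (c n)). ennpowr (g y) p \<partial>\<mu>)" for n
    unfolding En_def G_def by (intro nn_integral_cong) (auto split: split_indicator)
  hence "pae (%\<gamma> l. line_integral (G n) \<gamma> l < \<infinity>)" for n using r(2) by (intro pae_Lp) auto
  hence "pae (%\<gamma> l. \<forall>n. line_integral (G n) \<gamma> l < \<infinity>)" by (rule pae_countable)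
  thus ?thesis
  proof (rule pae_mono)
    fix \<gamma> l assume \<gamma>: "arclength_curve \<gamma> l" and fin: "\<forall>n. line_integral (G n) \<gamma> l < \<infinity>"
    have "compact (ext_curve \<gamma> l ` {0..l})"
      by (intro compact_continuous_image continuous_on_subset[OF ext_curve_continuous[OF \<gamma>]]) auto
    moreover have "ext_curve \<gamma> l ` {0..l} \<subseteq> (\<Union>n. ball (c n) (r (c n)))" using C(2) cC by blast
    ultimately obtain F where F: "finite F" "ext_curve \<gamma> l ` {0..l} \<subseteq> (\<Union>n\<in>F. ball (c n) (r (c n)))"
      using compactE_image[of "ext_curve \<gamma> l ` {0..l}" UNIV "%n. ball (c n) (r (c n))" thesis] by blast
    note [measurable] = ext_curve_measurable[OF \<gamma>]
    have "line_integral g \<gamma> l <= (\<integral>\<^sup>+\<tau>. (\<Sum>n\<in>F. G n (ext_curve \<gamma> l \<tau>) * indicator {0..l} \<tau>) \<partial>lborel)"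
      unfolding line_integral_eq_seg seg_def
    proof (rule nn_integral_mono)
      fix \<tau> :: real
      show "g (\<gamma> \<tau>) * indicator {0..l} \<tau> <= (\<Sum>n\<in>F. G n (ext_curve \<gamma> l \<tau>) * indicator {0..l} \<tau>)"
      proof (cases "\<tau> \<in> {0..l}")
        case True
        then obtain n where n: "n \<in> F" "ext_curve \<gamma> l \<tau> \<in> ball (c n) (r (c n))" using F(2) by blast
        hence "g (\<gamma> \<tau>) * indicator {0..l} \<tau> = G n (ext_curve \<gamma> l \<tau>) * indicator {0..l} \<tau>"
          using True by (simp add: G_def)
        also have "... <= (\<Sum>n\<in>F. G n (ext_curve \<gamma> l \<tau>) * indicator {0..l} \<tau>)"
          using F(1) n(1) by (intro member_le_sum) auto
        finally show ?thesis .
      qed simp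
    qed
    also have "... = (\<Sum>n\<in>F. \<integral>\<^sup>+\<tau>. G n (ext_curve \<gamma> l \<tau>) * indicator {0..l} \<tau> \<partial>lborel)"
      by (rule nn_integral_sum) measurable
    also have "... = (\<Sum>n\<in>F. line_integral (G n) \<gamma> l)" unfolding line_integral_eq_seg seg_def
      by (intro sum.cong refl nn_integral_cong) (auto split: split_indicator)
    also have "... < \<infinity>" using fin F(1) by (simp add: less_top)
    finally show "line_integral g \<gamma> l < \<infinity>" .
  qed
qed

end

section \<open>Weak upper gradients along good curves\<close>

lemma ext_diff_ereal [simp]: "ext_diff (ereal a) (ereal b) = ennreal \<bar>a - b\<bar>" by (simp add: ext_diff_def)

lemma divide_antimono_ennreal:
  fixes a b c :: ennreal
  assumes "b <= a" shows "c / (1 + a) <= c / (1 + b)"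
proof (cases "b = top")
  case False
  hence "c = (1 + b) * (c / (1 + b))"
    by (simp add: ennreal_times_divide mult.commute mult_divide_eq_ennreal less_top add_eq_0_iff_both_eq_0)
  also have "... <= (1 + a) * (c / (1 + b))" using assms by (intro mult_right_mono add_left_mono) auto
  finally show ?thesis by (intro divide_le_posI_ennreal) (auto simp: add_pos_nonneg)
qed (use assms in \<open>simp add: top_unique\<close>)

lemma ext_diff_self_finite:
  assumes "ext_diff a a < \<infinity>" shows "\<bar>a\<bar> ~= \<infinity>" using assms by (auto simp: ext_diff_def)

context newtonian_space
begin

text \<open>The inequality on all subcurves together with a finite integral. The case
  \<open>s = t\<close> matters: \<open>ext_diff\<close> of an infinite value with itself is
  infinite, so a good curve meets only finite values of \<open>u\<close>.\<close>

definition good :: "('a => ereal) => ('a => ennreal) => (real => 'a) => real => bool" where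
  "good u g \<gamma> l \<longleftrightarrow> line_integral g \<gamma> l < \<infinity> \<and>
     (\<forall>s t. 0 <= s --> s <= t --> t <= l --> ext_diff (u (\<gamma> s)) (u (\<gamma> t)) <= seg (%\<tau>. g (\<gamma> \<tau>)) s t)"

lemma good_iff_acp:
  assumes "arclength_curve \<gamma> l" "g \<in> borel_measurable borel"
  shows "good u g \<gamma> l \<longleftrightarrow> (\<forall>t. 0 <= t --> t <= l --> \<bar>u (\<gamma> t)\<bar> ~= \<infinity>) \<and>
     acp (%t. real_of_ereal (u (\<gamma> t))) (%t. g (ext_curve \<gamma> l t)) l" (is "?L \<longleftrightarrow> ?R1 \<and> ?R2")
proof
  have seg: "seg (%\<tau>. g (ext_curve \<gamma> l \<tau>)) s t = seg (%\<tau>. g (\<gamma> \<tau>)) s t" if "0 <= s" "t <= l" for s t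
    using seg_ext_curve that .
  have ext: "ext_diff a b = ennreal \<bar>real_of_ereal a - real_of_ereal b\<bar>"
    if "\<bar>a\<bar> ~= \<infinity>" "\<bar>b\<bar> ~= \<infinity>" for a b using that by (cases a; cases b) auto
  {
    assume L: ?L
    have R1: ?R1
    proof (intro allI impI)
      fix t assume t: "0 <= t" "t <= l"
      have "ext_diff (u (\<gamma> t)) (u (\<gamma> t)) <= seg (%\<tau>. g (\<gamma> \<tau>)) t t" using L t by (simp add: good_def)
      also have "... <= line_integral g \<gamma> l" unfolding line_integral_eq_seg using t by (intro seg_subset)
      also have "... < \<infinity>" using L by (simp add: good_def)
      finally show "\<bar>u (\<gamma> t)\<bar> ~= \<infinity>" by (rule ext_diff_self_finite)
    qed
    moreover have ?R2 unfolding acp_def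
    proof (intro conjI allI impI)
      show "(%t. g (ext_curve \<gamma> l t)) \<in> borel_measurable borel" by (rule measurable_along[OF assms])
      show "seg (%t. g (ext_curve \<gamma> l t)) 0 l < \<infinity>" using L seg[of 0 l] by (simp add: good_def line_integral_eq_seg)
      fix s t assume st: "0 <= s" "s <= t" "t <= l"
      have "ext_diff (u (\<gamma> s)) (u (\<gamma> t)) <= seg (%\<tau>. g (\<gamma> \<tau>)) s t" using L st by (simp add: good_def)
      thus "ennreal \<bar>real_of_ereal (u (\<gamma> s)) - real_of_ereal (u (\<gamma> t))\<bar> <= seg (%t. g (ext_curve \<gamma> l t)) s t"
        using R1 st seg[of s t] by (simp add: ext)
    qed
    ultimately show "?R1 \<and> ?R2" ..
  }
  assume R: "?R1 \<and> ?R2"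
  show ?L unfolding good_def
  proof (intro conjI allI impI)
    show "line_integral g \<gamma> l < \<infinity>" using R seg[of 0 l] by (simp add: acp_def line_integral_eq_seg)
    fix s t assume st: "0 <= s" "s <= t" "t <= l"
    hence "ennreal \<bar>real_of_ereal (u (\<gamma> s)) - real_of_ereal (u (\<gamma> t))\<bar> <= seg (%t. g (ext_curve \<gamma> l t)) s t"
      using R by (simp add: acp_def)
    thus "ext_diff (u (\<gamma> s)) (u (\<gamma> t)) <= seg (%\<tau>. g (\<gamma> \<tau>)) s t"
      using R st seg[of s t] by (simp add: ext)
  qed
qed

lemma good_cong:
  assumes "arclength_curve \<gamma> l" "good u g \<gamma> l" "AE t in lborel. 0 <= t --> t <= l --> g (\<gamma> t) = h (\<gamma> t)"
  shows "good u h \<gamma> l"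
proof -
  have eq: "seg (%\<tau>. g (\<gamma> \<tau>)) s t = seg (%\<tau>. h (\<gamma> \<tau>)) s t" if "0 <= s" "t <= l" for s t
  proof (rule antisym)
    show "seg (%\<tau>. g (\<gamma> \<tau>)) s t <= seg (%\<tau>. h (\<gamma> \<tau>)) s t"
      using assms(3) by (intro seg_mono_AE, eventually_elim) (use that in auto)
    show "seg (%\<tau>. h (\<gamma> \<tau>)) s t <= seg (%\<tau>. g (\<gamma> \<tau>)) s t"
      using assms(3) by (intro seg_mono_AE, eventually_elim) (use that in auto)
  qed
  thus ?thesis using assms(2) by (simp add: good_def line_integral_eq_seg)
qed

lemma pae_good_cong:
  assumes "pae (good u g)" "AE x in \<mu>. g x = h x"
  shows "pae (good u h)" by (rule pae_mono[OF pae_conj[OF assms(1) pae_null[OF assms(2)]]]) (use good_cong in blast)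

text \<open>A Borel representative is evaluated along curves, so that measurability along the curve
  is automatic. By \<open>wug_pae\<close> any two Borel representatives serve equally well, and
  \<open>weak_upper_gradient_iff_wug\<close> identifies this notion with weak upper gradients in the
  local \<open>L^p\<close> space.\<close>

definition wug :: "('a => ereal) => ('a => ennreal) => bool" where
  "wug u g \<longleftrightarrow> g \<in> bmeas \<and>
     (\<exists>g0\<in>borel_measurable borel. (AE x in \<mu>. g0 x = g x) \<and> pae (good u g0))"

lemma wugI:
  assumes "g \<in> bmeas" "g0 \<in> borel_measurable borel" "AE x in \<mu>. g0 x = g x" "pae (good u g0)"
  shows "wug u g" using assms unfolding wug_def by blast

lemma wugI_borel:
  assumes "g \<in> borel_measurable borel" "pae (good u g)" shows "wug u g"
  by (rule wugI[OF meas_mu[OF assms(1)] assms(1) _ assms(2)]) simp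

lemma wug_measurable: "wug u g ==> g \<in> bmeas" by (simp add: wug_def)

lemma wug_pae:
  assumes "wug u g" "g0 \<in> borel_measurable borel" "AE x in \<mu>. g0 x = g x"
  shows "pae (good u g0)"
proof -
  from assms(1) obtain g1 where g1: "g1 \<in> borel_measurable borel" "AE x in \<mu>. g1 x = g x" "pae (good u g1)"
    unfolding wug_def by blast
  have "AE x in \<mu>. g1 x = g0 x" using g1(2) assms(3) by eventually_elim simp
  thus ?thesis by (rule pae_good_cong[OF g1(3)])
qed

lemma wug_borelE:
  assumes "wug u g"
  obtains g0 where "g0 \<in> borel_measurable borel" "AE x in \<mu>. g0 x = g x" "pae (good u g0)"
  using assms unfolding wug_def by blast

lemma wug_AE_cong:
  assumes "wug u g" "g' \<in> bmeas" "AE x in \<mu>. g x = g' x"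
  shows "wug u g'"
proof -
  obtain g0 where g0: "g0 \<in> borel_measurable borel" "AE x in \<mu>. g0 x = g x" "pae (good u g0)"
    using assms(1) by (rule wug_borelE)
  have "AE x in \<mu>. g0 x = g' x" using g0(2) assms(3) by eventually_elim simp
  thus ?thesis using wugI[OF assms(2) g0(1) _ g0(3)] by blast
qed

lemma wug_min:
  assumes "wug u g" "wug u h" shows "wug u (%x. min (g x) (h x))"
proof -
  obtain g0 where g0: "g0 \<in> borel_measurable borel" "AE x in \<mu>. g0 x = g x" "pae (good u g0)"
    using assms(1) by (rule wug_borelE)
  obtain h0 where h0: "h0 \<in> borel_measurable borel" "AE x in \<mu>. h0 x = h x" "pae (good u h0)"
    using assms(2) by (rule wug_borelE)
  note [measurable] = g0(1) h0(1) wug_measurable[OF assms(1)] wug_measurable[OF assms(2)]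
  show ?thesis
  proof (rule wugI)
    show "(%x. min (g x) (h x)) \<in> bmeas" by measurable
    show m: "(%x. min (g0 x) (h0 x)) \<in> borel_measurable borel" by measurable
    show "AE x in \<mu>. min (g0 x) (h0 x) = min (g x) (h x)" using g0(2) h0(2) by eventually_elim simp
    show "pae (good u (%x. min (g0 x) (h0 x)))"
    proof (rule pae_mono[OF pae_conj[OF g0(3) h0(3)]])
      fix \<gamma> l assume \<gamma>: "arclength_curve \<gamma> l" and A: "good u g0 \<gamma> l \<and> good u h0 \<gamma> l"
      note G = conjunct1[OF A, unfolded good_iff_acp[OF \<gamma> g0(1)]]
      note H = conjunct2[OF A, unfolded good_iff_acp[OF \<gamma> h0(1)]]
      show "good u (%x. min (g0 x) (h0 x)) \<gamma> l" unfolding good_iff_acp[OF \<gamma> m]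
        using conjunct1[OF G] acp_min[OF conjunct2[OF G] conjunct2[OF H]] by (rule conjI)
    qed
  qed
qed

text \<open>Simultaneous Borel representatives with one common exceptional null set, on which all of
  them are 0. Pointwise relations between the \<open>G n\<close>, such as monotonicity in
  \<open>n\<close>, then hold for the representatives everywhere.\<close>

lemma wug_borel_seqE:
  fixes G :: "nat => 'a => ennreal" and u :: "nat => 'a => ereal"
  assumes "!!n. wug (u n) (G n)"
  obtains H N where "!!n. H n \<in> borel_measurable borel" "N \<in> sets borel" "AE x in \<mu>. x \<notin> N"
    "!!n x. x \<notin> N ==> H n x = G n x" "!!n x. x \<in> N ==> H n x = 0" "!!n. pae (good (u n) (H n))"
proof -
  have "\<forall>n. \<exists>g0. g0 \<in> borel_measurable borel \<and> (AE x in \<mu>. g0 x = G n x)"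
    using assms unfolding wug_def by blast
  from choice[OF this] obtain H0 where H0: "!!n. H0 n \<in> borel_measurable borel" "!!n. AE x in \<mu>. H0 n x = G n x" by blast
  have "AE x in \<mu>. \<forall>n. H0 n x = G n x" using H0(2) by (simp add: AE_all_countable)
  then obtain N where N: "N \<in> sets borel" "emeasure \<mu> N = 0" "!!x. x \<notin> N ==> \<forall>n. H0 n x = G n x"
    by (rule AE_borel_null) blast
  have AEN: "AE x in \<mu>. x \<notin> N" using N by (intro AE_I[of _ _ N]) (auto intro: borel_sets)
  define H where "H = (%n x. if x \<in> N then 0 else H0 n x)"
  show thesis
  proof
    show H: "H n \<in> borel_measurable borel" for n unfolding H_def using N(1) H0(1) by measurable
    show "H n x = G n x" if "x \<notin> N" for n x using that N(3)[of x] by (simp add: H_def)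
    show "H n x = 0" if "x \<in> N" for n x using that by (simp add: H_def)
    have "AE x in \<mu>. H n x = G n x" for n using AEN by eventually_elim (use N(3) in \<open>auto simp: H_def\<close>)
    thus "pae (good (u n) (H n))" for n by (rule wug_pae[OF assms H])
  qed fact+
qed

lemma wug_INF:
  fixes G :: "nat => 'a => ennreal"
  assumes "!!n. wug u (G n)" "!!n x. G (Suc n) x <= G n x"
  shows "wug u (%x. INF n. G n x)"
proof -
  obtain H N where H: "!!n. H n \<in> borel_measurable borel" "N \<in> sets borel" "AE x in \<mu>. x \<notin> N"
    "!!n x. x \<notin> N ==> H n x = G n x" "!!n x. x \<in> N ==> H n x = 0" "!!n. pae (good u (H n))"
    by (rule wug_borel_seqE[of "%_. u" G, OF assms(1)]) blast
  note [measurable] = H(1) wug_measurable[OF assms(1)]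
  show ?thesis
  proof (rule wugI)
    show "(%x. INF n. G n x) \<in> bmeas" by measurable
    show m: "(%x. INF n. H n x) \<in> borel_measurable borel" by measurable
    show "AE x in \<mu>. (INF n. H n x) = (INF n. G n x)" using H(3) by eventually_elim (simp add: H(4))
    show "pae (good u (%x. INF n. H n x))"
    proof (rule pae_mono[OF pae_countable[OF H(6)]])
      fix \<gamma> l assume \<gamma>: "arclength_curve \<gamma> l" and g: "\<forall>n. good u (H n) \<gamma> l"
      have "H (Suc n) x <= H n x" for n x by (cases "x \<in> N") (simp_all add: H(4,5) assms(2))
      hence "acp (%t. real_of_ereal (u (\<gamma> t))) (%t. INF n. H n (ext_curve \<gamma> l t)) l"
        using g unfolding good_iff_acp[OF \<gamma> H(1)] by (intro acp_decseq) auto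
      thus "good u (%x. INF n. H n x) \<gamma> l" unfolding good_iff_acp[OF \<gamma> m]
        using conjunct1[OF g[THEN spec[of _ 0], unfolded good_iff_acp[OF \<gamma> H(1)]]] by (rule conjI[rotated])
    qed
  qed
qed

section \<open>The minimal weak upper gradient\<close>

text \<open>Local integrability makes almost every line integral finite, and \<open>pae_sub\<close>
  passes the end point inequality to subcurves; both are needed for \<open>good\<close>. The
  converse compares line integrals of almost everywhere equal functions along almost every
  curve.\<close>

lemma weak_upper_gradient_iff_wug:
  assumes "g \<in> Lp_loc p \<mu>"
  shows "weak_upper_gradient p \<mu> u g \<longleftrightarrow> wug u g"
proof
  assume w: "weak_upper_gradient p \<mu> u g"
  have gm: "g \<in> bmeas" using w by (simp add: weak_upper_gradient_def)
  obtain g0 where g0: "g0 \<in> borel_measurable borel" "AE x in \<mu>. g0 x = g x" using ex_borel[OF gm] by blast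
  note [measurable] = g0(1) meas_mu[OF g0(1)] gm
  have loc: "g0 \<in> Lp_loc p \<mu>"
  proof -
    have "(\<integral>\<^sup>+y\<in>ball x r. ennpowr (g0 y) p \<partial>\<mu>) = (\<integral>\<^sup>+y\<in>ball x r. ennpowr (g y) p \<partial>\<mu>)" for x r
      using g0(2) by (intro nn_integral_cong_AE, eventually_elim) simp
    thus ?thesis using assms meas_mu[OF g0(1)] by (simp add: Lp_loc_def)
  qed
  show "wug u g"
  proof (rule wugI[OF gm g0])
    have "pae (%\<gamma> l. ext_diff (u (\<gamma> 0)) (u (\<gamma> l)) <= line_integral g \<gamma> l)"
      using w by (simp add: weak_upper_gradient_def)
    hence "pae (%\<gamma> l. ext_diff (u (\<gamma> 0)) (u (\<gamma> l)) <= line_integral g0 \<gamma> l)"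
    proof (rule pae_mono[OF pae_conj[OF pae_null[OF g0(2)]]])
      fix \<gamma> l assume A: "(AE t in lborel. 0 <= t --> t <= l --> g0 (\<gamma> t) = g (\<gamma> t)) \<and>
         ext_diff (u (\<gamma> 0)) (u (\<gamma> l)) <= line_integral g \<gamma> l"
      have "line_integral g \<gamma> l <= line_integral g0 \<gamma> l" unfolding line_integral_eq_seg
        using conjunct1[OF A] by (intro seg_mono_AE, eventually_elim) auto
      thus "ext_diff (u (\<gamma> 0)) (u (\<gamma> l)) <= line_integral g0 \<gamma> l" using A by (blast intro: order_trans)
    qed
    from pae_conj[OF pae_Lp_loc[OF g0(1) loc] pae_sub[OF this]]
    show "pae (good u g0)"
    proof (rule pae_mono)
      fix \<gamma> l assume \<gamma>: "arclength_curve \<gamma> l" and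
        A: "line_integral g0 \<gamma> l < \<infinity> \<and> (\<forall>s t. 0 <= s --> s < t --> t <= l -->
           ext_diff (u (\<gamma> (s + 0))) (u (\<gamma> (s + (t - s)))) <= line_integral g0 (%\<tau>. \<gamma> (s + \<tau>)) (t - s))"
      have l: "0 < l" using \<gamma> by (simp add: arclength_curve_def)
      have lt: "ext_diff (u (\<gamma> s)) (u (\<gamma> t)) <= seg (%\<tau>. g0 (\<gamma> \<tau>)) s t" if "0 <= s" "s < t" "t <= l" for s t
      proof -
        have "ext_diff (u (\<gamma> (s + 0))) (u (\<gamma> (s + (t - s)))) <= line_integral g0 (%\<tau>. \<gamma> (s + \<tau>)) (t - s)"
          using conjunct2[OF A] that by blast
        also have "... = seg (%\<tau>. g0 (\<gamma> \<tau>)) s t" using that by (intro line_integral_sub[OF \<gamma> g0(1)]) auto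
        finally show ?thesis by simp
      qed
      \<comment> \<open>An infinite value at \<open>t\<close> has infinite \<open>ext_diff\<close>
        to every value. Since \<open>0 < l\<close> there is a second parameter to pair with
        \<open>t\<close>, which contradicts the finite integral over the curve.\<close>
      have fin: "\<bar>u (\<gamma> t)\<bar> ~= \<infinity>" if t: "0 <= t" "t <= l" for t
      proof
        assume inf: "\<bar>u (\<gamma> t)\<bar> = \<infinity>"
        have top: "ext_diff (u (\<gamma> t)) a = \<infinity>" "ext_diff a (u (\<gamma> t)) = \<infinity>" for a
          using inf by (cases "u (\<gamma> t)"; cases a; simp add: ext_diff_def)+
        have "\<exists>s s'. 0 <= s \<and> s < s' \<and> s' <= l \<and> ext_diff (u (\<gamma> s)) (u (\<gamma> s')) = \<infinity>"
        proof (cases "t < l")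
          case True thus ?thesis using t top by blast
        next
          case False thus ?thesis using t top l by (intro exI[of _ 0] exI[of _ t]) auto
        qed
        then obtain s s' where s: "0 <= s" "s < s'" "s' <= l" "ext_diff (u (\<gamma> s)) (u (\<gamma> s')) = \<infinity>" by blast
        hence "seg (%\<tau>. g0 (\<gamma> \<tau>)) s s' = \<infinity>" using lt[of s s'] by (simp add: top_unique)
        thus False using A seg_subset[of 0 s s' l "%\<tau>. g0 (\<gamma> \<tau>)"] s by (simp add: line_integral_eq_seg top_unique)
      qed
      show "good u g0 \<gamma> l" unfolding good_def
      proof (intro conjI allI impI)
        show "line_integral g0 \<gamma> l < \<infinity>" using A by blast
        fix s t assume st: "0 <= s" "s <= t" "t <= l"
        show "ext_diff (u (\<gamma> s)) (u (\<gamma> t)) <= seg (%\<tau>. g0 (\<gamma> \<tau>)) s t"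
        proof (cases "s = t")
          case True
          have "ext_diff (u (\<gamma> s)) (u (\<gamma> s)) = 0" using fin[of s] st by (cases "u (\<gamma> s)") auto
          thus ?thesis using True by simp
        qed (use lt st in auto)
      qed
    qed
  qed
next
  assume w: "wug u g"
  obtain g0 where g0: "g0 \<in> borel_measurable borel" "AE x in \<mu>. g0 x = g x" "pae (good u g0)" using w by (rule wug_borelE)
  have "pae (%\<gamma> l. ext_diff (u (\<gamma> 0)) (u (\<gamma> l)) <= line_integral g \<gamma> l)"
  proof (rule pae_mono[OF pae_conj[OF pae_null[OF g0(2)] g0(3)]])
    fix \<gamma> l assume \<gamma>: "arclength_curve \<gamma> l" and A: "(AE t in lborel. 0 <= t --> t <= l --> g0 (\<gamma> t) = g (\<gamma> t)) \<and>
       good u g0 \<gamma> l"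
    have "line_integral g0 \<gamma> l <= line_integral g \<gamma> l" unfolding line_integral_eq_seg
      using conjunct1[OF A] by (intro seg_mono_AE, eventually_elim) auto
    moreover have "ext_diff (u (\<gamma> 0)) (u (\<gamma> l)) <= line_integral g0 \<gamma> l"
      using A \<gamma> by (simp add: good_def line_integral_eq_seg arclength_curve_def)
    ultimately show "ext_diff (u (\<gamma> 0)) (u (\<gamma> l)) <= line_integral g \<gamma> l" by (rule order_trans[rotated])
  qed
  thus "weak_upper_gradient p \<mu> u g" using wug_measurable[OF w] by (simp add: weak_upper_gradient_def)
qed

lemma Lp_loc_mono:
  assumes "g \<in> Lp_loc p \<mu>" "h \<in> bmeas" "AE x in \<mu>. h x <= g x"
  shows "h \<in> Lp_loc p \<mu>"
proof -
  have "(\<integral>\<^sup>+y\<in>ball x r. ennpowr (h y) p \<partial>\<mu>) <= (\<integral>\<^sup>+y\<in>ball x r. ennpowr (g y) p \<partial>\<mu>)" for x r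
    using assms(3) by (intro nn_integral_mono_AE, eventually_elim) (auto intro!: mult_right_mono ennpowr_mono p0)
  hence "\<exists>r>0. (\<integral>\<^sup>+y\<in>ball x r. ennpowr (h y) p \<partial>\<mu>) < \<infinity>" for x
    using assms(1) le_less_trans unfolding Lp_loc_def mem_Collect_eq by meson
  thus ?thesis using assms(2) unfolding Lp_loc_def by blast
qed

lemma En_finite_Lp_loc:
  assumes "g \<in> bmeas" "En g < \<infinity>" shows "g \<in> Lp_loc p \<mu>"
proof -
  have "(\<integral>\<^sup>+y\<in>ball x r. ennpowr (g y) p \<partial>\<mu>) <= En g" for x r
    unfolding En_def by (intro nn_integral_mono) (auto split: split_indicator)
  hence "(\<integral>\<^sup>+y\<in>ball x 1. ennpowr (g y) p \<partial>\<mu>) < \<infinity>" for x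
    using assms(2) by (rule le_less_trans)
  thus ?thesis using assms(1) unfolding Lp_loc_def by (auto intro!: exI[of _ 1])
qed

text \<open>Weak upper gradients are closed under minima and decreasing limits, so a minimal one is
  found by maximizing a strictly decreasing functional that is bounded even for functions of
  infinite energy: \<open>\<Phi> g\<close>, the integral of \<open>h / (1 + g)\<close> with
  \<open>h\<close> positive and integrable. A maximizer \<open>g\<close> lies almost everywhere
  below every \<open>g'\<close>, since otherwise the minimum of the two would give a larger
  value.\<close>

lemma ex_minimal_wug:
  assumes "wug u g1" "g1 \<in> Lp_loc p \<mu>"
  shows "\<exists>g. wug u g \<and> g \<in> Lp_loc p \<mu> \<and> (\<forall>g'. wug u g' --> (AE x in \<mu>. g x <= g' x))"
proof -
  obtain h where h[measurable]: "h \<in> bmeas" and hfin: "integral\<^sup>N \<mu> h ~= \<infinity>"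
    and hpos: "!!x. x \<in> space \<mu> ==> 0 < h x \<and> h x < \<infinity>" using Ex_finite_integrable_function by blast
  define \<Phi> where "\<Phi> g = (\<integral>\<^sup>+x. h x / (1 + g x) \<partial>\<mu>)" for g :: "'a => ennreal"
  define S where "S = (SUP g\<in>{g. wug u g}. \<Phi> g)"
  have le_h: "h x / (1 + a) <= h x" for x and a :: ennreal by (rule divide_le_posI_ennreal) (simp_all add: add_pos_nonneg distrib_right)
  have \<Phi>_le: "\<Phi> g <= integral\<^sup>N \<mu> h" for g unfolding \<Phi>_def by (intro nn_integral_mono le_h)
  have Sfin: "S < \<infinity>"
  proof -
    have "S <= integral\<^sup>N \<mu> h" unfolding S_def by (intro SUP_least \<Phi>_le)
    thus ?thesis using hfin by (simp add: less_top le_less_trans)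
  qed
  have "\<exists>g. wug u g \<and> S - ennreal (1 / real (Suc n)) <= \<Phi> g" for n
  proof (cases "S = 0")
    case True
    thus ?thesis using assms(1) by auto
  next
    case False
    hence "S - ennreal (1 / real (Suc n)) < S" using Sfin by (intro ennreal_between) (auto simp: zero_less_iff_neq_zero)
    hence "\<exists>g\<in>{g. wug u g}. S - ennreal (1 / real (Suc n)) < \<Phi> g" unfolding S_def less_SUP_iff .
    thus ?thesis using less_imp_le by blast
  qed
  hence "\<forall>n. \<exists>g. wug u g \<and> S - ennreal (1 / real (Suc n)) <= \<Phi> g" ..
  from choice[OF this] obtain f where
    f: "!!n. wug u (f n)" "!!n. S - ennreal (1 / real (Suc n)) <= \<Phi> (f n)" by blast
  \<comment> \<open>\<open>g1\<close> takes part in the minima so that the limit stays in the local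
    \<open>L^p\<close> space.\<close>
  define G where "G = rec_nat (%x. min (g1 x) (f 0 x)) (%n g x. min (g x) (f (Suc n) x))"
  have G0: "G 0 = (%x. min (g1 x) (f 0 x))" and GS: "G (Suc n) = (%x. min (G n x) (f (Suc n) x))" for n by (simp_all add: G_def)
  have wG: "wug u (G n)" for n by (induction n) (simp_all add: G0 GS wug_min assms(1) f(1))
  have Gle: "G n x <= f n x" for n x by (cases n) (simp_all add: G0 GS)
  define g where "g = (%x. INF n. G n x)"
  have wg: "wug u g" unfolding g_def by (rule wug_INF[OF wG]) (simp add: GS)
  have gle: "g x <= f n x" "g x <= g1 x" for x n
  proof -
    show "g x <= f n x" unfolding g_def by (rule INF_lower2[of n]) (simp_all add: Gle)
    show "g x <= g1 x" unfolding g_def by (rule INF_lower2[of 0]) (simp_all add: G0)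
  qed
  have \<Phi>_mono: "\<Phi> a <= \<Phi> b" if "!!x. b x <= a x" for a b
    unfolding \<Phi>_def using that by (intro nn_integral_mono divide_antimono_ennreal) 
  have "S <= \<Phi> g"
  proof (rule ennreal_le_epsilon)
    fix e :: real assume "0 < e"
    then obtain n where n: "1 / real (Suc n) < e" using nat_approx_posE by blast
    have "S <= \<Phi> g + ennreal (1 / real (Suc n))"
      using order_trans[OF f(2)[of n] \<Phi>_mono[of g "f n"]] gle(1) by (simp add: ennreal_minus_le_iff add.commute)
    also have "... <= \<Phi> g + ennreal e" using n by (intro add_left_mono ennreal_leI) simp
    finally show "S <= \<Phi> g + ennreal e" .
  qed
  have "AE x in \<mu>. g x <= g' x" if g': "wug u g'" for g'
  proof -
    note [measurable] = wug_measurable[OF wg] wug_measurable[OF g']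
    have "\<Phi> (%x. min (g x) (g' x)) <= S" unfolding S_def using wug_min[OF wg g'] by (intro SUP_upper) simp
    hence le: "\<Phi> (%x. min (g x) (g' x)) <= \<Phi> g" using \<open>S <= \<Phi> g\<close> by (rule order_trans)
    have pt: "h x / (1 + g x) <= h x / (1 + min (g x) (g' x))" for x by (intro divide_antimono_ennreal) simp
    have "\<Phi> g < \<infinity>" by (rule le_less_trans[OF \<Phi>_le]) (use hfin in \<open>simp add: less_top\<close>)
    hence "(\<integral>\<^sup>+x. h x / (1 + min (g x) (g' x)) - h x / (1 + g x) \<partial>\<mu>) = \<Phi> (%x. min (g x) (g' x)) - \<Phi> g"
      unfolding \<Phi>_def using pt by (subst nn_integral_diff) (auto simp: less_top)
    also have "... = 0" using le le_less_trans[OF le] \<open>\<Phi> g < \<infinity>\<close> by (simp add: diff_eq_0_iff_ennreal)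
    finally have "AE x in \<mu>. h x / (1 + min (g x) (g' x)) - h x / (1 + g x) = 0" by (subst (asm) nn_integral_0_iff_AE) auto
    thus ?thesis
    proof eventually_elim
      case (elim x)
      have hx: "0 < h x" "h x < top" using hpos[of x] by auto
      have "h x / (1 + g x) < top" using le_less_trans[OF le_h[of x "g x"] hx(2)] .
      hence le: "h x / (1 + min (g x) (g' x)) <= h x / (1 + g x)" using elim by (simp add: diff_eq_0_iff_ennreal)
      show "g x <= g' x"
      proof (rule ccontr)
        assume "\<not> g x <= g' x"
        hence lt: "g' x < g x" by simp
        then obtain b where b: "g' x = ennreal b" "0 <= b" by (cases "g' x") auto
        obtain c where c: "h x = ennreal c" "0 < c" using hx by (cases "h x") auto
        have "h x / (1 + g x) < h x / (1 + g' x)"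
        proof (cases "g x")
          case (real a)
          hence ab: "b < a" using lt b by (simp add: ennreal_less_iff)
          have "c / (1 + a) < c / (1 + b)" using c b ab by (intro divide_strict_left_mono) auto
          moreover have "h x / (1 + g x) = ennreal (c / (1 + a))"
            unfolding c real using c real by (simp add: divide_ennreal flip: ennreal_1 ennreal_plus)
          moreover have "h x / (1 + g' x) = ennreal (c / (1 + b))"
            unfolding c b using c b by (simp add: divide_ennreal flip: ennreal_1 ennreal_plus)
          moreover have "0 < c / (1 + b)" using b c by simp
          ultimately show ?thesis by (simp only: ennreal_lessI)
        next
          case top
          have "h x / (1 + g' x) = ennreal (c / (1 + b))"
            unfolding c b using c b by (simp add: divide_ennreal flip: ennreal_1 ennreal_plus)
          thus ?thesis using top b c by (simp add: ennreal_less_zero_iff)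
        qed
        thus False using le lt by (simp add: min_def split: if_splits)
      qed
    qed
  qed
  moreover have "g \<in> Lp_loc p \<mu>" using gle(2) by (intro Lp_loc_mono[OF assms(2) wug_measurable[OF wg]]) auto
  ultimately show ?thesis using wg by blast
qed

abbreviation mug :: "('a => ereal) => 'a => ennreal" where
  "mug \<equiv> min_weak_upper_gradient p \<mu>"

lemma mug:
  assumes "wug u g" "g \<in> Lp_loc p \<mu>"
  shows "wug u (mug u)" "mug u \<in> Lp_loc p \<mu>" "AE x in \<mu>. mug u x <= g x"
proof -
  have "\<exists>g. is_min_weak_upper_gradient p \<mu> u g"
  proof -
    obtain g0 where "wug u g0" "g0 \<in> Lp_loc p \<mu>" "\<forall>g'. wug u g' --> (AE x in \<mu>. g0 x <= g' x)"
      using ex_minimal_wug[OF assms] by blast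
    thus ?thesis unfolding is_min_weak_upper_gradient_def using weak_upper_gradient_iff_wug by blast
  qed
  hence "is_min_weak_upper_gradient p \<mu> u (mug u)" unfolding min_weak_upper_gradient_def by (rule someI_ex)
  hence m: "weak_upper_gradient p \<mu> u (mug u)" "mug u \<in> Lp_loc p \<mu>"
    "!!g'. weak_upper_gradient p \<mu> u g' ==> g' \<in> Lp_loc p \<mu> ==> AE x in \<mu>. mug u x <= g' x"
    unfolding is_min_weak_upper_gradient_def by blast+
  show "wug u (mug u)" "mug u \<in> Lp_loc p \<mu>" using m(1,2) weak_upper_gradient_iff_wug by blast+
  show "AE x in \<mu>. mug u x <= g x" using m(3) assms weak_upper_gradient_iff_wug by blast
qed

lemma En_mug_le:
  assumes "wug u g" "En g < \<infinity>"
  shows "En (mug u) <= En g" using mug(3)[OF assms(1) En_finite_Lp_loc[OF wug_measurable[OF assms(1)] assms(2)]] by (rule En_mono_AE)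

text \<open>Adding a function whose line integral is infinite on all exceptional curves turns a weak
  upper gradient into a genuine one, at the cost of a larger but still finite energy.\<close>

lemma ex_upper_gradient:
  assumes "wug u g" "En g < \<infinity>"
  obtains g' where "upper_gradient u g'" "En g' < \<infinity>" "g' \<in> borel_measurable borel"
proof -
  obtain g0 where g0: "g0 \<in> borel_measurable borel" "AE x in \<mu>. g0 x = g x" "pae (good u g0)"
    using assms(1) by (rule wug_borelE)
  obtain \<rho> where \<rho>: "\<rho> \<in> borel_measurable borel" "En \<rho> < \<infinity>"
    "!!\<gamma> l. arclength_curve \<gamma> l ==> \<not> good u g0 \<gamma> l ==> line_integral \<rho> \<gamma> l = \<infinity>"
    using g0(3) by (rule paeE) blast
  note [measurable] = g0(1) \<rho>(1) meas_mu[OF g0(1)] meas_mu[OF \<rho>(1)]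
  show thesis
  proof
    show m: "(%x. g0 x + \<rho> x) \<in> borel_measurable borel" by measurable
    have "En g0 = En g" using g0(2) by (rule En_cong_AE)
    hence "ennreal (2 powr p) * (En g0 + En \<rho>) < \<infinity>" using assms(2) \<rho>(2) by (simp add: ennreal_mult_less_top)
    thus "En (%x. g0 x + \<rho> x) < \<infinity>" by (rule le_less_trans[OF En_add_le, rotated 2]) measurable
    show "upper_gradient u (%x. g0 x + \<rho> x)" unfolding upper_gradient_on_def
    proof (intro conjI allI impI m)
      fix \<gamma> :: "real => 'a" and l assume "arclength_curve \<gamma> l \<and> \<gamma> ` {0..l} \<subseteq> UNIV"
      hence \<gamma>: "arclength_curve \<gamma> l" ..
      show "ext_diff (u (\<gamma> 0)) (u (\<gamma> l)) <= line_integral (%x. g0 x + \<rho> x) \<gamma> l"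
      proof (cases "good u g0 \<gamma> l")
        case True
        hence "ext_diff (u (\<gamma> 0)) (u (\<gamma> l)) <= line_integral g0 \<gamma> l"
          using \<gamma> by (simp add: good_def line_integral_eq_seg arclength_curve_def)
        also have "... <= line_integral (%x. g0 x + \<rho> x) \<gamma> l" by (rule line_integral_mono) simp
        finally show ?thesis .
      next
        case False
        have "line_integral \<rho> \<gamma> l <= line_integral (%x. g0 x + \<rho> x) \<gamma> l" by (rule line_integral_mono) simp
        thus ?thesis using \<rho>(3)[OF \<gamma> False] by (simp add: top_unique)
      qed
    qed
  qed
qed

section \<open>Membership and norm in the Newtonian space\<close>

lemma newtonian_norm_powr:
  "ennpowr (newtonian_norm p \<mu> u) p = En (%x. e2ennreal \<bar>u x\<bar>) + En (mug u)"
  using p0 by (simp add: newtonian_norm_def En_def ennpowr_ennpowr)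

lemma newtonianI:
  assumes "u \<in> bmeas" "wug u g" "En g < \<infinity>" "En (%x. e2ennreal \<bar>u x\<bar>) < \<infinity>"
  shows "u \<in> newtonian p \<mu>"
    "ennpowr (newtonian_norm p \<mu> u) p <= En (%x. e2ennreal \<bar>u x\<bar>) + En g"
proof -
  show le: "ennpowr (newtonian_norm p \<mu> u) p <= En (%x. e2ennreal \<bar>u x\<bar>) + En g"
    unfolding newtonian_norm_powr by (intro add_left_mono En_mug_le assms)
  obtain g' where g': "upper_gradient u g'" "En g' < \<infinity>" "g' \<in> borel_measurable borel"
    using assms(2,3) by (rule ex_upper_gradient)
  have "g' \<in> Lp_loc p \<mu>" using meas_mu[OF g'(3)] g'(2) by (rule En_finite_Lp_loc)
  moreover have "newtonian_norm p \<mu> u < \<infinity>"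
  proof -
    have "ennpowr (newtonian_norm p \<mu> u) p < top" using le by (rule le_less_trans) (use assms(3,4) in simp)
    thus ?thesis by simp
  qed
  ultimately show "u \<in> newtonian p \<mu>" using assms(1) g'(1) unfolding newtonian_def by blast
qed

lemma newtonianD:
  assumes "u \<in> newtonian p \<mu>"
  shows "u \<in> bmeas" "wug u (mug u)" "En (mug u) < \<infinity>" "En (%x. e2ennreal \<bar>u x\<bar>) < \<infinity>"
proof -
  obtain g where g: "g \<in> Lp_loc p \<mu>" "upper_gradient u g" and um: "u \<in> bmeas"
    and fin: "newtonian_norm p \<mu> u < \<infinity>" using assms unfolding newtonian_def by blast
  show "u \<in> bmeas" by (rule um)
  have "weak_upper_gradient p \<mu> u g" unfolding weak_upper_gradient_def
  proof
    show "g \<in> bmeas" using g(1) by (simp add: Lp_loc_def)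
    show "pae (%\<gamma> l. ext_diff (u (\<gamma> 0)) (u (\<gamma> l)) <= line_integral g \<gamma> l)"
    proof (rule paeI[of "%_. 0"])
      fix \<gamma> l assume "arclength_curve \<gamma> l" "\<not> ext_diff (u (\<gamma> 0)) (u (\<gamma> l)) <= line_integral g \<gamma> l"
      thus "line_integral (%_. 0) \<gamma> l = \<infinity>" using g(2) unfolding upper_gradient_on_def by blast
    qed (simp_all add: En_def)
  qed
  thus "wug u (mug u)" using mug(1) g(1) weak_upper_gradient_iff_wug by blast
  have "ennpowr (newtonian_norm p \<mu> u) p < top" using fin by simp
  thus "En (mug u) < \<infinity>" "En (%x. e2ennreal \<bar>u x\<bar>) < \<infinity>"
    unfolding newtonian_norm_powr by (simp_all add: less_top)
qed

end

section \<open>Calculus of weak upper gradients\<close>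

lemma acp_lipschitz_comp:
  assumes "acp f G l" "0 <= c" "!!s t. \<bar>f' s - f' t\<bar> <= c * \<bar>f s - f t\<bar>"
  shows "acp f' (%t. ennreal c * G t) l"
proof -
  note [measurable] = acpD(1)[OF assms(1)]
  have eq: "seg (%t. ennreal c * G t) s t = ennreal c * seg G s t" for s t unfolding seg_def by (simp add: nn_integral_cmult mult.assoc)
  show ?thesis unfolding acp_def eq
  proof (intro conjI allI impI)
    show "ennreal c * seg G 0 l < \<infinity>" using acpD(2)[OF assms(1)] by (simp add: ennreal_mult_less_top)
    fix s t assume st: "0 <= s" "s <= t" "t <= l"
    have "ennreal \<bar>f' s - f' t\<bar> <= ennreal (c * \<bar>f s - f t\<bar>)" by (intro ennreal_leI assms(3))
    also have "... = ennreal c * ennreal \<bar>f s - f t\<bar>" using assms(2) by (simp add: ennreal_mult)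
    also have "... <= ennreal c * seg G s t" by (intro mult_left_mono acpD(3)[OF assms(1) st]) simp
    finally show "ennreal \<bar>f' s - f' t\<bar> <= ennreal c * seg G s t" .
  qed measurable
qed

lemma acp_sum2:
  assumes 1: "acp f1 G1 l" and 2: "acp f2 G2 l"
    and le: "!!s t. \<bar>f s - f t\<bar> <= \<bar>f1 s - f1 t\<bar> + \<bar>f2 s - f2 t\<bar>"
  shows "acp f (%t. G1 t + G2 t) l"
proof -
  note [measurable] = acpD(1)[OF 1] acpD(1)[OF 2]
  show ?thesis unfolding acp_def seg_add[OF acpD(1)[OF 1] acpD(1)[OF 2]]
  proof (intro conjI allI impI)
    show "seg G1 0 l + seg G2 0 l < \<infinity>" using acpD(2)[OF 1] acpD(2)[OF 2] by simp
    fix s t assume st: "0 <= s" "s <= t" "t <= l"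
    have "ennreal \<bar>f s - f t\<bar> <= ennreal (\<bar>f1 s - f1 t\<bar> + \<bar>f2 s - f2 t\<bar>)" by (intro ennreal_leI le)
    also have "... = ennreal \<bar>f1 s - f1 t\<bar> + ennreal \<bar>f2 s - f2 t\<bar>" by simp
    also have "... <= seg G1 s t + seg G2 s t" by (intro add_mono acpD(3)[OF 1 st] acpD(3)[OF 2 st])
    finally show "ennreal \<bar>f s - f t\<bar> <= seg G1 s t + seg G2 s t" .
  qed measurable
qed

context newtonian_space
begin

abbreviation rwug :: "('a => real) => ('a => ennreal) => bool" where
  "rwug u \<equiv> wug (%x. ereal (u x))"

lemma good_real_iff:
  assumes "arclength_curve \<gamma> l" "g \<in> borel_measurable borel"
  shows "good (%x. ereal (u x)) g \<gamma> l \<longleftrightarrow> acp (%t. u (\<gamma> t)) (%t. g (ext_curve \<gamma> l t)) l"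
  using good_iff_acp[OF assms, of "%x. ereal (u x)"] by simp

text \<open>\<open>F\<close> is controlled on finite values only, because good curves meet no
  others. This is what allows extended real functions to be truncated to real ones.\<close>

lemma wug_lipschitz_comp:
  assumes "wug u g" "0 <= c" "!!a b. \<bar>F (ereal a) - F (ereal b)\<bar> <= c * \<bar>a - b\<bar>"
  shows "rwug (%x. F (u x)) (%x. ennreal c * g x)"
proof -
  obtain g0 where g0: "g0 \<in> borel_measurable borel" "AE x in \<mu>. g0 x = g x" "pae (good u g0)"
    using assms(1) by (rule wug_borelE)
  note [measurable] = g0(1) wug_measurable[OF assms(1)]
  show ?thesis
  proof (rule wugI)
    show m: "(%x. ennreal c * g0 x) \<in> borel_measurable borel" by measurable
    show "AE x in \<mu>. ennreal c * g0 x = ennreal c * g x" using g0(2) by eventually_elim simp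
    show "pae (good (%x. ereal (F (u x))) (%x. ennreal c * g0 x))"
    proof (rule pae_mono[OF g0(3)])
      fix \<gamma> l assume \<gamma>: "arclength_curve \<gamma> l" and A: "good u g0 \<gamma> l"
      note B = A[unfolded good_iff_acp[OF \<gamma> g0(1)]]
      define f where "f t = F (ereal (real_of_ereal (u (\<gamma> t))))" for t
      have eq: "f t = F (u (\<gamma> t))" if "0 <= t" "t <= l" for t using conjunct1[OF B] that by (simp add: f_def ereal_real')
      have "acp f (%t. ennreal c * g0 (ext_curve \<gamma> l t)) l"
        using conjunct2[OF B] assms(2) by (rule acp_lipschitz_comp) (simp add: f_def assms(3))
      hence "acp (%t. F (u (\<gamma> t))) (%t. ennreal c * g0 (ext_curve \<gamma> l t)) l" unfolding acp_def using eq by simp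
      thus "good (%x. ereal (F (u x))) (%x. ennreal c * g0 x) \<gamma> l" unfolding good_real_iff[OF \<gamma> m] .
    qed
  qed measurable
qed

lemma rwug_lipschitz_comp:
  assumes "rwug u g" "0 <= c" "!!a b. \<bar>F a - F b\<bar> <= c * \<bar>a - b\<bar>"
  shows "rwug (%x. F (u x)) (%x. ennreal c * g x)"
  using wug_lipschitz_comp[of "%x. ereal (u x)" g c "%a. F (real_of_ereal a)"] assms by simp

lemma rwug_contraction:
  assumes "rwug u g" "!!a b. \<bar>F a - F b\<bar> <= \<bar>a - b\<bar>"
  shows "rwug (%x. F (u x)) g" using rwug_lipschitz_comp[of u g 1 F] assms by simp

lemma rwug_sum2:
  assumes 1: "rwug u1 g1" and 2: "rwug u2 g2"
    and le: "!!x y. \<bar>u x - u y\<bar> <= \<bar>u1 x - u1 y\<bar> + \<bar>u2 x - u2 y\<bar>"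
  shows "rwug u (%x. g1 x + g2 x)"
proof -
  obtain g0 where g0: "g0 \<in> borel_measurable borel" "AE x in \<mu>. g0 x = g1 x" "pae (good (%x. ereal (u1 x)) g0)"
    using 1 by (rule wug_borelE)
  obtain h0 where h0: "h0 \<in> borel_measurable borel" "AE x in \<mu>. h0 x = g2 x" "pae (good (%x. ereal (u2 x)) h0)"
    using 2 by (rule wug_borelE)
  note [measurable] = g0(1) h0(1) wug_measurable[OF 1] wug_measurable[OF 2]
  show ?thesis
  proof (rule wugI)
    show m: "(%x. g0 x + h0 x) \<in> borel_measurable borel" by measurable
    show "AE x in \<mu>. g0 x + h0 x = g1 x + g2 x" using g0(2) h0(2) by eventually_elim simp
    show "pae (good (%x. ereal (u x)) (%x. g0 x + h0 x))"
    proof (rule pae_mono[OF pae_conj[OF g0(3) h0(3)]])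
      fix \<gamma> l assume \<gamma>: "arclength_curve \<gamma> l" and A: "good (%x. ereal (u1 x)) g0 \<gamma> l \<and> good (%x. ereal (u2 x)) h0 \<gamma> l"
      show "good (%x. ereal (u x)) (%x. g0 x + h0 x) \<gamma> l" unfolding good_real_iff[OF \<gamma> m]
        using A[unfolded good_real_iff[OF \<gamma> g0(1)] good_real_iff[OF \<gamma> h0(1)]] le
        by (intro acp_sum2[of "%t. u1 (\<gamma> t)" _ l "%t. u2 (\<gamma> t)"]) auto
    qed
  qed measurable
qed

text \<open>Enlarging a gradient could destroy the finiteness of line integrals that
  \<open>good\<close> requires. The upper bound \<open>k\<close>, a weak upper gradient of some
  function \<open>v\<close>, restores it.\<close>

lemma wug_mono:
  assumes 1: "wug u g" and 2: "wug v k" and [measurable]: "g' \<in> bmeas"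
    and le: "AE x in \<mu>. g x <= g' x" "AE x in \<mu>. g' x <= k x"
  shows "wug u g'"
proof -
  obtain g0 where g0: "g0 \<in> borel_measurable borel" "AE x in \<mu>. g0 x = g x" "pae (good u g0)" using 1 by (rule wug_borelE)
  obtain k0 where k0: "k0 \<in> borel_measurable borel" "AE x in \<mu>. k0 x = k x" "pae (good v k0)" using 2 by (rule wug_borelE)
  obtain h0 where h0: "h0 \<in> borel_measurable borel" "AE x in \<mu>. h0 x = g' x" using ex_borel[of g'] by auto
  have "AE x in \<mu>. g0 x <= h0 x \<and> h0 x <= k0 x" using le g0(2) k0(2) h0(2) by eventually_elim simp
  note N = pae_null[OF this]
  show ?thesis
  proof (rule wugI[OF _ h0])
    show "pae (good u h0)"
    proof (rule pae_mono[OF pae_conj[OF N pae_conj[OF g0(3) k0(3)]]])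
      fix \<gamma> l assume \<gamma>: "arclength_curve \<gamma> l" and
        A: "(AE t in lborel. 0 <= t --> t <= l --> g0 (\<gamma> t) <= h0 (\<gamma> t) \<and> h0 (\<gamma> t) <= k0 (\<gamma> t)) \<and>
          good u g0 \<gamma> l \<and> good v k0 \<gamma> l"
      show "good u h0 \<gamma> l" unfolding good_def
      proof (intro conjI allI impI)
        have "line_integral h0 \<gamma> l <= line_integral k0 \<gamma> l" unfolding line_integral_eq_seg
          using conjunct1[OF A] by (intro seg_mono_AE, eventually_elim) auto
        also have "... < \<infinity>" using A by (simp add: good_def)
        finally show "line_integral h0 \<gamma> l < \<infinity>" .
        fix s t assume st: "0 <= s" "s <= t" "t <= l"
        have "ext_diff (u (\<gamma> s)) (u (\<gamma> t)) <= seg (%\<tau>. g0 (\<gamma> \<tau>)) s t" using A st by (simp add: good_def)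
        also have "... <= seg (%\<tau>. h0 (\<gamma> \<tau>)) s t"
          using conjunct1[OF A] by (intro seg_mono_AE, eventually_elim) (use st in auto)
        finally show "ext_diff (u (\<gamma> s)) (u (\<gamma> t)) <= seg (%\<tau>. h0 (\<gamma> \<tau>)) s t" .
      qed
    qed
  qed fact
qed

text \<open>No curve-wise measurability of \<open>u\<close> is needed: \<open>u\<close> agrees almost everywhere with a Borel set's
  indicator as far as the level set is concerned, and almost every curve does not see the difference.\<close>

lemma rwug_locality:
  assumes 1: "rwug u g" and [measurable]: "u \<in> bmeas"
  shows "rwug u (%x. if u x = c then 0 else g x)"
proof -
  obtain g0 where g0: "g0 \<in> borel_measurable borel" "AE x in \<mu>. g0 x = g x" "pae (good (%x. ereal (u x)) g0)"
    using 1 by (rule wug_borelE)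
  have "{x \<in> space \<mu>. u x ~= c} \<in> sets \<mu>" by measurable
  then obtain S where S: "S \<in> sets borel" "AE x in \<mu>. x \<in> S \<longleftrightarrow> u x ~= c" by (rule ex_borel_set) simp
  note [measurable] = g0(1) S(1) wug_measurable[OF 1]
  define h0 where "h0 = (%x. g0 x * indicator S x)"
  show ?thesis
  proof (rule wugI)
    show m: "h0 \<in> borel_measurable borel" unfolding h0_def by measurable
    show "AE x in \<mu>. h0 x = (if u x = c then 0 else g x)" using g0(2) S(2) by eventually_elim (auto simp: h0_def)
    show "pae (good (%x. ereal (u x)) h0)"
    proof (rule pae_mono[OF pae_conj[OF pae_null[OF S(2)] g0(3)]])
      fix \<gamma> l assume \<gamma>: "arclength_curve \<gamma> l" and
        A: "(AE t in lborel. 0 <= t --> t <= l --> (\<gamma> t \<in> S \<longleftrightarrow> u (\<gamma> t) ~= c)) \<and> good (%x. ereal (u x)) g0 \<gamma> l"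
      note B = conjunct2[OF A, unfolded good_real_iff[OF \<gamma> g0(1)]]
      show "good (%x. ereal (u x)) h0 \<gamma> l" unfolding good_real_iff[OF \<gamma> m]
      proof (rule acp_locality[OF B measurable_along[OF \<gamma> m]])
        show "AE t in lborel. 0 <= t --> t <= l --> u (\<gamma> t) ~= c --> g0 (ext_curve \<gamma> l t) <= h0 (ext_curve \<gamma> l t)"
          using conjunct1[OF A] by eventually_elim (auto simp: h0_def)
        show "h0 (ext_curve \<gamma> l t) <= g0 (ext_curve \<gamma> l t)" for t by (auto simp: h0_def split: split_indicator)
      qed
    qed
  qed measurable
qed

text \<open>The oscillation of \<open>v\<close> between two points is at most that of some
  \<open>u n\<close>, up to a supremum, and each of these is bounded by the supremum of the
  gradients. Its finite energy makes the line integrals finite on almost every curve.\<close>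

lemma rwug_SUP:
  fixes u :: "nat => 'a => real"
  assumes w: "!!n. rwug (u n) (g n)" and fin: "En (%x. SUP n. g n x) < \<infinity>"
    and le: "!!x y. ennreal \<bar>v x - v y\<bar> <= (SUP n. ennreal \<bar>u n x - u n y\<bar>)"
  shows "rwug v (%x. SUP n. g n x)"
proof -
  obtain H N where H: "!!n. H n \<in> borel_measurable borel" "N \<in> sets borel" "AE x in \<mu>. x \<notin> N"
    "!!n x. x \<notin> N ==> H n x = g n x" "!!n x. x \<in> N ==> H n x = 0" "!!n. pae (good (%x. ereal (u n x)) (H n))"
    by (rule wug_borel_seqE[of "%n x. ereal (u n x)" g, OF w]) blast
  note [measurable] = H(1) wug_measurable[OF w]
  have ae: "AE x in \<mu>. (SUP n. H n x) = (SUP n. g n x)" using H(3) by eventually_elim (simp add: H(4))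
  have m: "(%x. SUP n. H n x) \<in> borel_measurable borel" by measurable
  have "En (%x. SUP n. H n x) < \<infinity>" using fin En_cong_AE[OF ae] by simp
  note L = pae_Lp[OF m this]
  show ?thesis
  proof (rule wugI[OF _ m ae])
    show "(%x. SUP n. g n x) \<in> bmeas" by measurable
    show "pae (good (%x. ereal (v x)) (%x. SUP n. H n x))"
    proof (rule pae_mono[OF pae_conj[OF L pae_countable[OF H(6)]]])
      fix \<gamma> l assume \<gamma>: "arclength_curve \<gamma> l" and
        A: "line_integral (%x. SUP n. H n x) \<gamma> l < \<infinity> \<and> (\<forall>n. good (%x. ereal (u n x)) (H n) \<gamma> l)"
      show "good (%x. ereal (v x)) (%x. SUP n. H n x) \<gamma> l" unfolding good_def
      proof (intro conjI allI impI)
        show "line_integral (%x. SUP n. H n x) \<gamma> l < \<infinity>" using A by blast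
        fix s t assume st: "0 <= s" "s <= t" "t <= l"
        have "ext_diff (ereal (v (\<gamma> s))) (ereal (v (\<gamma> t))) <= (SUP n. ennreal \<bar>u n (\<gamma> s) - u n (\<gamma> t)\<bar>)"
          using le by simp
        also have "... <= seg (%\<tau>. SUP n. H n (\<gamma> \<tau>)) s t"
        proof (rule SUP_least)
          fix n
          have "ennreal \<bar>u n (\<gamma> s) - u n (\<gamma> t)\<bar> <= seg (%\<tau>. H n (\<gamma> \<tau>)) s t"
            using conjunct2[OF A] st by (simp add: good_def)
          also have "... <= seg (%\<tau>. SUP n. H n (\<gamma> \<tau>)) s t" by (intro seg_mono SUP_upper) simp
          finally show "ennreal \<bar>u n (\<gamma> s) - u n (\<gamma> t)\<bar> <= seg (%\<tau>. SUP n. H n (\<gamma> \<tau>)) s t" .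
        qed
        finally show "ext_diff (ereal (v (\<gamma> s))) (ereal (v (\<gamma> t))) <= seg (%\<tau>. SUP n. H n (\<gamma> \<tau>)) s t" .
      qed
    qed
  qed
qed

lemma rwug_Lipschitz:
  assumes "0 <= L" "!!x y. \<bar>u x - u y\<bar> <= L * dist x y"
  shows "rwug u (%_. ennreal L)"
proof (rule wugI_borel)
  show m: "(%_. ennreal L) \<in> borel_measurable borel" by simp
  show "pae (good (%x. ereal (u x)) (%_. ennreal L))"
  proof (rule paeI[of "%_. 0"])
    fix \<gamma> :: "real => 'a" and l assume \<gamma>: "arclength_curve \<gamma> l" and "\<not> good (%x. ereal (u x)) (%_. ennreal L) \<gamma> l"
    have seg: "seg (%_. ennreal L) s t = ennreal (L * (t - s))" if "s <= t" for s t
      using that assms(1) by (simp add: seg_def nn_integral_cmult_indicator ennreal_mult)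
    have "good (%x. ereal (u x)) (%_. ennreal L) \<gamma> l" unfolding good_real_iff[OF \<gamma> m] acp_def
    proof (intro conjI allI impI)
      show "seg (%t. ennreal L) 0 l < \<infinity>" using \<gamma> by (subst seg) (auto simp: arclength_curve_def)
      fix s t assume st: "0 <= s" "s <= t" "t <= l"
      have "\<bar>u (\<gamma> s) - u (\<gamma> t)\<bar> <= L * dist (\<gamma> s) (\<gamma> t)" by (rule assms(2))
      also have "... <= L * (t - s)" using arclength_curve_dist[OF \<gamma> st] assms(1) by (intro mult_left_mono)
      finally show "ennreal \<bar>u (\<gamma> s) - u (\<gamma> t)\<bar> <= seg (%t. ennreal L) s t"
        using st by (simp add: seg ennreal_leI)
    qed simp
    thus "line_integral (%_. 0) \<gamma> l = \<infinity>" using \<open>\<not> good _ _ _ _\<close> by blast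
  qed (simp_all add: En_def)
qed

lemma rwug_const: "rwug (%_. c) (%_. 0)" using rwug_Lipschitz[of 0 "%_. c"] by simp

text \<open>Both \<open>u1 + (u2 - u1)\<^sup>+\<close> and \<open>u2 + (u1 - u2)\<^sup>+\<close> equal the maximum; the minimum of the two
  resulting gradients is the glued one.\<close>

lemma rwug_max:
  assumes 1: "rwug u1 g1" and 2: "rwug u2 g2"
    and [measurable]: "u1 \<in> bmeas" "u2 \<in> bmeas"
  shows "rwug (%x. max (u1 x) (u2 x)) (%x. if u2 x <= u1 x then g1 x else g2 x)"
proof -
  note [measurable] = wug_measurable[OF 1] wug_measurable[OF 2]
  have s: "rwug (%x. max (u1 x) (u2 x)) (%x. g1 x + g2 x)" by (rule rwug_sum2[OF 1 2]) (auto simp: max_def)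
  have a: "rwug (%x. max (u1 x) (u2 x)) (%x. g1 x + (if max (u2 x - u1 x) 0 = 0 then 0 else g1 x + g2 x))"
    by (rule rwug_sum2[OF 1 rwug_locality[OF rwug_sum2[OF 1 2]]]) (auto simp: max_def)
  have b: "rwug (%x. max (u1 x) (u2 x)) (%x. g2 x + (if max (u1 x - u2 x) 0 = 0 then 0 else g1 x + g2 x))"
    by (rule rwug_sum2[OF 2 rwug_locality[OF rwug_sum2[OF 1 2]]]) (auto simp: max_def)
  show ?thesis
  proof (rule wug_mono[OF wug_min[OF a b] s])
    show "AE x in \<mu>. min (g1 x + (if max (u2 x - u1 x) 0 = 0 then 0 else g1 x + g2 x))
        (g2 x + (if max (u1 x - u2 x) 0 = 0 then 0 else g1 x + g2 x)) <= (if u2 x <= u1 x then g1 x else g2 x)"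
      by (rule AE_I2) (auto simp: max_def min_le_iff_disj)
  qed auto
qed

lemma rwug_min:
  assumes 1: "rwug u1 g1" and 2: "rwug u2 g2"
    and [measurable]: "u1 \<in> bmeas" "u2 \<in> bmeas"
  shows "rwug (%x. min (u1 x) (u2 x)) (%x. if u1 x <= u2 x then g1 x else g2 x)"
proof -
  have "rwug (%x. - u1 x) g1" "rwug (%x. - u2 x) g2" by (rule rwug_contraction[OF 1] rwug_contraction[OF 2]; simp)+
  from rwug_max[OF this] have "rwug (%x. max (- u1 x) (- u2 x)) (%x. if - u2 x <= - u1 x then g1 x else g2 x)" by simp
  from rwug_contraction[OF this, of uminus] show ?thesis by (simp add: minus_max_eq_min)
qed

text \<open>Values in \<open>[0, 1]\<close> keep suprema and infima of arbitrary sequences finite.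
  Finite energy is asked of the gradient only, so constants are allowed even when the total measure
  is infinite.\<close>

definition npair :: "('a => real) => ('a => ennreal) => bool" where
  "npair u g \<longleftrightarrow> u \<in> bmeas \<and> (\<forall>x. 0 <= u x \<and> u x <= 1) \<and> rwug u g \<and> En g < \<infinity>"

lemma npairD:
  assumes "npair u g"
  shows "u \<in> bmeas" "0 <= u x" "u x <= 1" "rwug u g" "En g < \<infinity>" "g \<in> bmeas"
  using assms wug_measurable unfolding npair_def by blast+

section \<open>Capacities\<close>

text \<open>An upper bound \<open>e\<close> for the Sobolev capacity of \<open>A\<close>, expressed
  by a single competitor with values in \<open>[0, 1]\<close> instead of an infimum.\<close>

definition capt :: "'a set => ennreal => bool" where
  "capt A e \<longleftrightarrow> (\<exists>u g. npair u g \<and> (\<forall>x\<in>A. u x = 1) \<and> En (%x. ennreal (u x)) + En g <= e)"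

lemma capt_mono: "capt A e ==> B \<subseteq> A ==> e <= e' ==> capt B e'" unfolding capt_def by (meson order_trans subsetD)

lemma cSUP_diff_le:
  fixes u :: "nat => 'b => real"
  assumes bdd: "!!x. bdd_above (range (%n. u n x))"
  shows "ennreal \<bar>(SUP n. u n x) - (SUP n. u n y)\<bar> <= (SUP n. ennreal \<bar>u n x - u n y\<bar>)"
proof -
  define v where "v x = (SUP n. u n x)" for x
  have *: "ennreal (v x - v y) <= (SUP n. ennreal \<bar>u n x - u n y\<bar>)" for x y
  proof (rule ennreal_le_epsilon)
    fix \<epsilon> :: real assume "0 < \<epsilon>"
    hence "v x - \<epsilon> < v x" by simp
    then obtain n where n: "v x - \<epsilon> < u n x" unfolding v_def using less_cSUP_iff[OF _ bdd] by blast
    have "u n y <= v y" unfolding v_def by (intro cSUP_upper bdd) simp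
    hence "ennreal (v x - v y) <= ennreal (\<bar>u n x - u n y\<bar> + \<epsilon>)" using n by (intro ennreal_leI) auto
    also have "... <= (SUP n. ennreal \<bar>u n x - u n y\<bar>) + ennreal \<epsilon>"
    proof -
      have "ennreal \<bar>u n x - u n y\<bar> <= (SUP n. ennreal \<bar>u n x - u n y\<bar>)" by (rule SUP_upper) simp
      thus ?thesis using \<open>0 < \<epsilon>\<close> by (simp add: add_right_mono)
    qed
    finally show "ennreal (v x - v y) <= (SUP n. ennreal \<bar>u n x - u n y\<bar>) + ennreal \<epsilon>" .
  qed
  show ?thesis
  proof (cases "v y <= v x")
    case True
    hence "\<bar>v x - v y\<bar> = v x - v y" by simp
    thus ?thesis using *[of x y] unfolding v_def by metis
  next
    case False
    hence "\<bar>v x - v y\<bar> = v y - v x" by simp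
    thus ?thesis using *[of y x] unfolding v_def by (simp add: abs_minus_commute)
  qed
qed

lemma npair_SUP:
  fixes u :: "nat => 'a => real"
  assumes p: "!!n. npair (u n) (g n)" and fin: "En (%x. SUP n. g n x) < \<infinity>"
  shows "npair (%x. SUP n. u n x) (%x. SUP n. g n x)"
proof -
  note [measurable] = npairD(1)[OF p]
  have bdd: "bdd_above (range (%n. u n x))" for x using npairD(3)[OF p] by (intro bdd_aboveI2)
  show ?thesis unfolding npair_def
  proof (intro conjI allI)
    show "(%x. SUP n. u n x) \<in> bmeas" using bdd by measurable
    show "0 <= (SUP n. u n x)" for x by (rule cSUP_upper2[OF bdd UNIV_I[of 0]]) (rule npairD(2)[OF p])
    show "(SUP n. u n x) <= 1" for x using npairD(3)[OF p] by (intro cSUP_least) auto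
    show "rwug (%x. SUP n. u n x) (%x. SUP n. g n x)" by (rule rwug_SUP[OF npairD(4)[OF p] fin]) (rule cSUP_diff_le[OF bdd])
  qed (rule fin)
qed

lemma npair_complement: "npair u g ==> npair (%x. 1 - u x) g" unfolding npair_def using rwug_contraction[of u g "%a. 1 - a"] by auto

lemma npair_INF:
  fixes u :: "nat => 'a => real"
  assumes p: "!!n. npair (u n) (g n)" and fin: "En (%x. SUP n. g n x) < \<infinity>"
  shows "npair (%x. INF n. u n x) (%x. SUP n. g n x)"
proof -
  have "(SUP n. 1 - u n x) = 1 - (INF n. u n x)" for x
  proof -
    have bdd: "bdd_below (range (%n. u n x))" using npairD(2)[OF p] by (intro bdd_belowI2)
    have bdd': "bdd_above (range (%n. 1 - u n x))" using npairD(2)[OF p] by (intro bdd_aboveI2[of _ _ 1]) auto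
    show ?thesis
    proof (rule antisym)
      show "(SUP n. 1 - u n x) <= 1 - (INF n. u n x)" by (intro cSUP_least) (auto intro: cINF_lower[OF bdd])
      have "1 - (SUP n. 1 - u n x) <= u n x" for n using cSUP_upper[OF UNIV_I bdd', of n] by simp
      hence "1 - (SUP n. 1 - u n x) <= (INF n. u n x)" by (intro cINF_greatest) auto
      thus "1 - (INF n. u n x) <= (SUP n. 1 - u n x)" by simp
    qed
  qed
  thus ?thesis using npair_complement[OF npair_SUP[OF npair_complement[OF p] fin]] by simp
qed

text \<open>The supremum of the competitors is a competitor for the union. Both parts of its energy
  are at most the sums of the corresponding parts, by \<open>En_SUP_le\<close>.\<close>

lemma capt_UN:
  fixes A :: "nat => 'a set"
  assumes "!!n. capt (A n) (e n)" "(\<Sum>n. e n) < \<infinity>"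
  shows "capt (\<Union>n. A n) (\<Sum>n. e n)"
proof -
  have "\<forall>n. \<exists>ug. npair (fst ug) (snd ug) \<and> (\<forall>x\<in>A n. fst ug x = 1) \<and> En (%x. ennreal (fst ug x)) + En (snd ug) <= e n"
    using assms(1) unfolding capt_def by simp
  from choice[OF this] obtain ug where
    ug: "!!n. npair (fst (ug n)) (snd (ug n))" "!!n x. x \<in> A n ==> fst (ug n) x = 1"
     "!!n. En (%x. ennreal (fst (ug n) x)) + En (snd (ug n)) <= e n" by blast
  define u where "u = (%n. fst (ug n))"
  define g where "g = (%n. snd (ug n))"
  have p: "npair (u n) (g n)" and one: "x \<in> A n ==> u n x = 1" and le: "En (%x. ennreal (u n x)) + En (g n) <= e n" for n x
    using ug by (simp_all add: u_def g_def)
  note [measurable] = npairD(1)[OF p] npairD(6)[OF p]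
  define v where "v = (%x. SUP n. u n x)"
  have bdd: "bdd_above (range (%n. u n x))" for x using npairD(3)[OF p] by (intro bdd_aboveI2)
  have sums: "(\<Sum>n. En (%x. ennreal (u n x))) + (\<Sum>n. En (g n)) <= (\<Sum>n. e n)"
    by (subst suminf_add) (auto intro!: suminf_le le)
  have 1: "En (%x. SUP n. g n x) <= (\<Sum>n. En (g n))" by (rule En_SUP_le) measurable
  have fin: "En (%x. SUP n. g n x) < \<infinity>"
  proof -
    note 1
    also have "(\<Sum>n. En (g n)) <= (\<Sum>n. En (%x. ennreal (u n x))) + (\<Sum>n. En (g n))" by simp
    also note sums
    also note assms(2)
    finally show ?thesis .
  qed
  have vp: "npair v (%x. SUP n. g n x)" unfolding v_def by (rule npair_SUP[OF p fin])
  have ev: "ennreal (v x) <= (SUP n. ennreal (u n x))" for x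
  proof -
    have fin: "(SUP n. ennreal (u n x)) <= 1" using npairD(3)[OF p] by (intro SUP_least) simp
    have "v x <= enn2real (SUP n. ennreal (u n x))" unfolding v_def
    proof (rule cSUP_least)
      fix n
      have "(SUP n. ennreal (u n x)) < top" using fin by (rule le_less_trans) simp
      hence "enn2real (ennreal (u n x)) <= enn2real (SUP n. ennreal (u n x))" by (intro enn2real_mono SUP_upper) simp_all
      thus "u n x <= enn2real (SUP n. ennreal (u n x))" using npairD(2)[OF p] by simp
    qed simp
    hence "ennreal (v x) <= ennreal (enn2real (SUP n. ennreal (u n x)))" by (rule ennreal_leI)
    also have "... = (SUP n. ennreal (u n x))" by (intro ennreal_enn2real le_less_trans[OF fin]) (simp add: less_top[symmetric])
    finally show ?thesis .
  qed
  have "En (%x. ennreal (v x)) <= En (%x. SUP n. ennreal (u n x))" by (rule En_mono[OF ev])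
  also have "... <= (\<Sum>n. En (%x. ennreal (u n x)))" by (rule En_SUP_le) measurable
  finally have 2: "En (%x. ennreal (v x)) <= (\<Sum>n. En (%x. ennreal (u n x)))" .
  have "v x = 1" if "x \<in> (\<Union>n. A n)" for x
  proof -
    obtain n where "x \<in> A n" using \<open>x \<in> (\<Union>n. A n)\<close> by blast
    hence "1 <= v x" unfolding v_def using one by (intro cSUP_upper2[OF bdd, of n]) auto
    moreover have "v x <= 1" by (rule npairD(3)[OF vp])
    ultimately show ?thesis by simp
  qed
  moreover have "En (%x. ennreal (v x)) + En (%x. SUP n. g n x) <= (\<Sum>n. e n)" using add_mono[OF 2 1] sums by (rule order_trans)
  ultimately show ?thesis using vp unfolding capt_def by blast
qed

definition capnull :: "'a set => bool" where
  "capnull A \<longleftrightarrow> (\<forall>e>0. capt A (ennreal e))"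

lemma capnull_subset: "capnull A ==> B \<subseteq> A ==> capnull B" unfolding capnull_def using capt_mono by blast

lemma capnull_UN:
  fixes A :: "nat => 'a set"
  assumes "!!n. capnull (A n)" shows "capnull (\<Union>n. A n)" unfolding capnull_def
proof (intro allI impI)
  fix e :: real assume e: "0 < e"
  have eq: "(\<Sum>n. ennreal (e * (1/2)^Suc n)) = ennreal e"
    using e sums_mult[OF power_half_series, of e] by (intro suminf_ennreal_eq) auto
  have "capt (\<Union>n. A n) (\<Sum>n. ennreal (e * (1/2)^Suc n))"
  proof (rule capt_UN)
    show "capt (A n) (ennreal (e * (1/2)^Suc n))" for n using assms[of n] e unfolding capnull_def by simp
    show "(\<Sum>n. ennreal (e * (1/2)^Suc n)) < \<infinity>" unfolding eq by simp
  qed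
  thus "capt (\<Union>n. A n) (ennreal e)" unfolding eq .
qed

lemma capnull_Un: "capnull A ==> capnull B ==> capnull (A \<union> B)" using capnull_UN[of "%n::nat. if n = 0 then A else B"]
  by (rule capnull_subset[rotated 2]) (auto split: if_splits)

lemma newtonian_truncate:
  assumes "u \<in> newtonian p \<mu>" "0 <= c"
  shows "npair (%x. real_of_ereal (min 1 (ereal c * \<bar>u x\<bar>))) (%x. ennreal c * mug u x)"
    "En (%x. ennreal (real_of_ereal (min 1 (ereal c * \<bar>u x\<bar>)))) <= ennreal (c powr p) * En (%x. e2ennreal \<bar>u x\<bar>)"
proof -
  note u = newtonianD[OF assms(1)]
  note [measurable] = u(1) wug_measurable[OF u(2)]
  define F where "F = (%a. real_of_ereal (min 1 (ereal c * \<bar>a\<bar>)))"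
  have Fr: "F (ereal a) = min 1 (c * \<bar>a\<bar>)" for a by (simp add: F_def min_def)
  have F01: "0 <= F a \<and> F a <= 1" for a
  proof (cases a)
    case (real r) thus ?thesis using assms(2) by (simp add: Fr)
  qed (use assms(2) in \<open>auto simp: F_def min_def zero_ereal_def[symmetric]\<close>)
  have lip: "\<bar>F (ereal a) - F (ereal b)\<bar> <= c * \<bar>a - b\<bar>" for a b
  proof -
    have "\<bar>c * \<bar>a\<bar> - c * \<bar>b\<bar>\<bar> <= c * \<bar>a - b\<bar>"
      using assms(2) by (simp add: right_diff_distrib[symmetric] abs_mult mult_left_mono)
    thus ?thesis unfolding Fr by (simp add: min_def abs_if split: if_splits)
  qed
  have w: "rwug (%x. F (u x)) (%x. ennreal c * mug u x)" by (rule wug_lipschitz_comp[OF u(2) assms(2) lip])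
  have "En (%x. ennreal c * mug u x) < \<infinity>" using u(3) assms(2) by (subst En_cmult) (auto simp: ennreal_mult_less_top)
  moreover have "(%x. F (u x)) \<in> bmeas" unfolding F_def by measurable
  ultimately show "npair (%x. real_of_ereal (min 1 (ereal c * \<bar>u x\<bar>))) (%x. ennreal c * mug u x)"
    using w F01 unfolding npair_def F_def by blast
  have "ennreal (F a) <= ennreal c * e2ennreal \<bar>a\<bar>" for a
  proof (cases "c = 0")
    case True
    have "F a = 0" unfolding F_def True by (simp add: zero_ereal_def[symmetric] min_def)
    thus ?thesis by simp
  next
    case False
    show ?thesis
    proof (cases a)
      case (real r)
      hence "ennreal (F a) <= ennreal (c * \<bar>r\<bar>)" by (simp add: Fr ennreal_leI)
      also have "... = ennreal c * e2ennreal \<bar>a\<bar>" using real assms(2) by (simp add: ennreal_mult)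
      finally show ?thesis .
    qed (use False assms(2) in \<open>auto simp: ennreal_mult_top\<close>)
  qed
  hence "En (%x. ennreal (F (u x))) <= En (%x. ennreal c * e2ennreal \<bar>u x\<bar>)" by (intro En_mono) 
  also have "... = ennreal (c powr p) * En (%x. e2ennreal \<bar>u x\<bar>)" using assms(2) by (intro En_cmult) measurable
  finally show "En (%x. ennreal (real_of_ereal (min 1 (ereal c * \<bar>u x\<bar>)))) <= ennreal (c powr p) * En (%x. e2ennreal \<bar>u x\<bar>)"
    unfolding F_def .
qed

lemma npair_newtonian:
  assumes "npair u g" "En (%x. ennreal (u x)) < \<infinity>"
  shows "(%x. ereal (u x)) \<in> newtonian p \<mu>"
    "ennpowr (newtonian_norm p \<mu> (%x. ereal (u x))) p <= En (%x. ennreal (u x)) + En g"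
proof -
  note [measurable] = npairD(1)[OF assms(1)]
  have eq: "(%x. e2ennreal \<bar>ereal (u x)\<bar>) = (%x. ennreal (u x))" using npairD(2)[OF assms(1)] by (auto simp: fun_eq_iff)
  have "(%x. ereal (u x)) \<in> bmeas" by measurable
  from newtonianI[OF this npairD(4,5)[OF assms(1)]] assms(2)
  show "(%x. ereal (u x)) \<in> newtonian p \<mu>"
    "ennpowr (newtonian_norm p \<mu> (%x. ereal (u x))) p <= En (%x. ennreal (u x)) + En g" unfolding eq by blast+
qed

lemma sobolev_capacity_0_iff: "sobolev_capacity p \<mu> A = 0 \<longleftrightarrow> capnull A"
proof
  assume 0: "sobolev_capacity p \<mu> A = 0"
  show "capnull A" unfolding capnull_def
  proof (intro allI impI)
    fix e :: real assume "0 < e"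
    hence "sobolev_capacity p \<mu> A < ennreal e" using 0 by simp
    hence "\<exists>u\<in>{u \<in> newtonian p \<mu>. \<forall>x\<in>A. u x = 1}. ennpowr (newtonian_norm p \<mu> u) p < ennreal e"
      unfolding sobolev_capacity_def INF_less_iff .
    then obtain u where u: "u \<in> newtonian p \<mu>" "\<forall>x\<in>A. u x = 1" "ennpowr (newtonian_norm p \<mu> u) p < ennreal e"
      by auto
    note t = newtonian_truncate[OF u(1), of 1]
    have "En (%x. ennreal (real_of_ereal (min 1 (ereal 1 * \<bar>u x\<bar>)))) + En (%x. ennreal 1 * mug u x) <= ennreal e"
    proof -
      have "En (%x. ennreal (real_of_ereal (min 1 (ereal 1 * \<bar>u x\<bar>)))) <= En (%x. e2ennreal \<bar>u x\<bar>)"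
        using t(2) by simp
      hence "En (%x. ennreal (real_of_ereal (min 1 (ereal 1 * \<bar>u x\<bar>)))) + En (%x. ennreal 1 * mug u x)
          <= En (%x. e2ennreal \<bar>u x\<bar>) + En (mug u)" by (simp add: add_right_mono)
      also have "... <= ennreal e" using less_imp_le[OF u(3)] unfolding newtonian_norm_powr .
      finally show ?thesis .
    qed
    moreover have "\<forall>x\<in>A. real_of_ereal (min 1 (ereal 1 * \<bar>u x\<bar>)) = 1" using u(2) by (simp add: one_ereal_def)
    ultimately show "capt A (ennreal e)" unfolding capt_def using t(1)[OF zero_le_one] by blast
  qed
next
  assume A: "capnull A"
  have "sobolev_capacity p \<mu> A <= 0"
  proof (rule ennreal_le_epsilon)
    fix e :: real assume "0 < e"
    hence "capt A (ennreal e)" using A unfolding capnull_def by blast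
    then obtain u g where u: "npair u g" "\<forall>x\<in>A. u x = 1" "En (%x. ennreal (u x)) + En g <= ennreal e"
      unfolding capt_def by blast
    have "En (%x. ennreal (u x)) <= ennreal e" using u(3) by (rule order_trans[rotated]) simp
    hence fin: "En (%x. ennreal (u x)) < \<infinity>" by (rule le_less_trans) simp
    have "sobolev_capacity p \<mu> A <= ennpowr (newtonian_norm p \<mu> (%x. ereal (u x))) p"
      unfolding sobolev_capacity_def using npair_newtonian(1)[OF u(1) fin] u(2) by (intro INF_lower) (auto simp: one_ereal_def)
    also have "... <= ennreal e" using npair_newtonian(2)[OF u(1) fin] u(3) by (rule order_trans)
    finally show "sobolev_capacity p \<mu> A <= 0 + ennreal e" by simp
  qed
  thus "sobolev_capacity p \<mu> A = 0" by simp
qed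

lemma variational_capacity_le:
  assumes "npair u g" "En (%x. ennreal (u x)) < \<infinity>" "!!x. x \<in> A ==> u x = 1" "!!x. x \<notin> G ==> u x = 0"
  shows "vcap A G <= En g"
proof -
  have "vcap A G <= En (mug (%x. ereal (u x)))" unfolding variational_capacity_def En_def
    using npair_newtonian(1)[OF assms(1,2)] assms(3,4) by (intro INF_lower) (auto simp: newtonian0_def one_ereal_def zero_ereal_def)
  also have "... <= En g" by (rule En_mug_le[OF npairD(4,5)[OF assms(1)]])
  finally show ?thesis .
qed

text \<open>Every competitor can be replaced by its truncation \<open>min 1 |u|\<close>, which has
  no larger gradient; so it suffices to bound the energies of pairs from below.\<close>

lemma variational_capacity_ge:
  assumes "!!u g. npair u g ==> (!!x. x \<in> A ==> u x = 1) ==> (!!x. x \<notin> G ==> u x = 0) ==> K <= En g"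
  shows "K <= vcap A G" unfolding variational_capacity_def
proof (rule INF_greatest)
  fix u assume "u \<in> {u \<in> newtonian0 p \<mu> G. \<forall>x\<in>A. 1 <= u x}"
  hence u: "u \<in> newtonian p \<mu>" "!!x. x \<notin> G ==> u x = 0" "!!x. x \<in> A ==> 1 <= u x" by (auto simp: newtonian0_def)
  have "K <= En (%x. ennreal 1 * mug u x)"
  proof (rule assms[OF newtonian_truncate(1)[OF u(1), of 1]])
    show "real_of_ereal (min 1 (ereal 1 * \<bar>u x\<bar>)) = 1" if "x \<in> A" for x
    proof -
      have "1 <= \<bar>u x\<bar>" using u(3)[OF that] by (cases "u x") auto
      thus ?thesis by (simp add: min_def one_ereal_def)
    qed
    show "real_of_ereal (min 1 (ereal 1 * \<bar>u x\<bar>)) = 0" if "x \<notin> G" for x using u(2)[OF that] by simp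
  qed simp
  thus "K <= (\<integral>\<^sup>+x. ennpowr (mug u x) p \<partial>\<mu>)" by (simp add: En_def)
qed

end

section \<open>Outer regularity and differentiation\<close>

lemma emeasure_UN_le_count_space:
  assumes "countable D" "!!i. i \<in> D ==> B i \<in> sets M"
  shows "emeasure M (\<Union>i\<in>D. B i) <= (\<integral>\<^sup>+i. emeasure M (B i) \<partial>count_space D)"
proof -
  have "(\<Union>i\<in>D. B i) \<in> sets M" using assms by (intro sets.countable_UN') auto
  hence "emeasure M (\<Union>i\<in>D. B i) = (\<integral>\<^sup>+x. indicator (\<Union>i\<in>D. B i) x \<partial>M)" by simp
  also have "... <= (\<integral>\<^sup>+x. (\<integral>\<^sup>+i. indicator (B i) x \<partial>count_space D) \<partial>M)"
  proof (rule nn_integral_mono)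
    fix x
    show "indicator (\<Union>i\<in>D. B i) x <= (\<integral>\<^sup>+i. indicator (B i) x \<partial>count_space D)"
    proof (cases "x \<in> (\<Union>i\<in>D. B i)")
      case True
      then obtain i where i: "i \<in> D" "x \<in> B i" by blast
      have "(1::ennreal) = (\<integral>\<^sup>+j. indicator {i} j \<partial>count_space D)" using i by simp
      also have "... <= (\<integral>\<^sup>+i. indicator (B i) x \<partial>count_space D)"
        using i by (intro nn_integral_mono) (auto split: split_indicator)
      finally show ?thesis using True by simp
    qed simp
  qed
  also have "... = (\<integral>\<^sup>+i. (\<integral>\<^sup>+x. indicator (B i) x \<partial>M) \<partial>count_space D)"
    using assms by (intro nn_integral_count_space_nn_integral) auto
  also have "... = (\<integral>\<^sup>+i. emeasure M (B i) \<partial>count_space D)" using assms by (intro nn_integral_cong) auto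
  finally show ?thesis .
qed

text \<open>The sets squeezed between a closed and an open set up to small measure form a
  sigma-algebra. It contains the closed sets, since a nonempty closed set is the intersection of its
  open neighbourhoods of width \<open>1 / (n + 1)\<close>.\<close>

lemma finite_borel_closed_open:
  fixes M :: "'b::metric_space measure"
  assumes sM: "sets M = sets borel" and fin: "emeasure M UNIV < \<infinity>"
    and A: "A \<in> sets borel" and e: "0 < (e::real)"
  shows "\<exists>F G. closed F \<and> open G \<and> F \<subseteq> A \<and> A \<subseteq> G \<and> emeasure M (G - F) < ennreal e"
proof -
  have spM: "space M = UNIV" using sM by (metis sets_eq_imp_space_eq space_borel)
  have fm: "emeasure M B < \<infinity>" for B
  proof -
    have "emeasure M B <= emeasure M (space M)" by (rule emeasure_space)
    thus ?thesis using fin spM by (simp add: le_less_trans)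
  qed
  have [simp]: "B \<in> sets M" if "B \<in> sets borel" for B using that sM by simp
  have "A \<in> sigma_sets UNIV {S. closed S}" using A by (simp add: borel_eq_closed)
  hence "\<forall>e>0. \<exists>F G. closed F \<and> open G \<and> F \<subseteq> A \<and> A \<subseteq> G \<and> emeasure M (G - F) < ennreal e"
  proof (induction A)
    case (Basic A)
    hence cl: "closed A" by simp
    show ?case
    proof (cases "A = {}")
      case True
      thus ?thesis by (intro allI impI exI[of _ "{}"]) auto
    next
      case False
      define G where "G = (%n::nat. {x. infdist x A < 1 / real (Suc n)})"
      have oG: "open (G n)" for n unfolding G_def by (intro open_Collect_less continuous_on_infdist continuous_intros)
      have AG: "A \<subseteq> G n" for n unfolding G_def by auto
      have "(\<Inter>n. G n - A) = {}"
      proof (rule ccontr)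
        assume "(\<Inter>n. G n - A) ~= {}"
        then obtain x where x: "x \<notin> A" "!!n. infdist x A < 1 / real (Suc n)" by (auto simp: G_def)
        hence "infdist x A > 0" using in_closed_iff_infdist_zero[OF cl False, of x] infdist_nonneg[of x A] by linarith
        then obtain n where "1 / real (Suc n) < infdist x A" using nat_approx_posE by blast
        thus False using x(2)[of n] by simp
      qed
      moreover have "(%n. emeasure M (G n - A)) \<longlonglongrightarrow> emeasure M (\<Inter>n. G n - A)"
      proof (rule Lim_emeasure_decseq)
        show "range (%n. G n - A) \<subseteq> sets M" using oG cl by (auto intro!: sets.Diff borel_open borel_closed)
        show "decseq (%n. G n - A)" unfolding G_def by (intro decseq_SucI) (auto intro: less_le_trans simp: frac_le)
        show "emeasure M (G i - A) ~= \<infinity>" for i using fm[of "G i - A"] by simp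
      qed
      ultimately have lim: "(%n. emeasure M (G n - A)) \<longlonglongrightarrow> 0" by (simp only: emeasure_empty)
      show ?thesis
      proof (intro allI impI)
        fix e :: real assume "0 < e"
        hence "eventually (%n. emeasure M (G n - A) < ennreal e) sequentially" by (intro order_tendstoD(2)[OF lim]) simp
        from eventually_happens'[OF sequentially_bot this]
        obtain n where "emeasure M (G n - A) < ennreal e" ..
        thus "\<exists>F G. closed F \<and> open G \<and> F \<subseteq> A \<and> A \<subseteq> G \<and> emeasure M (G - F) < ennreal e"
          using cl oG AG by blast
      qed
    qed
  next
    case Empty
    show ?case by (intro allI impI exI[of _ "{}"]) auto
  next
    case (Compl A)
    show ?case
    proof (intro allI impI)
      fix e :: real assume e: "0 < e"
      from Compl.IH[rule_format, OF e]
      obtain F G where FG: "closed F" "open G" "F \<subseteq> A" "A \<subseteq> G" "emeasure M (G - F) < ennreal e" by (elim exE conjE)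
      have "(- F) - (- G) = G - F" by auto
      thus "\<exists>F G. closed F \<and> open G \<and> F \<subseteq> UNIV - A \<and> UNIV - A \<subseteq> G \<and> emeasure M (G - F) < ennreal e"
        using FG by (intro exI[of _ "- G"] exI[of _ "- F"]) auto
    qed
  next
    case (Union a)
    show ?case
    proof (intro allI impI)
      fix e :: real assume e: "0 < e"
      define d where "d = (%n::nat. (e/2) * (1/2)^Suc n)"
      have d: "0 < d n" for n using e by (simp add: d_def)
      have "\<forall>n. \<exists>FG. closed (fst FG) \<and> open (snd FG) \<and> fst FG \<subseteq> a n \<and> a n \<subseteq> snd FG \<and>
          emeasure M (snd FG - fst FG) < ennreal (d n)" using Union.IH d by simp
      from choice[OF this] obtain FG where FG: "!!n. closed (fst (FG n))" "!!n. open (snd (FG n))"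
        "!!n. fst (FG n) \<subseteq> a n" "!!n. a n \<subseteq> snd (FG n)" "!!n. emeasure M (snd (FG n) - fst (FG n)) < ennreal (d n)"
        by blast
      define F where "F = (%n. fst (FG n))"
      define G where "G = (%n. snd (FG n))"
      have bF: "F n \<in> sets borel" and bG: "G n \<in> sets borel" for n using FG(1,2) by (auto simp: F_def G_def intro: borel_closed)
      have 1: "emeasure M (\<Union>n. G n - F n) <= ennreal (e/2)"
      proof -
        have "emeasure M (\<Union>n. G n - F n) <= (\<Sum>n. emeasure M (G n - F n))"
          using bF bG by (intro emeasure_subadditive_countably) auto
        also have "... <= (\<Sum>n. ennreal (d n))" using FG(5) by (intro suminf_le) (auto simp: F_def G_def intro: less_imp_le)
        also have "... = ennreal (e/2)"
          using e sums_mult[OF power_half_series, of "e/2"] unfolding d_def by (intro suminf_ennreal_eq) auto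
        finally show ?thesis .
      qed
      \<comment> \<open>The union of the closed sets \<open>F n\<close> need not be closed. A finite
        union is, and the remainder \<open>H N\<close> decreases to the empty set, so its measure
        tends to 0.\<close>
      define H where "H = (%N::nat. (\<Union>n. F n) - (\<Union>n<N. F n))"
      have "(%N. emeasure M (H N)) \<longlonglongrightarrow> emeasure M (\<Inter>N. H N)"
      proof (rule Lim_emeasure_decseq)
        show "range H \<subseteq> sets M" unfolding H_def using bF by auto
        show "decseq H" unfolding H_def by (intro decseq_SucI) auto
        show "emeasure M (H i) ~= \<infinity>" for i using fm[of "H i"] by simp
      qed
      moreover have "(\<Inter>N. H N) = {}" unfolding H_def by auto
      ultimately have lim: "(%N. emeasure M (H N)) \<longlonglongrightarrow> 0" by simp
      have "eventually (%N. emeasure M (H N) < ennreal (e/2)) sequentially" using e by (intro order_tendstoD(2)[OF lim]) simp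
      from eventually_happens'[OF sequentially_bot this]
      obtain N where N: "emeasure M (H N) < ennreal (e/2)" ..
      have "emeasure M ((\<Union>n. G n) - (\<Union>n<N. F n)) <= emeasure M ((\<Union>n. G n - F n) \<union> H N)"
        using bF bG by (intro emeasure_mono) (auto simp: H_def)
      also have "... <= emeasure M (\<Union>n. G n - F n) + emeasure M (H N)"
        using bF bG unfolding H_def by (intro emeasure_subadditive) auto
      also have "... < ennreal (e/2) + ennreal (e/2)"
        using add_less_le_mono_ennreal[OF N 1] fm[of "\<Union>n. G n - F n"] by (simp add: add.commute)
      also have "... = ennreal e" using e by (simp flip: ennreal_plus)
      finally have "emeasure M ((\<Union>n. G n) - (\<Union>n<N. F n)) < ennreal e" .
      moreover have "closed (\<Union>n<N. F n)" "open (\<Union>n. G n)" using FG(1,2) by (auto simp: F_def G_def)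
      moreover have "(\<Union>n<N. F n) \<subseteq> (\<Union>n. a n)" "(\<Union>n. a n) \<subseteq> (\<Union>n. G n)"
        using FG(3,4) unfolding F_def G_def by blast+
      ultimately show "\<exists>F G. closed F \<and> open G \<and> F \<subseteq> (\<Union>i. a i) \<and> (\<Union>i. a i) \<subseteq> G \<and> emeasure M (G - F) < ennreal e"
        by blast
    qed
  qed
  thus ?thesis using e by blast
qed

context newtonian_space
begin

abbreviation m :: "'a => real => real" where
  "m x r \<equiv> measure \<mu> (ball x r)"

lemma emeasure_ball: "emeasure \<mu> (ball x r) = ennreal (m x r)" using ball_finite[of x r] by (intro emeasure_eq_ennreal_measure) simp

lemma m_pos: "0 < r ==> 0 < m x r" using ball_pos[of r x] unfolding emeasure_ball by simp

lemma emeasure_subset_ball: "A \<subseteq> ball x r ==> emeasure \<mu> A < \<infinity>"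
  using emeasure_mono[of A "ball x r" \<mu>] ball_finite[of x r] by (auto intro: le_less_trans)

lemma ball_Collect_fmeasurable:
  assumes "{y \<in> space \<mu>. P y} \<in> sets \<mu>" shows "{y \<in> ball x r. P y} \<in> fmeasurable \<mu>"
proof -
  have "{y \<in> ball x r. P y} = ball x r \<inter> {y \<in> space \<mu>. P y}" by auto
  thus ?thesis using assms by (auto intro!: fmeasurableI emeasure_subset_ball)
qed

lemma m_mono: "ball x r \<subseteq> ball y s ==> m x r <= m y s"
  using ball_finite[of y s] by (intro measure_mono_fmeasurable) (auto simp: fmeasurable_def)

text \<open>Two reductions lead to finite Borel measures: \<open>A\<close> is enlarged by a null set
  to a Borel set \<open>T\<close>, and the measure is restricted to the ball to make it
  finite.\<close>

lemma outer_regular_ball: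
  assumes A: "A \<in> sets \<mu>" "A \<subseteq> ball x0 R" and e: "0 < (e::real)"
  obtains G where "open G" "A \<subseteq> G" "emeasure \<mu> (G - A) < ennreal e"
proof -
  obtain S where S: "S \<in> sets borel" "AE x in \<mu>. x \<in> S \<longleftrightarrow> x \<in> A" using A(1) by (rule ex_borel_set)
  obtain N where N: "N \<in> sets borel" "emeasure \<mu> N = 0" "!!x. x \<notin> N ==> (x \<in> S \<longleftrightarrow> x \<in> A)"
    by (rule AE_borel_null[OF S(2)]) blast
  define T where "T = (S \<union> N) \<inter> ball x0 R"
  have T: "T \<in> sets borel" "A \<subseteq> T" "T - A \<subseteq> N" using S(1) N A(2) by (auto simp: T_def)
  obtain \<nu> where \<nu>: "sets \<nu> = sets borel" "\<mu> = completion \<nu>" using ex_completion by blast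
  define M where "M = density \<nu> (indicator (ball x0 R))"
  have sM: "sets M = sets borel" using \<nu>(1) by (simp add: M_def)
  have emM: "emeasure M B = emeasure \<mu> (B \<inter> ball x0 R)" if "B \<in> sets borel" for B
  proof -
    have "emeasure M B = (\<integral>\<^sup>+x. indicator (ball x0 R) x * indicator B x \<partial>\<nu>)"
      unfolding M_def using that \<nu>(1) by (intro emeasure_density) auto
    also have "... = (\<integral>\<^sup>+x. indicator (B \<inter> ball x0 R) x \<partial>\<nu>)"
      by (intro nn_integral_cong) (auto split: split_indicator)
    also have "... = emeasure \<nu> (B \<inter> ball x0 R)" using that \<nu>(1) by (intro nn_integral_indicator) auto
    also have "... = emeasure \<mu> (B \<inter> ball x0 R)" unfolding \<nu>(2) using that \<nu>(1) by (simp add: emeasure_completion)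
    finally show ?thesis .
  qed
  have "emeasure M UNIV < \<infinity>" by (subst emM) (use ball_finite in auto)
  from finite_borel_closed_open[OF sM this T(1) e]
  obtain F G where FG: "open G" "F \<subseteq> T" "T \<subseteq> G" "emeasure M (G - F) < ennreal e" "closed F" by blast
  show thesis
  proof
    show "open (G \<inter> ball x0 R)" using FG(1) by auto
    show "A \<subseteq> G \<inter> ball x0 R" using T(2) FG(3) A(2) by blast
    have GF: "G - F \<in> sets borel" "(G - F) \<inter> ball x0 R \<in> sets borel" using FG(1) borel_closed[OF FG(5)] by auto
    have "emeasure \<mu> (G \<inter> ball x0 R - A) <= emeasure \<mu> (((G - F) \<inter> ball x0 R) \<union> N)"
      using T(3) FG(2) N(1) GF(2) by (intro emeasure_mono borel_sets sets.Un) auto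
    also have "... = emeasure \<mu> ((G - F) \<inter> ball x0 R)"
      using N(2) borel_sets[OF N(1)] borel_sets[OF GF(2)] by (intro emeasure_Un_null_set null_setsI)
    also have "... = emeasure M (G - F)" by (rule emM[OF GF(1), symmetric])
    finally show "emeasure \<mu> (G \<inter> ball x0 R - A) < ennreal e" using FG(4) by simp
  qed
qed

lemma AE_notin_if_small:
  assumes "!!e::real. 0 < e ==> \<exists>T\<in>sets \<mu>. N \<subseteq> T \<and> emeasure \<mu> T <= ennreal e"
  shows "AE x in \<mu>. x \<notin> N"
proof -
  have "\<forall>n::nat. \<exists>T. T \<in> sets \<mu> \<and> N \<subseteq> T \<and> emeasure \<mu> T <= ennreal (1 / real (Suc n))"
    using assms by (metis of_nat_0_less_iff zero_less_Suc zero_less_divide_1_iff)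
  from choice[OF this] obtain T where T: "!!n. T n \<in> sets \<mu>" "!!n. N \<subseteq> T n"
    "!!n. emeasure \<mu> (T n) <= ennreal (1 / real (Suc n))" by blast
  have "emeasure \<mu> (\<Inter>n. T n) <= 0"
  proof (rule ennreal_le_epsilon)
    fix e :: real assume "0 < e"
    then obtain n where n: "1 / real (Suc n) < e" using nat_approx_posE by blast
    have "emeasure \<mu> (\<Inter>n. T n) <= emeasure \<mu> (T n)" using T(1) by (intro emeasure_mono) auto
    also have "... <= ennreal (1 / real (Suc n))" by (rule T(3))
    also have "... <= ennreal e" using n by (intro ennreal_leI) simp
    finally show "emeasure \<mu> (\<Inter>n. T n) <= 0 + ennreal e" by simp
  qed
  thus ?thesis using T(1,2) by (intro AE_I[of _ _ "\<Inter>n. T n"]) auto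
qed

definition avg :: "('a => real) => 'a => real => real" where
  "avg u x r = (LINT y:ball x r|\<mu>. u y) / m x r"

lemma integrable_ball:
  fixes u :: "'a => real"
  assumes "u \<in> bmeas" "!!y. \<bar>u y\<bar> <= K"
  shows "set_integrable \<mu> (ball x r) u" unfolding set_integrable_def using ball_finite[of x r] assms
  by (intro integrableI_bounded_set_indicator[where B = K]) auto

end

section \<open>Coverings and differentiation of integrals in doubling spaces\<close>

locale doubling_space = newtonian_space +
  fixes CD :: real
  assumes CD1: "1 <= CD" and dbl: "!!x r. 0 < r ==> m x (2 * r) <= CD * m x r"
begin

lemma m_power: "0 < r ==> m x (2 ^ n * r) <= CD ^ n * m x r"
proof (induction n)
  case (Suc n)
  have "m x (2 ^ Suc n * r) = m x (2 * (2 ^ n * r))" by (simp add: mult.assoc)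
  also have "... <= CD * m x (2 ^ n * r)" using Suc.prems by (intro dbl) simp
  also have "... <= CD * (CD ^ n * m x r)" using CD1 Suc by (intro mult_left_mono) auto
  finally show ?case by simp
qed simp

lemma m_le: "0 < r ==> ball y s \<subseteq> ball x (2 ^ n * r) ==> m y s <= CD ^ n * m x r"
  using m_mono[of y s x "2 ^ n * r"] m_power[of r x n] by linarith

text \<open>A weak type estimate for the maximal function of \<open>\<nu>\<close> over dyadic radii:
  on disjoint balls \<open>\<nu>\<close> is additive, and tripling them costs the factor
  \<open>CD ^ 2\<close> because \<open>3 <= 2 ^ 2\<close>. The right-hand side involves
  \<open>\<nu>\<close> only on the union of the balls, so a locally small \<open>\<nu>\<close> gives
  a small bound.\<close>

lemma covering_weak:
  fixes \<nu> :: "'a measure"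
  assumes R: "0 < R" and s\<nu>: "sets \<nu> = sets \<mu>"
    and le: "!!x j. (x, j) \<in> I ==> emeasure \<mu> (ball x (R / 2 ^ j)) <= K * emeasure \<nu> (ball x (R / 2 ^ j))"
  shows "emeasure \<mu> (\<Union>(x, j)\<in>I. ball x (R / 2 ^ j)) <= ennreal (CD ^ 2) * (K * emeasure \<nu> (\<Union>(x, j)\<in>I. ball x (R / 2 ^ j)))"
proof -
  obtain D where D: "D \<subseteq> I" "disjoint_family_on (%(x, j). ball x (R / 2 ^ j)) D"
    "(\<Union>(x, j)\<in>I. ball x (R / 2 ^ j)) \<subseteq> (\<Union>(x, j)\<in>D. ball x (3 * (R / 2 ^ j)))"
    by (rule vitali_dyadic[OF R, of I]) blast
  define B where "B = (%i::'a \<times> nat. ball (fst i) (R / 2 ^ snd i))"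
  define B3 where "B3 = (%i::'a \<times> nat. ball (fst i) (3 * (R / 2 ^ snd i)))"
  have disj: "disjoint_family_on B D" using D(2) by (simp add: B_def case_prod_beta')
  have cD: "countable D" by (rule countable_disjoint_family[OF disj]) (use R in \<open>auto simp: B_def intro!: ball_pos\<close>)
  have oI: "(\<Union>(x, j)\<in>I. ball x (R / 2 ^ j)) \<in> sets \<mu>" by (intro borel_sets borel_open) auto
  have B3: "emeasure \<mu> (B3 i) <= ennreal (CD ^ 2) * (K * emeasure \<nu> (B i))" if "i \<in> D" for i
  proof -
    have "0 < R / 2 ^ snd i" using R by simp
    hence "m (fst i) (3 * (R / 2 ^ snd i)) <= CD ^ 2 * m (fst i) (R / 2 ^ snd i)"
      by (rule m_le) (use R in \<open>intro subset_ball, simp add: divide_right_mono\<close>)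
    hence "emeasure \<mu> (B3 i) <= ennreal (CD ^ 2 * m (fst i) (R / 2 ^ snd i))" unfolding B3_def emeasure_ball by (rule ennreal_leI)
    also have "... = ennreal (CD ^ 2) * emeasure \<mu> (B i)" using CD1 by (simp add: B_def emeasure_ball ennreal_mult)
    also have "... <= ennreal (CD ^ 2) * (K * emeasure \<nu> (B i))"
      using le[of "fst i" "snd i"] D(1) that unfolding B_def by (intro mult_left_mono) auto
    finally show ?thesis .
  qed
  have "emeasure \<mu> (\<Union>(x, j)\<in>I. ball x (R / 2 ^ j)) <= emeasure \<mu> (\<Union>i\<in>D. B3 i)"
    using D(3) by (intro emeasure_mono borel_sets borel_open) (auto simp: B3_def case_prod_beta)
  also have "... <= (\<integral>\<^sup>+i. emeasure \<mu> (B3 i) \<partial>count_space D)"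
    using cD by (intro emeasure_UN_le_count_space) (auto simp: B3_def)
  also have "... <= (\<integral>\<^sup>+i. ennreal (CD ^ 2) * (K * emeasure \<nu> (B i)) \<partial>count_space D)"
    using B3 by (intro nn_integral_mono) auto
  also have "... = ennreal (CD ^ 2) * (K * (\<integral>\<^sup>+i. emeasure \<nu> (B i) \<partial>count_space D))"
    by (simp add: nn_integral_cmult)
  also have "(\<integral>\<^sup>+i. emeasure \<nu> (B i) \<partial>count_space D) = emeasure \<nu> (\<Union>i\<in>D. B i)"
    using cD disj s\<nu> by (intro emeasure_UN_countable[symmetric]) (auto simp: B_def)
  also have "... <= emeasure \<nu> (\<Union>(x, j)\<in>I. ball x (R / 2 ^ j))"
    using D(1) oI s\<nu> by (intro emeasure_mono) (auto simp: B_def case_prod_beta)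
  finally show ?thesis by (simp add: mult_left_mono)
qed

text \<open>Let \<open>A\<close> be the part of \<open>{u < a}\<close> in a ball and
  \<open>G\<close> an open superset with \<open>G - A\<close> small. A ball inside \<open>G\<close>
  with average above \<open>b\<close> has at least the fraction \<open>b - a\<close> of its measure
  outside \<open>A\<close>, because \<open>u <= 1\<close>. So \<open>covering_weak\<close>, applied
  to the restriction of \<open>\<mu>\<close> to the complement of \<open>A\<close>, bounds the union
  of these balls by a multiple of the measure of \<open>G - A\<close>.\<close>

lemma differentiation_aux:
  fixes u :: "'a => real"
  assumes u[measurable]: "u \<in> bmeas" and u01: "!!x. 0 <= u x" "!!x. u x <= 1"
    and R: "0 < R" and ab: "a < b"
  shows "AE x in \<mu>. \<not> (u x < a \<and> (\<forall>n. \<exists>j\<ge>n. b < avg u x (R / 2 ^ j)))"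
proof (cases "0 <= a")
  case False
  thus ?thesis using u01(1) by (intro AE_I2) (metis less_le_trans not_le order.asym)
next
  case a0: True
  define N where "N = {x. u x < a \<and> (\<forall>n. \<exists>j\<ge>n. b < avg u x (R / 2 ^ j))}"
  fix x0 :: 'a
  have "AE x in \<mu>. x \<notin> N \<inter> ball x0 (real k)" for k :: nat
  proof (rule AE_notin_if_small)
    fix e :: real assume e: "0 < e"
    define A where "A = {x \<in> space \<mu>. u x < a} \<inter> ball x0 (real k)"
    have A: "A \<in> sets \<mu>" unfolding A_def by (intro sets.Int ball_sets) measurable
    have d: "0 < e * (b - a) / CD ^ 2" using e ab CD1 by simp
    obtain G where G: "open G" "A \<subseteq> G" "emeasure \<mu> (G - A) < ennreal (e * (b - a) / CD ^ 2)"
      by (rule outer_regular_ball[OF A _ d, of x0 "real k"]) (auto simp: A_def)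
    define I where "I = {(x, j). ball x (R / 2 ^ j) \<subseteq> G \<inter> ball x0 (real k) \<and> b < avg u x (R / 2 ^ j)}"
    define T where "T = (\<Union>(x, j)\<in>I. ball x (R / 2 ^ j))"
    have TG: "T \<subseteq> G \<inter> ball x0 (real k)" unfolding T_def I_def by auto
    have oT: "T \<in> sets \<mu>" unfolding T_def by (intro borel_sets borel_open) auto
    define \<nu> where "\<nu> = density \<mu> (indicator (- A))"
    have mA: "- A \<in> sets \<mu>" using sets.Diff[OF sets.top A] by (simp add: Compl_eq_Diff_UNIV)
    have em\<nu>: "emeasure \<nu> B = emeasure \<mu> (B - A)" if "B \<in> sets \<mu>" for B
    proof -
      have "emeasure \<nu> B = (\<integral>\<^sup>+x. indicator (- A) x * indicator B x \<partial>\<mu>)"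
        unfolding \<nu>_def using that mA by (intro emeasure_density) auto
      also have "... = (\<integral>\<^sup>+x. indicator (B - A) x \<partial>\<mu>)"
        by (intro nn_integral_cong) (auto split: split_indicator)
      finally show ?thesis using that A by simp
    qed
    have "emeasure \<mu> T <= ennreal (CD ^ 2) * (ennreal (1 / (b - a)) * emeasure \<nu> T)" unfolding T_def
    proof (rule covering_weak[OF R])
      show "sets \<nu> = sets \<mu>" by (simp add: \<nu>_def)
      fix x j assume xj: "(x, j) \<in> I"
      let ?B = "ball x (R / 2 ^ j)"
      have BG: "?B \<subseteq> G \<inter> ball x0 (real k)" "b < avg u x (R / 2 ^ j)" using xj by (auto simp: I_def)
      have r: "0 < R / 2 ^ j" using R by simp
      have mB: "0 < m x (R / 2 ^ j)" using m_pos[OF r] .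
      have fin: "?B - A \<in> fmeasurable \<mu>" "?B \<in> fmeasurable \<mu>"
        using A emeasure_subset_ball[of "?B - A" x "R / 2 ^ j"] ball_finite[of x "R / 2 ^ j"] by (auto simp: fmeasurable_def)
      have bA: "u y <= a + indicator (?B - A) y" if "y \<in> ?B" for y
        using that BG(1) u01(2)[of y] a0 by (cases "y \<in> A") (auto simp: A_def split: split_indicator)
      have "b * m x (R / 2 ^ j) <= (LINT y:?B|\<mu>. u y)" using BG(2) mB by (simp add: avg_def pos_less_divide_eq less_imp_le)
      also have "... <= (LINT y:?B|\<mu>. a + indicator (?B - A) y)"
      proof (rule set_integral_mono)
        show "set_integrable \<mu> ?B u" using u01 by (intro integrable_ball[of u 1]) auto
        show "set_integrable \<mu> ?B (%y. a + indicator (?B - A) y)"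
          using fin a0 by (intro integrable_ball[of _ "a + 1"]) (auto split: split_indicator)
      qed (rule bA)
      also have "... = (LINT y:?B|\<mu>. a) + (LINT y:?B|\<mu>. indicator (?B - A) y)"
        using fin by (intro set_integral_add integrable_ball[of _ "\<bar>a\<bar>"] integrable_ball[of _ 1]) auto
      also have "(LINT y:?B|\<mu>. a) = a * m x (R / 2 ^ j)" by (simp add: set_lebesgue_integral_def)
      also have "(LINT y:?B|\<mu>. indicator (?B - A) y) = (LINT y|\<mu>. indicator (?B - A) y)"
        unfolding set_lebesgue_integral_def by (intro Bochner_Integration.integral_cong) (auto split: split_indicator)
      also have "... = measure \<mu> (?B - A)" by simp
      finally have "(b - a) * m x (R / 2 ^ j) <= measure \<mu> (?B - A)" by (simp add: algebra_simps)
      hence "m x (R / 2 ^ j) <= 1 / (b - a) * measure \<mu> (?B - A)" using ab by (simp add: pos_le_divide_eq mult.commute)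
      hence "emeasure \<mu> ?B <= ennreal (1 / (b - a) * measure \<mu> (?B - A))" unfolding emeasure_ball by (rule ennreal_leI)
      also have "... = ennreal (1 / (b - a)) * emeasure \<mu> (?B - A)"
        unfolding emeasure_eq_measure2[OF fin(1)] using ab by (intro ennreal_mult') simp
      finally show "emeasure \<mu> ?B <= ennreal (1 / (b - a)) * emeasure \<nu> ?B" by (simp add: em\<nu>)
    qed
    also have "emeasure \<nu> T = emeasure \<mu> (T - A)" by (rule em\<nu>[OF oT])
    also have "emeasure \<mu> (T - A) <= emeasure \<mu> (G - A)"
      using TG by (intro emeasure_mono sets.Diff A borel_sets[OF borel_open[OF G(1)]]) auto
    also have "... <= ennreal (e * (b - a) / CD ^ 2)" using G(3) by simp
    also have "ennreal (CD ^ 2) * (ennreal (1 / (b - a)) * ennreal (e * (b - a) / CD ^ 2)) = ennreal e"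
      using ab e CD1 by (simp flip: ennreal_mult)
    finally have "emeasure \<mu> T <= ennreal e" by (simp add: mult_left_mono)
    moreover have "N \<inter> ball x0 (real k) \<subseteq> T"
    proof
      fix x assume x: "x \<in> N \<inter> ball x0 (real k)"
      hence "x \<in> G \<inter> ball x0 (real k)" using G(2) by (auto simp: N_def A_def)
      then obtain \<epsilon> where eps: "0 < \<epsilon>" "ball x \<epsilon> \<subseteq> G \<inter> ball x0 (real k)"
        using G(1) by (meson open_Int open_ball open_contains_ball)
      obtain n where n: "R / 2 ^ n < \<epsilon>"
      proof -
        obtain n where "R / \<epsilon> < 2 ^ n" using real_arch_pow[of 2 "R / \<epsilon>"] by auto
        thus thesis using that[of n] eps(1) by (simp add: field_simps)
      qed
      obtain j where j: "n <= j" "b < avg u x (R / 2 ^ j)" using x by (auto simp: N_def)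
      have "R / 2 ^ j <= R / 2 ^ n" using R j(1) by (intro divide_left_mono) (auto intro: power_increasing)
      hence "ball x (R / 2 ^ j) \<subseteq> ball x \<epsilon>" using n by (intro subset_ball) simp
      hence "(x, j) \<in> I" using eps j by (auto simp: I_def)
      thus "x \<in> T" unfolding T_def using R by (intro UN_I[of "(x, j)"]) auto
    qed
    ultimately show "\<exists>T\<in>sets \<mu>. N \<inter> ball x0 (real k) \<subseteq> T \<and> emeasure \<mu> T <= ennreal e"
      using oT by blast
  qed
  hence "AE x in \<mu>. \<forall>k::nat. x \<notin> N \<inter> ball x0 (real k)" unfolding AE_all_countable by blast
  thus ?thesis
  proof eventually_elim
    case (elim x)
    obtain k :: nat where "dist x0 x < real k" using reals_Archimedean2 by blast
    thus ?case using elim by (auto simp: N_def)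
  qed
qed

lemma avg_diff:
  assumes "u \<in> bmeas" "v \<in> bmeas" "!!y. \<bar>u y\<bar> <= K" "!!y. \<bar>v y\<bar> <= K"
  shows "avg (%x. u x - v x) x r = avg u x r - avg v x r"
  unfolding avg_def using integrable_ball[OF assms(1,3)] integrable_ball[OF assms(2,4)]
  by (simp add: set_integral_diff diff_divide_distrib)

lemma avg_const: "0 < r ==> avg (%_. c) x r = c" using m_pos[of r x] by (simp add: avg_def set_lebesgue_integral_def)

text \<open>The one-sided statement is applied to \<open>u\<close> and to \<open>1 - u\<close>, for
  all pairs of rational thresholds.\<close>

lemma differentiation:
  fixes u :: "'a => real"
  assumes u[measurable]: "u \<in> bmeas" and u01: "!!x. 0 <= u x" "!!x. u x <= 1" and R: "0 < R"
  shows "AE x in \<mu>. (%j. avg u x (R / 2 ^ j)) \<longlonglongrightarrow> u x"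
proof -
  have "AE x in \<mu>. \<forall>a\<in>\<rat>. \<forall>b\<in>\<rat>. a < b --> \<not> (u x < a \<and> (\<forall>n. \<exists>j\<ge>n. b < avg u x (R / 2 ^ j)))"
    using differentiation_aux[OF u u01 R] by (intro AE_ball_countable' countable_rat) auto
  moreover have "AE x in \<mu>. \<forall>a\<in>\<rat>. \<forall>b\<in>\<rat>. a < b -->
      \<not> (1 - u x < a \<and> (\<forall>n. \<exists>j\<ge>n. b < avg (%x. 1 - u x) x (R / 2 ^ j)))"
    using differentiation_aux[of "%x. 1 - u x", OF _ _ _ R] u01 by (intro AE_ball_countable' countable_rat) auto
  ultimately show ?thesis
  proof eventually_elim
    case (elim x)
    have up: "eventually (%j. avg v x (R / 2 ^ j) < b) sequentially"
      if v: "\<forall>a\<in>\<rat>. \<forall>b\<in>\<rat>. a < b --> \<not> (v x < a \<and> (\<forall>n. \<exists>j\<ge>n. b < avg v x (R / 2 ^ j)))" and b: "v x < b" for v b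
    proof -
      obtain q1 where q1: "q1 \<in> \<rat>" "v x < q1" "q1 < b" using Rats_dense_in_real[OF b] by blast
      obtain q2 where q2: "q2 \<in> \<rat>" "q1 < q2" "q2 < b" using Rats_dense_in_real[OF q1(3)] by blast
      obtain n where "!!j. n <= j ==> avg v x (R / 2 ^ j) <= q2" using v q1 q2 by (meson not_le)
      thus ?thesis using q2(3) unfolding eventually_sequentially by (meson le_less_trans)
    qed
    have c: "avg (%x. 1 - u x) x (R / 2 ^ j) = 1 - avg u x (R / 2 ^ j)" for j
      using avg_diff[of "%_. 1" u 1 x "R / 2 ^ j"] avg_const[of "R / 2 ^ j" 1 x] u01 R by simp
    show ?case
    proof (rule order_tendstoI)
      fix b assume "u x < b"
      thus "eventually (%j. avg u x (R / 2 ^ j) < b) sequentially" by (rule up[OF elim(1)])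
    next
      fix a assume "a < u x"
      hence "1 - u x < 1 - a" by simp
      from up[OF elim(2) this] show "eventually (%j. a < avg u x (R / 2 ^ j)) sequentially" unfolding c by simp
    qed
  qed
qed

end

section \<open>The Poincare inequality and a weak Sobolev-Poincare inequality\<close>

lemma ball_subsetI: "dist y x + s <= r ==> ball x s \<subseteq> (ball y r :: 'b::metric_space set)"
  by (smt (verit) dist_triangle mem_ball subsetI)

lemma powr_product:
  assumes "0 < p" "0 <= a" "0 <= b" "0 <= c" "0 <= (d::real)"
  shows "(a * b * c * d powr (1 / p)) powr p = a powr p * b powr p * c powr p * d" using assms by (simp add: powr_mult powr_powr)

context doubling_space
begin

lemma avg_mono:
  assumes "u \<in> bmeas" "v \<in> bmeas" "!!y. \<bar>u y\<bar> <= K" "!!y. \<bar>v y\<bar> <= K"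
    and "!!y. y \<in> ball x r ==> u y <= v y"
  shows "avg u x r <= avg v x r" unfolding avg_def using assms(5)
  by (intro divide_right_mono set_integral_mono integrable_ball[OF assms(1,3)] integrable_ball[OF assms(2,4)]) auto

lemma avg_cong: "(!!y. y \<in> ball x r ==> u y = v y) ==> avg u x r = avg v x r" unfolding avg_def set_lebesgue_integral_def
  by (intro arg_cong2[where f="(/)"] Bochner_Integration.integral_cong) (auto split: split_indicator)

lemma avg_nonneg: "(!!y. 0 <= u y) ==> 0 <= avg u x r" unfolding avg_def set_lebesgue_integral_def
  by (intro divide_nonneg_nonneg integral_nonneg_AE) auto

lemma avg_abs_le:
  assumes u[measurable]: "u \<in> bmeas" and bd: "!!y. \<bar>u y\<bar> <= K"
    and r: "0 < r" and sub: "ball y s \<subseteq> ball x r" and s: "0 < s" and le: "m x r <= D * m y s"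
  shows "\<bar>avg u y s - c\<bar> <= D * avg (%z. \<bar>u z - c\<bar>) x r"
proof -
  have bd': "\<bar>u z - c\<bar> <= K + \<bar>c\<bar>" for z using bd[of z] by linarith
  have int: "set_integrable \<mu> (ball x r) (%z. \<bar>u z - c\<bar>)" for x r
    using bd' by (intro integrable_ball[of _ "K + \<bar>c\<bar>"]) auto
  have int2: "set_integrable \<mu> (ball x r) (%z. u z - c)" for x r using bd' by (intro integrable_ball[of _ "K + \<bar>c\<bar>"]) auto
  have K: "0 <= K" using bd[of x] by linarith
  have "avg u y s - c = avg (%z. u z - c) y s"
    using avg_diff[of u "%_. c" "K + \<bar>c\<bar>" y s] avg_const[OF s, of c y] bd K by (simp add: add_increasing2)
  also have "\<bar>...\<bar> <= (LINT z:ball y s|\<mu>. \<bar>u z - c\<bar>) / m y s" unfolding avg_def abs_divide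
    using set_integral_norm_bound[OF int2[of y s]] by (intro divide_mono) (use m_pos[OF s] in auto)
  also have "... <= (LINT z:ball x r|\<mu>. \<bar>u z - c\<bar>) / m y s"
  proof (intro divide_right_mono)
    show "(LINT z:ball y s|\<mu>. \<bar>u z - c\<bar>) <= (LINT z:ball x r|\<mu>. \<bar>u z - c\<bar>)"
      using sub int[of x r] int[of y s] unfolding set_lebesgue_integral_def set_integrable_def
      by (intro integral_mono) (auto split: split_indicator)
  qed simp
  also have "... <= (LINT z:ball x r|\<mu>. \<bar>u z - c\<bar>) * (D / m x r)"
  proof -
    have "1 / m y s <= D / m x r" using le m_pos[OF s, of y] m_pos[OF r, of x] by (simp add: field_simps)
    moreover have "0 <= (LINT z:ball x r|\<mu>. \<bar>u z - c\<bar>)"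
      unfolding set_lebesgue_integral_def by (intro integral_nonneg_AE) auto
    ultimately have "(LINT z:ball x r|\<mu>. \<bar>u z - c\<bar>) * (1 / m y s) <= (LINT z:ball x r|\<mu>. \<bar>u z - c\<bar>) * (D / m x r)"
      by (rule mult_left_mono)
    thus ?thesis by simp
  qed
  also have "... = D * avg (%z. \<bar>u z - c\<bar>) x r" by (simp add: avg_def)
  finally show ?thesis .
qed

text \<open>The measure \<open>\<nu>\<close> stands for the energy measure with density
  \<open>g ^ p\<close>. The dilation is a power of two so that doubling compares the balls
  directly.\<close>

definition PI :: "('a => real) => 'a measure => real => nat => bool" where
  "PI u \<nu> C n \<longleftrightarrow> (\<forall>x r. 0 < r -->
     avg (%y. \<bar>u y - avg u x r\<bar>) x r <= C * r * (measure \<nu> (ball x (2 ^ n * r)) / m x (2 ^ n * r)) powr (1 / p))"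

lemma PI_avg_diff:
  assumes u: "u \<in> bmeas" and u01: "!!x. 0 <= u x" "!!x. u x <= 1" and pi: "PI u \<nu> C n"
    and r: "0 < r" and s: "0 < s" and sub: "ball y s \<subseteq> ball x r" "ball x r \<subseteq> ball y (2 ^ k * s)"
  shows "\<bar>avg u y s - avg u x r\<bar> <= CD ^ k * (C * r * (measure \<nu> (ball x (2 ^ n * r)) / m x (2 ^ n * r)) powr (1 / p))"
proof -
  have "\<bar>avg u y s - avg u x r\<bar> <= CD ^ k * avg (%z. \<bar>u z - avg u x r\<bar>) x r"
    using u01 by (intro avg_abs_le[OF u _ r sub(1) s m_le[OF s sub(2)], of 1]) auto
  also have "... <= CD ^ k * (C * r * (measure \<nu> (ball x (2 ^ n * r)) / m x (2 ^ n * r)) powr (1 / p))"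
    using pi r CD1 unfolding PI_def by (intro mult_left_mono) auto
  finally show ?thesis .
qed

definition mu_ratio :: "'a measure => 'a => real => real" where
  "mu_ratio \<nu> x r = measure \<nu> (ball x r) / m x r"

text \<open>At a Lebesgue point \<open>y\<close> where \<open>u\<close> is far from its average, one of the telescoping terms must
  exceed \<open>2 ^ - (j / 2)\<close> times a constant, because these numbers are summable.\<close>

lemma telescope:
  assumes u: "u \<in> bmeas" and u01: "!!x. 0 <= u x" "!!x. u x <= 1" and pi: "PI u \<nu> C n"
    and r: "0 < r" and lim: "(%j. avg u y (r / 2 ^ j)) \<longlonglongrightarrow> u y"
    and q: "0 < q" "q < 1"
    and small: "!!j. CD * (C * (r / 2 ^ j) * (mu_ratio \<nu> y (2 ^ n * (r / 2 ^ j))) powr (1 / p)) <= (1 - q) * s * q ^ j"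
  shows "\<bar>u y - avg u y r\<bar> <= s"
proof -
  define a where "a = (%j. avg u y (r / 2 ^ j))"
  have step: "\<bar>a (Suc j) - a j\<bar> <= (1 - q) * s * q ^ j" for j
  proof -
    have "\<bar>avg u y (r / 2 ^ Suc j) - avg u y (r / 2 ^ j)\<bar> <= CD ^ 1 *
        (C * (r / 2 ^ j) * (measure \<nu> (ball y (2 ^ n * (r / 2 ^ j))) / m y (2 ^ n * (r / 2 ^ j))) powr (1 / p))"
      using r by (intro PI_avg_diff[OF u u01 pi]) (auto intro!: subset_ball simp: field_simps)
    also have "... <= (1 - q) * s * q ^ j" using small[of j] unfolding mu_ratio_def by simp
    finally show ?thesis by (simp add: a_def)
  qed
  have s0: "0 <= s"
  proof -
    have "0 <= (1 - q) * s * q ^ 0" using step[of 0] by linarith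
    thus ?thesis using q by (simp add: zero_le_mult_iff)
  qed
  have part: "\<bar>a k - a 0\<bar> <= s" for k
  proof -
    have "\<bar>a k - a 0\<bar> <= s * (1 - q ^ k)"
    proof (induction k)
      case (Suc k)
      have "\<bar>a (Suc k) - a 0\<bar> <= \<bar>a (Suc k) - a k\<bar> + \<bar>a k - a 0\<bar>" by simp
      also have "... <= (1 - q) * s * q ^ k + s * (1 - q ^ k)" using step Suc by (intro add_mono)
      also have "... = s * (1 - q ^ Suc k)" by (simp add: algebra_simps)
      finally show ?case .
    qed simp
    also have "... <= s * 1" using s0 q by (intro mult_left_mono) auto
    finally show ?thesis by simp
  qed
  have "(%k. \<bar>a k - a 0\<bar>) \<longlonglongrightarrow> \<bar>u y - a 0\<bar>" using lim unfolding a_def by (intro tendsto_intros)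
  hence "\<bar>u y - a 0\<bar> <= s" by (rule LIMSEQ_le_const2) (use part in auto)
  thus ?thesis by (simp add: a_def)
qed

text \<open>A weak type Sobolev-Poincare inequality in scale-invariant form. An exponent
  \<open>\<kappa>\<close> larger than 1 is the gain over the Poincare inequality that drives the De
  Giorgi iteration.\<close>

definition wsp :: "real => nat => real => real => bool" where
  "wsp C n K \<kappa> \<longleftrightarrow> (\<forall>u \<nu> x r s. u \<in> bmeas --> (\<forall>y. 0 <= u y) --> (\<forall>y. u y <= 1) --> finite_measure \<nu> -->
     sets \<nu> = sets \<mu> --> PI u \<nu> C n --> 0 < r --> 0 < s -->
     measure \<mu> {y \<in> ball x r. s < \<bar>u y - avg u x r\<bar>} <=
       m x r * (K * ((r / s) powr p * measure \<nu> (ball x (2 ^ (n + 1) * r)) / m x r)) powr \<kappa>)"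

text \<open>At a Lebesgue point \<open>y\<close> where \<open>u\<close> deviates by more than
  \<open>s\<close>, telescoping yields a scale \<open>j\<close> at which \<open>\<nu>\<close> is
  large on a ball about \<open>y\<close>. Allowing the terms to decay like
  \<open>2 ^ - (j / 2)\<close> instead of \<open>2 ^ - j\<close> leaves a factor
  \<open>2 powr (- (j * p / 2))\<close>, which doubling converts into a power
  \<open>\<theta>\<close> of the relative measure of the ball. This power is the gain; a covering by
  such balls finishes the estimate.\<close>

lemma weak_sobolev_poincare:
  assumes C: "0 < C"
  obtains K \<kappa> where "1 <= K" "1 < \<kappa>" "wsp C n K \<kappa>"
proof -
  obtain N :: nat where N: "CD < 2 ^ N" using real_arch_pow[of 2 CD] by auto
  \<comment> \<open>Chosen so that \<open>CD powr \<theta> <= 2 powr (p / 2)\<close>. Relative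
    measures of balls decay at most like powers of \<open>1 / CD\<close>, so the factor
    \<open>2 powr (- (j * p / 2))\<close> is at most \<open>CD\<close> times the power
    \<open>\<theta>\<close> of the relative measure at scale \<open>j\<close>.\<close>
  define \<theta> where "\<theta> = p / (2 * (real N + p))"
  have \<theta>: "0 < \<theta>" "\<theta> < 1" using p1 by (auto simp: \<theta>_def field_simps add_pos_nonneg)
  \<comment> \<open>The exponent that solves \<open>X powr (1 - \<theta>) <= Y\<close> for
    \<open>X\<close>.\<close>
  define \<kappa> where "\<kappa> = 1 / (1 - \<theta>)"
  have \<kappa>: "1 < \<kappa>" using \<theta> by (simp add: \<kappa>_def field_simps)
  define q where "q = (1/2::real) powr (1/2)"
  have q: "0 < q" "q < 1" by (simp_all add: q_def powr_half_sqrt)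
  define K0 where "K0 = (8 * CD ^ 2 * C) powr p"
  define K1 where "K1 = (2 * CD * C / (1 - q)) powr p"
  define K where "K = 1 + K0 + CD ^ 2 * (K1 * CD)"
  have K01: "0 <= K0" "0 <= K1" by (simp_all add: K0_def K1_def)
  have K: "1 <= K" "K0 <= K" "CD ^ 2 * (K1 * CD) <= K" using K01 CD1 by (auto simp: K_def)
  show thesis
  proof (rule that[OF K(1) \<kappa>], unfold wsp_def, intro allI impI)
    fix u \<nu> x and r s :: real
    assume u[measurable]: "u \<in> bmeas" and "\<forall>y. 0 <= u y" "\<forall>y. u y <= 1"
      and fin: "finite_measure \<nu>" and s\<nu>: "sets \<nu> = sets \<mu>" and pi: "PI u \<nu> C n" and r: "0 < r" and s: "0 < s"
    hence u01: "!!y. 0 <= u y" "!!y. u y <= 1" by blast+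
    interpret \<nu>: finite_measure \<nu> by fact
    define V where "V = measure \<nu> (ball x (2 ^ (n + 1) * r))"
    define M where "M = m x r"
    have M: "0 < M" using m_pos[OF r] by (simp add: M_def)
    define Q where "Q = (r / s) powr p * V / M"
    have V: "0 <= V" by (simp add: V_def)
    have Q: "0 <= Q" using V M by (simp add: Q_def)
    define S where "S = {y \<in> ball x r. s < \<bar>u y - avg u x r\<bar>}"
    have S: "S \<in> sets \<mu>" unfolding S_def by (rule fmeasurableD[OF ball_Collect_fmeasurable]) measurable
    have SM: "measure \<mu> S <= M"
      unfolding M_def using S ball_finite[of x r] by (intro measure_mono_fmeasurable) (auto simp: S_def fmeasurable_def)
    have "measure \<mu> S <= M * (K * Q) powr \<kappa>"
    proof (cases "1 <= K * Q")
      case True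
      hence "1 <= (K * Q) powr \<kappa>" using \<kappa> by (intro ge_one_powr_ge_zero) auto
      hence "M * 1 <= M * (K * Q) powr \<kappa>" using M by (intro mult_left_mono) auto
      thus ?thesis using SM by simp
    next
      case KQ: False
      have mvM: "M <= m x (2 ^ (n + 1) * r)"
      proof -
        have "1 * r <= 2 ^ (n + 1) * r" using r by (intro mult_right_mono) (auto simp: one_le_power simp del: power_Suc)
        thus ?thesis unfolding M_def by (intro m_mono subset_ball) simp
      qed
      \<comment> \<open>Since \<open>K * Q < 1\<close>, moving the centre of the average from
        \<open>x\<close> to \<open>y\<close> costs less than half of the deviation \<open>s\<close>;
        the other half is left for the telescoping at \<open>y\<close>.\<close>
      have first: "\<bar>avg u y r - avg u x r\<bar> < s / 2" if y: "y \<in> ball x r" for y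
      proof -
        define A where "A = C * (2 * r) * (measure \<nu> (ball x (2 ^ n * (2 * r))) / m x (2 ^ n * (2 * r))) powr (1 / p)"
        have "\<bar>avg u y r - avg u x (2 * r)\<bar> <= CD ^ 2 * A" unfolding A_def
        proof (rule PI_avg_diff[OF u u01 pi])
          show "ball y r \<subseteq> ball x (2 * r)" using y by (intro ball_subsetI) simp
          show "ball x (2 * r) \<subseteq> ball y (2 ^ 2 * r)" using y r by (intro ball_subsetI) (simp add: dist_commute)
        qed (use r in auto)
        moreover have "\<bar>avg u x r - avg u x (2 * r)\<bar> <= CD ^ 1 * A"
          unfolding A_def using r by (intro PI_avg_diff[OF u u01 pi]) (auto intro!: subset_ball)
        moreover have "CD ^ 1 * A <= CD ^ 2 * A" using CD1 C r by (intro mult_right_mono power_increasing) (auto simp: A_def)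
        ultimately have 1: "\<bar>avg u y r - avg u x r\<bar> <= 2 * (CD ^ 2 * A)" by linarith
        have 2: "A <= C * (2 * r) * (V / M) powr (1 / p)"
        proof -
          have "measure \<nu> (ball x (2 ^ n * (2 * r))) / m x (2 ^ n * (2 * r)) <= V / M"
            using mvM M V by (intro frac_le) (auto simp: V_def mult.assoc mult.left_commute)
          thus ?thesis unfolding A_def using C r p0 by (intro mult_left_mono powr_mono2) (auto intro!: divide_nonneg_nonneg)
        qed
        have 3: "8 * CD ^ 2 * C * r / s * (V / M) powr (1 / p) < 1"
        proof (rule ccontr)
          assume "\<not> ?thesis"
          hence "1 <= (8 * CD ^ 2 * C * r / s * (V / M) powr (1 / p)) powr p" using p0 by (intro ge_one_powr_ge_zero) auto
          also have "... = ((8 * CD ^ 2 * C) * (r / s) * (V / M) powr (1 / p)) powr p" by simp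
          also have "... = K0 * Q" unfolding K0_def Q_def using C r s CD1 V M p0 by (subst powr_mult powr_powr)+ (auto simp: powr_powr)
          also have "... <= K * Q" using K(2) Q by (intro mult_right_mono)
          finally show False using KQ by simp
        qed
        have "2 * (CD ^ 2 * A) <= 2 * (CD ^ 2 * (C * (2 * r) * (V / M) powr (1 / p)))" using 2 by (intro mult_left_mono) auto
        also have "... = (s / 2) * (8 * CD ^ 2 * C * r / s * (V / M) powr (1 / p))" using s by simp
        also have "... < (s / 2) * 1" using 3 s by (intro mult_strict_left_mono) auto
        finally show ?thesis using 1 by simp
      qed
      \<comment> \<open>The same constant must serve all scales \<open>j\<close>. It is normalized
        so that \<open>K' * V\<close> is the desired bound up to the factor \<open>CD ^ 2\<close> of
        \<open>covering_weak\<close>, which \<open>K\<close> has room for.\<close>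
      define K' where "K' = M * (K1 * CD * Q) powr \<kappa> / V"
      define I where "I = {(y, j). y \<in> ball x r \<and>
        emeasure \<mu> (ball y ((2 ^ n * r) / 2 ^ j)) <= ennreal K' * emeasure \<nu> (ball y ((2 ^ n * r) / 2 ^ j))}"
      define T where "T = (\<Union>(y, j)\<in>I. ball y ((2 ^ n * r) / 2 ^ j))"
      have R: "0 < 2 ^ n * r" using r by simp
      have oT: "T \<in> sets \<mu>" unfolding T_def by (intro borel_sets borel_open) auto
      have subV: "ball y ((2 ^ n * r) / 2 ^ j) \<subseteq> ball x (2 ^ (n + 1) * r)" if "y \<in> ball x r" for y j
      proof -
        have "(2 ^ n * r) / 2 ^ j <= (2 ^ n * r) / 1" using r by (intro divide_left_mono) auto
        moreover have "r <= 2 ^ n * r" using r by (simp add: mult_le_cancel_right1)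
        ultimately have "dist y x + (2 ^ n * r) / 2 ^ j <= 2 ^ (n + 1) * r" using that by (simp add: dist_commute)
        thus ?thesis by (intro ball_subsetI) (simp add: dist_commute)
      qed
      have TV: "T \<subseteq> ball x (2 ^ (n + 1) * r)" unfolding T_def I_def using subV by blast
      have "emeasure \<mu> T <= ennreal (CD ^ 2) * (ennreal K' * emeasure \<nu> T)"
        unfolding T_def by (rule covering_weak[OF R s\<nu>]) (simp add: I_def)
      also have "emeasure \<nu> T <= ennreal V"
        unfolding V_def \<nu>.emeasure_eq_measure[symmetric] using TV s\<nu> by (intro emeasure_mono) auto
      also have "ennreal (CD ^ 2) * (ennreal K' * ennreal V) = ennreal (CD ^ 2 * (K' * V))"
      proof -
        have "0 <= K'" using M V by (simp add: K'_def)
        thus ?thesis using CD1 V by (simp add: ennreal_mult)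
      qed
      also have "... <= ennreal (M * (K * Q) powr \<kappa>)"
      proof (rule ennreal_leI)
        have "K' * V <= M * (K1 * CD * Q) powr \<kappa>" using M V by (simp add: K'_def)
        hence "CD ^ 2 * (K' * V) <= CD ^ 2 * (M * (K1 * CD * Q) powr \<kappa>)" by (intro mult_left_mono) auto
        also have "... <= (CD ^ 2) powr \<kappa> * (M * (K1 * CD * Q) powr \<kappa>)"
        proof (rule mult_right_mono)
          have "(CD ^ 2) powr 1 <= (CD ^ 2) powr \<kappa>" using \<kappa> CD1 by (intro powr_mono) auto
          thus "CD ^ 2 <= (CD ^ 2) powr \<kappa>" using CD1 by simp
        qed (use M in auto)
        also have "... = M * (CD ^ 2 * (K1 * CD) * Q) powr \<kappa>" using K01 CD1 Q by (simp add: powr_mult)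
        also have "... <= M * (K * Q) powr \<kappa>"
          using M K(3) Q \<kappa> CD1 K01 by (intro mult_left_mono powr_mono2 mult_right_mono) auto
        finally show "CD ^ 2 * (K' * V) <= M * (K * Q) powr \<kappa>" .
      qed
      finally have "emeasure \<mu> T <= ennreal (M * (K * Q) powr \<kappa>)" by (simp add: mult_left_mono)
      moreover have "emeasure \<mu> S <= emeasure \<mu> T"
      proof (rule emeasure_mono_AE[OF _ oT])
        show "AE y in \<mu>. y \<in> S --> y \<in> T" using differentiation[OF u u01 r]
        proof eventually_elim
          case (elim y)
          show ?case
          proof
            assume y: "y \<in> S"
            hence yB: "y \<in> ball x r" and far: "s < \<bar>u y - avg u x r\<bar>" by (auto simp: S_def)
            have "\<not> (\<forall>j. CD * (C * (r / 2 ^ j) * (mu_ratio \<nu> y (2 ^ n * (r / 2 ^ j))) powr (1 / p)) <= (1 - q) * (s/2) * q ^ j)"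
            proof
              assume "\<forall>j. CD * (C * (r / 2 ^ j) * (mu_ratio \<nu> y (2 ^ n * (r / 2 ^ j))) powr (1 / p)) <= (1 - q) * (s/2) * q ^ j"
              hence "\<bar>u y - avg u y r\<bar> <= s / 2" by (intro telescope[OF u u01 pi r elim q]) auto
              thus False using first[OF yB] far by linarith
            qed
            then obtain j where j: "(1 - q) * (s/2) * q ^ j < CD * (C * (r / 2 ^ j) * (mu_ratio \<nu> y (2 ^ n * (r / 2 ^ j))) powr (1 / p))"
              by (auto simp: not_le)
            define mj where "mj = m y ((2 ^ n * r) / 2 ^ j)"
            define vj where "vj = measure \<nu> (ball y ((2 ^ n * r) / 2 ^ j))"
            have mj: "0 < mj" unfolding mj_def using r by (intro m_pos) simp
            have vj: "0 <= vj" "vj <= V"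
              unfolding vj_def V_def using subV[OF yB, of j] s\<nu> by (auto intro!: \<nu>.finite_measure_mono)
            have rat: "mu_ratio \<nu> y (2 ^ n * (r / 2 ^ j)) = vj / mj" by (simp add: mu_ratio_def vj_def mj_def)
            have "q ^ j < (2 * CD * C / (1 - q)) * (r / s) * (1/2) ^ j * (vj / mj) powr (1 / p)"
              using j q s unfolding rat by (simp add: field_simps power_divide)
            hence "(q ^ j) powr p < ((2 * CD * C / (1 - q)) * (r / s) * (1/2) ^ j * (vj / mj) powr (1 / p)) powr p"
              using q p0 by (intro powr_less_mono2) auto
            also have "... = K1 * (r / s) powr p * ((1/2) ^ j) powr p * (vj / mj)"
              unfolding K1_def using C r s CD1 vj mj p0 q by (intro powr_product) auto
            finally have l1: "(q ^ j) powr p < K1 * (r / s) powr p * ((1/2) ^ j) powr p * (vj / mj)" .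
            have qj: "(q ^ j) powr p = (1/2) powr (real j * p / 2)" by (simp add: q_def powr_realpow[symmetric] powr_powr mult.commute)
            have hj: "((1/2::real) ^ j) powr p = (1/2) powr (real j * p)" by (simp add: powr_realpow[symmetric] powr_powr)
            have "(1/2::real) powr (real j * p) = (1/2) powr (real j * p / 2) * (1/2) powr (real j * p / 2)"
              by (metis field_sum_of_halves powr_add)
            with l1 have l2: "1 < K1 * (r / s) powr p * (1/2) powr (real j * p / 2) * (vj / mj)"
            proof -
              define h where "h = (1/2::real) powr (real j * p / 2)"
              have "h * 1 < h * (K1 * (r / s) powr p * h * (vj / mj))"
                using l1 \<open>(1/2::real) powr (real j * p) = _\<close> unfolding qj hj h_def[symmetric] by (simp add: mult_ac)
              thus ?thesis unfolding h_def[symmetric] by (rule mult_left_less_imp_less) (simp add: h_def)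
            qed
            have mM: "1 / CD ^ (j + 1) <= mj / M"
            proof -
              have "M <= CD ^ (j + 1) * m y (r / 2 ^ j)" unfolding M_def
              proof (rule m_le)
                have "dist x y + r <= 2 * r" using yB by simp
                thus "ball x r \<subseteq> ball y (2 ^ (j + 1) * (r / 2 ^ j))" by (intro ball_subsetI) (simp add: dist_commute)
              qed (use r in simp)
              also have "m y (r / 2 ^ j) <= mj"
                unfolding mj_def using r by (intro m_mono subset_ball divide_right_mono) (auto simp: mult_le_cancel_right1)
              finally have "M <= CD ^ (j + 1) * mj" using CD1 by (simp add: mult_left_mono)
              thus ?thesis using M CD1 by (simp add: field_simps)
            qed
            have "(1/2::real) powr (real j * p / 2) <= CD powr (- (real j * \<theta>))"
            proof -
              have "CD powr \<theta> <= (2 powr real N) powr \<theta>"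
                using N CD1 \<theta> by (intro powr_mono2) (auto simp: powr_realpow)
              also have "... = 2 powr (real N * \<theta>)" by (simp add: powr_powr)
              also have "... <= 2 powr (p / 2)"
              proof (rule powr_mono)
                have "real N * \<theta> = p / 2 * (real N / (real N + p))" by (simp add: \<theta>_def)
                also have "... <= p / 2 * 1" using p1 by (intro mult_left_mono) (auto simp: divide_le_eq_1)
                finally show "real N * \<theta> <= p / 2" by simp
              qed simp
              finally have "(CD powr \<theta>) powr real j <= (2 powr (p / 2)) powr real j" by (intro powr_mono2) auto
              hence "CD powr (real j * \<theta>) <= 2 powr (real j * p / 2)" by (simp add: powr_powr mult.commute)
              hence "inverse (2 powr (real j * p / 2)) <= inverse (CD powr (real j * \<theta>))"
                using CD1 by (intro le_imp_inverse_le) auto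
              thus ?thesis using CD1 by (simp add: powr_minus powr_divide inverse_eq_divide)
            qed
            also have "... = CD powr \<theta> * (1 / CD ^ (j + 1)) powr \<theta>"
            proof -
              have "1 / CD ^ (j + 1) = CD powr (- (real (j + 1)))" using CD1 by (simp only: powr_minus_divide powr_realpow)
              hence "CD powr \<theta> * (1 / CD ^ (j + 1)) powr \<theta> = CD powr (\<theta> + - (real (j + 1)) * \<theta>)"
                by (simp only: powr_powr powr_add)
              also have "\<theta> + - (real (j + 1)) * \<theta> = - (real j * \<theta>)" by (simp add: algebra_simps)
              finally show ?thesis by simp
            qed
            also have "... <= CD * (mj / M) powr \<theta>"
            proof (rule mult_mono)
              have "CD powr \<theta> <= CD powr 1" using CD1 \<theta> by (intro powr_mono) auto
              thus "CD powr \<theta> <= CD" using CD1 by simp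
              show "(1 / CD ^ (j + 1)) powr \<theta> <= (mj / M) powr \<theta>" using mM \<theta> CD1 by (intro powr_mono2) auto
            qed (use CD1 in auto)
            finally have l3: "1 < K1 * (r / s) powr p * (CD * (mj / M) powr \<theta>) * (vj / mj)" using l2 K01 vj mj
              by (smt (verit) divide_nonneg_pos mult_left_mono mult_nonneg_nonneg mult_right_mono powr_ge_zero)
            define X where "X = mj / M"
            have X: "0 < X" using mj M by (simp add: X_def)
            have vpos: "0 < vj"
            proof (rule ccontr)
              assume "\<not> 0 < vj" hence "vj = 0" using vj by simp
              thus False using l2 by simp
            qed
            hence Vpos: "0 < V" using vj by simp
            define t where "t = vj / V"
            have t: "0 <= t" "t <= 1" using vj Vpos by (auto simp: t_def)
            have "X < K1 * CD * Q * t * X powr \<theta>"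
            proof -
              have "X * 1 < X * (K1 * (r / s) powr p * (CD * X powr \<theta>) * (vj / mj))"
                using l3 X unfolding X_def by (intro mult_strict_left_mono) auto
              also have "... = K1 * CD * Q * t * X powr \<theta>" unfolding Q_def t_def X_def using mj M Vpos by (simp add: field_simps)
              finally show ?thesis by simp
            qed
            hence "X powr (1 - \<theta>) < K1 * CD * Q * t" using X by (simp add: powr_diff divide_less_eq)
            hence "(X powr (1 - \<theta>)) powr \<kappa> <= (K1 * CD * Q * t) powr \<kappa>" using \<kappa> by (intro powr_mono2) auto
            moreover have "(X powr (1 - \<theta>)) powr \<kappa> = X" using \<theta> X by (simp add: powr_powr \<kappa>_def)
            \<comment> \<open>Here \<open>t\<close> is the share of \<open>V\<close> that the ball
              carries. Replacing \<open>t powr \<kappa>\<close> by \<open>t\<close> makes the bound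
              linear in \<open>\<nu>\<close>, hence summable over disjoint balls, with a constant
              independent of \<open>j\<close>.\<close>
            moreover have "(K1 * CD * Q * t) powr \<kappa> <= (K1 * CD * Q) powr \<kappa> * t"
            proof -
              have "t powr \<kappa> <= t powr 1" using t \<kappa> by (intro powr_mono') auto
              hence "t powr \<kappa> <= t" using t by (cases "t = 0") auto
              thus ?thesis using K01 CD1 Q t by (simp add: powr_mult mult_left_mono)
            qed
            ultimately have "X <= (K1 * CD * Q) powr \<kappa> * t" by linarith
            hence "mj <= K' * vj" unfolding X_def K'_def t_def using M Vpos by (simp add: field_simps)
            hence "ennreal mj <= ennreal K' * ennreal vj" using vj M V by (simp add: ennreal_mult[symmetric] K'_def ennreal_leI)
            hence "(y, j) \<in> I" using yB unfolding I_def mj_def vj_def by (simp add: emeasure_ball \<nu>.emeasure_eq_measure)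
            thus "y \<in> T" unfolding T_def using r by (intro UN_I[of "(y, j)"]) auto
          qed
        qed
      qed
      ultimately have "emeasure \<mu> S <= ennreal (M * (K * Q) powr \<kappa>)" by (rule order_trans[rotated])
      thus ?thesis using M by (simp add: measure_def enn2real_leI)
    qed
    thus "measure \<mu> {y \<in> ball x r. s < \<bar>u y - avg u x r\<bar>} <=
        m x r * (K * ((r / s) powr p * measure \<nu> (ball x (2 ^ (n + 1) * r)) / m x r)) powr \<kappa>"
      unfolding S_def M_def Q_def V_def .
  qed
qed

end

section \<open>Energy measures, cutoff functions and the Poincare inequality for pairs\<close>

context newtonian_space
begin

definition nug :: "('a => ennreal) => 'a measure" where
  "nug g = density \<mu> (%x. ennpowr (g x) p)"

abbreviation nugb :: "('a => ennreal) => 'a => real => real" where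
  "nugb g x r \<equiv> measure (nug g) (ball x r)"

lemma sets_nug [simp]: "sets (nug g) = sets \<mu>" by (simp add: nug_def)

lemma emeasure_nug:
  assumes "g \<in> bmeas" "A \<in> sets \<mu>"
  shows "emeasure (nug g) A = (\<integral>\<^sup>+x\<in>A. ennpowr (g x) p \<partial>\<mu>)"
  unfolding nug_def using assms by (subst emeasure_density) auto

lemma emeasure_nug_UNIV: "g \<in> bmeas ==> emeasure (nug g) UNIV = En g"
  using emeasure_nug[of g UNIV] sets.top[of \<mu>] by (simp add: En_def)

lemma finite_nug:
  assumes "g \<in> bmeas" "En g < \<infinity>" shows "finite_measure (nug g)"
  by (rule finite_measureI) (use emeasure_nug_UNIV[OF assms(1)] assms(2) in \<open>simp add: nug_def\<close>)

definition cutoff :: "'a => real => 'a => real" where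
  "cutoff z \<rho> x = max 0 (min 1 (2 - dist z x / \<rho>))"

lemma cutoff:
  assumes "0 < \<rho>"
  shows "rwug (cutoff z \<rho>) (%x. if cutoff z \<rho> x = 0 then 0 else ennreal (1 / \<rho>))"
    "cutoff z \<rho> \<in> bmeas" "0 <= cutoff z \<rho> x" "cutoff z \<rho> x <= 1"
    "x \<in> ball z \<rho> ==> cutoff z \<rho> x = 1" "cutoff z \<rho> x ~= 0 ==> x \<in> ball z (2 * \<rho>)"
proof -
  define \<eta> where \<eta>_eq: "\<eta> = cutoff z \<rho>"
  have \<eta>_def: "\<eta> = (%x. max 0 (min 1 (2 - dist z x / \<rho>)))" unfolding \<eta>_eq cutoff_def ..
  have "continuous_on UNIV \<eta>" unfolding \<eta>_def by (intro continuous_intros) (use assms(1) in auto)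
  hence m: "\<eta> \<in> bmeas" by (intro meas_mu borel_measurable_continuous_onI)
  have "\<bar>\<eta> x - \<eta> y\<bar> <= 1 / \<rho> * dist x y" for x y
  proof -
    have "\<bar>\<eta> x - \<eta> y\<bar> <= \<bar>dist z x / \<rho> - dist z y / \<rho>\<bar>" unfolding \<eta>_def by linarith
    also have "... = \<bar>dist z x - dist z y\<bar> / \<rho>" using assms(1) by (simp add: diff_divide_distrib[symmetric])
    also have "... <= dist x y / \<rho>"
    proof (rule divide_right_mono)
      show "\<bar>dist z x - dist z y\<bar> <= dist x y"
        using dist_triangle[of z x y] dist_triangle[of z y x] by (simp add: dist_commute)
    qed (use assms(1) in simp)
    finally show ?thesis by simp
  qed
  hence "rwug \<eta> (%_. ennreal (1 / \<rho>))" using assms(1) by (intro rwug_Lipschitz) auto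
  hence w: "rwug \<eta> (%x. if \<eta> x = 0 then 0 else ennreal (1 / \<rho>))" using m by (rule rwug_locality)
  show "rwug (cutoff z \<rho>) (%x. if cutoff z \<rho> x = 0 then 0 else ennreal (1 / \<rho>))" "cutoff z \<rho> \<in> bmeas"
    using w m unfolding \<eta>_eq by blast+
  show "0 <= cutoff z \<rho> x" "cutoff z \<rho> x <= 1" by (simp_all add: cutoff_def)
  show "cutoff z \<rho> x = 1" if "x \<in> ball z \<rho>" using that assms(1) by (simp add: cutoff_def min_def max_def field_simps)
  show "x \<in> ball z (2 * \<rho>)" if "cutoff z \<rho> x ~= 0"
    using that assms(1) by (simp add: cutoff_def min_def max_def field_simps split: if_splits)
qed

lemma const_ball_measurable: "(%x. ennreal c * indicator (ball z R) x) \<in> bmeas" by (rule meas_mu) measurable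

lemma En_const_ball: "0 <= c ==> En (%x. ennreal c * indicator (ball z R) x) = ennreal (c powr p) * emeasure \<mu> (ball z R)"
proof -
  assume c: "0 <= c"
  have "En (%x. ennreal c * indicator (ball z R) x) = ennreal (c powr p) * En (indicator (ball z R))"
    by (intro En_cmult borel_measurable_indicator ball_sets c)
  also have "En (indicator (ball z R)) = (\<integral>\<^sup>+x. indicator (ball z R) x \<partial>\<mu>)"
    unfolding En_def by (intro nn_integral_cong) (auto split: split_indicator)
  finally show ?thesis by simp
qed

end

context doubling_space
begin

definition poincare_const :: "real => real => bool" where
  "poincare_const CP \<Lambda> \<longleftrightarrow> (\<forall>z r u. 0 < r \<and> u \<in> Dp_loc p \<mu> \<and> (\<integral>\<^sup>+x. e2ennreal \<bar>u x\<bar> \<partial>\<mu>) < \<infinity> -->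
     (\<integral>\<^sup>+x\<in>ball z r. e2ennreal \<bar>u x - ereal (mean_value \<mu> u (ball z r))\<bar> \<partial>\<mu>) / emeasure \<mu> (ball z r)
     <= ennreal (CP * diameter (ball z r)) *
        ennpowr ((\<integral>\<^sup>+x\<in>ball z (\<Lambda> * r). ennpowr (mug u x) p \<partial>\<mu>) / emeasure \<mu> (ball z (\<Lambda> * r))) (1 / p))"

text \<open>The assumed inequality speaks of globally integrable functions and of minimal gradients.
  Taking the minimum with a cutoff that is 1 on the dilated ball makes \<open>u\<close> integrable
  and, as \<open>u <= 1\<close>, changes neither \<open>u\<close> nor \<open>g\<close> on that ball.
  The factor 2 comes from the diameter, and \<open>CD ^ n\<close> pays for passing from the dilation
  \<open>\<Lambda>\<close> to \<open>2 ^ n\<close>.\<close>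

lemma poincare_npair:
  assumes CP: "0 < CP" "1 <= \<Lambda>" and raw: "poincare_const CP \<Lambda>" and u: "npair u g" and n: "\<Lambda> <= 2 ^ n"
  shows "PI u (nug g) (2 * CP * CD ^ n) n" unfolding PI_def
proof (intro allI impI)
  fix z :: 'a and r :: real assume r: "0 < r"
  note [measurable] = npairD(1)[OF u] npairD(6)[OF u]
  interpret \<nu>: finite_measure "nug g" by (rule finite_nug[OF npairD(6)[OF u] npairD(5)[OF u]])
  define \<rho> where "\<rho> = \<Lambda> * r"
  have \<rho>: "0 < \<rho>" "r <= \<rho>" using r CP(2) by (auto simp: \<rho>_def mult_le_cancel_right1)
  define \<eta> where "\<eta> = cutoff z \<rho>"
  note \<eta> = cutoff[OF \<rho>(1), where z = z, folded \<eta>_def]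
  note [measurable] = \<eta>(2)
  define v where "v = (%x. min (u x) (\<eta> x))"
  define h where "h = (%x. if u x <= \<eta> x then g x else if \<eta> x = 0 then 0 else ennreal (1 / \<rho>))"
  have vm[measurable]: "v \<in> bmeas" unfolding v_def by measurable
  have hm[measurable]: "h \<in> bmeas" unfolding h_def by measurable
  have v: "rwug v h" unfolding v_def h_def by (rule rwug_min[OF npairD(4)[OF u] \<eta>(1) npairD(1)[OF u] \<eta>(2)])
  have v01: "0 <= v x" "v x <= 1" for x using npairD(2,3)[OF u, of x] \<eta>(3,4)[of x] by (auto simp: v_def min_le_iff_disj)
  have vu: "v x = u x" "h x = g x" if "x \<in> ball z \<rho>" for x
    using \<eta>(5)[OF that] npairD(3)[OF u, of x] by (auto simp: v_def h_def)
  have "En h <= En (%x. g x + ennreal (1 / \<rho>) * indicator (ball z (2 * \<rho>)) x)"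
    using \<eta>(6) by (intro En_mono) (auto simp: h_def split: split_indicator)
  also have "... <= ennreal (2 powr p) * (En g + ennreal ((1 / \<rho>) powr p) * emeasure \<mu> (ball z (2 * \<rho>)))"
  proof -
    have "0 <= 1 / \<rho>" using \<rho>(1) by simp
    from En_const_ball[OF this, of z "2 * \<rho>"] show ?thesis
      using En_add_le[of g "%x. ennreal (1 / \<rho>) * indicator (ball z (2 * \<rho>)) x"]
      by (simp add: npairD(6)[OF u] const_ball_measurable)
  qed
  also have "... < \<infinity>" using npairD(5)[OF u] ball_finite[of z "2 * \<rho>"] by (simp add: ennreal_mult_less_top)
  finally have hfin: "En h < \<infinity>" .
  define w where "w = (%x. ereal (v x))"
  have wm: "w \<in> bmeas" unfolding w_def by measurable
  obtain g' where g': "upper_gradient w g'" "En g' < \<infinity>" "g' \<in> borel_measurable borel"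
    unfolding w_def by (rule ex_upper_gradient[OF v hfin])
  have D: "w \<in> Dp_loc p \<mu>" unfolding Dp_loc_def
  proof (intro CollectI conjI allI wm exI)
    fix x
    show "(0::real) < 1" by simp
    show "upper_gradient_on (ball x 1) w g'" using g'(1) unfolding upper_gradient_on_def by blast
    have "(\<integral>\<^sup>+y\<in>ball x 1. ennpowr (g' y) p \<partial>\<mu>) <= En g'"
      unfolding En_def by (intro nn_integral_mono) (auto split: split_indicator)
    thus "(\<integral>\<^sup>+y\<in>ball x 1. ennpowr (g' y) p \<partial>\<mu>) < \<infinity>" using g'(2) by (rule le_less_trans)
  qed
  have "(\<integral>\<^sup>+x. e2ennreal \<bar>w x\<bar> \<partial>\<mu>) <= (\<integral>\<^sup>+x. indicator (ball z (2 * \<rho>)) x \<partial>\<mu>)"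
  proof (rule nn_integral_mono)
    fix x show "e2ennreal \<bar>w x\<bar> <= indicator (ball z (2 * \<rho>)) x"
    proof (cases "\<eta> x = 0")
      case True
      hence "v x = 0" using npairD(2)[OF u, of x] by (simp add: v_def)
      thus ?thesis by (simp add: w_def)
    next
      case False
      thus ?thesis using \<eta>(6)[OF False] v01[of x] by (simp add: w_def)
    qed
  qed
  also have "... < \<infinity>" using ball_finite[of z "2 * \<rho>"] by simp
  finally have I: "(\<integral>\<^sup>+x. e2ennreal \<bar>w x\<bar> \<partial>\<mu>) < \<infinity>" .
  define A where "A = avg u z r"
  have sub: "ball z r \<subseteq> ball z \<rho>" using \<rho>(2) by (rule subset_ball)
  have "avg v z r = A" unfolding A_def by (rule avg_cong) (use vu(1) sub in auto)
  hence mv: "mean_value \<mu> w (ball z r) = A" unfolding mean_value_def w_def avg_def by simp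
  have mr: "0 < m z r" "0 < m z \<rho>" "0 < m z (2 ^ n * r)" using r \<rho> by (auto intro!: m_pos)
  have int: "set_integrable \<mu> (ball z r) (%y. \<bar>u y - A\<bar>)"
  proof (rule integrable_ball[of _ "1 + \<bar>A\<bar>"])
    show "\<bar>\<bar>u y - A\<bar>\<bar> <= 1 + \<bar>A\<bar>" for y using npairD(2,3)[OF u, of y] by linarith
  qed measurable
  have "(\<integral>\<^sup>+x\<in>ball z r. e2ennreal \<bar>w x - ereal A\<bar> \<partial>\<mu>) = (\<integral>\<^sup>+x. ennreal (indicator (ball z r) x *\<^sub>R \<bar>u x - A\<bar>) \<partial>\<mu>)"
    using vu(1) sub by (intro nn_integral_cong) (auto simp: w_def split: split_indicator)
  also have "... = ennreal (LINT y:ball z r|\<mu>. \<bar>u y - A\<bar>)"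
    unfolding set_lebesgue_integral_def using int unfolding set_integrable_def by (intro nn_integral_eq_integral) auto
  finally have lhs: "(\<integral>\<^sup>+x\<in>ball z r. e2ennreal \<bar>w x - ereal (mean_value \<mu> w (ball z r))\<bar> \<partial>\<mu>) / emeasure \<mu> (ball z r)
      = ennreal (avg (%y. \<bar>u y - A\<bar>) z r)" unfolding mv emeasure_ball avg_def using mr(1)
    by (simp add: divide_ennreal set_lebesgue_integral_def integral_nonneg_AE)
  have "(\<integral>\<^sup>+x\<in>ball z \<rho>. ennpowr (mug w x) p \<partial>\<mu>) <= (\<integral>\<^sup>+x\<in>ball z \<rho>. ennpowr (g x) p \<partial>\<mu>)"
  proof (rule nn_integral_mono_AE)
    have "AE x in \<mu>. mug w x <= h x" unfolding w_def by (rule mug(3)[OF v En_finite_Lp_loc[OF hm hfin]])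
    thus "AE x in \<mu>. ennpowr (mug w x) p * indicator (ball z \<rho>) x <= ennpowr (g x) p * indicator (ball z \<rho>) x"
      by eventually_elim (use vu(2) p0 in \<open>force split: split_indicator intro: ennpowr_mono\<close>)
  qed
  also have "... = ennreal (nugb g z \<rho>)" by (simp add: emeasure_nug[symmetric] \<nu>.emeasure_eq_measure)
  finally have "ennpowr ((\<integral>\<^sup>+x\<in>ball z \<rho>. ennpowr (mug w x) p \<partial>\<mu>) / emeasure \<mu> (ball z \<rho>)) (1 / p)
      <= ennpowr (ennreal (nugb g z \<rho>) / emeasure \<mu> (ball z \<rho>)) (1 / p)"
    using p0 by (intro ennpowr_mono divide_right_mono_ennreal) auto
  also have "... = ennreal ((nugb g z \<rho> / m z \<rho>) powr (1 / p))"
    unfolding emeasure_ball using mr(2) by (simp add: divide_ennreal ennpowr_ennreal)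
  finally have e: "ennpowr ((\<integral>\<^sup>+x\<in>ball z \<rho>. ennpowr (mug w x) p \<partial>\<mu>) / emeasure \<mu> (ball z \<rho>)) (1 / p)
      <= ennreal ((nugb g z \<rho> / m z \<rho>) powr (1 / p))" .
  have dm: "diameter (ball z r) <= 2 * r"
  proof -
    have d: "dist a b <= 2 * r" if "a \<in> ball z r" "b \<in> ball z r" for a b
      using that dist_triangle3[of a b z] by (simp add: dist_commute)
    have ne: "ball z r ~= {}" using r by auto
    hence "diameter (ball z r) = (SUP (x, y)\<in>ball z r \<times> ball z r. dist x y)" unfolding diameter_def by simp
    also have "... <= 2 * r" by (rule cSUP_least) (use ne d in auto)
    finally show ?thesis .
  qed
  have "ennreal (avg (%y. \<bar>u y - A\<bar>) z r) <= ennreal (CP * diameter (ball z r)) *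
      ennpowr ((\<integral>\<^sup>+x\<in>ball z \<rho>. ennpowr (mug w x) p \<partial>\<mu>) / emeasure \<mu> (ball z \<rho>)) (1 / p)"
    using raw[unfolded poincare_const_def, rule_format, OF conjI[OF r conjI[OF D I]], of z] unfolding lhs \<rho>_def .
  also have "... <= ennreal (CP * (2 * r)) * ennreal ((nugb g z \<rho> / m z \<rho>) powr (1 / p))"
    by (intro mult_mono[OF ennreal_leI[OF mult_left_mono[OF dm less_imp_le[OF CP(1)]]] e]) auto
  also have "... = ennreal (CP * (2 * r) * (nugb g z \<rho> / m z \<rho>) powr (1 / p))" using CP(1) r by (simp add: ennreal_mult)
  finally have 1: "avg (%y. \<bar>u y - A\<bar>) z r <= CP * (2 * r) * (nugb g z \<rho> / m z \<rho>) powr (1 / p)"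
    using CP(1) r by (subst (asm) ennreal_le_iff) auto
  have 2: "nugb g z \<rho> / m z \<rho> <= CD ^ n * (nugb g z (2 ^ n * r) / m z (2 ^ n * r))"
  proof -
    have sub2: "ball z \<rho> \<subseteq> ball z (2 ^ n * r)" unfolding \<rho>_def using n r by (intro subset_ball mult_right_mono) auto
    have "m z (2 ^ n * r) <= CD ^ n * m z r" by (rule m_power[OF r])
    also have "... <= CD ^ n * m z \<rho>" using CD1 m_mono[OF sub] by (intro mult_left_mono) auto
    finally have a: "1 / m z \<rho> <= CD ^ n / m z (2 ^ n * r)" using mr by (simp add: field_simps)
    have "nugb g z \<rho> * (1 / m z \<rho>) <= nugb g z (2 ^ n * r) * (CD ^ n / m z (2 ^ n * r))"
      using a mr sub2 by (intro mult_mono \<nu>.finite_measure_mono) auto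
    thus ?thesis by (simp add: mult.commute)
  qed
  have "(nugb g z \<rho> / m z \<rho>) powr (1 / p)
      <= (CD ^ n * (nugb g z (2 ^ n * r) / m z (2 ^ n * r))) powr (1 / p)" using 2 p0 by (intro powr_mono2) auto
  also have "... = (CD ^ n) powr (1 / p) * (nugb g z (2 ^ n * r) / m z (2 ^ n * r)) powr (1 / p)" by (rule powr_mult)
  also have "... <= CD ^ n * (nugb g z (2 ^ n * r) / m z (2 ^ n * r)) powr (1 / p)"
  proof (rule mult_right_mono)
    have "(CD ^ n) powr (1 / p) <= (CD ^ n) powr 1" using CD1 p1 by (intro powr_mono) (auto simp: one_le_power)
    thus "(CD ^ n) powr (1 / p) <= CD ^ n" using CD1 by simp
  qed simp
  finally have 3: "(nugb g z \<rho> / m z \<rho>) powr (1 / p) <= ..." .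
  have "CP * (2 * r) * (nugb g z \<rho> / m z \<rho>) powr (1 / p) <=
      CP * (2 * r) * (CD ^ n * (nugb g z (2 ^ n * r) / m z (2 ^ n * r)) powr (1 / p))" using CP(1) r by (intro mult_left_mono 3) auto
  with 1 show "avg (%y. \<bar>u y - avg u z r\<bar>) z r <=
      2 * CP * CD ^ n * r * (nugb g z (2 ^ n * r) / m z (2 ^ n * r)) powr (1 / p)" unfolding A_def by (simp add: mult_ac)
qed

end

section \<open>Existence of minimizers\<close>

lemma powr_strict_midpoint:
  fixes p t :: real
  assumes p: "1 < p" and t: "0 <= t" "t < 1"
  shows "((1 + t) / 2) powr p < (1 + t powr p) / 2"
proof -
  define c where "c = (1 + t) / 2"
  have c: "t < c" "c < 1" "0 < c" using t by (auto simp: c_def)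
  have cont: "continuous_on {a..b} (%x::real. x powr p)" if "0 <= a" for a b
    using p that by (intro continuous_on_powr' continuous_intros) auto
  have der: "((%x. x powr p) has_real_derivative p * z powr (p - 1)) (at z)" if "0 < z" for z
    using has_real_derivative_powr[OF that, of p] .
  have mvt: "\<exists>l z. a < z \<and> z < b \<and> ((%x. x powr p) has_real_derivative l) (at z) \<and> b powr p - a powr p = (b - a) * l"
    if "0 <= a" "a < b" for a b
  proof (rule MVT[OF that(2) cont[OF that(1)]])
    show "(%x. x powr p) differentiable (at x)" if "a < x" "x < b" for x
      using der[of x] that \<open>0 <= a\<close> by (auto simp: real_differentiable_def)
  qed
  obtain l1 z1 where z1: "t < z1" "z1 < c" "((%x. x powr p) has_real_derivative l1) (at z1)" "c powr p - t powr p = (c - t) * l1"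
    using mvt[OF t(1) c(1)] by (elim exE conjE)
  obtain l2 z2 where z2: "c < z2" "z2 < 1" "((%x. x powr p) has_real_derivative l2) (at z2)" "1 powr p - c powr p = (1 - c) * l2"
    using mvt[OF less_imp_le[OF c(3)] c(2)] by (elim exE conjE)
  have l: "l1 = p * z1 powr (p - 1)" "l2 = p * z2 powr (p - 1)"
    using DERIV_unique[OF z1(3) der] DERIV_unique[OF z2(3) der] z1 z2 c t by auto
  have "z1 powr (p - 1) < z2 powr (p - 1)" using z1 z2 p t by (intro powr_less_mono2) auto
  hence "l1 < l2" using p by (simp add: l)
  hence "(1 - c) * l1 < (1 - c) * l2" using c by (intro mult_strict_left_mono) auto
  moreover have "c - t = 1 - c" by (simp add: c_def field_simps)
  ultimately have "c powr p - t powr p < 1 powr p - c powr p" unfolding z1(4) z2(4) by (simp only:)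
  thus ?thesis by (simp add: c_def)
qed

text \<open>A quantitative form of strict convexity, from compactness of the set of ratios bounded away
  from 1.\<close>

lemma powr_uniform_convexity:
  fixes p \<epsilon> :: real
  assumes p: "1 < p" and e: "0 < \<epsilon>"
  obtains K where "0 < K" "!!a b. 0 <= a ==> 0 <= b ==>
    \<bar>a - b\<bar> powr p + K * ((a + b) / 2) powr p <= (\<epsilon> + K / 2) * (a powr p + b powr p)"
proof -
  \<comment> \<open>Ratios above \<open>1 - d\<close> are paid for by \<open>\<epsilon>\<close>
    alone, since \<open>d powr p <= \<epsilon>\<close>. For the others the midpoint gap has a
    positive minimum \<open>k\<close>, so \<open>1 / k\<close> times the gap is at least 1.\<close>
  define d where "d = min 1 (\<epsilon> powr (1 / p))"
  have d: "0 < d" "d <= 1" using e by (auto simp: d_def)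
  have dp: "d powr p <= \<epsilon>"
  proof -
    have "d powr p <= (\<epsilon> powr (1 / p)) powr p" using d p by (intro powr_mono2) (auto simp: d_def)
    thus ?thesis using e p by (simp add: powr_powr)
  qed
  define \<phi> where "\<phi> = (%t::real. (1 + t powr p) / 2 - ((1 + t) / 2) powr p)"
  have "continuous_on {0..1 - d} \<phi>" unfolding \<phi>_def using p by (intro continuous_intros continuous_on_powr') auto
  then obtain t0 where t0: "t0 \<in> {0..1 - d}" "!!t. t \<in> {0..1 - d} ==> \<phi> t0 <= \<phi> t"
    using continuous_attains_inf[of "{0..1 - d}" \<phi>] d by auto
  define k where "k = \<phi> t0"
  have k: "0 < k" using powr_strict_midpoint[OF p, of t0] t0(1) d by (simp add: k_def \<phi>_def)
  have phi0: "0 <= \<phi> t" if "0 <= t" "t <= 1" for t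
    using powr_strict_midpoint[OF p that(1)] that by (cases "t = 1") (auto simp: \<phi>_def)
  have key: "\<bar>a - b\<bar> powr p + 1 / k * ((a + b) / 2) powr p <= (\<epsilon> + (1 / k) / 2) * (a powr p + b powr p)"
    if ab: "0 <= a" "a <= b" for a b
  proof (cases "b = 0")
    case False
    hence b: "0 < b" using ab by simp
    define t where "t = a / b"
    have t: "0 <= t" "t <= 1" and a: "a = b * t" using ab b by (auto simp: t_def)
    have 1: "(1 - t) powr p <= \<epsilon> + \<phi> t / k"
    proof (cases "t <= 1 - d")
      case True
      have "(1 - t) powr p <= 1" using t p by (intro powr_le1) auto
      also have "... <= \<phi> t / k" using t0(2)[of t] True t k by (simp add: k_def)
      finally show ?thesis using e by linarith
    next
      case False
      have "(1 - t) powr p <= d powr p" using False t p by (intro powr_mono2) auto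
      moreover have "0 <= \<phi> t / k" using phi0[OF t] k by simp
      ultimately show ?thesis using dp by linarith
    qed
    have "\<bar>a - b\<bar> powr p = b powr p * (1 - t) powr p"
    proof -
      have "\<bar>a - b\<bar> = b * (1 - t)" using a ab by (simp add: algebra_simps)
      thus ?thesis by (simp add: powr_mult)
    qed
    moreover have "((a + b) / 2) powr p = b powr p * ((1 + t) / 2) powr p"
    proof -
      have "(a + b) / 2 = b * ((1 + t) / 2)" using a by (simp add: algebra_simps)
      thus ?thesis by (simp only: powr_mult)
    qed
    moreover have "a powr p = b powr p * t powr p" unfolding a by (simp add: powr_mult)
    moreover have "b powr p * ((1 - t) powr p + 1 / k * ((1 + t) / 2) powr p) <= b powr p * ((\<epsilon> + (1 / k) / 2) * (t powr p + 1))"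
    proof (intro mult_left_mono)
      have "(1 - t) powr p + 1 / k * ((1 + t) / 2) powr p <= \<epsilon> + \<phi> t / k + 1 / k * ((1 + t) / 2) powr p" using 1 by simp
      also have "... = \<epsilon> + 1 / k / 2 * (t powr p + 1)" by (simp add: \<phi>_def diff_divide_distrib add_divide_distrib algebra_simps)
      also have "... <= \<epsilon> * (t powr p + 1) + 1 / k / 2 * (t powr p + 1)" using e by (simp add: algebra_simps)
      finally show "(1 - t) powr p + 1 / k * ((1 + t) / 2) powr p <= (\<epsilon> + (1 / k) / 2) * (t powr p + 1)"
        by (simp add: algebra_simps)
    qed simp
    ultimately show ?thesis by (simp add: algebra_simps add_divide_distrib)
  qed (use ab p in simp)
  show thesis
  proof (rule that[of "1 / k"])
    show "0 < 1 / k" using k by simp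
    fix a b :: real assume ab: "0 <= a" "0 <= b"
    show "\<bar>a - b\<bar> powr p + 1 / k * ((a + b) / 2) powr p <= (\<epsilon> + (1 / k) / 2) * (a powr p + b powr p)"
    proof (cases "a <= b")
      case True thus ?thesis using key ab by blast
    next
      case False
      thus ?thesis using key[of b a] ab by (simp add: add.commute abs_minus_commute)
    qed
  qed
qed

lemma ennpowr_liminf_le:
  assumes "0 < a" shows "ennpowr (liminf f) a <= liminf (%n. ennpowr (f n) a)"
proof -
  have "ennpowr (liminf f) a = ennpowr (SUP n. INF i\<in>{n..}. f i) a" by (simp add: liminf_SUP_INF)
  also have "... <= (SUP n. ennpowr (INF i\<in>{n..}. f i) a)" by (rule ennpowr_SUP_le[OF assms])
  also have "... <= (SUP n. INF i\<in>{n..}. ennpowr (f i) a)" using assms by (intro SUP_mono' INF_greatest ennpowr_mono INF_lower) auto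
  also have "... = liminf (%n. ennpowr (f n) a)" by (simp add: liminf_SUP_INF)
  finally show ?thesis .
qed

lemma liminf_add_le:
  fixes f g :: "nat => ennreal"
  shows "liminf f + liminf g <= liminf (%n. f n + g n)"
proof -
  have "liminf f + liminf g = (SUP n. (INF i\<in>{n..}. f i) + (INF i\<in>{n..}. g i))" unfolding liminf_SUP_INF
    by (intro ennreal_SUP_add[symmetric]) (auto simp: incseq_def intro!: INF_superset_mono)
  also have "... <= (SUP n. INF i\<in>{n..}. f i + g i)" by (intro SUP_mono' INF_greatest add_mono INF_lower) auto
  finally show ?thesis by (simp add: liminf_SUP_INF)
qed

context newtonian_space
begin

abbreviation Er :: "('a => real) => ennreal" where "Er u \<equiv> En (%x. ennreal (u x))"

abbreviation energy :: "('a => real) => ('a => ennreal) => ennreal" where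
  "energy u g \<equiv> Er u + En g"

text \<open>The capacitary potential of \<open>A\<close> for the full Sobolev energy, zero-order
  term included, as in \<open>capt\<close>.\<close>

definition minimizer :: "'a set => ('a => real) => ('a => ennreal) => bool" where
  "minimizer A v g \<longleftrightarrow> npair v g \<and> (\<forall>x\<in>A. v x = 1) \<and> energy v g < \<infinity> \<and>
     (\<forall>u h. npair u h --> (\<forall>x\<in>A. u x = 1) --> energy v g <= energy u h)"

lemma npair_midpoint:
  assumes 1: "npair u1 (%x. ennreal (g1 x))" and 2: "npair u2 (%x. ennreal (g2 x))"
    and nn: "!!x. 0 <= g1 x" "!!x. 0 <= g2 x"
  shows "npair (%x. (u1 x + u2 x) / 2) (%x. ennreal ((g1 x + g2 x) / 2))"
proof -
  note [measurable] = npairD(1)[OF 1] npairD(1)[OF 2] npairD(6)[OF 1] npairD(6)[OF 2]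
  have h1: "rwug (%x. u1 x / 2) (%x. ennreal (1/2) * ennreal (g1 x))"
    using rwug_lipschitz_comp[OF npairD(4)[OF 1], of "1/2" "%a. a / 2"] by (simp add: diff_divide_distrib[symmetric])
  have h2: "rwug (%x. u2 x / 2) (%x. ennreal (1/2) * ennreal (g2 x))"
    using rwug_lipschitz_comp[OF npairD(4)[OF 2], of "1/2" "%a. a / 2"] by (simp add: diff_divide_distrib[symmetric])
  have eq: "ennreal (1/2) * ennreal (g1 x) + ennreal (1/2) * ennreal (g2 x) = ennreal ((g1 x + g2 x) / 2)" for x
  proof -
    have half: "ennreal (1/2) * ennreal a = ennreal (a / 2)" if "0 <= a" for a
      using that by (intro trans[OF ennreal_mult[symmetric]]) auto
    show ?thesis using nn by (simp only: half add_divide_distrib) (simp flip: ennreal_plus)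
  qed
  have w: "rwug (%x. (u1 x + u2 x) / 2) (%x. ennreal ((g1 x + g2 x) / 2))"
    using rwug_sum2[OF h1 h2, of "%x. (u1 x + u2 x) / 2"] unfolding eq by (auto simp: add_divide_distrib)
  have "En (%x. ennreal ((g1 x + g2 x) / 2)) <= En (%x. ennreal (g1 x) + ennreal (g2 x))"
    using nn by (intro En_mono) (auto simp: add_nonneg_nonneg ennreal_leI simp flip: ennreal_plus)
  also have "... <= ennreal (2 powr p) * (Er g1 + Er g2)" by (rule En_add_le) measurable
  also have "... < \<infinity>" using npairD(5)[OF 1] npairD(5)[OF 2] by (simp add: ennreal_mult_less_top)
  finally have "En (%x. ennreal ((g1 x + g2 x) / 2)) < \<infinity>" .
  moreover have "0 <= (u1 x + u2 x) / 2 \<and> (u1 x + u2 x) / 2 <= 1" for x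
    using npairD(2,3)[OF 1, of x] npairD(2,3)[OF 2, of x] by simp
  ultimately show ?thesis using w unfolding npair_def by auto
qed

lemma npair_real:
  assumes "npair u g"
  obtains h where "npair u (%x. ennreal (h x))" "!!x. 0 <= h x" "Er h = En g" "h \<in> bmeas"
proof -
  note [measurable] = npairD(6)[OF assms]
  define h where "h = (%x. enn2real (g x))"
  have m: "h \<in> bmeas" unfolding h_def by measurable
  have "(\<integral>\<^sup>+x. ennpowr (g x) p \<partial>\<mu>) ~= \<infinity>" using npairD(5)[OF assms] by (simp add: En_def)
  hence "AE x in \<mu>. ennpowr (g x) p ~= \<infinity>" by (intro nn_integral_noteq_infinite) auto
  hence ae: "AE x in \<mu>. g x = ennreal (h x)" by eventually_elim (simp add: h_def less_top)
  have E: "Er h = En g" by (rule En_cong_AE) (use ae in eventually_elim, simp)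
  have "rwug u (%x. ennreal (h x))" by (rule wug_AE_cong[OF npairD(4)[OF assms] _ ae]) (use m in measurable)
  hence "npair u (%x. ennreal (h x))" using assms E unfolding npair_def by auto
  thus thesis using that E m by (auto simp: h_def)
qed

lemma En_convexity:
  assumes e: "0 < \<epsilon>"
  obtains K where "0 < K" "!!f h. f \<in> bmeas ==> h \<in> bmeas ==> (!!x. 0 <= f x) ==> (!!x. 0 <= h x) ==>
     En (%x. ennreal \<bar>f x - h x\<bar>) + ennreal K * En (%x. ennreal ((f x + h x) / 2)) <=
     ennreal (\<epsilon> + K / 2) * (Er f + Er h)"
proof -
  obtain K where K: "0 < K" "!!a b. 0 <= a ==> 0 <= b ==>
    \<bar>a - b\<bar> powr p + K * ((a + b) / 2) powr p <= (\<epsilon> + K / 2) * (a powr p + b powr p)"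
    by (rule powr_uniform_convexity[OF p1 e]) blast
  show thesis
  proof (rule that[OF K(1)])
    fix f h :: "'a => real"
    assume [measurable]: "f \<in> bmeas" "h \<in> bmeas" and nn: "!!x. 0 <= f x" "!!x. 0 <= h x"
    have eq: "Er k = (\<integral>\<^sup>+x. ennreal (k x powr p) \<partial>\<mu>)" if "!!x. 0 <= k x" for k
      unfolding En_def using that by (simp add: ennpowr_ennreal)
    have nn2: "0 <= (f x + h x) / 2" for x using nn by (simp add: add_nonneg_nonneg)
    have "En (%x. ennreal \<bar>f x - h x\<bar>) + ennreal K * En (%x. ennreal ((f x + h x) / 2))
       = (\<integral>\<^sup>+x. ennreal (\<bar>f x - h x\<bar> powr p) \<partial>\<mu>) + (\<integral>\<^sup>+x. ennreal K * ennreal (((f x + h x) / 2) powr p) \<partial>\<mu>)"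
      by (subst eq, simp, subst eq, rule nn2) (simp add: nn_integral_cmult)
    also have "... = (\<integral>\<^sup>+x. ennreal (\<bar>f x - h x\<bar> powr p) + ennreal K * ennreal (((f x + h x) / 2) powr p) \<partial>\<mu>)"
      by (rule nn_integral_add[symmetric]) measurable
    also have "... <= (\<integral>\<^sup>+x. ennreal (\<epsilon> + K / 2) * (ennreal (f x powr p) + ennreal (h x powr p)) \<partial>\<mu>)"
    proof (rule nn_integral_mono)
      fix x
      have "ennreal (\<bar>f x - h x\<bar> powr p) + ennreal K * ennreal (((f x + h x) / 2) powr p)
          = ennreal (\<bar>f x - h x\<bar> powr p + K * ((f x + h x) / 2) powr p)" using K(1) by (simp add: ennreal_mult)
      also have "... <= ennreal ((\<epsilon> + K / 2) * (f x powr p + h x powr p))" by (intro ennreal_leI K(2) nn)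
      also have "... = ennreal (\<epsilon> + K / 2) * (ennreal (f x powr p) + ennreal (h x powr p))"
        using K(1) e by (simp add: ennreal_mult)
      finally show "ennreal (\<bar>f x - h x\<bar> powr p) + ennreal K * ennreal (((f x + h x) / 2) powr p) <= ..." .
    qed
    also have "... = ennreal (\<epsilon> + K / 2) * (Er f + Er h)" using nn by (simp add: eq nn_integral_cmult nn_integral_add)
    finally show "En (%x. ennreal \<bar>f x - h x\<bar>) + ennreal K * En (%x. ennreal ((f x + h x) / 2)) <=
     ennreal (\<epsilon> + K / 2) * (Er f + Er h)" .
  qed
qed

definition admissible :: "'a set => ('a => real) => ('a => real) => bool" where
  "admissible A u g \<longleftrightarrow> npair u (%x. ennreal (g x)) \<and> (\<forall>x. 0 <= g x) \<and> g \<in> bmeas \<and> (\<forall>x\<in>A. u x = 1)"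

abbreviation near_min :: "'a set => real => real => ('a => real) => ('a => real) => bool" where
  "near_min A I \<delta> u g \<equiv> admissible A u g \<and> energy u (%x. ennreal (g x)) <= ennreal (I + \<delta>)"

text \<open>The midpoint of two near minimizers is admissible, so its energy is at least
  \<open>I\<close>; uniform convexity then bounds the distance of the two gradients. Only the
  gradients are shown to be close, since the functions are later handled by a pointwise lower
  limit.\<close>

lemma minimizing_cauchy:
  assumes I: "!!u g. admissible A u g ==> ennreal I <= energy u (%x. ennreal (g x))" and I0: "0 <= I" and e: "0 < \<eta>"
  obtains \<delta> where "0 < \<delta>"
    "!!u1 g1 u2 g2. near_min A I \<delta> u1 g1 ==> near_min A I \<delta> u2 g2 ==> En (%x. ennreal \<bar>g1 x - g2 x\<bar>) <= ennreal \<eta>"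
proof -
  \<comment> \<open>\<open>\<epsilon>\<close> is paid against the energies, which are at most
    \<open>I + 1\<close>, and \<open>\<delta>\<close> against the constant \<open>K\<close> that
    belongs to \<open>\<epsilon>\<close>; each costs at most \<open>\<eta> / 2\<close>.\<close>
  define \<epsilon> where "\<epsilon> = \<eta> / (4 * (I + 1))"
  have eps: "0 < \<epsilon>" using e I0 by (simp add: \<epsilon>_def)
  obtain K where K: "0 < K" "!!f h. f \<in> bmeas ==> h \<in> bmeas ==> (!!x. 0 <= f x) ==> (!!x. 0 <= h x) ==>
     En (%x. ennreal \<bar>f x - h x\<bar>) + ennreal K * En (%x. ennreal ((f x + h x) / 2)) <=
     ennreal (\<epsilon> + K / 2) * (Er f + Er h)" by (rule En_convexity[OF eps]) blast
  define \<delta> where "\<delta> = min 1 (\<eta> / (2 * K))"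
  have d: "0 < \<delta>" "\<delta> <= 1" "K * \<delta> <= \<eta> / 2" using e K(1) by (auto simp: \<delta>_def min_def field_simps)
  show thesis
  proof (rule that[OF d(1)])
    fix u1 g1 u2 g2
    assume "near_min A I \<delta> u1 g1" "near_min A I \<delta> u2 g2"
    hence a: "admissible A u1 g1" "admissible A u2 g2"
      and E: "energy u1 (%x. ennreal (g1 x)) <= ennreal (I + \<delta>)" "energy u2 (%x. ennreal (g2 x)) <= ennreal (I + \<delta>)" by auto
    have p: "npair u1 (%x. ennreal (g1 x))" "npair u2 (%x. ennreal (g2 x))"
      and nn: "!!x. 0 <= g1 x" "!!x. 0 <= g2 x" and [measurable]: "g1 \<in> bmeas" "g2 \<in> bmeas"
      and one: "\<forall>x\<in>A. u1 x = 1" "\<forall>x\<in>A. u2 x = 1" using a unfolding admissible_def by blast+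
    have adm: "admissible A (%x. (u1 x + u2 x) / 2) (%x. (g1 x + g2 x) / 2)"
      unfolding admissible_def using npair_midpoint[OF p nn] nn one by (auto simp: add_nonneg_nonneg)
    define mu where "mu = En (%x. ennreal ((u1 x + u2 x) / 2))"
    define mg where "mg = En (%x. ennreal ((g1 x + g2 x) / 2))"
    have mid: "ennreal I <= mu + mg" using I[OF adm] by (simp add: mu_def mg_def)
    have Ku: "ennreal K * mu <= ennreal (\<epsilon> + K / 2) * (Er u1 + Er u2)"
      using K(2)[OF npairD(1)[OF p(1)] npairD(1)[OF p(2)] npairD(2)[OF p(1)] npairD(2)[OF p(2)]]
      unfolding mu_def by (rule order_trans[rotated]) simp
    have Kg: "En (%x. ennreal \<bar>g1 x - g2 x\<bar>) + ennreal K * mg <= ennreal (\<epsilon> + K / 2) * (Er g1 + Er g2)"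
      unfolding mg_def by (rule K(2)) (use nn in auto)
    have "En (%x. ennreal \<bar>g1 x - g2 x\<bar>) + ennreal K * ennreal I <= En (%x. ennreal \<bar>g1 x - g2 x\<bar>) + ennreal K * (mu + mg)"
      by (intro add_left_mono mult_left_mono mid) simp
    also have "... = (En (%x. ennreal \<bar>g1 x - g2 x\<bar>) + ennreal K * mg) + ennreal K * mu" by (simp add: distrib_left add_ac)
    also have "... <= ennreal (\<epsilon> + K / 2) * (Er g1 + Er g2) +
        ennreal (\<epsilon> + K / 2) * (Er u1 + Er u2)" by (intro add_mono Kg Ku)
    also have "... = ennreal (\<epsilon> + K / 2) * (energy u1 (%x. ennreal (g1 x)) + energy u2 (%x. ennreal (g2 x)))"
      by (simp add: distrib_left add_ac)
    also have "... <= ennreal (\<epsilon> + K / 2) * (ennreal (I + \<delta>) + ennreal (I + \<delta>))"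
      by (intro mult_left_mono add_mono E) simp
    also have "... = ennreal ((\<epsilon> + K / 2) * (2 * (I + \<delta>)))"
    proof -
      have "ennreal (I + \<delta>) + ennreal (I + \<delta>) = ennreal (2 * (I + \<delta>))"
        using I0 d by (simp add: ennreal_plus[symmetric] del: ennreal_plus)
      thus ?thesis using eps K(1) I0 d by (simp add: ennreal_mult)
    qed
    also have "(\<epsilon> + K / 2) * (2 * (I + \<delta>)) <= \<eta> + K * I"
    proof -
      have "\<epsilon> * (2 * (I + \<delta>)) <= \<epsilon> * (2 * (I + 1))" using eps d by (intro mult_left_mono) auto
      also have "... = \<eta> / 2" using I0 by (simp add: \<epsilon>_def field_simps)
      finally have "\<epsilon> * (2 * (I + \<delta>)) <= \<eta> / 2" .
      thus ?thesis using d(3) by (simp add: algebra_simps)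
    qed
    finally have "En (%x. ennreal \<bar>g1 x - g2 x\<bar>) + ennreal (K * I) <= ennreal \<eta> + ennreal (K * I)"
      using K(1) I0 e by (simp add: ennreal_mult ennreal_leI)
    thus "En (%x. ennreal \<bar>g1 x - g2 x\<bar>) <= ennreal \<eta>" by (simp add: add.commute ennreal_add_left_cancel_le)
  qed
qed

text \<open>The potential must equal 1 at every point of \<open>A\<close>, so it is built pointwise,
  as the lower limit \<open>v\<close> of a minimizing sequence; suprema and infima of pairs are
  pairs. Its gradient is the upper limit of the \<open>g n\<close>, and this is almost everywhere a
  genuine limit because the increments of the gradients are summable. Fatou's lemma then bounds the
  energy.\<close>

lemma ex_minimizer:
  assumes "capt A e" "e < \<infinity>"
  obtains v g where "minimizer A v g"
proof -
  define X where "X = (INF ug\<in>{ug. npair (fst ug) (snd ug) \<and> (\<forall>x\<in>A. fst ug x = 1)}. energy (fst ug) (snd ug))"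
  obtain u0 h0 where u0: "npair u0 h0" "\<forall>x\<in>A. u0 x = 1" "energy u0 h0 <= e" using assms(1) unfolding capt_def by blast
  have X_le: "X <= energy u h" if "npair u h" "\<forall>x\<in>A. u x = 1" for u h
    unfolding X_def using that by (intro INF_lower2[of "(u, h)"]) auto
  have "X <= e" using X_le[OF u0(1,2)] u0(3) by (rule order_trans)
  hence "X < \<infinity>" using assms(2) by (rule le_less_trans)
  then obtain I where I: "X = ennreal I" "0 <= I" by (cases X) auto
  have I_le: "ennreal I <= energy u (%x. ennreal (g x))" if "admissible A u g" for u g
    using X_le[of u "%x. ennreal (g x)"] that I(1) unfolding admissible_def by simp
  have near: "\<exists>u g. near_min A I \<delta> u g" if "0 < \<delta>" for \<delta>
  proof -
    have "X < ennreal (I + \<delta>)" using I that by (simp add: ennreal_less_iff)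
    then obtain u h where u: "npair u h" "\<forall>x\<in>A. u x = 1" "energy u h < ennreal (I + \<delta>)"
      unfolding X_def INF_less_iff by auto
    obtain g where "npair u (%x. ennreal (g x))" "!!x. 0 <= g x" "Er g = En h" "g \<in> bmeas" by (rule npair_real[OF u(1)]) blast
    thus ?thesis using u(2,3) unfolding admissible_def by (intro exI[of _ u] exI[of _ g]) (simp add: less_imp_le)
  qed
  \<comment> \<open>Small enough to outweigh the factor \<open>(2 powr p) ^ Suc n\<close> in
    \<open>En_suminf_le\<close>.\<close>
  define \<eta> where "\<eta> = (%n::nat. (1/2) ^ n / (2 powr p) ^ Suc n)"
  have eta: "0 < \<eta> n" for n by (simp add: \<eta>_def)
  have "\<exists>\<delta>. 0 < \<delta> \<and> (\<forall>u1 g1 u2 g2. near_min A I \<delta> u1 g1 --> near_min A I \<delta> u2 g2 -->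
      En (%x. ennreal \<bar>g1 x - g2 x\<bar>) <= ennreal (\<eta> n))" for n by (rule minimizing_cauchy[OF I_le I(2) eta[of n]]) blast+
  hence "\<forall>n. \<exists>\<delta>. 0 < \<delta> \<and> (\<forall>u1 g1 u2 g2. near_min A I \<delta> u1 g1 --> near_min A I \<delta> u2 g2 -->
      En (%x. ennreal \<bar>g1 x - g2 x\<bar>) <= ennreal (\<eta> n))" ..
  from choice[OF this] obtain d where d: "!!n. 0 < d n" "!!n u1 g1 u2 g2. near_min A I (d n) u1 g1 ==>
      near_min A I (d n) u2 g2 ==> En (%x. ennreal \<bar>g1 x - g2 x\<bar>) <= ennreal (\<eta> n)" by blast
  \<comment> \<open>\<open>D\<close> respects the tolerances of two consecutive indices, so that the
    \<open>n\<close>-th term and the next one are both near minimal for the tolerance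
    \<open>d n\<close>.\<close>
  define D where "D = (%n. min (1 / real (Suc n)) (min (d n) (d (n - 1))))"
  have D: "0 < D n" "D n <= d n" "D (Suc n) <= d n" "D n <= 1 / real (Suc n)" for n using d(1) by (auto simp: D_def)
  have "\<forall>n. \<exists>u g. near_min A I (D n) u g" using near[OF D(1)] by blast
  from choice[OF this] obtain u where "\<forall>n. \<exists>g. near_min A I (D n) (u n) g" ..
  from choice[OF this] obtain g where ug: "\<forall>n. near_min A I (D n) (u n) (g n)" ..
  hence a: "admissible A (u n) (g n)" and E: "energy (u n) (%x. ennreal (g n x)) <= ennreal (I + D n)" for n by blast+
  have np: "npair (u n) (%x. ennreal (g n x))" and g0: "0 <= g n x" and gm[measurable]: "g n \<in> bmeas"
    and one: "x \<in> A ==> u n x = 1" for n x using a[of n] unfolding admissible_def by blast+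
  note [measurable] = npairD(1)[OF np]
  have diff: "En (%x. ennreal \<bar>g n x - g (Suc n) x\<bar>) <= ennreal (\<eta> n)" for n
  proof (rule d(2))
    show "near_min A I (d n) (u n) (g n)" using a[of n] order_trans[OF E[of n]] D(2)[of n] by (simp add: ennreal_leI)
    show "near_min A I (d n) (u (Suc n)) (g (Suc n))"
      using a[of "Suc n"] order_trans[OF E[of "Suc n"]] D(3)[of n] by (simp add: ennreal_leI)
  qed
  define h where "h = (%x. \<Sum>n. ennreal \<bar>g n x - g (Suc n) x\<bar>)"
  have [measurable]: "h \<in> bmeas" unfolding h_def by measurable
  have hfin: "En h < \<infinity>"
  proof -
    have "En h <= (\<Sum>n. ennreal ((2 powr p) ^ Suc n) * En (%x. ennreal \<bar>g n x - g (Suc n) x\<bar>))"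
      unfolding h_def by (rule En_suminf_le) measurable
    also have "... <= (\<Sum>n. ennreal ((2 powr p) ^ Suc n) * ennreal (\<eta> n))" by (intro suminf_le mult_left_mono diff) auto
    also have "... = (\<Sum>n. ennreal ((1/2) ^ n))" by (intro suminf_cong) (simp add: \<eta>_def flip: ennreal_mult del: power_Suc)
    also have "... = ennreal (\<Sum>n. (1/2) ^ n)" by (intro suminf_ennreal2) auto
    also have "... < \<infinity>" by simp
    finally show ?thesis .
  qed
  have bound: "ennreal (g n x) <= ennreal (g 0 x) + h x" for n x
  proof -
    have "g n x <= g 0 x + (\<Sum>i<n. \<bar>g i x - g (Suc i) x\<bar>)" by (induction n) auto
    hence "ennreal (g n x) <= ennreal (g 0 x + (\<Sum>i<n. \<bar>g i x - g (Suc i) x\<bar>))" by (rule ennreal_leI)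
    also have "... = ennreal (g 0 x) + (\<Sum>i<n. ennreal \<bar>g i x - g (Suc i) x\<bar>)" using g0 by (simp add: sum_nonneg)
    also have "... <= ennreal (g 0 x) + h x" unfolding h_def by (intro add_left_mono sum_le_suminf) auto
    finally show ?thesis .
  qed
  \<comment> \<open>\<open>S n\<close> dominates all gradients from \<open>n\<close> on and is
    therefore a gradient of the infimum of the functions from \<open>n\<close> on. Its energy is
    finite thanks to the majorant \<open>g 0 + h\<close>.\<close>
  define S where "S = (%n x. SUP i. ennreal (g (n + i) x))"
  have Sm[measurable]: "S n \<in> bmeas" for n unfolding S_def by measurable
  have Sdec: "S (Suc n) x <= S n x" for n x unfolding S_def by (rule SUP_mono) (metis UNIV_I add_Suc_shift order_refl)
  have SE: "En (S n) < \<infinity>" for n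
  proof -
    have "En (S n) <= En (%x. ennreal (g 0 x) + h x)" unfolding S_def by (intro En_mono SUP_least bound)
    also have "... <= ennreal (2 powr p) * (Er (g 0) + En h)" by (rule En_add_le) measurable
    also have "... < \<infinity>" using npairD(5)[OF np[of 0]] hfin by (simp add: ennreal_mult_less_top)
    finally show ?thesis .
  qed
  define w where "w = (%n x. INF i. u (n + i) x)"
  have wnp: "npair (w n) (S n)" for n unfolding w_def S_def by (rule npair_INF[OF np]) (use SE[of n] in \<open>simp add: S_def\<close>)
  have bddu: "bdd_below (range (%i. u (n + i) x))" for n x using npairD(2)[OF np] by (intro bdd_belowI2)
  have wmono: "w n x <= w (n + k) x" for n k x
    unfolding w_def by (rule cINF_greatest) (auto simp: add.assoc intro!: cINF_lower[OF bddu])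
  have bddw: "bdd_above (range (%n. w (k + n) x))" for k x using npairD(3)[OF wnp] by (intro bdd_aboveI2)
  define v where "v = (%x. SUP n. w n x)"
  have vk: "v x = (SUP n. w (k + n) x)" for k x
  proof (rule antisym)
    show "v x <= (SUP n. w (k + n) x)" unfolding v_def
    proof (rule cSUP_least)
      fix n have "w n x <= w (k + n) x" using wmono[of n x k] by (simp add: add.commute)
      also have "... <= (SUP n. w (k + n) x)" by (intro cSUP_upper bddw) simp
      finally show "w n x <= (SUP n. w (k + n) x)" .
    qed simp
    show "(SUP n. w (k + n) x) <= v x" unfolding v_def using bddw[of 0 x] by (intro cSUP_least cSUP_upper) auto
  qed
  have vS: "npair v (S k)" for k
  proof -
    have le: "(SUP n. S (k + n) x) = S k x" for x
    proof (rule antisym)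
      have "S (k + n) x <= S k x" for n by (induction n) (auto intro: order_trans[OF Sdec])
      thus "(SUP n. S (k + n) x) <= S k x" by (intro SUP_least)
      show "S k x <= (SUP n. S (k + n) x)" by (rule SUP_upper2[of 0]) auto
    qed
    have "npair (%x. SUP n. w (k + n) x) (%x. SUP n. S (k + n) x)" by (rule npair_SUP[OF wnp]) (use SE in \<open>simp add: le\<close>)
    thus ?thesis unfolding le vk[symmetric] .
  qed
  define G where "G = (%x. INF n. S n x)"
  have [measurable]: "G \<in> bmeas" unfolding G_def by measurable
  have wG: "rwug v G" unfolding G_def by (rule wug_INF[of "%x. ereal (v x)" S, OF npairD(4)[OF vS] Sdec])
  have GE: "En G < \<infinity>"
  proof -
    have "En G <= En (S 0)" unfolding G_def by (intro En_mono INF_lower) simp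
    thus ?thesis using SE by (rule le_less_trans)
  qed
  have vG: "npair v G" using vS[of 0] wG GE unfolding npair_def by blast
  have v1: "\<forall>x\<in>A. v x = 1" unfolding v_def w_def using one by simp
  have v_liminf: "ennreal (v x) <= liminf (%n. ennreal (u n x))" for x
  proof -
    have "ennreal (v x) <= (SUP n. ennreal (w n x))"
    proof (rule ennreal_le_epsilon)
      fix e :: real assume e: "0 < e"
      then obtain n where "v x - e < w n x" 
        using less_cSUP_iff[of "UNIV :: nat set" "%n. w n x" "v x - e"] bddw[of 0 x] unfolding v_def by auto
      hence "ennreal (v x) <= ennreal (w n x + e)" by (intro ennreal_leI) simp
      also have "... = ennreal (w n x) + ennreal e" using e npairD(2)[OF wnp] by simp
      also have "... <= (SUP n. ennreal (w n x)) + ennreal e" by (intro add_right_mono SUP_upper) simp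
      finally show "ennreal (v x) <= (SUP n. ennreal (w n x)) + ennreal e" .
    qed
    also have "... <= liminf (%n. ennreal (u n x))" unfolding liminf_SUP_INF
    proof (intro SUP_mono' INF_greatest ennreal_leI)
      fix n i :: nat assume "i \<in> {n..}"
      hence "u i x = u (n + (i - n)) x" by simp
      moreover have "w n x <= u (n + (i - n)) x" unfolding w_def by (rule cINF_lower[OF bddu UNIV_I])
      ultimately show "w n x <= u i x" by simp
    qed
    finally show ?thesis .
  qed
  have G_liminf: "AE x in \<mu>. G x <= liminf (%n. ennreal (g n x))"
  proof -
    have "(\<integral>\<^sup>+x. ennpowr (h x) p \<partial>\<mu>) ~= \<infinity>" using hfin by (simp add: En_def)
    hence "AE x in \<mu>. ennpowr (h x) p ~= \<infinity>" by (intro nn_integral_noteq_infinite) auto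
    thus ?thesis
    proof eventually_elim
      case (elim x)
      hence "(\<Sum>n. ennreal \<bar>g n x - g (Suc n) x\<bar>) ~= top" by (simp add: h_def)
      hence sm: "summable (%n. \<bar>g n x - g (Suc n) x\<bar>)" by (intro summable_suminf_not_top) auto
      hence "summable (%n. g n x - g (Suc n) x)" by (rule summable_rabs_cancel)
      hence "(%n. \<Sum>i<n. g i x - g (Suc i) x) \<longlonglongrightarrow> (\<Sum>i. g i x - g (Suc i) x)" by (rule summable_LIMSEQ)
      hence "(%n. g 0 x - g n x) \<longlonglongrightarrow> (\<Sum>i. g i x - g (Suc i) x)"
      proof -
        have "(\<Sum>i<n. g i x - g (Suc i) x) = g 0 x - g n x" for n by (induction n) auto
        thus ?thesis using \<open>(%n. \<Sum>i<n. g i x - g (Suc i) x) \<longlonglongrightarrow> _\<close> by simp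
      qed
      hence "(%n. g 0 x - (g 0 x - g n x)) \<longlonglongrightarrow> g 0 x - (\<Sum>i. g i x - g (Suc i) x)"
        by (intro tendsto_diff tendsto_const)
      hence lim: "(%n. ennreal (g n x)) \<longlonglongrightarrow> ennreal (g 0 x - (\<Sum>i. g i x - g (Suc i) x))"
        by (intro tendsto_ennrealI) simp
      have "G x = limsup (%n. ennreal (g n x))"
      proof -
        have "S n x = (SUP m\<in>{n..}. ennreal (g m x))" for n unfolding S_def
        proof (intro antisym SUP_least)
          show "ennreal (g (n + i) x) <= (SUP m\<in>{n..}. ennreal (g m x))" for i by (rule SUP_upper) simp
          show "ennreal (g m x) <= (SUP i. ennreal (g (n + i) x))" if "m \<in> {n..}" for m
            by (rule SUP_upper2[of "m - n"]) (use that in auto)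
        qed
        thus ?thesis by (simp add: G_def limsup_INF_SUP)
      qed
      also have "... = liminf (%n. ennreal (g n x))" using lim_imp_Limsup[OF _ lim] lim_imp_Liminf[OF _ lim] by simp
      finally show ?case by simp
    qed
  qed
  have "energy v G <= ennreal I"
  proof -
    have "energy v G <= (\<integral>\<^sup>+x. liminf (%n. ennpowr (ennreal (u n x)) p) \<partial>\<mu>) + (\<integral>\<^sup>+x. liminf (%n. ennpowr (ennreal (g n x)) p) \<partial>\<mu>)"
    proof (rule add_mono)
      show "Er v <= (\<integral>\<^sup>+x. liminf (%n. ennpowr (ennreal (u n x)) p) \<partial>\<mu>)"
        unfolding En_def using p0 by (intro nn_integral_mono order_trans[OF ennpowr_mono[OF v_liminf] ennpowr_liminf_le]) auto
      show "En G <= (\<integral>\<^sup>+x. liminf (%n. ennpowr (ennreal (g n x)) p) \<partial>\<mu>)"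
        unfolding En_def using G_liminf by (intro nn_integral_mono_AE, eventually_elim)
          (rule order_trans[OF ennpowr_mono[OF _ p0(2)] ennpowr_liminf_le[OF p0(1)]])
    qed
    also have "... <= liminf (%n. Er (u n)) + liminf (%n. Er (g n))" unfolding En_def by (intro add_mono nn_integral_liminf) measurable
    also have "... <= liminf (%n. energy (u n) (%x. ennreal (g n x)))" by (rule liminf_add_le)
    also have "... <= liminf (%n. ennreal (I + 1 / real (Suc n)))"
    proof (intro Liminf_mono always_eventually allI)
      fix n show "energy (u n) (%x. ennreal (g n x)) <= ennreal (I + 1 / real (Suc n))"
        using E[of n] by (rule order_trans) (simp add: ennreal_leI D del: of_nat_Suc)
    qed
    also have "... = ennreal I"
    proof (rule lim_imp_Liminf)
      have "(%n. I + 1 / real (Suc n)) \<longlonglongrightarrow> I + 0" by (intro tendsto_add tendsto_const LIMSEQ_Suc lim_1_over_n)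
      thus "(%n. ennreal (I + 1 / real (Suc n))) \<longlonglongrightarrow> ennreal I" by (intro tendsto_ennrealI) simp
    qed simp
    finally show ?thesis .
  qed
  moreover from this have "energy v G < \<infinity>" by (rule le_less_trans) simp
  moreover have "energy v G <= energy u h" if "npair u h" "\<forall>x\<in>A. u x = 1" for u h
    using calculation(1) X_le[OF that] unfolding I(1) by (rule order_trans)
  ultimately have "minimizer A v G" unfolding minimizer_def using vG v1 by blast
  thus thesis by (rule that)
qed

lemma minimizerD:
  assumes "minimizer A v g"
  shows "npair v g" "x \<in> A ==> v x = 1" "energy v g < \<infinity>"
    "npair u h ==> (!!x. x \<in> A ==> u x = 1) ==> energy v g <= energy u h" using assms unfolding minimizer_def by blast+

lemma npair_truncate_below:
  assumes u: "npair v g" and k: "0 < k" "k <= 1"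
  shows "npair (%x. max 0 (k - v x)) (%x. if v x < k then g x else 0)"
proof -
  note [measurable] = npairD(1)[OF u] npairD(6)[OF u]
  have "rwug (%x. max 0 (k - v x)) g" by (rule rwug_contraction[OF npairD(4)[OF u]]) auto
  from rwug_locality[OF this, of 0]
  have "rwug (%x. max 0 (k - v x)) (%x. if max 0 (k - v x) = 0 then 0 else g x)" by simp
  moreover have "(%x. if max 0 (k - v x) = 0 then 0 else g x) = (%x. if v x < k then g x else 0)" by (auto simp: fun_eq_iff max_def)
  ultimately have w: "rwug (%x. max 0 (k - v x)) (%x. if v x < k then g x else 0)" by simp
  have "En (%x. if v x < k then g x else 0) <= En g" by (rule En_mono) auto
  hence "En (%x. if v x < k then g x else 0) < \<infinity>" using npairD(5)[OF u] by (rule le_less_trans)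
  moreover have "0 <= max 0 (k - v x) \<and> max 0 (k - v x) <= 1" for x using k npairD(2)[OF u, of x] by auto
  ultimately show ?thesis using w unfolding npair_def by simp
qed

text \<open>Comparison with the competitor \<open>max v (k \<eta>)\<close>, where \<open>\<eta>\<close> is a cutoff function.\<close>

lemma caccioppoli:
  assumes min: "minimizer A v g" and \<rho>: "0 < \<rho>" "\<rho> <= 1" and k: "0 < k" "k <= 1"
  shows "nugb (%x. if v x < k then g x else 0) z \<rho>
    <= 2 * (k / \<rho>) powr p * lev v k z (2 * \<rho>)"
proof -
  have np: "npair v g" by (rule minimizerD(1)[OF min])
  note \<eta> = cutoff[OF \<rho>(1), where z = z]
  note [measurable] = npairD(1)[OF np] npairD(6)[OF np] \<eta>(2)
  define w where "w = (%x. max (v x) (k * cutoff z \<rho> x))"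
  define h where "h = (%x. if k * cutoff z \<rho> x <= v x then g x else ennreal k * (if cutoff z \<rho> x = 0 then 0 else ennreal (1 / \<rho>)))"
  have [measurable]: "h \<in> bmeas" unfolding h_def by measurable
  have "rwug (%x. k * cutoff z \<rho> x) (%x. ennreal k * (if cutoff z \<rho> x = 0 then 0 else ennreal (1 / \<rho>)))"
    using k by (intro rwug_lipschitz_comp[OF \<eta>(1)]) (auto simp: abs_mult right_diff_distrib[symmetric])
  from rwug_max[OF npairD(4)[OF np] this]
  have wug: "rwug w h" unfolding w_def h_def by simp
  \<comment> \<open>The competitor differs from \<open>v\<close> only on \<open>T\<close>, where
    \<open>v < k\<close> and the cutoff is positive. Off \<open>T\<close> the two energies agree;
    their common value \<open>R\<close> is cancelled, so it has to be finite.\<close>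
  define T where "T = {x. v x < k * cutoff z \<rho> x}"
  have T_eq: "T = {x \<in> space \<mu>. v x < k * cutoff z \<rho> x}" by (simp add: T_def)
  have [measurable]: "T \<in> sets \<mu>" unfolding T_eq by measurable
  have Tsub: "T \<subseteq> {x. v x < k} \<inter> ball z (2 * \<rho>)"
  proof
    fix x assume x: "x \<in> T"
    have "k * cutoff z \<rho> x <= k * 1" using k \<eta>(4) by (intro mult_left_mono) auto
    moreover have "cutoff z \<rho> x ~= 0" using x npairD(2)[OF np, of x] by (auto simp: T_def)
    ultimately show "x \<in> {x. v x < k} \<inter> ball z (2 * \<rho>)" using x \<eta>(6)[of x] by (auto simp: T_def)
  qed
  have Tfin: "emeasure \<mu> T < \<infinity>" by (rule emeasure_subset_ball[of _ z "2 * \<rho>"]) (use Tsub in blast)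
  have hT: "h x <= ennreal (k / \<rho>)" if "x \<in> T" for x using that k \<rho> by (auto simp: h_def T_def simp flip: ennreal_mult)
  have split: "En f = (\<integral>\<^sup>+x\<in>T. ennpowr (f x) p \<partial>\<mu>) + (\<integral>\<^sup>+x\<in>-T. ennpowr (f x) p \<partial>\<mu>)" if "f \<in> bmeas" for f
  proof -
    have "-T \<in> sets \<mu>" using sets.Diff[OF sets.top \<open>T \<in> sets \<mu>\<close>] by (simp add: Compl_eq_Diff_UNIV)
    thus ?thesis unfolding En_def using that
      by (subst nn_integral_add[symmetric]) (auto intro!: nn_integral_cong split: split_indicator)
  qed
  define R where "R = (\<integral>\<^sup>+x\<in>-T. ennpowr (ennreal (v x)) p \<partial>\<mu>) + (\<integral>\<^sup>+x\<in>-T. ennpowr (g x) p \<partial>\<mu>)"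
  have off: "(\<integral>\<^sup>+x\<in>-T. ennpowr (ennreal (w x)) p \<partial>\<mu>) = (\<integral>\<^sup>+x\<in>-T. ennpowr (ennreal (v x)) p \<partial>\<mu>)"
    "(\<integral>\<^sup>+x\<in>-T. ennpowr (h x) p \<partial>\<mu>) = (\<integral>\<^sup>+x\<in>-T. ennpowr (g x) p \<partial>\<mu>)"
    by (intro nn_integral_cong; auto simp: T_def w_def h_def max_def split: split_indicator)+
  have wm: "w \<in> bmeas" unfolding w_def by measurable
  \<comment> \<open>Two terms of the same size, hence the factor 2: \<open>\<rho> <= 1\<close> gives
    \<open>k <= k / \<rho>\<close>, so the zero-order term of the energy is no larger than the bound
    for the gradient term.\<close>
  have up: "(\<integral>\<^sup>+x\<in>T. ennpowr (ennreal (w x)) p \<partial>\<mu>) + (\<integral>\<^sup>+x\<in>T. ennpowr (h x) p \<partial>\<mu>) <= ennreal (2 * (k / \<rho>) powr p) * emeasure \<mu> T"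
  proof -
    have "ennreal (w x) <= ennreal (k / \<rho>)" if "x \<in> T" for x
    proof (rule ennreal_leI)
      have "w x = k * cutoff z \<rho> x" using that by (simp add: w_def T_def)
      also have "... <= k * 1" using k \<eta>(4) by (intro mult_left_mono) auto
      also have "... <= k / \<rho>" using k \<rho> by (simp add: field_simps mult_left_le)
      finally show "w x <= k / \<rho>" .
    qed
    hence "(\<integral>\<^sup>+x\<in>T. ennpowr (ennreal (w x)) p \<partial>\<mu>) <= (\<integral>\<^sup>+x\<in>T. ennpowr (ennreal (k / \<rho>)) p \<partial>\<mu>)"
      using p0 by (intro nn_integral_mono) (auto split: split_indicator intro!: ennpowr_mono)
    moreover have "(\<integral>\<^sup>+x\<in>T. ennpowr (h x) p \<partial>\<mu>) <= (\<integral>\<^sup>+x\<in>T. ennpowr (ennreal (k / \<rho>)) p \<partial>\<mu>)"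
      using hT p0 by (intro nn_integral_mono) (auto split: split_indicator intro!: ennpowr_mono)
    moreover have "(\<integral>\<^sup>+x\<in>T. ennpowr (ennreal (k / \<rho>)) p \<partial>\<mu>) = ennreal ((k / \<rho>) powr p) * emeasure \<mu> T"
      using k \<rho> by (simp add: ennpowr_ennreal nn_integral_cmult_indicator)
    ultimately have "(\<integral>\<^sup>+x\<in>T. ennpowr (ennreal (w x)) p \<partial>\<mu>) + (\<integral>\<^sup>+x\<in>T. ennpowr (h x) p \<partial>\<mu>)
      <= ennreal ((k / \<rho>) powr p) * emeasure \<mu> T + ennreal ((k / \<rho>) powr p) * emeasure \<mu> T" by (intro add_mono) auto
    also have "... = ennreal (2 * (k / \<rho>) powr p) * emeasure \<mu> T" by (simp add: ennreal_mult' mult_2[symmetric] mult.assoc)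
    finally show ?thesis .
  qed
  have Rfin: "R < \<infinity>"
  proof -
    have "R <= energy v g" unfolding R_def by (subst (1 2) split) (auto intro!: add_mono)
    thus ?thesis using minimizerD(3)[OF min] by (rule le_less_trans)
  qed
  have Ew: "energy w h = R + ((\<integral>\<^sup>+x\<in>T. ennpowr (ennreal (w x)) p \<partial>\<mu>) + (\<integral>\<^sup>+x\<in>T. ennpowr (h x) p \<partial>\<mu>))"
    using wm by (subst (1 2) split) (auto simp: R_def off add_ac)
  have Ev: "energy v g = R + ((\<integral>\<^sup>+x\<in>T. ennpowr (ennreal (v x)) p \<partial>\<mu>) + (\<integral>\<^sup>+x\<in>T. ennpowr (g x) p \<partial>\<mu>))"
    by (subst (1 2) split) (auto simp: R_def add_ac)
  have "En h <= energy w h" by simp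
  also have "... < \<infinity>"
  proof -
    have "ennreal (2 * (k / \<rho>) powr p) * emeasure \<mu> T < \<infinity>" using Tfin by (simp add: ennreal_mult_less_top)
    from le_less_trans[OF up this] show ?thesis unfolding Ew using Rfin by simp
  qed
  finally have "npair w h" unfolding npair_def using wug wm npairD(2,3)[OF np] \<eta>(3,4) k by (auto simp: w_def max_def mult_le_one)
  moreover have "w x = 1" if "x \<in> A" for x
  proof -
    have "k * cutoff z \<rho> x <= 1" using \<eta>(3,4)[of x] k by (intro mult_le_one) auto
    thus ?thesis using minimizerD(2)[OF min that] by (simp add: w_def)
  qed
  ultimately have "energy v g <= energy w h" by (rule minimizerD(4)[OF min])
  hence "(\<integral>\<^sup>+x\<in>T. ennpowr (ennreal (v x)) p \<partial>\<mu>) + (\<integral>\<^sup>+x\<in>T. ennpowr (g x) p \<partial>\<mu>) <=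
    (\<integral>\<^sup>+x\<in>T. ennpowr (ennreal (w x)) p \<partial>\<mu>) + (\<integral>\<^sup>+x\<in>T. ennpowr (h x) p \<partial>\<mu>)"
    unfolding Ev Ew ennreal_add_left_cancel_le using Rfin by auto
  also note up
  finally have main: "(\<integral>\<^sup>+x\<in>T. ennpowr (g x) p \<partial>\<mu>) <= ennreal (2 * (k / \<rho>) powr p) * emeasure \<mu> T"
    by (rule order_trans[rotated]) simp
  have gk: "(%x. if v x < k then g x else 0) \<in> bmeas" by measurable
  have "emeasure (nug (%x. if v x < k then g x else 0)) (ball z \<rho>) = (\<integral>\<^sup>+x\<in>ball z \<rho>. ennpowr (if v x < k then g x else 0) p \<partial>\<mu>)"
    by (rule emeasure_nug[OF gk]) simp
  also have "... <= (\<integral>\<^sup>+x\<in>T. ennpowr (g x) p \<partial>\<mu>)"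
    using \<eta>(5) by (intro nn_integral_mono) (auto simp: T_def split: split_indicator)
  also note main
  also have "emeasure \<mu> T <= emeasure \<mu> ({x \<in> space \<mu>. v x < k} \<inter> ball z (2 * \<rho>))"
  proof (rule emeasure_mono)
    have "{x \<in> space \<mu>. v x < k} \<in> sets \<mu>" by measurable
    thus "{x \<in> space \<mu>. v x < k} \<inter> ball z (2 * \<rho>) \<in> sets \<mu>" by (intro sets.Int ball_sets)
  qed (use Tsub in auto)
  also have "... = ennreal (lev v k z (2 * \<rho>))"
    using emeasure_subset_ball[of "{x \<in> space \<mu>. v x < k} \<inter> ball z (2 * \<rho>)" z "2 * \<rho>"]
    by (subst emeasure_eq_ennreal_measure) auto
  also have "ennreal (2 * (k / \<rho>) powr p) * ... = ennreal (2 * (k / \<rho>) powr p * lev v k z (2 * \<rho>))"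
    by (simp add: ennreal_mult')
  finally have "emeasure (nug (%x. if v x < k then g x else 0)) (ball z \<rho>)
      <= ennreal (2 * (k / \<rho>) powr p * lev v k z (2 * \<rho>))" by (simp add: mult_left_mono)
  thus ?thesis by (simp add: measure_def enn2real_leI)
qed

end

section \<open>Expansion of positivity for minimizers\<close>

locale pi_space = doubling_space +
  fixes CP :: real and nL :: nat
  assumes CP: "0 < CP" and poincare: "npair u g ==> PI u (nug g) CP nL"
begin

lemma level_set:
  assumes "v \<in> bmeas"
  shows "{x. v x < (k::real)} \<inter> ball z r \<in> sets \<mu>" "{x. v x < k} \<inter> ball z r \<in> fmeasurable \<mu>"
proof -
  have "{x \<in> space \<mu>. v x < k} \<in> sets \<mu>" using assms by measurable
  hence "{x \<in> space \<mu>. v x < k} \<inter> ball z r \<in> sets \<mu>" by (intro sets.Int ball_sets)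
  thus "{x. v x < k} \<inter> ball z r \<in> sets \<mu>" by simp
  thus "{x. v x < k} \<inter> ball z r \<in> fmeasurable \<mu>"
    using emeasure_subset_ball[of "{x. v x < k} \<inter> ball z r" z r] by (intro fmeasurableI) auto
qed

lemma level_measure_le:
  assumes "v \<in> bmeas" "k <= k'" "ball z r \<subseteq> ball z' r'"
  shows "lev v k z r <= lev v k' z' r'" using assms(2,3) level_set[OF assms(1)] by (intro measure_mono_fmeasurable) auto

lemma level_measure_le_ball:
  assumes "v \<in> bmeas"
  shows "lev v k z r <= m z r" using level_set(1)[OF assms] ball_finite[of z r]
  by (intro measure_mono_fmeasurable) (auto simp: fmeasurable_def)

lemma measure_le_avg:
  assumes u[measurable]: "u \<in> bmeas" and u01: "!!x. 0 <= u x" "!!x. u x <= 1"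
    and S: "S \<in> sets \<mu>" "S \<subseteq> ball z r" and r: "0 < r" and c: "0 <= c" "!!x. x \<in> S ==> c <= u x"
  shows "c * measure \<mu> S <= avg u z r * m z r"
proof -
  have fin: "S \<in> fmeasurable \<mu>" using S emeasure_subset_ball[OF S(2)] by (auto simp: fmeasurable_def)
  have "c * measure \<mu> S = (LINT x|\<mu>. c * indicator S x)" using fin by simp
  also have "... <= (LINT x:ball z r|\<mu>. u x)" unfolding set_lebesgue_integral_def
  proof (rule integral_mono)
    show "integrable \<mu> (%x. c * indicator S x)" using fin by (auto simp: fmeasurable_def)
    show "integrable \<mu> (%x. indicator (ball z r) x *\<^sub>R u x)"
      using integrable_ball[of u 1 z r] u01 by (auto simp: set_integrable_def)
    show "c * indicator S x <= indicator (ball z r) x *\<^sub>R u x" for x using c S(2) u01 by (auto split: split_indicator)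
  qed
  also have "... = avg u z r * m z r" using m_pos[OF r, of z] by (simp add: avg_def)
  finally show ?thesis .
qed

lemma avg_le_level:
  assumes v: "v \<in> bmeas" "!!x. 0 <= v x" and r: "0 < r" and k: "0 < k" "k <= 1"
  shows "avg (%x. max 0 (k - v x)) z r * m z r <= k * lev v k z r"
proof -
  note [measurable] = v(1)
  have "avg (%x. max 0 (k - v x)) z r * m z r = (LINT x:ball z r|\<mu>. max 0 (k - v x))" using m_pos[OF r, of z] by (simp add: avg_def)
  also have "... <= (LINT x|\<mu>. k * indicator ({x. v x < k} \<inter> ball z r) x)" unfolding set_lebesgue_integral_def
  proof (rule integral_mono)
    show "integrable \<mu> (%x. k * indicator ({x. v x < k} \<inter> ball z r) x)"
      using level_set(2)[OF v(1), of k z r] by (auto simp: fmeasurable_def)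
    show "integrable \<mu> (%x. indicator (ball z r) x *\<^sub>R max 0 (k - v x))"
    proof -
      have "\<bar>max 0 (k - v y)\<bar> <= 1" for y using k v(2)[of y] by auto
      thus ?thesis using integrable_ball[of "%x. max 0 (k - v x)" 1 z r] by (simp add: set_integrable_def)
    qed
    show "indicator (ball z r) x *\<^sub>R max 0 (k - v x) <= k * indicator ({x. v x < k} \<inter> ball z r) x" for x
      using k v(2)[of x] by (auto split: split_indicator)
  qed
  also have "... = k * lev v k z r" using level_set(2)[OF v(1), of k z r] by simp
  finally show ?thesis .
qed

lemma ennpowr_sum_disjoint:
  assumes "finite S" "!!i j. i \<in> S ==> j \<in> S ==> i ~= j ==> f i = 0 \<or> f j = 0"
  shows "ennpowr (\<Sum>i\<in>S. f i) a <= (\<Sum>i\<in>S. ennpowr (f i) a)"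
proof (cases "\<exists>i\<in>S. f i ~= 0")
  case True
  then obtain i where i: "i \<in> S" "f i ~= 0" by blast
  have "(\<Sum>j\<in>S. f j) = f i + (\<Sum>j\<in>S - {i}. f j)" by (rule sum.remove[OF assms(1) i(1)])
  also have "(\<Sum>j\<in>S - {i}. f j) = 0" using assms(2)[OF i(1)] i by (intro sum.neutral) auto
  finally have "ennpowr (\<Sum>j\<in>S. f j) a = ennpowr (f i) a" by simp
  also have "... <= (\<Sum>i\<in>S. ennpowr (f i) a)" using assms(1) i(1) by (intro member_le_sum) auto
  finally show ?thesis .
qed simp

text \<open>The sum \<open>\<Sum>m<M. 2 ^ (m + 1) * T m\<close> of truncations of \<open>v\<close> between the levels \<open>2 ^ - (m + 1)\<close> and
  \<open>2 ^ - m\<close> plays the role of \<open>log (1 / v)\<close>, for which the Caccioppoli inequality gives an energy of order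
  \<open>M\<close>, whereas the Poincare inequality needs energy of order \<open>M ^ p\<close> to reach the value \<open>M\<close>.\<close>

lemma log_truncation:
  assumes min: "minimizer A v g" and r: "0 < r" "2 ^ nL * r <= 1" and M: "0 < (M::nat)"
  shows "\<exists>u. u \<in> bmeas \<and> (\<forall>x. 0 <= u x \<and> u x <= 1) \<and> (\<forall>x. v x = 1 --> u x = 0) \<and>
     (\<forall>x. v x < (1/2) ^ M --> u x = 1) \<and>
     avg (%y. \<bar>u y - avg u z r\<bar>) z r <= CP * (2 * 2 powr p * CD) powr (1 / p) * real M powr (1 / p - 1)"
proof -
  have np: "npair v g" by (rule minimizerD(1)[OF min])
  note [measurable] = npairD(1)[OF np] npairD(6)[OF np]
  define a where "a = (%i::nat. (1/2::real) ^ i)"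
  have a: "0 < a i" "a i <= 1" "a (Suc i) = a i / 2" for i by (auto simp: a_def power_le_one)
  define T where "T = (%i x. min (max 0 (a i - v x)) (a (Suc i)))"
  define t where "t = (%i x. if a (Suc i) < v x \<and> v x < a i then g x else 0)"
  have Tm[measurable]: "T i \<in> bmeas" for i unfolding T_def by measurable
  have tm[measurable]: "t i \<in> bmeas" for i unfolding t_def by measurable
  have Tt: "rwug (T i) (t i)" for i
  proof -
    have "rwug (T i) (%x. if max 0 (a i - v x) = 0 then 0 else g x)"
    proof -
      have 1: "rwug (T i) g" unfolding T_def by (rule rwug_contraction[OF npairD(4)[OF np]]) (auto simp: min_def max_def)
      have "(%x. if T i x = 0 then 0 else g x) = (%x. if max 0 (a i - v x) = 0 then 0 else g x)"
        using a(1)[of "Suc i"] by (auto simp: T_def fun_eq_iff min_def)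
      thus ?thesis using rwug_locality[OF 1 Tm, of 0] by simp
    qed
    from rwug_locality[OF this Tm, of "a (Suc i)"]
    have "rwug (T i) (%x. if T i x = a (Suc i) then 0 else if max 0 (a i - v x) = 0 then 0 else g x)" .
    moreover have "(%x. if T i x = a (Suc i) then 0 else if max 0 (a i - v x) = 0 then 0 else g x) = t i"
      using a(1)[of i] a(3)[of i] by (auto simp: T_def t_def fun_eq_iff min_def max_def)
    ultimately show ?thesis by simp
  qed
  \<comment> \<open>Each truncation \<open>T i\<close> has height \<open>a (Suc i)\<close>. The
    factors turn them into \<open>M\<close> layers of height \<open>1 / M\<close>, whose sum
    \<open>U M\<close> is 0 where \<open>v = 1\<close> and 1 where
    \<open>v < (1/2) ^ M\<close>.\<close>
  define c where "c = (%i. 1 / (a (Suc i) * real M))"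
  have c: "0 < c i" for i using a M by (simp add: c_def)
  define U where "U = (%N x. \<Sum>i<N. c i * T i x)"
  define H where "H = (%N x. \<Sum>i<N. ennreal (c i) * t i x)"
  have Um[measurable]: "U N \<in> bmeas" for N unfolding U_def by measurable
  have Hm[measurable]: "H N \<in> bmeas" for N unfolding H_def by measurable
  have UH: "rwug (U N) (H N)" for N
  proof (induction N)
    case 0
    show ?case unfolding U_def H_def using rwug_const[of 0] by simp
  next
    case (Suc N)
    have "rwug (%x. c N * T N x) (%x. ennreal (c N) * t N x)"
      using c[of N] by (intro rwug_lipschitz_comp[OF Tt]) (auto simp: abs_mult right_diff_distrib[symmetric])
    from rwug_sum2[OF Suc this, of "U (Suc N)"] show ?case unfolding U_def H_def by simp
  qed
  have T01: "0 <= T i x" "T i x <= a (Suc i)" for i x using a(1)[of "Suc i"] by (auto simp: T_def min_def)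
  have U0: "0 <= U N x" for N x unfolding U_def using T01 c by (intro sum_nonneg mult_nonneg_nonneg) (auto intro: less_imp_le)
  have U1: "U M x <= 1" for x
  proof -
    have "U M x <= (\<Sum>i<M. 1 / real M)" unfolding U_def
    proof (rule sum_mono)
      fix i
      have "c i * T i x <= c i * a (Suc i)" using T01 c[of i] by (intro mult_left_mono) auto
      thus "c i * T i x <= 1 / real M" using a(1)[of "Suc i"] by (simp add: c_def)
    qed
    thus ?thesis using M by simp
  qed
  have one: "U M x = 0" if "v x = 1" for x
  proof -
    have "T i x = 0" for i using that a(2)[of i] a(1)[of "Suc i"] by (simp add: T_def)
    thus ?thesis by (simp add: U_def)
  qed
  have low: "U M x = 1" if "v x < (1/2) ^ M" for x
  proof -
    have "T i x = a (Suc i)" if "i < M" for i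
    proof -
      have "(1/2::real) ^ M <= (1/2) ^ Suc i" using that by (intro power_decreasing) auto
      hence "v x <= a (Suc i)" using \<open>v x < (1/2) ^ M\<close> by (simp add: a_def)
      thus ?thesis using a(3)[of i] by (simp add: T_def min_def max_def)
    qed
    hence "U M x = (\<Sum>i<M. 1 / real M)" unfolding U_def using a(1) by (intro sum.cong) (auto simp: c_def less_imp_neq[THEN not_sym])
    thus ?thesis using M by simp
  qed
  have tE: "ennpowr (H M x) p <= (\<Sum>i<M. ennpowr (ennreal (c i) * t i x) p)" for x unfolding H_def
  proof (rule ennpowr_sum_disjoint)
    fix i j assume ij: "i \<in> {..<M}" "j \<in> {..<M}" "i ~= j"
    have lt: "t i x = 0 \<or> t j x = 0" if "i < j" for i j
    proof -
      have "a j <= a (Suc i)" unfolding a_def using that by (intro power_decreasing) auto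
      thus ?thesis by (auto simp: t_def)
    qed
    have "t i x = 0 \<or> t j x = 0" using ij(3) lt[of i j] lt[of j i] by (metis linorder_neqE_nat)
    thus "ennreal (c i) * t i x = 0 \<or> ennreal (c j) * t j x = 0" by auto
  qed simp
  define \<rho> where "\<rho> = 2 ^ nL * r"
  have \<rho>: "0 < \<rho>" "\<rho> <= 1" using r by (auto simp: \<rho>_def)
  \<comment> \<open>The Caccioppoli inequality gives the same bound for every layer, because the
    powers of \<open>a i\<close> cancel. The gradients of the layers live on disjoint sets, so the
    sum has energy of order \<open>M * M powr (- p)\<close>.\<close>
  have mi: "(\<integral>\<^sup>+x\<in>ball z \<rho>. ennpowr (ennreal (c i) * t i x) p \<partial>\<mu>) <= ennreal (real M powr (- p) * (2 * 2 powr p * \<rho> powr (- p) * CD * m z \<rho>))" for i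
  proof -
    let ?gk = "%x. if v x < a i then g x else 0"
    interpret \<nu>: finite_measure "nug ?gk"
      by (intro finite_nug npairD(5)[OF npair_truncate_below[OF np a(1,2)]] npairD(6)[OF npair_truncate_below[OF np a(1,2)]])
    have [measurable]: "(%x. ennpowr (?gk x) p * indicator (ball z \<rho>) x) \<in> bmeas"
      by (intro borel_measurable_times_ennreal borel_measurable_indicator ball_sets) measurable
    have "(\<integral>\<^sup>+x\<in>ball z \<rho>. ennpowr (ennreal (c i) * t i x) p \<partial>\<mu>) <= (\<integral>\<^sup>+x\<in>ball z \<rho>. ennreal (c i powr p) * ennpowr (?gk x) p \<partial>\<mu>)"
      using c[of i] by (intro nn_integral_mono) (auto simp: ennpowr_cmult less_imp_le t_def split: split_indicator)
    also have "... = ennreal (c i powr p) * (\<integral>\<^sup>+x\<in>ball z \<rho>. ennpowr (?gk x) p \<partial>\<mu>)"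
      by (subst nn_integral_cmult[symmetric]) (auto simp: mult.assoc)
    also have "(\<integral>\<^sup>+x\<in>ball z \<rho>. ennpowr (?gk x) p \<partial>\<mu>) = ennreal (nugb ?gk z \<rho>)"
      by (simp add: emeasure_nug[symmetric] \<nu>.emeasure_eq_measure)
    also have "... <= ennreal (2 * (a i / \<rho>) powr p * (CD * m z \<rho>))"
    proof (rule ennreal_leI)
      have "nugb ?gk z \<rho> <= 2 * (a i / \<rho>) powr p * lev v (a i) z (2 * \<rho>)" by (rule caccioppoli[OF min \<rho> a(1,2)])
      also have "... <= 2 * (a i / \<rho>) powr p * (CD * m z \<rho>)"
      proof (rule mult_left_mono)
        have "lev v (a i) z (2 * \<rho>) <= m z (2 * \<rho>)" by (rule level_measure_le_ball) measurable
        also have "... <= CD * m z \<rho>" by (rule dbl[OF \<rho>(1)])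
        finally show "lev v (a i) z (2 * \<rho>) <= CD * m z \<rho>" .
      qed simp
      finally show "nugb ?gk z \<rho> <= 2 * (a i / \<rho>) powr p * (CD * m z \<rho>)" .
    qed
    also have "ennreal (c i powr p) * ennreal (2 * (a i / \<rho>) powr p * (CD * m z \<rho>)) = ennreal (c i powr p * (2 * (a i / \<rho>) powr p * (CD * m z \<rho>)))"
      using CD1 by (simp add: ennreal_mult')
    also have "c i powr p * (2 * (a i / \<rho>) powr p * (CD * m z \<rho>)) = real M powr (- p) * (2 * 2 powr p * \<rho> powr (- p) * CD * m z \<rho>)"
    proof -
      have "c i = 2 / (a i * real M)" by (simp add: c_def a(3))
      hence "c i powr p = 2 powr p / (a i powr p * real M powr p)" by (simp add: powr_divide powr_mult)
      moreover have "(a i / \<rho>) powr p = a i powr p / \<rho> powr p" by (simp add: powr_divide)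
      moreover have "a i powr p ~= 0" "\<rho> powr p ~= 0" "real M powr p ~= 0" using a(1)[of i] \<rho> M by auto
      ultimately show ?thesis by (simp only: powr_minus) (simp only: divide_simps, simp)
    qed
    finally show ?thesis by (simp add: mult_left_mono)
  qed
  have "emeasure (nug (H M)) (ball z \<rho>) = (\<integral>\<^sup>+x\<in>ball z \<rho>. ennpowr (H M x) p \<partial>\<mu>)"
    by (rule emeasure_nug) auto
  also have "... <= (\<integral>\<^sup>+x. (\<Sum>i<M. ennpowr (ennreal (c i) * t i x) p * indicator (ball z \<rho>) x) \<partial>\<mu>)"
    unfolding sum_distrib_right[symmetric] by (intro nn_integral_mono mult_right_mono tE) auto
  also have "... = (\<Sum>i<M. (\<integral>\<^sup>+x\<in>ball z \<rho>. ennpowr (ennreal (c i) * t i x) p \<partial>\<mu>))"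
    by (intro nn_integral_sum borel_measurable_times_ennreal borel_measurable_indicator ball_sets) measurable
  also have "... <= (\<Sum>i<M. ennreal (real M powr (- p) * (2 * 2 powr p * \<rho> powr (- p) * CD * m z \<rho>)))"
    by (rule sum_mono[OF mi])
  also have "... = ennreal (real M * (real M powr (- p) * (2 * 2 powr p * \<rho> powr (- p) * CD * m z \<rho>)))"
    by (simp add: ennreal_of_nat_eq_real_of_nat ennreal_mult')
  finally have eH: "emeasure (nug (H M)) (ball z \<rho>) <= ..." .
  have Hfin: "En (H M) < \<infinity>"
  proof -
    have "En (H M) <= (\<integral>\<^sup>+x. (\<Sum>i<M. ennpowr (ennreal (c i) * t i x) p) \<partial>\<mu>)"
      unfolding En_def using tE by (intro nn_integral_mono)
    also have "... = (\<Sum>i<M. En (%x. ennreal (c i) * t i x))" unfolding En_def by (rule nn_integral_sum) measurable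
    also have "... < \<infinity>"
    proof -
      have "En (%x. ennreal (c i) * t i x) < \<infinity>" for i
      proof -
        have "En (t i) <= En g" unfolding t_def by (intro En_mono) auto
        hence "En (t i) < \<infinity>" using npairD(5)[OF np] by (rule le_less_trans)
        thus ?thesis using c[of i] by (subst En_cmult) (auto simp: ennreal_mult_less_top less_imp_le)
      qed
      thus ?thesis by (simp add: less_top)
    qed
    finally show ?thesis .
  qed
  have npU: "npair (U M) (H M)" unfolding npair_def using U0 U1 UH Hfin by auto
  have mr: "0 < m z \<rho>" using m_pos[OF \<rho>(1)] .
  interpret \<nu>: finite_measure "nug (H M)" by (rule finite_nug[OF Hm Hfin])
  define B where "B = 2 * 2 powr p * CD"
  have B: "0 < B" using CD1 by (simp add: B_def)
  have "nugb (H M) z \<rho> <= real M * (real M powr (- p) * (2 * 2 powr p * \<rho> powr (- p) * CD * m z \<rho>))"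
    using eH CD1 by (subst (asm) \<nu>.emeasure_eq_measure) (simp add: ennreal_le_iff)
  also have "... = (B * \<rho> powr (- p) * real M powr (1 - p)) * m z \<rho>"
    using M by (simp add: B_def powr_diff powr_minus divide_simps)
  finally have "nugb (H M) z \<rho> / m z \<rho> <= B * \<rho> powr (- p) * real M powr (1 - p)" using mr by (simp add: divide_le_eq)
  hence "(nugb (H M) z \<rho> / m z \<rho>) powr (1 / p) <= (B * \<rho> powr (- p) * real M powr (1 - p)) powr (1 / p)"
    using p0 by (intro powr_mono2) auto
  also have "... = B powr (1 / p) * \<rho> powr (- 1) * real M powr (1 / p - 1)"
    using p0 by (simp add: powr_mult powr_powr diff_divide_distrib)
  finally have q: "(nugb (H M) z \<rho> / m z \<rho>) powr (1 / p) <= B powr (1 / p) * \<rho> powr (- 1) * real M powr (1 / p - 1)" .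
  have "avg (%y. \<bar>U M y - avg (U M) z r\<bar>) z r <= CP * r * (nugb (H M) z \<rho> / m z \<rho>) powr (1 / p)"
    using poincare[OF npU] r(1) unfolding PI_def \<rho>_def by blast
  also have "... <= CP * r * (B powr (1 / p) * \<rho> powr (- 1) * real M powr (1 / p - 1))" using CP r by (intro mult_left_mono q) auto
  also have "... = CP * B powr (1 / p) * real M powr (1 / p - 1) * (r / \<rho>)" using \<rho>(1) by (simp add: powr_minus divide_simps)
  also have "... <= CP * B powr (1 / p) * real M powr (1 / p - 1) * 1"
  proof (rule mult_left_mono)
    have "1 * r <= 2 ^ nL * r" using r(1) by (intro mult_right_mono) (auto simp: one_le_power)
    thus "r / \<rho> <= 1" using \<rho>(1) by (simp add: \<rho>_def)
  qed (use CP in auto)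
  finally have "avg (%y. \<bar>U M y - avg (U M) z r\<bar>) z r <= CP * (2 * 2 powr p * CD) powr (1 / p) * real M powr (1 / p - 1)"
    by (simp add: B_def)
  thus ?thesis using U0 U1 one low by (intro exI[of _ "U M"]) auto
qed

text \<open>The logarithmic function vanishes on \<open>S\<close> and is 1 where
  \<open>v < (1/2) ^ M\<close>, and its mean oscillation tends to 0 as \<open>M\<close> grows, since
  \<open>1 / p - 1 < 0\<close>. As \<open>S\<close> has density at least \<open>c\<close>, the mean
  value \<open>w\<close> is small, and then so is the set where the function is 1.\<close>

lemma shrink:
  assumes c: "0 < c" and e: "0 < \<epsilon>"
  obtains M where "0 < M" "!!S A v g z r. minimizer A v g ==> 0 < r ==> 2 ^ nL * r <= 1 ==>
    S \<in> sets \<mu> ==> S \<subseteq> ball z r ==> (!!x. x \<in> S ==> v x = 1) ==> c * m z r <= measure \<mu> S ==>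
    lev v ((1/2) ^ M) z r <= \<epsilon> * m z r"
proof -
  define C where "C = CP * (2 * 2 powr p * CD) powr (1 / p)"
  have C: "0 < C" using CP CD1 by (simp add: C_def)
  have "(%n::nat. C / c * real n powr (1 / p - 1)) \<longlonglongrightarrow> C / c * 0"
  proof (intro tendsto_mult tendsto_const tendsto_neg_powr)
    show "1 / p - 1 < 0" using p1 by simp
    show "filterlim real at_top sequentially" by (rule filterlim_real_sequentially)
  qed
  hence "eventually (%n. C / c * real n powr (1 / p - 1) < \<epsilon>) sequentially" using e by (intro order_tendstoD(2)) auto
  hence "eventually (%n. C / c * real n powr (1 / p - 1) < \<epsilon> \<and> 0 < n) sequentially"
    using eventually_gt_at_top[of "0::nat"] by eventually_elim simp
  from eventually_happens'[OF sequentially_bot this]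
  obtain M where M: "C / c * real M powr (1 / p - 1) < \<epsilon>" "0 < M" by blast
  show thesis
  proof (rule that[OF M(2)])
    fix S A v g z and r :: real
    assume min: "minimizer A v g" and r: "0 < r" "2 ^ nL * r <= 1"
      and S: "S \<in> sets \<mu>" "S \<subseteq> ball z r" "!!x. x \<in> S ==> v x = 1" "c * m z r <= measure \<mu> S"
    obtain u where u[measurable]: "u \<in> bmeas" and u01: "!!x. 0 <= u x" "!!x. u x <= 1"
      and uone: "!!x. v x = 1 ==> u x = 0" and ulow: "!!x. v x < (1/2) ^ M ==> u x = 1"
      and uavg: "avg (%y. \<bar>u y - avg u z r\<bar>) z r <= C * real M powr (1 / p - 1)"
      using log_truncation[OF min r M(2), of z] unfolding C_def by blast
    define w where "w = avg u z r"
    have w0: "0 <= w" unfolding w_def by (rule avg_nonneg[OF u01(1)])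
    have mz: "0 < m z r" by (rule m_pos[OF r(1)])
    have w1: "w <= 1"
    proof -
      have "w <= avg (%_. 1) z r" unfolding w_def using u01 by (intro avg_mono[of _ _ 1]) auto
      thus ?thesis using avg_const[OF r(1), of 1 z] by simp
    qed
    have "w * measure \<mu> S <= avg (%y. \<bar>u y - w\<bar>) z r * m z r"
    proof (rule measure_le_avg)
      show "\<bar>u x - w\<bar> <= 1" for x using u01[of x] w0 w1 by auto
      show "w <= \<bar>u x - w\<bar>" if "x \<in> S" for x using uone[OF S(3)[OF that]] w0 by simp
    qed (use S r w0 in auto)
    hence "w * (c * m z r) <= (C * real M powr (1 / p - 1)) * m z r"
      using uavg mult_left_mono[OF S(4) w0] mult_right_mono[OF uavg, of "m z r"] unfolding w_def[symmetric] by simp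
    hence "w * c <= C * real M powr (1 / p - 1)" using mz by simp
    hence "w <= C / c * real M powr (1 / p - 1)" using c by (simp add: field_simps)
    hence we: "w <= \<epsilon>" using M(1) by simp
    have v: "v \<in> bmeas" by (rule npairD(1)[OF minimizerD(1)[OF min]])
    have "1 * lev v ((1/2) ^ M) z r <= w * m z r" unfolding w_def using u01 ulow r by (intro measure_le_avg level_set(1)[OF v]) auto
    also have "... <= \<epsilon> * m z r" using we by (intro mult_right_mono) auto
    finally show "lev v ((1/2) ^ M) z r <= \<epsilon> * m z r" by simp
  qed
qed

end

section \<open>De Giorgi iteration and the capacity of the set of points of positive density\<close>

lemma geometric_decay:
  fixes \<kappa> A p b :: real
  assumes \<kappa>: "1 < \<kappa>" and A: "0 < A" and b: "0 < b" and p: "0 < p"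
  obtains \<tau> \<epsilon> where "0 < \<tau>" "\<tau> <= 1/2" "0 < \<epsilon>" "\<epsilon> <= b"
    "!!j::nat. (A * ((2 powr p) ^ j * (\<epsilon> * \<tau> ^ j))) powr \<kappa> <= \<epsilon> * \<tau> ^ Suc j"
proof -
  \<comment> \<open>The bound on \<open>\<tau>\<close> beats the growth of
    \<open>(2 powr p) ^ j\<close> raised to the power \<open>\<kappa>\<close>, and the bound on
    \<open>\<epsilon>\<close> absorbs \<open>A powr \<kappa>\<close> and leaves one factor
    \<open>\<tau>\<close>. Both use the positive gain \<open>\<kappa> - 1\<close>.\<close>
  define \<tau> where "\<tau> = min (1/2) (2 powr (- (p * \<kappa> / (\<kappa> - 1))))"
  define \<epsilon> where "\<epsilon> = min b ((\<tau> / A powr \<kappa>) powr (1 / (\<kappa> - 1)))"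
  have \<tau>: "0 < \<tau>" "\<tau> <= 1/2" by (auto simp: \<tau>_def)
  have \<epsilon>: "0 < \<epsilon>" "\<epsilon> <= b" using A b \<tau> by (auto simp: \<epsilon>_def)
  have "\<tau> powr (\<kappa> - 1) <= (2 powr (- (p * \<kappa> / (\<kappa> - 1)))) powr (\<kappa> - 1)"
    using \<kappa> \<tau>(1) by (intro powr_mono2) (auto simp: \<tau>_def)
  also have "... = 2 powr (- (p * \<kappa>))" using \<kappa> by (simp add: powr_powr)
  finally have "2 powr (p * \<kappa>) * \<tau> powr (\<kappa> - 1) <= 2 powr (p * \<kappa>) * 2 powr (- (p * \<kappa>))" by simp
  hence t1: "2 powr (p * \<kappa>) * \<tau> powr (\<kappa> - 1) <= 1" by (simp add: powr_add[symmetric])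
  have "\<epsilon> powr (\<kappa> - 1) <= ((\<tau> / A powr \<kappa>) powr (1 / (\<kappa> - 1))) powr (\<kappa> - 1)"
    using \<kappa> \<epsilon>(1) by (intro powr_mono2) (auto simp: \<epsilon>_def)
  also have "... = \<tau> / A powr \<kappa>" using \<kappa> \<tau> A by (simp add: powr_powr)
  finally have e1: "A powr \<kappa> * \<epsilon> powr (\<kappa> - 1) <= \<tau>" using A by (simp add: field_simps)
  have "(A * ((2 powr p) ^ j * (\<epsilon> * \<tau> ^ j))) powr \<kappa> <= \<epsilon> * \<tau> ^ Suc j" for j :: nat
  proof -
    define Q where "Q = 2 powr (p * \<kappa>) * \<tau> powr (\<kappa> - 1)"
    have "x powr \<kappa> = x powr (\<kappa> - 1) * x" if "0 < x" for x :: real using that powr_add[of x "\<kappa> - 1" 1] by simp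
    hence e2: "\<epsilon> powr \<kappa> = \<epsilon> powr (\<kappa> - 1) * \<epsilon>" and t2: "\<tau> powr \<kappa> = \<tau> powr (\<kappa> - 1) * \<tau>" using \<tau> \<epsilon> by auto
    have pw: "(x ^ j) powr \<kappa> = (x powr \<kappa>) ^ j" if "0 < x" for x :: real
      using that by (simp add: powr_realpow[symmetric] powr_powr mult.commute)
    have "(A * ((2 powr p) ^ j * (\<epsilon> * \<tau> ^ j))) powr \<kappa> = A powr \<kappa> * (((2 powr p) powr \<kappa>) ^ j * (\<epsilon> powr \<kappa> * (\<tau> powr \<kappa>) ^ j))"
      using A \<epsilon> \<tau> by (simp add: powr_mult pw)
    also have "... = (A powr \<kappa> * \<epsilon> powr (\<kappa> - 1)) * (Q ^ j * (\<epsilon> * \<tau> ^ j))"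
      by (simp add: e2 t2 Q_def powr_powr power_mult_distrib)
    also have "... <= \<tau> * (1 * (\<epsilon> * \<tau> ^ j))"
      using t1 \<epsilon> \<tau> by (intro mult_mono mult_right_mono e1 power_le_one) (auto simp: Q_def)
    finally show ?thesis by (simp add: mult_ac)
  qed
  thus thesis using that \<tau> \<epsilon> by blast
qed

context newtonian_space
begin

lemma capt_level:
  assumes w: "npair w h" and e: "energy w h <= e" and s: "0 < s"
  shows "capt {x. s <= w x} (ennreal ((1 / s) powr p) * e)"
proof -
  define v where "v = (%x. min 1 (1 / s * w x))"
  note [measurable] = npairD(1,6)[OF w]
  have 1: "\<bar>min 1 (1 / s * a) - min 1 (1 / s * b)\<bar> <= 1 / s * \<bar>a - b\<bar>" for a b :: real
  proof -
    have "\<bar>min 1 (1 / s * a) - min 1 (1 / s * b)\<bar> <= \<bar>1 / s * a - 1 / s * b\<bar>" by (simp add: min_def)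
    also have "... = 1 / s * \<bar>a - b\<bar>" using s abs_mult[of "1 / s" "a - b"] by (simp only: right_diff_distrib[symmetric]) simp
    finally show ?thesis .
  qed
  have Em: "En (%x. ennreal (1 / s) * f x) = ennreal ((1 / s) powr p) * En f" if "f \<in> bmeas" for f
    using s that by (intro En_cmult) auto
  have "rwug v (%x. ennreal (1 / s) * h x)" unfolding v_def using s 1 by (intro rwug_lipschitz_comp[OF npairD(4)[OF w]]) auto
  moreover have "v \<in> bmeas" unfolding v_def by measurable
  moreover have "En (%x. ennreal (1 / s) * h x) < \<infinity>" using npairD(5)[OF w] by (simp add: Em ennreal_mult_less_top)
  ultimately have np: "npair v (%x. ennreal (1 / s) * h x)" unfolding npair_def using npairD(2)[OF w] s by (auto simp: v_def)
  have "Er v <= En (%x. ennreal (1 / s) * ennreal (w x))"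
    using s npairD(2)[OF w] by (intro En_mono) (auto simp: v_def ennreal_mult'[symmetric] intro!: ennreal_leI)
  also have "... = ennreal ((1 / s) powr p) * Er w" by (intro Em) measurable
  finally have "energy v (%x. ennreal (1 / s) * h x) <= ennreal ((1 / s) powr p) * energy w h"
    by (simp add: Em distrib_left add_right_mono)
  also have "... <= ennreal ((1 / s) powr p) * e" using e by (intro mult_left_mono) auto
  finally show ?thesis unfolding capt_def
    using np s by (intro exI[of _ v] exI[of _ "%x. ennreal (1 / s) * h x"]) (auto simp: v_def field_simps)
qed

end

context pi_space
begin

text \<open>The levels decrease from \<open>\<delta>\<close> towards \<open>\<delta> / 2\<close>
  while the radii shrink to 0 about a fixed centre. Each step combines the weak Sobolev-Poincare
  inequality for \<open>max 0 (k j - v)\<close> with the Caccioppoli inequality, and the gain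
  \<open>\<kappa>\<close> makes the relative measures of the sublevel sets decay geometrically. So
  \<open>{v < \<delta> / 2}\<close> has density 0 at \<open>x\<close> along these radii.\<close>

lemma de_giorgi:
  obtains \<tau> \<epsilon> :: real and q :: nat where "0 < \<tau>" "\<tau> <= 1/2" "0 < \<epsilon>"
    "!!A v g \<delta> r x j. minimizer A v g ==> 0 < \<delta> ==> \<delta> <= 1 ==> 0 < r ==> r <= 1 ==>
       lev v \<delta> x r <= \<epsilon> * m x r ==>
       lev v (\<delta> / 2) x (r / 2 ^ (q * j)) <= \<epsilon> * \<tau> ^ j * m x (r / 2 ^ (q * j))"
    "0 < q"
proof -
  obtain K \<kappa> where K: "1 <= K" "1 < \<kappa>"
    and wsp': "wsp CP nL K \<kappa>" by (rule weak_sobolev_poincare[OF CP])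
  note wsp = wsp'[unfolded wsp_def, rule_format]
  \<comment> \<open>\<open>nL + 1\<close> doublings reach the ball in the weak Sobolev-Poincare
    inequality, and one more is spent in the Caccioppoli inequality.\<close>
  define q where "q = nL + 2"
  define A0 where "A0 = 2 * K * 16 powr p * CD ^ q"
  have A0: "0 < A0" "0 < 1 / (8 * CD ^ q)" using K CD1 by (auto simp: A0_def)
  obtain \<tau> \<epsilon> where \<tau>: "0 < \<tau>" "\<tau> <= 1/2" and \<epsilon>: "0 < \<epsilon>" "\<epsilon> <= 1 / (8 * CD ^ q)"
    and dec: "!!j::nat. (A0 * ((2 powr p) ^ j * (\<epsilon> * \<tau> ^ j))) powr \<kappa> <= \<epsilon> * \<tau> ^ Suc j"
    by (rule geometric_decay[OF K(2) A0 p0(1)]) blast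
  have main: "lev v (\<delta> / 2) x (r / 2 ^ (q * j)) <= \<epsilon> * \<tau> ^ j * m x (r / 2 ^ (q * j))"
    if min: "minimizer A v g" and \<delta>: "0 < \<delta>" "\<delta> <= 1" and r: "0 < r" "r <= 1"
      and start: "lev v \<delta> x r <= \<epsilon> * m x r" for A v g \<delta> r x j
  proof -
    have np: "npair v g" by (rule minimizerD(1)[OF min])
    note v = npairD(1)[OF np]
    define R where "R = (%j::nat. r / 2 ^ (q * j))"
    define k where "k = (%j::nat. \<delta> * (1/2 + (1/2) ^ Suc j))"
    have R: "0 < R j" "R j <= 1" "R (Suc j) = R j / 2 ^ q" for j
    proof -
      show "0 < R j" "R (Suc j) = R j / 2 ^ q" using r by (auto simp: R_def power_add)
      have "r / 2 ^ (q * j) <= 1 / 1" using r by (intro frac_le) auto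
      thus "R j <= 1" by (simp add: R_def)
    qed
    have k: "\<delta> / 2 <= k j" "k j <= \<delta>" "k j - k (Suc j) = \<delta> * (1/2) ^ j / 4" for j
    proof -
      have "(1/2::real) ^ Suc j <= (1/2) ^ 1" by (intro power_decreasing) auto
      hence "\<delta> * (1/2 + (1/2) ^ Suc j) <= \<delta> * 1" using \<delta> by (intro mult_left_mono) auto
      thus "k j <= \<delta>" by (simp add: k_def)
      show "\<delta> / 2 <= k j" using \<delta> by (simp add: k_def field_simps)
    qed (simp add: k_def algebra_simps)
    have step: "lev v (k j) x (R j) <= \<epsilon> * \<tau> ^ j * m x (R j)" for j
    proof (induction j)
      case 0
      thus ?case using start by (simp add: k_def R_def)
    next
      case (Suc j)
      define r' where "r' = R (Suc j)"
      define M where "M = lev v (k j) x (R j)"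
      have r': "0 < r'" "R j = 2 ^ q * r'" using R(1)[of "Suc j"] R(3)[of j] by (auto simp: r'_def)
      have k0: "0 < k j" "k j <= 1" using k(1,2)[of j] \<delta> by auto
      define u where "u = (%y. max 0 (k j - v y))"
      define gk where "gk = (%y. if v y < k j then g y else 0)"
      have npu: "npair u gk" unfolding u_def gk_def by (rule npair_truncate_below[OF np k0])
      have mr': "0 < m x r'" by (rule m_pos[OF r'(1)])
      have D: "m x (R j) <= CD ^ q * m x r'" unfolding r'(2) by (rule m_power[OF r'(1)])
      have M: "M <= \<epsilon> * \<tau> ^ j * (CD ^ q * m x r')"
      proof -
        have "\<epsilon> * \<tau> ^ j * m x (R j) <= \<epsilon> * \<tau> ^ j * (CD ^ q * m x r')" using \<epsilon> \<tau> by (intro mult_left_mono D) auto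
        thus ?thesis using Suc unfolding M_def by linarith
      qed
      \<comment> \<open>Half the gap between two consecutive levels. Where
        \<open>v < k (Suc j)\<close> one has \<open>u > 2 * s\<close>, and the smallness of
        \<open>\<epsilon>\<close> keeps the mean of \<open>u\<close> at most \<open>s\<close>, so
        such points deviate from the mean by more than \<open>s\<close>.\<close>
      define s where "s = \<delta> * (1/2) ^ j / 8"
      have s: "0 < s" using \<delta> by (simp add: s_def)
      have avg: "avg u x r' <= s"
      proof -
        have "avg u x r' * m x r' <= k j * lev v (k j) x r'" unfolding u_def by (rule avg_le_level[OF v npairD(2)[OF np] r'(1) k0])
        also have "... <= \<delta> * M"
        proof (rule mult_mono)
          have "1 * r' <= 2 ^ q * r'" using r'(1) by (intro mult_right_mono) auto
          thus "lev v (k j) x r' <= M" unfolding M_def r'(2) using k0 by (intro level_measure_le[OF v] subset_ball) auto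
        qed (use k(2) \<delta> in auto)
        also have "... <= \<delta> * (\<epsilon> * \<tau> ^ j * (CD ^ q * m x r'))" using M \<delta> by simp
        also have "... = \<delta> * (\<epsilon> * \<tau> ^ j * CD ^ q) * m x r'" by simp
        finally have "avg u x r' <= \<delta> * (\<epsilon> * \<tau> ^ j * CD ^ q)" using mr' by simp
        also have "\<epsilon> * \<tau> ^ j * CD ^ q <= 1 / (8 * CD ^ q) * (1/2) ^ j * CD ^ q"
          using \<epsilon> \<tau> CD1 by (intro mult_mono power_mono mult_right_mono) auto
        finally show ?thesis using \<delta> CD1 by (simp add: s_def)
      qed
      have avg0: "0 <= avg u x r'" by (rule avg_nonneg) (rule npairD(2)[OF npu])
      have sub: "{y. v y < k (Suc j)} \<inter> ball x r' \<subseteq> {y \<in> ball x r'. s < \<bar>u y - avg u x r'\<bar>}"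
      proof
        fix y assume "y \<in> {y. v y < k (Suc j)} \<inter> ball x r'"
        hence y: "v y < k (Suc j)" "y \<in> ball x r'" by auto
        hence "k j - v y > 2 * s" using k(3)[of j] by (simp add: s_def)
        hence "u y > 2 * s" by (simp add: u_def)
        thus "y \<in> {y \<in> ball x r'. s < \<bar>u y - avg u x r'\<bar>}" using y(2) avg by auto
      qed
      note [measurable] = npairD(1)[OF npu]
      have S: "{y \<in> ball x r'. s < \<bar>u y - avg u x r'\<bar>} \<in> fmeasurable \<mu>" by (rule ball_Collect_fmeasurable) measurable
      have "lev v (k (Suc j)) x r' <= measure \<mu> {y \<in> ball x r'. s < \<bar>u y - avg u x r'\<bar>}"
        by (rule measure_mono_fmeasurable[OF sub level_set(1)[OF v] S])
      also have "... <= m x r' * (K * ((r' / s) powr p * nugb gk x (2 ^ (nL + 1) * r') / m x r')) powr \<kappa>"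
        by (rule wsp[OF npairD(1-3)[OF npu] finite_nug[OF npairD(6,5)[OF npu]] sets_nug poincare[OF npu] r'(1) s])
      also have "... <= m x r' * (\<epsilon> * \<tau> ^ Suc j)"
      proof (intro mult_left_mono order_trans[OF powr_mono2 dec[of j]])
        have Rj: "2 ^ (nL + 1) * r' = R j / 2" using r'(2) by (simp add: q_def)
        have "nugb gk x (2 ^ (nL + 1) * r') <= 2 * (k j / (R j / 2)) powr p * lev v (k j) x (2 * (R j / 2))"
          unfolding Rj gk_def using R[of j] by (intro caccioppoli[OF min _ _ k0]) auto
        also have "... = 2 * (k j / (R j / 2)) powr p * M" by (simp add: M_def)
        also have "... <= 2 * (2 * \<delta> / R j) powr p * (\<epsilon> * \<tau> ^ j * (CD ^ q * m x r'))"
          using k(2)[of j] k0 R(1)[of j] p0 \<delta>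
          by (intro mult_mono M mult_left_mono powr_mono2) (auto simp: divide_right_mono M_def)
        finally have ca: "nugb gk x (2 ^ (nL + 1) * r') / m x r' <= 2 * (2 * \<delta> / R j) powr p * (\<epsilon> * \<tau> ^ j * CD ^ q)"
          using mr' by (simp add: divide_le_eq mult_ac)
        have "(r' / s) powr p * (2 * \<delta> / R j) powr p = (r' / s * (2 * \<delta> / R j)) powr p"
          using r'(1) s \<delta> R(1)[of j] by (simp add: powr_mult[symmetric])
        also have "r' / s * (2 * \<delta> / R j) = 16 * 2 ^ j / 2 ^ q"
          using r' s \<delta> by (simp add: s_def field_simps power_one_over)
        also have "(16 * 2 ^ j / 2 ^ q :: real) powr p <= (16 * 2 ^ j) powr p" using p0 by (intro powr_mono2) (auto simp: divide_le_eq)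
        also have "(16 * 2 ^ j :: real) powr p = 16 powr p * (2 powr p) ^ j"
          by (simp add: powr_mult powr_realpow[symmetric] powr_powr mult.commute)
        finally have rs: "(r' / s) powr p * (2 * \<delta> / R j) powr p <= 16 powr p * (2 powr p) ^ j" .
        have "K * ((r' / s) powr p * nugb gk x (2 ^ (nL + 1) * r') / m x r')
          = K * ((r' / s) powr p * (nugb gk x (2 ^ (nL + 1) * r') / m x r'))" by simp
        also have "... <= K * ((r' / s) powr p * (2 * (2 * \<delta> / R j) powr p * (\<epsilon> * \<tau> ^ j * CD ^ q)))"
          using K ca by (intro mult_left_mono) auto
        also have "... = 2 * K * CD ^ q * (\<epsilon> * \<tau> ^ j) * ((r' / s) powr p * (2 * \<delta> / R j) powr p)" by simp
        also have "... <= 2 * K * CD ^ q * (\<epsilon> * \<tau> ^ j) * (16 powr p * (2 powr p) ^ j)"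
          using K CD1 \<epsilon> \<tau> by (intro mult_left_mono rs) auto
        also have "... = A0 * ((2 powr p) ^ j * (\<epsilon> * \<tau> ^ j))" by (simp add: A0_def)
        finally show "K * ((r' / s) powr p * nugb gk x (2 ^ (nL + 1) * r') / m x r') <= A0 * ((2 powr p) ^ j * (\<epsilon> * \<tau> ^ j))" .
      qed (use K mr' in auto)
      finally show ?case by (simp add: r'_def mult_ac)
    qed
    have "lev v (\<delta> / 2) x (R j) <= lev v (k j) x (R j)" by (rule level_measure_le[OF v k(1)]) simp
    thus ?thesis using step[of j] unfolding R_def by simp
  qed
  show thesis by (rule that[OF \<tau> \<epsilon>(1) main]) (auto simp: q_def)
qed

text \<open>Along almost every curve \<open>w = c\<close> holds at almost every time spent in
  \<open>S\<close>. These times form a relatively open set and \<open>w\<close> is continuous along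
  the curve, so equality holds at all of them and the change is not seen. This turns an almost
  everywhere bound on an open set into one at every point, as a capacity estimate demands.\<close>

lemma rwug_modify_open:
  assumes w: "rwug w h" and S: "open S" and c: "AE x in \<mu>. x \<in> S --> w x = c"
  shows "rwug (%x. if x \<in> S then c else w x) h"
proof -
  obtain h0 where h0: "h0 \<in> borel_measurable borel" "AE x in \<mu>. h0 x = h x" "pae (good (%x. ereal (w x)) h0)"
    using w by (rule wug_borelE)
  show ?thesis
  proof (rule wugI[OF wug_measurable[OF w] h0(1,2)], rule pae_mono[OF pae_conj[OF h0(3) pae_null[OF c]]])
    fix \<gamma> l assume \<gamma>: "arclength_curve \<gamma> l"
      and A: "good (%x. ereal (w x)) h0 \<gamma> l \<and> (AE t in lborel. 0 <= t --> t <= l --> \<gamma> t \<in> S --> w (\<gamma> t) = c)"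
    have l: "0 < l" using \<gamma> by (simp add: arclength_curve_def)
    have cont: "continuous_on {0..l} (%t. w (\<gamma> t))"
      using conjunct1[OF A] unfolding good_real_iff[OF \<gamma> h0(1)] by (rule acp_continuous)
    have "continuous_on {0..l} (ext_curve \<gamma> l)" using ext_curve_continuous[OF \<gamma>] by (rule continuous_on_subset) simp
    hence cg: "continuous_on {0..l} \<gamma>" by (rule continuous_on_eq) simp
    have eq: "w (\<gamma> t) = c" if t: "0 <= t" "t <= l" and tS: "\<gamma> t \<in> S" for t
    proof (rule ccontr)
      assume ne: "w (\<gamma> t) ~= c"
      have "\<forall>\<^sub>F s in at t within {0..l}. \<gamma> s \<in> S"
        using cg t S tS by (auto simp: continuous_on_def intro!: topological_tendstoD)
      moreover have "\<forall>\<^sub>F s in at t within {0..l}. w (\<gamma> s) ~= c"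
        using cont t ne by (auto simp: continuous_on_def intro!: tendsto_imp_eventually_ne)
      ultimately have "\<forall>\<^sub>F s in at t within {0..l}. \<gamma> s \<in> S \<and> w (\<gamma> s) ~= c" by eventually_elim simp
      then obtain d where d: "0 < d" "!!s. s \<in> {0..l} ==> s ~= t ==> dist s t < d ==> \<gamma> s \<in> S \<and> w (\<gamma> s) ~= c"
        unfolding eventually_at by blast
      have d': "\<gamma> s \<in> S \<and> w (\<gamma> s) ~= c" if "s \<in> {max 0 (t - d)<..<min l (t + d)}" for s
      proof -
        have "s \<in> {0..l}" "dist s t < d" using that by (auto simp: dist_real_def abs_less_iff)
        thus ?thesis using d(2)[of s] ne tS by (cases "s = t") auto
      qed
      have "AE s in lborel. s \<notin> {max 0 (t - d)<..<min l (t + d)}" using conjunct2[OF A]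
      proof eventually_elim
        case (elim s)
        thus ?case using d'[of s] by auto
      qed
      hence "{max 0 (t - d)<..<min l (t + d)} \<in> null_sets lborel" by (subst AE_iff_null_sets) auto
      thus False using l t d(1) by (auto simp: null_sets_def)
    qed
    show "good (%x. ereal (if x \<in> S then c else w x)) h0 \<gamma> l" unfolding good_def
    proof (intro conjI allI impI)
      show "line_integral h0 \<gamma> l < \<infinity>" using A by (simp add: good_def)
      fix s t assume st: "0 <= s" "s <= t" "t <= l"
      have "(if \<gamma> \<tau> \<in> S then c else w (\<gamma> \<tau>)) = w (\<gamma> \<tau>)" if "0 <= \<tau>" "\<tau> <= l" for \<tau> using eq[OF that] by simp
      thus "ext_diff (ereal (if \<gamma> s \<in> S then c else w (\<gamma> s))) (ereal (if \<gamma> t \<in> S then c else w (\<gamma> t)))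
        <= seg (%\<tau>. h0 (\<gamma> \<tau>)) s t" using conjunct1[OF A] st by (simp add: good_def)
    qed
  qed
qed

text \<open>Points of positive density of \<open>G\<close>: there the minimizer for \<open>G\<close> is bounded below, on a whole
  neighbourhood.\<close>

lemma capt_density:
  assumes c: "0 < c"
  obtains K :: real and j0 where "0 < K" "!!G e. G \<in> sets \<mu> ==> capt G e ==> e < \<infinity> ==>
    capt {x. \<exists>j\<ge>j0. c * m x (1 / 2 ^ j) <= measure \<mu> (G \<inter> ball x (1 / 2 ^ j))} (ennreal K * e)"
proof -
  obtain \<tau> \<epsilon> :: real and q where \<tau>: "0 < \<tau>" "\<tau> <= 1/2" and \<epsilon>: "0 < \<epsilon>"
    and dg: "!!A v g \<delta> r x j. minimizer A v g ==> 0 < \<delta> ==> \<delta> <= 1 ==> 0 < r ==> r <= 1 ==>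
       lev v \<delta> x r <= \<epsilon> * m x r ==>
       lev v (\<delta> / 2) x (r / 2 ^ (q * j)) <= \<epsilon> * \<tau> ^ j * m x (r / 2 ^ (q * j))"
    and q: "0 < q" by (rule de_giorgi) blast
  \<comment> \<open>One factor \<open>CD\<close> passes from the ball where the density is
    \<open>c\<close> to the doubled ball; \<open>CD ^ 2\<close> passes from there to a ball about
    any point \<open>y\<close> of the original ball.\<close>
  have pos: "0 < c / CD" "0 < \<epsilon> / CD ^ 2" using c \<epsilon> CD1 by simp_all
  obtain M where M: "0 < M" and sh: "!!S A v g z r. minimizer A v g ==> 0 < r ==> 2 ^ nL * r <= 1 ==>
    S \<in> sets \<mu> ==> S \<subseteq> ball z r ==> (!!x. x \<in> S ==> v x = 1) ==> c / CD * m z r <= measure \<mu> S ==>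
    lev v ((1/2) ^ M) z r <= \<epsilon> / CD ^ 2 * m z r" by (rule shrink[OF pos]) blast
  define \<delta> where "\<delta> = (1/2::real) ^ M"
  have \<delta>: "0 < \<delta>" "\<delta> <= 1" by (auto simp: \<delta>_def power_le_one)
  show thesis
  proof (rule that)
    show "0 < (1 / (\<delta> / 2)) powr p" using \<delta> by simp
    fix G and e :: ennreal assume G: "G \<in> sets \<mu>" and e: "capt G e" "e < \<infinity>"
    obtain v g where min: "minimizer G v g" by (rule ex_minimizer[OF e])
    have np: "npair v g" by (rule minimizerD(1)[OF min])
    note [measurable] = npairD(1)[OF np] npairD(6)[OF np]
    let ?X = "{x. \<exists>j\<ge>nL + 1. c * m x (1 / 2 ^ j) <= measure \<mu> (G \<inter> ball x (1 / 2 ^ j))}"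
    define I where "I = {(x, j). nL + 1 <= j \<and> c * m x (1 / 2 ^ j) <= measure \<mu> (G \<inter> ball x (1 / 2 ^ j))}"
    define S where "S = (\<Union>(x, j)\<in>I. ball x (1 / 2 ^ j))"
    have XS: "?X \<subseteq> S" unfolding S_def I_def by force
    have S: "open S" unfolding S_def by (auto intro!: open_UN)
    let ?f = "indicat_real {y. v y < \<delta> / 2}"
    have "{y \<in> space \<mu>. v y < \<delta> / 2} \<in> sets \<mu>" by measurable
    hence fm: "?f \<in> bmeas" by (simp add: borel_measurable_indicator)
    \<comment> \<open>At a Lebesgue point \<open>y\<close> of the indicator of
      \<open>{v < \<delta> / 2}\<close> the averages converge to its value, and the iteration
      started at \<open>y\<close> makes them tend to 0 along a subsequence of radii. The argument
      works for almost every \<open>y\<close> in each ball of \<open>S\<close>, not only for the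
      centres.\<close>
    have big: "AE y in \<mu>. y \<in> S --> \<delta> / 2 <= v y"
    proof (rule AE_mp[OF differentiation[OF fm, of 1] AE_I2])
      fix y
      show "(%j. avg ?f y (1 / 2 ^ j)) \<longlonglongrightarrow> ?f y --> y \<in> S --> \<delta> / 2 <= v y"
      proof (intro impI, rule ccontr)
        assume lim: "(%j. avg ?f y (1 / 2 ^ j)) \<longlonglongrightarrow> ?f y" and yS: "y \<in> S" and less: "\<not> \<delta> / 2 <= v y"
        obtain x i where I: "(x, i) \<in> I" "y \<in> ball x (1 / 2 ^ i)" using yS unfolding S_def by blast
        define \<rho> where "\<rho> = (1 / 2 ^ i :: real)"
        have i: "nL + 1 <= i" "c * m x \<rho> <= measure \<mu> (G \<inter> ball x \<rho>)" using I by (auto simp: I_def \<rho>_def)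
        have \<rho>: "0 < \<rho>" "\<rho> <= 1" "2 ^ nL * (2 * \<rho>) <= 1"
        proof -
          have "(2::real) ^ (nL + 1) <= 2 ^ i" using i(1) by (intro power_increasing) auto
          thus "2 ^ nL * (2 * \<rho>) <= 1" by (simp add: \<rho>_def divide_simps)
        qed (auto simp: \<rho>_def)
        have "lev v \<delta> x (2 * \<rho>) <= \<epsilon> / CD ^ 2 * m x (2 * \<rho>)" unfolding \<delta>_def
        proof (rule sh[OF min])
          show "G \<inter> ball x \<rho> \<in> sets \<mu>" using G by auto
          show "G \<inter> ball x \<rho> \<subseteq> ball x (2 * \<rho>)" using \<rho> by auto
          have "c / CD * m x (2 * \<rho>) <= c / CD * (CD * m x \<rho>)" using pos by (intro mult_left_mono dbl \<rho>) auto
          thus "c / CD * m x (2 * \<rho>) <= measure \<mu> (G \<inter> ball x \<rho>)" using i(2) CD1 by simp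
        qed (use \<rho> minimizerD(2)[OF min] in auto)
        moreover have "ball y \<rho> \<subseteq> ball x (2 * \<rho>)" using I(2) by (intro ball_subsetI) (simp add: \<rho>_def)
        hence "lev v \<delta> y \<rho> <= lev v \<delta> x (2 * \<rho>)" by (intro level_measure_le npairD(1)[OF np]) auto
        moreover have "\<epsilon> / CD ^ 2 * m x (2 * \<rho>) <= \<epsilon> / CD ^ 2 * (CD ^ 2 * m y \<rho>)"
        proof (intro mult_left_mono m_le \<rho>)
          show "ball x (2 * \<rho>) \<subseteq> ball y (2 ^ 2 * \<rho>)" using I(2) \<rho>(1) unfolding \<rho>_def[symmetric] by (intro ball_subsetI) (simp add: dist_commute)
        qed (use pos in auto)
        ultimately have "lev v \<delta> y \<rho> <= \<epsilon> * m y \<rho>" using CD1 by simp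
        note dec = dg[OF min \<delta> \<rho>(1,2) this]
        have "avg ?f y (1 / 2 ^ (q * j + i)) <= \<epsilon> * \<tau> ^ j" for j
        proof -
          have "(LINT z:ball y s|\<mu>. ?f z) = lev v (\<delta> / 2) y s" for s
            using level_set(1)[OF npairD(1)[OF np], of "\<delta> / 2" y s]
            by (simp add: set_lebesgue_integral_def indicator_inter_arith[symmetric] Int_commute)
          moreover have "\<rho> / 2 ^ (q * j) = 1 / 2 ^ (q * j + i)" by (simp add: \<rho>_def power_add)
          ultimately show ?thesis using dec[of j] m_pos[of "1 / 2 ^ (q * j + i)" y] by (simp add: avg_def divide_le_eq)
        qed
        moreover have "(%j. \<epsilon> * \<tau> ^ j) \<longlonglongrightarrow> \<epsilon> * 0"
          using \<tau> by (intro tendsto_mult tendsto_const LIMSEQ_realpow_zero) auto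
        moreover have "(%j. avg ?f y (1 / 2 ^ (q * j + i))) \<longlonglongrightarrow> ?f y"
          using LIMSEQ_subseq_LIMSEQ[OF lim, of "%j. q * j + i"] q by (simp add: o_def strict_mono_def)
        ultimately have "?f y <= \<epsilon> * 0" by (intro LIMSEQ_le[of _ _ "%j. \<epsilon> * \<tau> ^ j"]) auto
        thus False using less by (simp add: indicator_def)
      qed
    qed auto
    \<comment> \<open>\<open>v\<close> is cut at \<open>\<delta> / 2\<close> so that the result is
      almost everywhere constant on \<open>S\<close>, as \<open>rwug_modify_open\<close>
      requires.\<close>
    define w where "w x = min (\<delta> / 2) (v x)" for x
    define w' where "w' x = (if x \<in> S then \<delta> / 2 else w x)" for x
    have aw: "AE x in \<mu>. x \<in> S --> w x = \<delta> / 2" using big by eventually_elim (simp add: w_def)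
    hence ae: "AE x in \<mu>. w' x = w x" by eventually_elim (simp add: w'_def)
    have "rwug w' g" unfolding w'_def
      by (rule rwug_modify_open[OF _ S aw], unfold w_def, rule rwug_contraction[OF npairD(4)[OF np]]) (simp add: min_def)
    moreover have [measurable]: "S \<in> sets \<mu>" using S by (intro borel_sets) auto
    have "w' \<in> bmeas" unfolding w'_def w_def by measurable
    ultimately have npw: "npair w' g" unfolding npair_def using npairD(2,3,5)[OF np] \<delta>
      by (auto simp: w'_def w_def min_le_iff_disj)
    have "Er w' = Er w" using ae by (intro En_cong_AE) auto
    also have "... <= Er v" by (intro En_mono ennreal_leI) (simp add: w_def)
    finally have "energy w' g <= energy v g" by (intro add_right_mono)
    also have "... <= e"
    proof -
      obtain u h where "npair u h" "\<forall>x\<in>G. u x = 1" "energy u h <= e" using e(1) unfolding capt_def by blast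
      thus ?thesis using minimizerD(4)[OF min, of u h] by auto
    qed
    finally have "capt {x. \<delta> / 2 <= w' x} (ennreal ((1 / (\<delta> / 2)) powr p) * e)" using \<delta> by (intro capt_level[OF npw]) auto
    thus "capt ?X (ennreal ((1 / (\<delta> / 2)) powr p) * e)" by (rule capt_mono) (use XS in \<open>auto simp: w'_def\<close>)
  qed
qed

end

section \<open>Approximation by Lipschitz functions\<close>

lemma mcshane:
  fixes u :: "'b::metric_space => real"
  assumes L: "0 <= L" and u01: "!!x. 0 <= u x" "!!x. u x <= 1"
    and lip: "!!x y. x \<in> F ==> y \<in> F ==> \<bar>u x - u y\<bar> <= L * dist x y"
  obtains \<phi> where "!!x y. \<bar>\<phi> x - \<phi> y\<bar> <= L * dist x y" "!!x. 0 <= \<phi> x" "!!x. \<phi> x <= 1"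
    "!!x. x \<in> F ==> \<phi> x = u x"
proof (cases "F = {}")
  case True
  thus thesis using L by (intro that[of "%_. 0"]) auto
next
  case False
  define \<psi> where "\<psi> x = (INF y\<in>F. u y + L * dist x y)" for x
  have bdd: "bdd_below ((%y. u y + L * dist x y) ` F)" for x using L u01 by (intro bdd_belowI[of _ 0]) auto
  have one: "\<psi> x <= \<psi> y + L * dist x y" for x y
  proof -
    have "\<psi> x - L * dist x y <= u z + L * dist y z" if "z \<in> F" for z
    proof -
      have "\<psi> x <= u z + L * dist x z" unfolding \<psi>_def by (rule cINF_lower[OF bdd that])
      moreover have "L * dist x z <= L * (dist x y + dist y z)" using L by (intro mult_left_mono dist_triangle)
      ultimately show ?thesis by (simp add: algebra_simps)
    qed
    hence "\<psi> x - L * dist x y <= \<psi> y" unfolding \<psi>_def[of y] using False by (intro cINF_greatest) auto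
    thus ?thesis by simp
  qed
  show thesis
  proof (rule that[of "%x. min 1 (\<psi> x)"])
    show "\<bar>min 1 (\<psi> x) - min 1 (\<psi> y)\<bar> <= L * dist x y" for x y
      using one[of x y] one[of y x] by (simp add: dist_commute min_def abs_if)
    show "0 <= min 1 (\<psi> x)" for x unfolding \<psi>_def using False L u01 by (intro min.boundedI cINF_greatest) auto
    show "min 1 (\<psi> x) = u x" if x: "x \<in> F" for x
    proof -
      have "\<psi> x <= u x + L * dist x x" unfolding \<psi>_def by (rule cINF_lower[OF bdd x])
      moreover have "u x <= u y + L * dist x y" if "y \<in> F" for y using lip[OF x that] by linarith
      hence "u x <= \<psi> x" unfolding \<psi>_def using False by (intro cINF_greatest) auto
      ultimately show ?thesis using u01(2)[of x] by simp
    qed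
  qed simp
qed

context newtonian_space
begin

text \<open>Dominated convergence. The part of \<open>g ^ p\<close> below
  \<open>t powr p / 2\<close> accounts for at most half of \<open>t powr p\<close> times the measure
  of a ball, so a ball with more energy than \<open>t powr p\<close> times its measure must be
  charged by the tail.\<close>

lemma En_tail:
  assumes g[measurable]: "g \<in> bmeas" and fin: "En g < \<infinity>" and e: "0 < e"
  obtains t where "1 <= t" "En (%x. if ennreal (t powr p / 2) < ennpowr (g x) p then g x else 0) < ennreal e"
proof -
  define G where "G = (%n x. if ennreal (real n powr p / 2) < ennpowr (g x) p then g x else 0)"
  have Gm[measurable]: "G n \<in> bmeas" for n unfolding G_def by measurable
  have "(%n. En (G n)) \<longlonglongrightarrow> (\<integral>\<^sup>+x. 0 \<partial>\<mu>)" unfolding En_def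
  proof (rule nn_integral_dominated_convergence[where w = "%x. ennpowr (g x) p"])
    show "AE x in \<mu>. ennpowr (G n x) p <= ennpowr (g x) p" for n unfolding G_def by (rule AE_I2) simp
    show "(\<integral>\<^sup>+x. ennpowr (g x) p \<partial>\<mu>) < \<infinity>" using fin by (simp add: En_def)
    have "AE x in \<mu>. ennpowr (g x) p ~= \<infinity>" using fin by (intro nn_integral_PInf_AE) (auto simp: En_def)
    thus "AE x in \<mu>. (%n. ennpowr (G n x) p) \<longlonglongrightarrow> 0"
    proof eventually_elim
      case (elim x)
      then obtain b where b: "ennpowr (g x) p = ennreal b" "0 <= b" by (cases "ennpowr (g x) p") auto
      have "ennpowr (G n x) p = 0" if n: "nat \<lceil>max 1 (2 * b)\<rceil> <= n" for n
      proof -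
        have n1: "1 <= real n" "2 * b <= real n" using n by linarith+
        have "real n powr 1 <= real n powr p" using n1 p1 by (intro powr_mono) auto
        hence "b <= real n powr p / 2" using n1 by simp
        hence "\<not> ennreal (real n powr p / 2) < ennpowr (g x) p" unfolding b(1) by (simp add: not_less ennreal_leI)
        thus ?thesis by (simp add: G_def)
      qed
      hence "eventually (%n. ennpowr (G n x) p = 0) sequentially" unfolding eventually_sequentially by blast
      thus ?case by (rule tendsto_eventually)
    qed
  qed measurable
  hence "eventually (%n. En (G n) < ennreal e) sequentially" using e by (intro order_tendstoD(2)) auto
  hence "eventually (%n. En (G n) < ennreal e \<and> 1 <= n) sequentially"
    using eventually_ge_at_top[of "1::nat"] by eventually_elim simp
  from eventually_happens'[OF sequentially_bot this]
  obtain n where "En (G n) < ennreal e" "1 <= n" by blast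
  thus thesis using that[of "real n"] unfolding G_def by simp
qed

lemma capt_Un:
  assumes "capt A a" "capt B b" "a + b < \<infinity>" shows "capt (A \<union> B) (a + b)"
proof -
  have 0: "capt {} 0" unfolding capt_def npair_def using rwug_const[of 0] by (intro exI[of _ "%_. 0"]) (auto simp: En_def)
  have s: "(\<Sum>n. if n = 0 then a else if n = Suc 0 then b else 0) = a + b" by (subst suminf_finite[of "{0, Suc 0}"]) auto
  have "capt (\<Union>n. if n = 0 then A else if n = Suc 0 then B else {}) (\<Sum>n. if n = 0 then a else if n = Suc 0 then b else 0)"
    using assms 0 by (intro capt_UN) (auto simp: s)
  thus ?thesis unfolding s by (rule capt_mono) (auto split: if_splits intro: UN_I[of 0] UN_I[of "Suc 0"])
qed

end

context pi_space
begin

text \<open>Chains of dyadic balls about \<open>x\<close> and \<open>y\<close>, on which the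
  averages of the energy are at most \<open>t powr p\<close>, give a Lipschitz bound at the scale of
  \<open>dist x y\<close>. Points at distance at least \<open>1 / 2\<close> are covered by the
  summand 2 in the constant, because \<open>u\<close> takes values in \<open>[0, 1]\<close>.\<close>

lemma lipschitz_off_bad_balls:
  assumes np: "npair u g" and t: "1 <= t"
    and F: "!!y j. y \<in> F ==> nugb g y (2 ^ nL / 2 ^ j) <= t powr p * m y (2 ^ nL / 2 ^ j)"
      "!!y. y \<in> F ==> (%j. avg u y (1 / 2 ^ j)) \<longlonglongrightarrow> u y"
    and xy: "x \<in> F" "y \<in> F"
  shows "\<bar>u x - u y\<bar> <= (2 + 16 * CD ^ 2 * CP) * t * dist x y"
proof -
  have rat: "(nugb g y (2 ^ nL / 2 ^ j) / m y (2 ^ nL / 2 ^ j)) powr (1 / p) <= t" if "y \<in> F" for y j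
  proof -
    have "nugb g y (2 ^ nL / 2 ^ j) / m y (2 ^ nL / 2 ^ j) <= t powr p"
      using F(1)[OF that, of j] m_pos[of "2 ^ nL / 2 ^ j" y] by (simp add: divide_le_eq)
    hence "(nugb g y (2 ^ nL / 2 ^ j) / m y (2 ^ nL / 2 ^ j)) powr (1 / p) <= (t powr p) powr (1 / p)"
      using p0 by (intro powr_mono2) auto
    thus ?thesis using t p0 by (simp add: powr_powr)
  qed
  have near: "\<bar>u y - avg u y (1 / 2 ^ i)\<bar> <= 2 * CD * CP * t / 2 ^ i" if y: "y \<in> F" for y i
  proof (rule telescope[OF npairD(1-3)[OF np] poincare[OF np], of "1 / 2 ^ i" _ "1/2"])
    show "(%j. avg u y (1 / 2 ^ i / 2 ^ j)) \<longlonglongrightarrow> u y"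
      using LIMSEQ_ignore_initial_segment[OF F(2)[OF y], of i] by (simp add: power_add mult.commute)
    show "CD * (CP * (1 / 2 ^ i / 2 ^ j) * (mu_ratio (nug g) y (2 ^ nL * (1 / 2 ^ i / 2 ^ j))) powr (1 / p))
      <= (1 - 1 / 2) * (2 * CD * CP * t / 2 ^ i) * (1 / 2) ^ j" for j
    proof -
      have "2 ^ nL * (1 / 2 ^ i / 2 ^ j) = (2 ^ nL / 2 ^ (i + j) :: real)" by (simp add: power_add)
      hence "mu_ratio (nug g) y (2 ^ nL * (1 / 2 ^ i / 2 ^ j)) powr (1 / p) <= t"
        using rat[OF y, of "i + j"] by (simp add: mu_ratio_def)
      hence "CD * (CP * (1 / 2 ^ i / 2 ^ j) * (mu_ratio (nug g) y (2 ^ nL * (1 / 2 ^ i / 2 ^ j))) powr (1 / p))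
        <= CD * (CP * (1 / 2 ^ i / 2 ^ j) * t)" using CP CD1 by (intro mult_left_mono) auto
      thus ?thesis by (simp add: power_one_over mult_ac)
    qed
  qed auto
  have c1: "2 <= (2 + 16 * CD ^ 2 * CP) * t" using mult_mono[of 2 "2 + 16 * CD ^ 2 * CP" 1 t] t CP by simp
  show ?thesis
  proof (cases "dist x y < 1 / 2 \<and> x ~= y")
    case False
    moreover have "1 <= (2 + 16 * CD ^ 2 * CP) * t * dist x y" if "1 / 2 <= dist x y" using mult_mono[OF c1 that] c1 by simp
    ultimately show ?thesis using npairD(2,3)[OF np, of x] npairD(2,3)[OF np, of y] by auto
  next
    case True
    have "\<exists>n. (1/2::real) ^ n < dist x y" using True by (intro real_arch_pow_inv) auto
    \<comment> \<open>The first dyadic scale below \<open>dist x y\<close>. As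
      \<open>dist x y < 1 / 2\<close>, its index is at least 2, so the scales one and two steps
      larger are available.\<close>
    then obtain n where n: "(1/2::real) ^ n < dist x y" "!!k. k < n ==> \<not> (1/2::real) ^ k < dist x y"
      using exists_least_iff[of "%n. (1/2::real) ^ n < dist x y"] by blast
    have "2 <= n"
    proof (rule ccontr)
      assume "\<not> 2 <= n"
      hence "(1/2::real) ^ 1 <= (1/2) ^ n" by (intro power_decreasing) auto
      thus False using n(1) True by simp
    qed
    then obtain i where i: "n = Suc (Suc i)" by (metis Suc_le_D add_2_eq_Suc le_Suc_ex)
    define r where "r = (1 / 2 ^ Suc i :: real)"
    have r: "0 < r" "dist x y <= r" "r < 2 * dist x y" using n(1) n(2)[of "Suc i"] by (auto simp: r_def i power_one_over)
    have "\<bar>avg u y r - avg u x (2 * r)\<bar> <= CD ^ 2 * (CP * (2 * r) * (nugb g x (2 ^ nL * (2 * r)) / m x (2 ^ nL * (2 * r))) powr (1 / p))"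
      using r by (intro PI_avg_diff[OF npairD(1-3)[OF np] poincare[OF np]] ball_subsetI) (auto simp: dist_commute)
    also have "... <= CD ^ 2 * (CP * (2 * r) * t)"
    proof -
      have "2 ^ nL * (2 * r) = 2 ^ nL / 2 ^ i" by (simp add: r_def)
      thus ?thesis using rat[OF xy(1), of i] CP r by (intro mult_left_mono) auto
    qed
    also have "... = 2 * (CD ^ 2 * CP * t * r)" by (simp add: mult_ac)
    finally have "\<bar>avg u y r - avg u x (2 * r)\<bar> <= 2 * (CD ^ 2 * CP * t * r)" .
    moreover have "\<bar>u y - avg u y r\<bar> <= 2 * (CD * CP * t * r)" using near[OF xy(2), of "Suc i"] by (simp add: r_def)
    moreover have "\<bar>u x - avg u x (2 * r)\<bar> <= 4 * (CD * CP * t * r)" using near[OF xy(1), of i] by (simp add: r_def)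
    moreover have "CD * CP * t * r <= CD ^ 2 * CP * t * r" using CD1 CP t r by (intro mult_right_mono) (auto simp: power2_eq_square)
    ultimately have "\<bar>u x - u y\<bar> <= 8 * (CD ^ 2 * CP * t * r)" by linarith
    also have "... <= 8 * (CD ^ 2 * CP * t * (2 * dist x y))" using CP t r by (intro mult_left_mono) auto
    also have "... <= (2 + 16 * CD ^ 2 * CP) * t * dist x y" using t by (simp add: algebra_simps)
    finally show ?thesis .
  qed
qed

text \<open>Off the union \<open>S\<close> of the balls where \<open>g ^ p\<close> has average above
  \<open>T\<close>, \<open>u\<close> agrees almost everywhere with a function that is Lipschitz
  there and has a McShane extension \<open>\<phi>\<close>. The difference and its gradient vanish
  almost everywhere off \<open>S\<close>, and \<open>T\<close> times the measure of \<open>S\<close>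
  is controlled by the tail of the energy. The approximation is in the full energy, so level sets of
  the difference have small capacity.\<close>

lemma lipschitz_density:
  assumes np: "npair u g" and e: "0 < e"
  obtains \<phi> h L where "0 <= L" "!!x y. \<bar>\<phi> x - \<phi> y\<bar> <= L * dist x y"
    "npair (%x. \<bar>u x - \<phi> x\<bar>) h" "energy (%x. \<bar>u x - \<phi> x\<bar>) h <= ennreal e"
proof -
  note [measurable] = npairD(1,6)[OF np]
  define c0 where "c0 = 2 + 16 * CD ^ 2 * CP"
  have c0: "2 <= c0" using CP by (simp add: c0_def)
  \<comment> \<open>\<open>Q\<close> collects the constants of the final estimate, in which every
    term is a multiple of the tail energy \<open>E\<close>.\<close>
  define Q where "Q = 2 * CD ^ 2 + 2 powr p * (1 + CD ^ 2 + 2 * CD ^ 2 * c0 powr p)"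
  have Q: "0 < Q" using CD1 by (auto simp: Q_def intro!: add_pos_nonneg mult_nonneg_nonneg add_nonneg_nonneg)
  obtain t where t: "1 <= t" and tail: "En (%x. if ennreal (t powr p / 2) < ennpowr (g x) p then g x else 0) < ennreal (e / Q)"
    using En_tail[OF npairD(6,5)[OF np], of "e / Q"] e Q by auto
  define T where "T = t powr p"
  have T: "1 <= T" unfolding T_def using t p0 by (intro ge_one_powr_ge_zero) auto
  define gA where "gA = (%x. if ennreal (T / 2) < ennpowr (g x) p then g x else 0)"
  have gA[measurable]: "gA \<in> bmeas" unfolding gA_def by measurable
  have fA: "En gA < \<infinity>" using tail unfolding gA_def T_def by (auto intro: less_trans)
  interpret \<nu>: finite_measure "nug g" by (rule finite_nug[OF npairD(6,5)[OF np]])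
  interpret A: finite_measure "nug gA" by (rule finite_nug[OF gA fA])
  define E where "E = measure (nug gA) UNIV"
  have E: "0 <= E" "E <= e / Q"
  proof -
    have "ennreal E = En gA" unfolding E_def A.emeasure_eq_measure[symmetric] by (rule emeasure_nug_UNIV[OF gA])
    also have "... < ennreal (e / Q)" using tail by (simp add: gA_def T_def)
    finally show "E <= e / Q" using e Q by (simp add: ennreal_less_iff E_def)
  qed (simp add: E_def)
  have split: "measure (nug g) S <= measure (nug gA) S + T / 2 * measure \<mu> S" if S[measurable]: "S \<in> fmeasurable \<mu>" for S
  proof -
    have Sm[measurable]: "S \<in> sets \<mu>" using S by (rule fmeasurableD)
    have "emeasure (nug g) S = (\<integral>\<^sup>+x. ennpowr (g x) p * indicator S x \<partial>\<mu>)" by (rule emeasure_nug) auto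
    also have "... <= (\<integral>\<^sup>+x. ennpowr (gA x) p * indicator S x + ennreal (T / 2) * indicator S x \<partial>\<mu>)"
      by (intro nn_integral_mono) (auto simp: gA_def not_less split: split_indicator)
    also have "... = (\<integral>\<^sup>+x. ennpowr (gA x) p * indicator S x \<partial>\<mu>) + (\<integral>\<^sup>+x. ennreal (T / 2) * indicator S x \<partial>\<mu>)"
      by (intro nn_integral_add) measurable
    also have "... = emeasure (nug gA) S + ennreal (T / 2) * emeasure \<mu> S"
      by (subst emeasure_nug[OF gA Sm]) (simp add: nn_integral_cmult_indicator)
    also have "... = ennreal (measure (nug gA) S + T / 2 * measure \<mu> S)"
      using T fmeasurableD2[OF S] ennreal_mult'[of "T / 2" "measure \<mu> S"]
      by (simp add: A.emeasure_eq_measure emeasure_eq_ennreal_measure)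
    finally show ?thesis using T unfolding \<nu>.emeasure_eq_measure by (subst (asm) ennreal_le_iff) auto
  qed
  define I where "I = {(x, j). T * m x (2 ^ nL / 2 ^ j) < nugb g x (2 ^ nL / 2 ^ j)}"
  define S where "S = (\<Union>(x, j)\<in>I. ball x (2 ^ nL / 2 ^ j))"
  have Sm[measurable]: "S \<in> sets \<mu>" unfolding S_def by (intro borel_sets borel_open) auto
  \<comment> \<open>On a bad ball the part of the energy below the threshold accounts for at most
    \<open>T / 2\<close> times its measure, so the tail \<open>gA\<close> alone has average at least
    \<open>T / 2\<close>.\<close>
  have "emeasure \<mu> S <= ennreal (CD ^ 2) * (ennreal (2 / T) * emeasure (nug gA) S)" unfolding S_def
  proof (rule covering_weak)
    fix x j assume "(x, j) \<in> I"
    hence "T * m x (2 ^ nL / 2 ^ j) < nugb g x (2 ^ nL / 2 ^ j)" by (simp add: I_def)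
    also have "... <= nugb gA x (2 ^ nL / 2 ^ j) + T / 2 * m x (2 ^ nL / 2 ^ j)" by (intro split fmeasurableI ball_sets ball_finite)
    finally have "m x (2 ^ nL / 2 ^ j) <= 2 / T * nugb gA x (2 ^ nL / 2 ^ j)" using T by (simp add: field_simps)
    thus "emeasure \<mu> (ball x (2 ^ nL / 2 ^ j)) <= ennreal (2 / T) * emeasure (nug gA) (ball x (2 ^ nL / 2 ^ j))"
      using T by (simp add: emeasure_ball A.emeasure_eq_measure ennreal_mult'[symmetric] ennreal_leI)
  qed auto
  also have "emeasure (nug gA) S <= ennreal E"
    unfolding E_def A.emeasure_eq_measure[symmetric] by (intro emeasure_mono) (auto simp: sets.top[of \<mu>, simplified])
  also have "ennreal (CD ^ 2) * (ennreal (2 / T) * ennreal E) = ennreal (CD ^ 2 * (2 / T * E))"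
  proof -
    have "0 <= 2 / T" using T by simp
    thus ?thesis unfolding ennreal_mult'[OF zero_le_power2] by (simp only: ennreal_mult')
  qed
  finally have eS: "emeasure \<mu> S <= ennreal (CD ^ 2 * (2 / T * E))" by (simp add: mult_left_mono)
  hence Sf: "S \<in> fmeasurable \<mu>" by (intro fmeasurableI Sm) (rule le_less_trans, assumption, simp)
  define M where "M = measure \<mu> S"
  have emS: "emeasure \<mu> S = ennreal M" using Sf unfolding M_def by (simp add: emeasure_eq_ennreal_measure fmeasurableD2)
  have M0: "0 <= M" by (simp add: M_def)
  have M: "T * M <= 2 * CD ^ 2 * E"
  proof -
    have "M <= CD ^ 2 * (2 / T * E)" using eS T E unfolding emS by (subst (asm) ennreal_le_iff) auto
    thus ?thesis using T by (simp add: field_simps)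
  qed
  define F where "F = {y. y \<notin> S \<and> (%j. avg u y (1 / 2 ^ j)) \<longlonglongrightarrow> u y}"
  have lip: "\<bar>u x - u y\<bar> <= (c0 * t) * dist x y" if "x \<in> F" "y \<in> F" for x y unfolding c0_def
  proof (rule lipschitz_off_bad_balls[OF np t _ _ that])
    fix y j assume y: "y \<in> F"
    hence "(y, j) \<notin> I" unfolding F_def S_def by fastforce
    thus "nugb g y (2 ^ nL / 2 ^ j) <= t powr p * m y (2 ^ nL / 2 ^ j)" by (simp add: I_def T_def)
  qed (simp add: F_def)
  have L0: "0 <= c0 * t" using c0 t by simp
  obtain \<phi> where \<phi>: "!!x y. \<bar>\<phi> x - \<phi> y\<bar> <= (c0 * t) * dist x y" "!!x. 0 <= \<phi> x" "!!x. \<phi> x <= 1"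
    "!!x. x \<in> F ==> \<phi> x = u x" by (rule mcshane[where F = F and u = u, OF L0 npairD(2,3)[OF np] lip]) blast+
  have "continuous_on UNIV \<phi>"
    by (rule lipschitz_on_continuous_on[OF lipschitz_onI[of _ _ "c0 * t"]]) (use \<phi>(1) L0 in \<open>auto simp: dist_real_def\<close>)
  hence [measurable]: "\<phi> \<in> bmeas" by (intro meas_mu borel_measurable_continuous_onI)
  define w where "w = (%x. \<bar>u x - \<phi> x\<bar>)"
  have [measurable]: "w \<in> bmeas" unfolding w_def by measurable
  define h where "h = (%x. if w x = 0 then 0 else g x + ennreal (c0 * t))"
  have "rwug w (%x. g x + ennreal (c0 * t))" by (rule rwug_sum2[OF npairD(4)[OF np] rwug_Lipschitz[OF L0 \<phi>(1)]]) (auto simp: w_def)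
  hence rw: "rwug w h" unfolding h_def by (rule rwug_locality) measurable
  have "AE x in \<mu>. x \<notin> S --> x \<in> F"
    using differentiation[OF npairD(1-3)[OF np] zero_less_one] by eventually_elim (auto simp: F_def)
  hence ae: "AE x in \<mu>. x \<notin> S --> w x = 0" by eventually_elim (auto simp: w_def \<phi>(4))
  have EnI: "En (%x. ennreal c * indicator S x) = ennreal (c powr p * M)" if "0 <= c" for c
  proof -
    have "En (indicator S) = (\<integral>\<^sup>+x. indicator S x \<partial>\<mu>)"
      unfolding En_def by (rule nn_integral_cong) (auto split: split_indicator)
    thus ?thesis using that emS Sm by (subst En_cmult) (auto simp: ennreal_mult')
  qed
  have Ew: "Er w <= ennreal M"
  proof -
    have "Er w <= En (%x. ennreal 1 * indicator S x)"
    proof (rule En_mono_AE)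
      show "AE x in \<mu>. ennreal (w x) <= ennreal 1 * indicator S x" using ae
      proof eventually_elim
        case (elim x)
        have "w x <= 1" using \<phi>(2,3)[of x] npairD(2,3)[OF np, of x] by (auto simp: w_def abs_le_iff)
        thus ?case using elim by (auto split: split_indicator)
      qed
    qed
    thus ?thesis using EnI[of 1] by simp
  qed
  have "En h <= En (%x. (if x \<in> S then g x else 0) + ennreal (c0 * t) * indicator S x)"
  proof (rule En_mono_AE)
    show "AE x in \<mu>. h x <= (if x \<in> S then g x else 0) + ennreal (c0 * t) * indicator S x"
      using ae by eventually_elim (auto simp: h_def split: split_indicator)
  qed
  also have "... <= ennreal (2 powr p) * (En (%x. if x \<in> S then g x else 0) + En (%x. ennreal (c0 * t) * indicator S x))"
    by (rule En_add_le) measurable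
  also have "En (%x. if x \<in> S then g x else 0) = emeasure (nug g) S"
    unfolding En_def by (subst emeasure_nug) (auto intro!: nn_integral_cong split: split_indicator)
  also have "... <= ennreal (E + T / 2 * M)"
  proof -
    have "measure (nug gA) S <= E" unfolding E_def by (rule A.finite_measure_mono) (auto simp: sets.top[of \<mu>, simplified])
    thus ?thesis using split[OF Sf] unfolding \<nu>.emeasure_eq_measure M_def by (intro ennreal_leI) simp
  qed
  also have "En (%x. ennreal (c0 * t) * indicator S x) = ennreal (c0 powr p * T * M)"
    unfolding EnI[OF L0] T_def using c0 t by (simp add: powr_mult)
  finally have "energy w h <= ennreal M + ennreal (2 powr p) * (ennreal (E + T / 2 * M) + ennreal (c0 powr p * T * M))"
    using Ew by (simp add: add_mono mult_left_mono)
  also have "... = ennreal (M + 2 powr p * ((E + T / 2 * M) + c0 powr p * T * M))"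
    using M0 E T by (simp add: ennreal_mult'[symmetric] ennreal_plus[symmetric] del: ennreal_plus)
  also have "... <= ennreal e"
  proof (rule ennreal_leI)
    have "M <= T * M" using M0 T by (simp add: mult_le_cancel_right1)
    hence "M <= 2 * CD ^ 2 * E" using M by linarith
    moreover have "c0 powr p * (T * M) <= c0 powr p * (2 * CD ^ 2 * E)" by (intro mult_left_mono M) simp
    hence "2 powr p * ((E + T / 2 * M) + c0 powr p * T * M) <= 2 powr p * ((E + CD ^ 2 * E) + c0 powr p * (2 * CD ^ 2 * E))"
      using M by (intro mult_left_mono add_mono) auto
    ultimately have "M + 2 powr p * ((E + T / 2 * M) + c0 powr p * T * M) <= Q * E" unfolding Q_def by (simp add: algebra_simps)
    also have "... <= Q * (e / Q)" using Q E by (intro mult_left_mono) auto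
    finally show "M + 2 powr p * ((E + T / 2 * M) + c0 powr p * T * M) <= e" using Q by simp
  qed
  finally have en: "energy w h <= ennreal e" .
  have "En h < \<infinity>"
  proof -
    have "En h <= energy w h" by (simp add: add_increasing)
    from order_trans[OF this en] show ?thesis by (rule le_less_trans) simp
  qed
  moreover have "w x <= 1" for x using \<phi>(2,3)[of x] npairD(2,3)[OF np, of x] by (auto simp: w_def abs_le_iff)
  ultimately have "npair w h" unfolding npair_def using rw by (auto simp: w_def)
  thus thesis using that[OF L0 \<phi>(1)] en unfolding w_def by blast
qed

text \<open>Let \<open>\<phi>\<close> be Lipschitz and within \<open>1/8\<close> of \<open>u\<close>
  off a set \<open>G\<close> of small capacity. If \<open>u x = 1\<close> and \<open>x\<close> is
  not in \<open>G\<close>, then \<open>\<phi>\<close> exceeds \<open>7/8\<close> at \<open>x\<close>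
  and \<open>3/4\<close> nearby, so the nearby points with \<open>u < 1/2\<close> lie in
  \<open>G\<close>. Hence \<open>G\<close> has density at least \<open>c\<close> in some small ball
  about \<open>x\<close>, and \<open>capt_density\<close> applies.\<close>

lemma capnull_density:
  assumes np: "npair u g" and c: "0 < c"
  shows "capnull {x. u x = 1 \<and> (\<forall>i. \<exists>j\<ge>i. c * m x (1 / 2 ^ j) <= lev u (1/2) x (1 / 2 ^ j))}" (is "capnull ?Z")
  unfolding capnull_def
proof (intro allI impI)
  fix e :: real assume e: "0 < e"
  obtain K :: real and j0 where K: "0 < K" and dens: "!!G e. G \<in> sets \<mu> ==> capt G e ==> e < \<infinity> ==>
    capt {x. \<exists>j\<ge>j0. c * m x (1 / 2 ^ j) <= measure \<mu> (G \<inter> ball x (1 / 2 ^ j))} (ennreal K * e)"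
    by (rule capt_density[OF c]) blast
  \<comment> \<open>\<open>1 / (1/8)\<close> comes from the level \<open>1/8\<close>, and
    \<open>1 + K\<close> from adding the capacities of \<open>G\<close> and of its points of
    positive density.\<close>
  define B where "B = (1 + K) * (1 / (1/8)) powr p"
  have B: "0 < B" using K by (simp add: B_def)
  have eB: "0 < e / B" using e B by simp
  obtain \<phi> h L where L: "0 <= L" "!!x y. \<bar>\<phi> x - \<phi> y\<bar> <= L * dist x y"
    and np': "npair (%x. \<bar>u x - \<phi> x\<bar>) h" and en: "energy (%x. \<bar>u x - \<phi> x\<bar>) h <= ennreal (e / B)"
    by (rule lipschitz_density[OF np eB]) blast
  note [measurable] = npairD(1)[OF np'] npairD(1)[OF np]
  define G where "G = {x. 1/8 <= \<bar>u x - \<phi> x\<bar>}"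
  have "{x \<in> space \<mu>. 1/8 <= \<bar>u x - \<phi> x\<bar>} \<in> sets \<mu>" by measurable
  hence Gm: "G \<in> sets \<mu>" by (simp add: G_def)
  define a where "a = ennreal ((1 / (1/8)) powr p) * ennreal (e / B)"
  have a: "capt G a" "a < \<infinity>" unfolding G_def a_def by (rule capt_level[OF np' en]) (auto simp: ennreal_mult_less_top)
  let ?D = "{x. \<exists>j\<ge>j0. c * m x (1 / 2 ^ j) <= measure \<mu> (G \<inter> ball x (1 / 2 ^ j))}"
  have "capt (G \<union> ?D) (a + ennreal K * a)"
    by (intro capt_Un dens Gm a) (use a(2) in \<open>auto simp: ennreal_mult_less_top\<close>)
  moreover have "?Z \<subseteq> G \<union> ?D"
  proof (safe)
    fix x assume x: "u x = 1" "x \<notin> G"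
      and inf: "\<forall>i. \<exists>j\<ge>i. c * m x (1 / 2 ^ j) <= lev u (1/2) x (1 / 2 ^ j)"
    have \<phi>x: "7/8 < \<phi> x" using x unfolding G_def mem_Collect_eq by arith
    have "\<exists>n. (1/2::real) ^ n < 1 / (8 * (L + 1))" using L by (intro real_arch_pow_inv) auto
    then obtain n where n: "(1/2::real) ^ n < 1 / (8 * (L + 1))" by blast
    obtain j where j: "max n j0 <= j" "c * m x (1 / 2 ^ j) <= lev u (1/2) x (1 / 2 ^ j)" using inf by blast
    have "{y. u y < 1/2} \<inter> ball x (1 / 2 ^ j) \<subseteq> G \<inter> ball x (1 / 2 ^ j)"
    proof
      fix y assume y: "y \<in> {y. u y < 1/2} \<inter> ball x (1 / 2 ^ j)"
      have "(1/2::real) ^ j <= (1/2) ^ n" using j(1) by (intro power_decreasing) auto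
      hence "dist x y < 1 / (8 * (L + 1))" using y n by (simp add: power_one_over)
      hence "(L + 1) * dist x y <= 1/8" using L(1) by (simp add: field_simps)
      moreover have "L * dist x y <= (L + 1) * dist x y" by (intro mult_right_mono) auto
      ultimately have "\<bar>\<phi> x - \<phi> y\<bar> <= 1/8" using L(2)[of x y] by linarith
      moreover have "u y < 1/2" using y by simp
      ultimately have "1/8 <= \<bar>u y - \<phi> y\<bar>" using \<phi>x by arith
      thus "y \<in> G \<inter> ball x (1 / 2 ^ j)" using y by (simp add: G_def)
    qed
    hence "lev u (1/2) x (1 / 2 ^ j) <= measure \<mu> (G \<inter> ball x (1 / 2 ^ j))"
      using Gm emeasure_subset_ball[of "G \<inter> ball x (1 / 2 ^ j)" x]
      by (intro measure_mono_fmeasurable level_set(1) fmeasurableI) auto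
    thus "\<exists>j\<ge>j0. c * m x (1 / 2 ^ j) <= measure \<mu> (G \<inter> ball x (1 / 2 ^ j))" using j by (intro exI[of _ j]) auto
  qed
  moreover have "a + ennreal K * a = ennreal e"
  proof -
    have "a = ennreal ((1 / (1/8)) powr p * (e / B))" unfolding a_def using e B by (subst ennreal_mult'[symmetric]) auto
    hence "a + ennreal K * a = ennreal ((1 / (1/8)) powr p * (e / B) + K * ((1 / (1/8)) powr p * (e / B)))"
      using K e B by (simp add: ennreal_mult'[symmetric] ennreal_plus[symmetric] del: ennreal_plus)
    also have "(1 / (1/8)) powr p * (e / B) + K * ((1 / (1/8)) powr p * (e / B)) = B * (e / B)"
      unfolding B_def distrib_right by (simp only: mult_1_left mult.assoc)
    finally show ?thesis using B by simp
  qed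
  ultimately show "capt ?Z (ennreal e)" using capt_mono by fastforce
qed

end

section \<open>Wolff potentials\<close>

lemma geometric_tail_le:
  fixes \<theta> :: real
  assumes "0 < \<theta>" "\<theta> < 1" shows "(\<Sum>j=k..<K. \<theta> ^ (j - k)) <= 1 / (1 - \<theta>)"
proof -
  have "(\<Sum>j=k..<K. \<theta> ^ (j - k)) = (\<Sum>i<K - k. \<theta> ^ i)"
    by (rule sum.reindex_bij_witness[of _ "%i. i + k" "%j. j - k"]) auto
  thus ?thesis using assms by (simp add: sum_gp_strict divide_right_mono)
qed

text \<open>Bounding each term by a geometric weight times a power of the whole weighted sum treats
  exponents below and above 1 alike, as is needed for \<open>q = p - 1\<close>.\<close>

lemma powr_geometric_sum:
  fixes q \<beta> :: real
  assumes q: "0 < q" and \<beta>: "1 < \<beta>"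
  obtains C where "0 < C" "!!c k K. (!!j. 0 <= c j) ==>
    (\<Sum>j=k..<K. c j) powr q <= C * (\<Sum>j=k..<K. \<beta> ^ (j - k) * c j powr q)"
proof -
  define \<theta> where "\<theta> = \<beta> powr (- (1 / q))"
  have \<theta>: "0 < \<theta>" "\<theta> < 1" unfolding \<theta>_def using q \<beta> by (auto intro!: powr_less_one)
  show thesis
  proof (rule that)
    show "0 < (1 / (1 - \<theta>)) powr q" using \<theta> by simp
    fix c :: "nat => real" and k K :: nat assume c: "!!j. 0 <= c j"
    define S where "S = (\<Sum>j=k..<K. \<beta> ^ (j - k) * c j powr q)"
    have S: "0 <= S" unfolding S_def using \<beta> by (intro sum_nonneg) auto
    have "c j <= \<theta> ^ (j - k) * S powr (1 / q)" if j: "j \<in> {k..<K}" for j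
    proof -
      have "\<beta> ^ (j - k) * c j powr q <= S" unfolding S_def using j \<beta> by (intro member_le_sum) auto
      hence "c j powr q <= (1 / \<beta>) ^ (j - k) * S" using \<beta> by (simp add: field_simps power_one_over)
      hence "(c j powr q) powr (1 / q) <= ((1 / \<beta>) ^ (j - k) * S) powr (1 / q)" using q by (intro powr_mono2) auto
      also have "... = ((1 / \<beta>) ^ (j - k)) powr (1 / q) * S powr (1 / q)" using S \<beta> by (simp add: powr_mult)
      also have "((1 / \<beta>) ^ (j - k)) powr (1 / q) = \<theta> ^ (j - k)"
        using \<beta> by (simp add: \<theta>_def powr_realpow[symmetric] powr_powr powr_minus_divide powr_divide mult.commute)
      finally show ?thesis using c[of j] q by (simp add: powr_powr)
    qed
    hence "(\<Sum>j=k..<K. c j) <= (\<Sum>j=k..<K. \<theta> ^ (j - k)) * S powr (1 / q)" unfolding sum_distrib_right by (rule sum_mono)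
    also have "... <= 1 / (1 - \<theta>) * S powr (1 / q)"
    proof (rule mult_right_mono)
      show "(\<Sum>j=k..<K. \<theta> ^ (j - k)) <= 1 / (1 - \<theta>)" by (rule geometric_tail_le[OF \<theta>])
    qed simp
    finally have "(\<Sum>j=k..<K. c j) powr q <= (1 / (1 - \<theta>) * S powr (1 / q)) powr q"
      using q c by (intro powr_mono2 sum_nonneg) auto
    also have "... = (1 / (1 - \<theta>)) powr q * S" using q S \<theta> by (subst powr_mult) (auto simp: powr_powr)
    finally show "(\<Sum>j=k..<K. c j) powr q <= (1 / (1 - \<theta>)) powr q * (\<Sum>j=k..<K. \<beta> ^ (j - k) * c j powr q)"
      by (simp add: S_def)
  qed
qed

lemma powr_diff_le:
  fixes a b p :: real
  assumes p: "1 < p" and ab: "0 <= b" "b <= a"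
  shows "a powr p <= b powr p + p * (a - b) * a powr (p - 1)"
proof (cases "b = a")
  case False
  hence "b < a" using ab by simp
  have "\<exists>l z. b < z \<and> z < a \<and> DERIV (%x. x powr p) z :> l \<and> a powr p - b powr p = (a - b) * l"
  proof (rule MVT[OF \<open>b < a\<close>])
    show "continuous_on {b..a} (%x. x powr p)" using ab p by (intro continuous_on_powr') (auto intro!: continuous_intros)
    show "(%x. x powr p) differentiable at x" if "b < x" "x < a" for x
      using has_real_derivative_powr[of x p] that ab by (auto simp: real_differentiable_def)
  qed
  then obtain l z where z: "b < z" "z < a" "DERIV (%x. x powr p) z :> l" "a powr p - b powr p = (a - b) * l" by blast
  have "l = p * z powr (p - 1)" using DERIV_unique[OF z(3) has_real_derivative_powr] z ab by simp
  moreover have "z powr (p - 1) <= a powr (p - 1)" using z ab p by (intro powr_mono2) auto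
  ultimately have "(a - b) * l <= (a - b) * (p * a powr (p - 1))" using p ab by (intro mult_left_mono) auto
  thus ?thesis using z(4) by (simp add: mult_ac)
qed simp

text \<open>For the tails \<open>T k\<close>, the mean value theorem gives
  \<open>T k powr p - T (Suc k) powr p <= p * c k * T k powr (p - 1)\<close>; summing over
  \<open>k\<close> and estimating the tails by \<open>powr_geometric_sum\<close> finishes. The
  outcome is linear in \<open>c k\<close> and has the power \<open>p - 1\<close> only on terms with
  \<open>j >= k\<close>.\<close>

lemma powr_sum_le:
  fixes p :: real
  assumes p: "1 < p" and \<beta>: "1 < \<beta>"
  obtains C where "0 < C" "!!c K. (!!j. 0 <= c j) ==>
    (\<Sum>j<K. c j) powr p <= C * (\<Sum>k<K. \<Sum>j=k..<K. \<beta> ^ (j - k) * (c k * c j powr (p - 1)))"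
proof -
  have p': "0 < p - 1" using p by simp
  obtain C where C: "0 < C" and le: "!!c k K. (!!j. 0 <= c j) ==>
    (\<Sum>j=k..<K. c j) powr (p - 1) <= C * (\<Sum>j=k..<K. \<beta> ^ (j - k) * c j powr (p - 1))"
    by (rule powr_geometric_sum[OF p' \<beta>]) blast
  show thesis
  proof (rule that)
    show "0 < p * C" using p C by simp
    fix c :: "nat => real" and K assume c: "!!j. 0 <= c j"
    define T where "T k = (\<Sum>j=k..<K. c j)" for k
    have "T k powr p <= (\<Sum>i=k..<K. p * c i * T i powr (p - 1))" if "k <= K" for k using that
    proof (induction k rule: inc_induct)
      case base
      thus ?case by (simp add: T_def)
    next
      case (step k)
      have Tk: "T k = c k + T (Suc k)" unfolding T_def using step(2) by (rule sum.atLeast_Suc_lessThan)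
      have "T k powr p <= T (Suc k) powr p + p * (T k - T (Suc k)) * T k powr (p - 1)"
        using c unfolding Tk by (intro powr_diff_le[OF p]) (auto simp: T_def sum_nonneg)
      thus ?case using step Tk by (simp add: sum.atLeast_Suc_lessThan)
    qed
    from this[of 0] have "(\<Sum>j<K. c j) powr p <= (\<Sum>i<K. p * c i * T i powr (p - 1))" by (simp add: T_def atLeast0LessThan)
    also have "... <= (\<Sum>k<K. p * c k * (C * (\<Sum>j=k..<K. \<beta> ^ (j - k) * c j powr (p - 1))))"
      unfolding T_def using p c by (intro sum_mono mult_left_mono le) auto
    also have "... = p * C * (\<Sum>k<K. \<Sum>j=k..<K. \<beta> ^ (j - k) * (c k * c j powr (p - 1)))"
      by (simp add: sum_distrib_left mult_ac)
    finally show "(\<Sum>j<K. c j) powr p <= p * C * (\<Sum>k<K. \<Sum>j=k..<K. \<beta> ^ (j - k) * (c k * c j powr (p - 1)))" .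
  qed
qed

context newtonian_space
begin

lemma dense_sequence:
  obtains d :: "nat => 'a" where "!!x r. 0 < r ==> \<exists>n. d n \<in> ball x r"
proof -
  have "\<exists>C. countable C \<and> (\<Union>x\<in>C. ball x (1 / 2 ^ n)) = (UNIV :: 'a set)" for n :: nat
    by (rule countable_cover_balls[of "%_. 1 / 2 ^ n"]) auto
  hence "\<forall>n::nat. \<exists>C. countable C \<and> (\<Union>x\<in>C. ball x (1 / 2 ^ n)) = (UNIV :: 'a set)" by blast
  from choice[OF this] obtain C where C': "\<forall>n::nat. countable (C n) \<and> (\<Union>x\<in>C n. ball x (1 / 2 ^ n)) = (UNIV :: 'a set)" ..
  note C = C'[rule_format, THEN conjunct1] C'[rule_format, THEN conjunct2]
  define D where "D = (\<Union>n. C n)"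
  have "C 0 ~= {}" using C(2)[of 0] by auto
  hence D: "countable D" "D ~= {}" unfolding D_def using C(1) by auto
  show thesis
  proof (rule that[of "from_nat_into D"])
    fix x :: 'a and r :: real assume r: "0 < r"
    have "\<exists>n. (1/2::real) ^ n < r" using r by (intro real_arch_pow_inv) auto
    then obtain n where n: "(1/2::real) ^ n < r" by blast
    have "x \<in> (\<Union>y\<in>C n. ball y (1 / 2 ^ n))" using C(2)[of n] by blast
    then obtain y where y: "y \<in> C n" "dist y x < 1 / 2 ^ n" by auto
    have "y \<in> D" using y(1) by (auto simp: D_def)
    then obtain i where "from_nat_into D i = y" using from_nat_into_surj[OF D(1)] by blast
    thus "\<exists>i. from_nat_into D i \<in> ball x r" using y(2) n by (intro exI[of _ i]) (auto simp: dist_commute power_one_over)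
  qed
qed

text \<open>Measurability is needed for the product sigma-algebra, so the set is written as a
  countable union of products of balls about a dense sequence.\<close>

lemma dist_less_measurable:
  fixes d :: "nat => 'a"
  assumes d: "!!x r. 0 < r ==> \<exists>n. d n \<in> ball x r" and s: "sets \<nu> = sets \<mu>"
  shows "{(x, y). dist x y < \<rho>} \<in> sets (\<mu> \<Otimes>\<^sub>M \<nu>)"
proof -
  have "{(x, y). dist x y < \<rho>} = (\<Union>n. \<Union>q::rat. ball (d n) (of_rat q) \<times> ball (d n) (\<rho> - of_rat q))" (is "?L = ?R")
  proof (intro subset_antisym subsetI)
    fix z assume "z \<in> ?L"
    then obtain x y where z: "z = (x, y)" "dist x y < \<rho>" by auto
    then obtain n where n: "d n \<in> ball x ((\<rho> - dist x y) / 2)" using d[of "(\<rho> - dist x y) / 2" x] by auto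
    hence "dist (d n) x < (\<rho> - dist x y) / 2" by (simp add: dist_commute)
    from of_rat_dense[OF this] obtain q where q: "dist (d n) x < of_rat q" "of_rat q < (\<rho> - dist x y) / 2" by blast
    have "dist (d n) y <= dist (d n) x + dist x y" by (rule dist_triangle)
    hence "dist (d n) y < \<rho> - of_rat q" using q n z by (simp add: dist_commute field_simps)
    thus "z \<in> ?R" using q z by auto
  next
    fix z assume "z \<in> ?R"
    then obtain n and q :: rat and x y where z: "z = (x, y)" "dist (d n) x < of_rat q" "dist (d n) y < \<rho> - of_rat q" by auto
    have "dist x y <= dist (d n) x + dist (d n) y" by (rule dist_triangle3)
    thus "z \<in> ?L" using z by auto
  qed
  also have "... \<in> sets (\<mu> \<Otimes>\<^sub>M \<nu>)"
    using s by (intro sets.countable_UN[THEN subsetD[rotated]] sets.countable_UN) auto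
  finally show ?thesis .
qed

end

text \<open>Far from \<open>z0\<close> the measure \<open>\<nu>\<close> vanishes on the ball, and
  near \<open>z0\<close> doubling bounds \<open>m y \<rho>\<close> below by a multiple of the fixed
  number \<open>m z0 \<rho>\<close>.\<close>

lemma (in doubling_space) measure_ratio_bounded:
  assumes "finite_measure \<nu>" and s: "sets \<nu> = sets \<mu>"
    and conc: "!!y r. R + r <= dist z0 y ==> measure \<nu> (ball y r) = 0" and \<rho>: "0 < \<rho>"
  obtains A where "0 <= A" "!!y. measure \<nu> (ball y \<rho>) <= A * m y \<rho>"
proof -
  interpret \<nu>: finite_measure \<nu> by fact
  obtain N where N: "(R + 2 * \<rho>) / \<rho> < 2 ^ N" using real_arch_pow[of 2 "(R + 2 * \<rho>) / \<rho>"] by auto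
  have mp: "0 < m z0 \<rho>" using m_pos \<rho> by auto
  show thesis
  proof (rule that)
    show A0: "0 <= measure \<nu> UNIV * (CD ^ N / m z0 \<rho>)" using CD1 by simp
    fix y
    show "measure \<nu> (ball y \<rho>) <= measure \<nu> UNIV * (CD ^ N / m z0 \<rho>) * m y \<rho>"
    proof (cases "R + \<rho> <= dist z0 y")
      case True
      thus ?thesis using conc[OF True] mult_nonneg_nonneg[OF A0 measure_nonneg, of \<mu> "ball y \<rho>"] by simp
    next
      case False
      have "ball z0 \<rho> \<subseteq> ball y (2 ^ N * \<rho>)" using False N \<rho> by (intro ball_subsetI) (simp add: dist_commute field_simps)
      from m_le[OF \<rho> this] have "1 <= CD ^ N / m z0 \<rho> * m y \<rho>" using mp by (simp add: divide_simps)
      moreover have "measure \<nu> (ball y \<rho>) <= measure \<nu> UNIV"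
        using sets.top[of \<nu>] sets_eq_imp_space_eq[OF s] by (intro \<nu>.finite_measure_mono) auto
      ultimately have "measure \<nu> (ball y \<rho>) * 1 <= measure \<nu> UNIV * (CD ^ N / m z0 \<rho> * m y \<rho>)"
        by (intro mult_mono) auto
      thus ?thesis by simp
    qed
  qed
qed

section \<open>Dyadic Wolff potentials and a competitor for the set where they diverge\<close>

abbreviation (in newtonian_space) wolff :: "('a => ennreal) => 'a => nat => real" where
  "wolff g x k \<equiv> ((1 / 2 ^ k) powr p * nugb g x (1 / 2 ^ k) / m x (1 / 2 ^ k)) powr (1 / (p - 1))"

text \<open>\<open>conc\<close> confines \<open>\<nu>\<close> to a ball, which bounds each Wolff
  term uniformly. \<open>small\<close> normalizes the four coarsest scales: the term at scale
  \<open>k + 4\<close> will be compared with scale \<open>k\<close>, so the first four have nothing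
  to be compared with.\<close>

locale wolff_space = doubling_space p \<mu> CD + \<nu>: finite_measure \<nu>
  for p :: real and \<mu> \<nu> :: "'a::metric_space measure" and CD :: real +
  fixes d :: "nat => 'a" and z0 :: 'a and R :: real
  assumes sets_\<nu>: "sets \<nu> = sets \<mu>"
    and dense: "0 < r ==> \<exists>n. d n \<in> ball x r"
    and conc: "R + r <= dist z0 y ==> measure \<nu> (ball y r) = 0"
    and small: "i < 4 ==> (1 / 2 ^ i) powr p * measure \<nu> (ball y (8 / 2 ^ i)) <= m y (8 / 2 ^ i)"
begin

definition rad :: "nat => real" where "rad k = 1 / 2 ^ k"

lemma rad: "0 < rad k" "rad k <= 1" "rad (Suc k) = rad k / 2" "k <= j ==> rad j <= rad k"
  by (auto simp: rad_def divide_simps power_increasing)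

text \<open>The two radii are kept apart so that enlarging the ball does not change the factor in
  front; with equal radii this is a term of the Wolff potential.\<close>

definition wf :: "'a => real => real => real" where
  "wf y \<rho>0 \<rho> = (\<rho>0 powr p * measure \<nu> (ball y \<rho>) / m y \<rho>) powr (1 / (p - 1))"

lemma wf_nonneg: "0 <= wf y \<rho>0 \<rho>" by (simp add: wf_def)

lemma wf_le:
  assumes r: "0 < \<rho>0" "\<rho>0 <= \<rho>0'" "0 < \<rho>" "0 < \<rho>'"
    and sub: "ball y \<rho> \<subseteq> ball y' \<rho>'" "ball y' \<rho>' \<subseteq> ball y (2 ^ n * \<rho>)"
  shows "wf y \<rho>0 \<rho> <= (CD ^ n) powr (1 / (p - 1)) * wf y' \<rho>0' \<rho>'"
proof -
  have mp: "0 < m y \<rho>" "0 < m y' \<rho>'" using m_pos r by auto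
  have "1 / m y \<rho> <= CD ^ n / m y' \<rho>'" using m_le[OF r(3) sub(2)] mp by (simp add: divide_simps mult.commute)
  moreover have "\<rho>0 powr p * measure \<nu> (ball y \<rho>) <= \<rho>0' powr p * measure \<nu> (ball y' \<rho>')"
    using r p0 sub(1) by (intro mult_mono powr_mono2 \<nu>.finite_measure_mono) (auto simp: sets_\<nu>)
  ultimately have "\<rho>0 powr p * measure \<nu> (ball y \<rho>) * (1 / m y \<rho>) <= \<rho>0' powr p * measure \<nu> (ball y' \<rho>') * (CD ^ n / m y' \<rho>')"
    by - (rule mult_mono, use mp in auto)
  hence "\<rho>0 powr p * measure \<nu> (ball y \<rho>) / m y \<rho> <= CD ^ n * (\<rho>0' powr p * measure \<nu> (ball y' \<rho>') / m y' \<rho>')"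
    by (simp add: mult_ac)
  hence "wf y \<rho>0 \<rho> <= (CD ^ n * (\<rho>0' powr p * measure \<nu> (ball y' \<rho>') / m y' \<rho>')) powr (1 / (p - 1))"
    unfolding wf_def using p1 mp by (intro powr_mono2) auto
  thus ?thesis unfolding wf_def using CD1 mp by (subst (asm) powr_mult) auto
qed

lemma wf_bounded:
  assumes \<rho>: "0 < \<rho>" obtains A where "!!y. wf y \<rho> \<rho> <= A"
proof -
  obtain A where A: "!!y. measure \<nu> (ball y \<rho>) <= A * m y \<rho>"
    by (rule measure_ratio_bounded[OF \<nu>.finite_measure_axioms sets_\<nu> conc \<rho>]) blast+
  have "wf y \<rho> \<rho> <= (\<rho> powr p * A) powr (1 / (p - 1))" for y
  proof -
    have "\<rho> powr p * (measure \<nu> (ball y \<rho>) / m y \<rho>) <= \<rho> powr p * A"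
      using A[of y] m_pos[OF \<rho>, of y] by (intro mult_left_mono) (auto simp: divide_le_eq)
    thus ?thesis unfolding wf_def using p1 by (intro powr_mono2) auto
  qed
  thus thesis by (rule that)
qed

definition a :: "nat => 'a => real" where "a k y = wf y (rad k) (rad k)"

text \<open>Up to constants and a change of scale, a Lipschitz version of the Wolff term. The
  supremum of bumps over a dense sequence does the work of a partition of unity.\<close>

definition \<Phi> :: "nat => 'a => real" where
  "\<Phi> k x = (SUP n. a k (d n) * cutoff (d n) (rad k) x)"

definition gr :: "nat => nat => 'a => ennreal" where
  "gr k n x = ennreal (a k (d n)) * (if cutoff (d n) (rad k) x = 0 then 0 else ennreal (1 / rad k))"

definition hr :: "nat => 'a => real" where "hr k x = enn2real (SUP n. gr k n x)"

text \<open>The truncation at 1 is what bounds the energy: where the sum has already reached 1,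
  finer scales contribute no gradient. The function \<open>c\<close> defined next is the gradient of
  scale \<open>k\<close> that survives this stopping.\<close>

definition U :: "nat => 'a => real" where "U K x = min 1 (\<Sum>k<K. \<Phi> k x)"

definition c :: "nat => 'a => real" where "c k x = (if U k x < 1 then hr k x else 0)"

lemma a_bounded: obtains A where "0 <= A" "!!y. a k y <= A"
proof -
  obtain A where A: "!!y. wf y (rad k) (rad k) <= A" by (rule wf_bounded[OF rad(1)]) blast
  thus thesis using that[of A] order_trans[OF wf_nonneg A] unfolding a_def by blast
qed

lemma a_nonneg: "0 <= a k y" by (simp add: a_def wf_nonneg)

lemma \<Phi>_term: "0 <= a k (d n) * cutoff (d n) (rad k) x" "a k (d n) * cutoff (d n) (rad k) x <= a k (d n)"
  using a_nonneg cutoff(3,4)[OF rad(1), of "d n" k x] by (auto intro: mult_left_le)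

lemma \<Phi>_bdd: "bdd_above (range (%n. a k (d n) * cutoff (d n) (rad k) x))"
proof -
  obtain A where "!!y. a k y <= A" by (rule a_bounded[where k = k]) blast
  thus ?thesis using order_trans[OF \<Phi>_term(2)] by (intro bdd_aboveI[of _ A]) blast
qed

lemma \<Phi>_ge: "d n \<in> ball x (rad k) ==> a k (d n) <= \<Phi> k x"
proof -
  assume "d n \<in> ball x (rad k)"
  hence "cutoff (d n) (rad k) x = 1" by (intro cutoff(5)[OF rad(1)]) (simp add: dist_commute)
  thus ?thesis unfolding \<Phi>_def using cSUP_upper[OF UNIV_I \<Phi>_bdd, of k n x] by simp
qed

lemma \<Phi>_nonneg: "0 <= \<Phi> k x"
  unfolding \<Phi>_def by (rule order_trans[OF \<Phi>_term(1)[of k 0 x]]) (rule cSUP_upper[OF UNIV_I \<Phi>_bdd])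

lemma gr_le:
  obtains A where "0 <= A" "!!n x. gr k n x <= ennreal A * indicator (ball z0 (R + 3)) x"
proof -
  obtain A where A: "0 <= A" "!!y. a k y <= A" by (rule a_bounded[where k = k]) blast
  have "gr k n x <= ennreal (A * (1 / rad k)) * indicator (ball z0 (R + 3)) x" for n x
  proof (cases "cutoff (d n) (rad k) x = 0 \<or> a k (d n) = 0")
    case False
    hence "dist (d n) x < 2 * rad k" using cutoff(6)[OF rad(1), of "d n" k x] by simp
    moreover have "dist z0 (d n) < R + rad k" using False conc[of "rad k" "d n"] by (auto simp: a_def wf_def not_le[symmetric])
    ultimately have "x \<in> ball z0 (R + 3)" using dist_triangle[of z0 x "d n"] rad(2)[of k] by simp
    moreover have "gr k n x <= ennreal (A * (1 / rad k))"
      unfolding gr_def using A rad(1)[of k] a_nonneg[of k "d n"] by (auto simp: ennreal_mult'[symmetric] intro!: ennreal_leI divide_right_mono)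
    ultimately show ?thesis by simp
  qed (auto simp: gr_def)
  thus thesis using that[of "A * (1 / rad k)"] A(1) rad(1)[of k] by simp
qed

lemma gr_measurable [measurable]: "gr k n \<in> bmeas"
proof -
  note [measurable] = cutoff(2)[OF rad(1), of "d n" k]
  show ?thesis unfolding gr_def by measurable
qed

lemma hr: "(SUP n. gr k n x) = ennreal (hr k x)" "0 <= hr k x"
proof -
  obtain A where A: "0 <= A" "!!n x. gr k n x <= ennreal A * indicator (ball z0 (R + 3)) x" by (rule gr_le[where k = k]) blast
  have "(SUP n. gr k n x) <= ennreal A * indicator (ball z0 (R + 3)) x" by (rule SUP_least) (rule A(2))
  also have "... < \<infinity>" by (auto simp: ennreal_mult_less_top split: split_indicator)
  finally show "(SUP n. gr k n x) = ennreal (hr k x)" by (simp add: hr_def)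
qed (simp add: hr_def)

lemma hr_measurable [measurable]: "hr k \<in> bmeas" unfolding hr_def by measurable

lemma hr_le:
  assumes "0 <= B" "!!n. x \<in> ball (d n) (2 * rad k) ==> a k (d n) <= B"
  shows "hr k x <= B / rad k"
proof -
  have "(SUP n. gr k n x) <= ennreal (B / rad k)"
  proof (rule SUP_least)
    fix n
    show "gr k n x <= ennreal (B / rad k)"
    proof (cases "cutoff (d n) (rad k) x = 0")
      case False
      hence "a k (d n) <= B" using cutoff(6)[OF rad(1), of "d n" k x] by (intro assms(2)) simp
      thus ?thesis unfolding gr_def using False rad(1)[of k] a_nonneg[of k "d n"]
        by (auto simp: ennreal_mult'[symmetric] intro!: ennreal_leI divide_right_mono)
    qed (simp add: gr_def)
  qed
  thus ?thesis unfolding hr(1) using assms(1) rad(1)[of k] by (subst (asm) ennreal_le_iff) auto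
qed

text \<open>Since the radii are at most 1, the height of a bump is at most its slope. Hence the
  estimates for the gradient also control the competitor \<open>U\<close> itself.\<close>

lemma \<Phi>_le_hr: "\<Phi> k x <= hr k x" unfolding \<Phi>_def
proof (rule cSUP_least)
  fix n
  show "a k (d n) * cutoff (d n) (rad k) x <= hr k x"
  proof (cases "cutoff (d n) (rad k) x = 0")
    case False
    have "ennreal (a k (d n)) <= gr k n x"
    proof -
      have "a k (d n) * 1 <= a k (d n) * (1 / rad k)" using rad[of k] a_nonneg by (intro mult_left_mono) auto
      thus ?thesis unfolding gr_def using False a_nonneg[of k "d n"] by (simp add: ennreal_mult'[symmetric] ennreal_leI)
    qed
    also have "... <= (SUP n. gr k n x)" by (rule SUP_upper) simp
    finally have "a k (d n) <= hr k x" unfolding hr(1) using hr(2) by (subst (asm) ennreal_le_iff) auto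
    thus ?thesis using \<Phi>_term(2)[of k n x] by linarith
  qed (simp add: hr)
qed simp

lemma hr_energy: "Er (hr k) < \<infinity>"
proof -
  obtain A where A: "0 <= A" "!!n x. gr k n x <= ennreal A * indicator (ball z0 (R + 3)) x" by (rule gr_le[where k = k]) blast
  have "Er (hr k) <= En (%x. ennreal A * indicator (ball z0 (R + 3)) x)" unfolding hr(1)[symmetric] by (intro En_mono SUP_least A)
  also have "... < \<infinity>" using A(1) by (simp add: En_const_ball emeasure_ball ennreal_mult_less_top)
  finally show ?thesis .
qed

lemma rwug_\<Phi>: "rwug (\<Phi> k) (%x. ennreal (hr k x))" unfolding hr(1)[symmetric]
proof (rule rwug_SUP)
  show "rwug (%x. a k (d n) * cutoff (d n) (rad k) x) (gr k n)" for n unfolding gr_def using a_nonneg[of k "d n"]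
    by (intro rwug_lipschitz_comp[OF cutoff(1)[OF rad(1)]]) (auto simp: abs_mult right_diff_distrib[symmetric])
  show "En (%x. SUP n. gr k n x) < \<infinity>" unfolding hr(1) by (rule hr_energy)
  show "ennreal \<bar>\<Phi> k x - \<Phi> k y\<bar> <= (SUP n. ennreal \<bar>a k (d n) * cutoff (d n) (rad k) x - a k (d n) * cutoff (d n) (rad k) y\<bar>)" for x y
    unfolding \<Phi>_def by (rule cSUP_diff_le[OF \<Phi>_bdd])
qed

lemma \<Phi>_measurable [measurable]: "\<Phi> k \<in> bmeas"
proof -
  note [measurable] = cutoff(2)[OF rad(1)]
  show ?thesis unfolding \<Phi>_def by (rule borel_measurable_cSUP[OF _ _ \<Phi>_bdd]) measurable
qed

lemma U_measurable [measurable]: "U k \<in> bmeas" unfolding U_def by measurable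

lemma c_measurable [measurable]: "c k \<in> bmeas" unfolding c_def by measurable

lemma c: "0 <= c k x" "c k x <= hr k x" by (auto simp: c_def hr)

lemma U_range: "0 <= U k x" "U k x <= 1" using \<Phi>_nonneg by (auto simp: U_def sum_nonneg)

lemma U_Suc: "U (Suc k) x = min 1 (U k x + \<Phi> k x)" using \<Phi>_nonneg[of k x] by (auto simp: U_def min_def)

text \<open>Where \<open>U (Suc K) = 1\<close> locality removes the gradient; elsewhere
  \<open>U K < 1\<close>, so the gradient \<open>hr K\<close> of the new term coincides with
  \<open>c K\<close>.\<close>

lemma rwug_U: "rwug (U K) (%x. \<Sum>k<K. ennreal (c k x))"
proof (induction K)
  case 0
  show ?case using rwug_const[of 0] by (simp add: U_def)
next
  case (Suc K)
  have 1: "rwug (U (Suc K)) (%x. (\<Sum>k<K. ennreal (c k x)) + ennreal (hr K x))"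
    by (rule rwug_sum2[OF Suc rwug_\<Phi>]) (auto simp: U_Suc min_def)
  have "rwug (U (Suc K)) (%x. if U (Suc K) x = 1 then 0 else (\<Sum>k<K. ennreal (c k x)) + ennreal (hr K x))"
    by (rule rwug_locality[OF 1 U_measurable])
  thus ?case
  proof (rule wug_mono[OF _ 1])
    have "U K x < 1" if "U (Suc K) x ~= 1" for x
      using that \<Phi>_nonneg[of K x] U_range[of K x] by (auto simp: U_Suc min_def split: if_splits)
    thus "AE x in \<mu>. (if U (Suc K) x = 1 then 0 else (\<Sum>k<K. ennreal (c k x)) + ennreal (hr K x)) <= (\<Sum>k<Suc K. ennreal (c k x))"
      by (intro AE_I2) (auto simp: c_def)
    show "AE x in \<mu>. (\<Sum>k<Suc K. ennreal (c k x)) <= (\<Sum>k<K. ennreal (c k x)) + ennreal (hr K x)"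
      using c by (intro AE_I2) (auto intro!: add_left_mono ennreal_leI)
  qed measurable
qed

lemma U_le: "U K x <= (\<Sum>k<K. c k x)"
proof (induction K)
  case (Suc K)
  have "U (Suc K) x <= U K x + c K x"
    using \<Phi>_le_hr[of K x] \<Phi>_nonneg[of K x] U_range[of K x] by (auto simp: U_Suc c_def min_def)
  thus ?case using Suc by simp
qed (simp add: U_def)

lemma hr_le_center: "hr j x <= (CD ^ 3) powr (1 / (p - 1)) * wf x (rad j) (4 * rad j) / rad j"
proof (rule hr_le)
  fix n assume x: "x \<in> ball (d n) (2 * rad j)"
  show "a j (d n) <= (CD ^ 3) powr (1 / (p - 1)) * wf x (rad j) (4 * rad j)" unfolding a_def
  proof (rule wf_le)
    show "ball (d n) (rad j) \<subseteq> ball x (4 * rad j)" "ball x (4 * rad j) \<subseteq> ball (d n) (2 ^ 3 * rad j)"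
      using x rad(1)[of j] by (auto intro!: ball_subsetI simp: dist_commute)
  qed (use rad(1)[of j] in auto)
qed (simp add: wf_nonneg)

text \<open>The power \<open>p - 1\<close> undoes the exponent \<open>1 / (p - 1)\<close> of the
  Wolff term, so the bound is linear in \<open>\<nu>\<close> and can be integrated by
  Fubini.\<close>

lemma hr_powr: "hr j x powr (p - 1) <= CD ^ 3 * (rad j * (measure \<nu> (ball x (4 * rad j)) / m x (4 * rad j)))"
proof -
  define W where "W = rad j powr p * measure \<nu> (ball x (4 * rad j)) / m x (4 * rad j)"
  have W: "0 <= W" by (simp add: W_def)
  have "hr j x powr (p - 1) <= ((CD ^ 3) powr (1 / (p - 1)) * W powr (1 / (p - 1)) / rad j) powr (p - 1)"
    using hr_le_center[of j x] hr(2)[of j x] p1 unfolding W_def wf_def by (intro powr_mono2) auto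
  also have "... = CD ^ 3 * W / rad j powr (p - 1)" using CD1 W rad(1)[of j] p1 by (simp add: powr_divide powr_mult powr_powr)
  also have "... = CD ^ 3 * (rad j * (measure \<nu> (ball x (4 * rad j)) / m x (4 * rad j)))"
    using rad(1)[of j] by (simp add: W_def powr_diff)
  finally show ?thesis .
qed

lemma hr_le_near:
  assumes y: "x \<in> ball y (4 * rad k)"
  shows "hr k x <= (CD ^ 4) powr (1 / (p - 1)) * wf y (rad k) (8 * rad k) / rad k"
proof (rule hr_le)
  fix n assume x: "x \<in> ball (d n) (2 * rad k)"
  have D: "dist (d n) y < 6 * rad k" using x y dist_triangle[of "d n" y x] by (simp add: dist_commute)
  show "a k (d n) <= (CD ^ 4) powr (1 / (p - 1)) * wf y (rad k) (8 * rad k)" unfolding a_def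
  proof (rule wf_le)
    show "ball (d n) (rad k) \<subseteq> ball y (8 * rad k)" "ball y (8 * rad k) \<subseteq> ball (d n) (2 ^ 4 * rad k)"
      using D rad(1)[of k] by (auto intro!: ball_subsetI simp: dist_commute)
  qed (use rad(1)[of k] in auto)
qed (simp add: wf_nonneg)

text \<open>Up to constants a bound for \<open>rad k * c k\<close> on the ball about
  \<open>y\<close>, switched off as soon as \<open>U k\<close> has reached 1 on that whole
  ball.\<close>

definition B :: "nat => 'a => real" where
  "B k y = (if \<exists>x\<in>ball y (4 * rad k). U k x < 1 then (CD ^ 4) powr (1 / (p - 1)) * wf y (rad k) (8 * rad k) else 0)"

lemma wf_le_\<Phi>:
  assumes x: "x \<in> ball y (4 * rad (k + 4))"
  shows "wf y (rad (k + 4)) (8 * rad (k + 4)) <= (CD ^ 2) powr (1 / (p - 1)) * \<Phi> k x"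
proof -
  define \<rho> where "\<rho> = rad (k + 4)"
  have \<rho>: "0 < \<rho>" "rad k = 16 * \<rho>" unfolding \<rho>_def by (auto simp: rad_def power_add)
  obtain n where n: "d n \<in> ball x (4 * \<rho>)" using dense[of "4 * \<rho>" x] \<rho>(1) by auto
  have D: "dist y (d n) < 8 * \<rho>" using n x dist_triangle[of y "d n" x] by (simp add: \<rho>_def)
  have "wf y \<rho> (8 * \<rho>) <= (CD ^ 2) powr (1 / (p - 1)) * wf (d n) (rad k) (rad k)"
  proof (rule wf_le)
    show "ball y (8 * \<rho>) \<subseteq> ball (d n) (rad k)" "ball (d n) (rad k) \<subseteq> ball y (2 ^ 2 * (8 * \<rho>))"
      unfolding \<rho>(2) using D \<rho>(1) by (auto intro!: ball_subsetI simp: dist_commute)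
  qed (use \<rho> in auto)
  also have "... <= (CD ^ 2) powr (1 / (p - 1)) * \<Phi> k x"
    using \<Phi>_ge[of n x k] n \<rho> by (intro mult_left_mono) (auto simp: a_def)
  finally show ?thesis by (simp add: \<rho>_def)
qed

text \<open>If \<open>n\<close> is the last scale still active at \<open>y\<close>, there is a point
  \<open>x\<close> near \<open>y\<close> with \<open>U n x < 1\<close>, so the
  \<open>\<Phi> k x\<close> with \<open>k < n\<close> add up to less than 1. They dominate the Wolff
  terms at \<open>y\<close> four scales later, and the first four terms are at most 1 each by
  \<open>small\<close>. This plays the part of a maximum principle: the stopped potential is bounded
  everywhere.\<close>

lemma sum_B: "(\<Sum>k<K. B k y) <= (CD ^ 4) powr (1 / (p - 1)) * (4 + (CD ^ 2) powr (1 / (p - 1)))" (is "_ <= ?A * (4 + ?D)")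
proof (cases "\<exists>k<K. \<exists>x\<in>ball y (4 * rad k). U k x < 1")
  case False
  hence "(\<Sum>k<K. B k y) = 0" by (intro sum.neutral) (auto simp: B_def)
  thus ?thesis by simp
next
  case True
  define P where "P = {k. k < K \<and> (\<exists>x\<in>ball y (4 * rad k). U k x < 1)}"
  have P: "finite P" "P ~= {}" using True by (auto simp: P_def)
  define n where "n = Max P"
  have "n \<in> P" unfolding n_def using P by (rule Max_in)
  then obtain x where x: "x \<in> ball y (4 * rad n)" "U n x < 1" by (auto simp: P_def)
  define W where "W k = wf y (rad k) (8 * rad k)" for k
  define f where "f k = (if k < 4 then 1 else ?D * \<Phi> (k - 4) x)" for k
  have f0: "0 <= f k" for k using \<Phi>_nonneg by (simp add: f_def)
  have W: "W k <= f k" if "k <= n" for k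
  proof (cases "k < 4")
    case True
    have "rad k powr p * measure \<nu> (ball y (8 * rad k)) / m y (8 * rad k) <= 1"
      using small[OF True, of y] m_pos[of "8 * rad k" y] rad(1)[of k] by (simp add: rad_def divide_le_eq)
    hence "W k <= 1 powr (1 / (p - 1))" unfolding W_def wf_def using p1 by (intro powr_mono2) auto
    thus ?thesis using True by (simp add: f_def)
  next
    case False
    have "x \<in> ball y (4 * rad ((k - 4) + 4))" using x(1) rad(4)[OF that] False by auto
    from wf_le_\<Phi>[OF this] show ?thesis using False by (simp add: W_def f_def)
  qed
  have "B k y <= ?A * (if k <= n then f k else 0)" if "k < K" for k
  proof (cases "k \<in> P")
    case True
    hence "k <= n" unfolding n_def using P by simp
    thus ?thesis using W[of k] f0[of k] by (simp add: B_def W_def mult_left_mono)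
  next
    case False
    thus ?thesis using that f0[of k] by (auto simp: B_def P_def)
  qed
  hence "(\<Sum>k<K. B k y) <= ?A * (\<Sum>k<K. if k <= n then f k else 0)" unfolding sum_distrib_left by (intro sum_mono) auto
  also have "(\<Sum>k<K. if k <= n then f k else 0) <= (\<Sum>k<4 + n. f k)"
    unfolding sum.If_cases[OF finite_lessThan] using f0 by (simp, intro sum_mono2) auto
  also have "(\<Sum>k<4 + n. f k) = (\<Sum>k<4. f k) + (\<Sum>k<n. f (4 + k))"
  proof (induction n)
    case (Suc n)
    have "4 + Suc n = Suc (4 + n)" by simp
    thus ?case using Suc by (simp only: sum.lessThan_Suc add.assoc)
  qed simp
  also have "... = 4 + ?D * (\<Sum>k<n. \<Phi> k x)" by (simp add: f_def sum_distrib_left)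
  also have "... <= 4 + ?D * 1" using x(2) by (intro add_left_mono mult_left_mono) (auto simp: U_def min_def split: if_splits)
  finally show ?thesis by (simp add: mult_left_mono)
qed

lemma ball_measure_measurable:
  assumes "sigma_finite_measure M" "sets M = sets \<mu>"
  shows "(%x. emeasure M (ball x \<rho>)) \<in> bmeas"
proof -
  have eq: "(%x. emeasure M (Pair x -` {(x, y). dist x y < \<rho>})) = (%x. emeasure M (ball x \<rho>))"
    by (intro ext arg_cong[where f = "emeasure M"]) auto
  show ?thesis
    unfolding eq[symmetric] by (rule sigma_finite_measure.measurable_emeasure_Pair[OF assms(1) dist_less_measurable[OF dense assms(2)]])
qed

lemma fubini_ball:
  assumes f[measurable]: "f \<in> bmeas"
  shows "(\<integral>\<^sup>+x. f x * emeasure \<nu> (ball x \<rho>) \<partial>\<mu>) = (\<integral>\<^sup>+y. (\<integral>\<^sup>+x\<in>ball y \<rho>. f x \<partial>\<mu>) \<partial>\<nu>)"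
proof -
  interpret P: pair_sigma_finite \<mu> \<nu> ..
  let ?Q = "{(x, y). dist x y < \<rho>}"
  have [measurable]: "?Q \<in> sets (\<mu> \<Otimes>\<^sub>M \<nu>)" by (rule dist_less_measurable[OF dense sets_\<nu>])
  have "(%z. f (fst z) * indicator ?Q z) \<in> borel_measurable (\<mu> \<Otimes>\<^sub>M \<nu>)" by measurable
  from P.Fubini[OF this]
  have "(\<integral>\<^sup>+y. (\<integral>\<^sup>+x. f x * indicator ?Q (x, y) \<partial>\<mu>) \<partial>\<nu>) = (\<integral>\<^sup>+x. (\<integral>\<^sup>+y. f x * indicator ?Q (x, y) \<partial>\<nu>) \<partial>\<mu>)" by simp
  moreover have "(\<integral>\<^sup>+y. f x * indicator ?Q (x, y) \<partial>\<nu>) = f x * emeasure \<nu> (ball x \<rho>)" for x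
  proof -
    have "(\<integral>\<^sup>+y. f x * indicator ?Q (x, y) \<partial>\<nu>) = (\<integral>\<^sup>+y. f x * indicator (ball x \<rho>) y \<partial>\<nu>)"
      by (intro nn_integral_cong) (simp add: indicator_def)
    thus ?thesis by (simp add: nn_integral_cmult_indicator sets_\<nu>)
  qed
  moreover have "(\<integral>\<^sup>+x. f x * indicator ?Q (x, y) \<partial>\<mu>) = (\<integral>\<^sup>+x\<in>ball y \<rho>. f x \<partial>\<mu>)" for y
    by (intro nn_integral_cong) (simp add: indicator_def dist_commute)
  ultimately show ?thesis by simp
qed

lemma m_measurable [measurable]: "(%x. m x \<rho>) \<in> bmeas"
proof -
  have "(%x. emeasure \<mu> (ball x \<rho>)) \<in> bmeas" by (rule ball_measure_measurable[OF sigma_finite_measure_axioms refl])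
  thus ?thesis unfolding measure_def by (rule measurable_compose) simp
qed

lemma B_measurable: "B k \<in> borel_measurable \<nu>"
proof -
  define S where "S = (\<Union>x\<in>{x. U k x < 1}. ball x (4 * rad k))"
  have S: "S \<in> sets \<mu>" unfolding S_def by (intro borel_sets borel_open) auto
  have [measurable]: "(%y. measure \<nu> (ball y (8 * rad k))) \<in> bmeas"
    using ball_measure_measurable[OF \<nu>.sigma_finite_measure_axioms sets_\<nu>] unfolding measure_def
    by (rule measurable_compose) simp
  have w: "(%y. wf y (rad k) (8 * rad k)) \<in> bmeas" unfolding wf_def by measurable
  have "B k = (%y. (CD ^ 4) powr (1 / (p - 1)) * wf y (rad k) (8 * rad k) * indicator S y)"
    by (auto simp: fun_eq_iff B_def S_def dist_commute split: split_indicator)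
  thus ?thesis unfolding measurable_cong_sets[OF sets_\<nu> refl] using w borel_measurable_indicator[OF S, where 'b = real] by simp
qed

text \<open>The denominator is the measure of the ball about \<open>x\<close>, as Fubini produces
  it; doubling moves it to \<open>y\<close> at the cost of \<open>CD\<close>.\<close>

lemma average_le_B:
  assumes "k <= j"
  shows "(\<integral>\<^sup>+x\<in>ball y (4 * rad j). ennreal (rad k * c k x / m x (4 * rad j)) \<partial>\<mu>) <= ennreal (CD * B k y)"
proof -
  define \<rho> where "\<rho> = 4 * rad j"
  have \<rho>: "0 < \<rho>" using rad(1)[of j] by (simp add: \<rho>_def)
  have mp: "0 < m y \<rho>" by (rule m_pos[OF \<rho>])
  have B0: "0 <= B k y" by (simp add: B_def wf_nonneg)
  have "(\<integral>\<^sup>+x\<in>ball y \<rho>. ennreal (rad k * c k x / m x \<rho>) \<partial>\<mu>) <= (\<integral>\<^sup>+x. ennreal (CD * B k y / m y \<rho>) * indicator (ball y \<rho>) x \<partial>\<mu>)"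
  proof (intro nn_integral_mono)
    fix x
    show "ennreal (rad k * c k x / m x \<rho>) * indicator (ball y \<rho>) x <= ennreal (CD * B k y / m y \<rho>) * indicator (ball y \<rho>) x"
    proof (cases "x \<in> ball y \<rho>")
      case True
      have xk: "x \<in> ball y (4 * rad k)" using True rad(4)[OF assms] by (simp add: \<rho>_def)
      have "rad k * c k x <= B k y"
      proof (cases "U k x < 1")
        case True
        hence "B k y = (CD ^ 4) powr (1 / (p - 1)) * wf y (rad k) (8 * rad k)" using xk by (auto simp: B_def)
        thus ?thesis using hr_le_near[OF xk] True rad(1)[of k] by (simp add: c_def field_simps)
      qed (simp add: c_def B0)
      moreover have "1 / m x \<rho> <= CD / m y \<rho>"
      proof -
        have "ball y \<rho> \<subseteq> ball x (2 ^ 1 * \<rho>)" using True by (intro ball_subsetI) (simp add: dist_commute)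
        from m_le[OF \<rho> this] show ?thesis using mp m_pos[OF \<rho>, of x] by (simp add: divide_simps mult.commute)
      qed
      ultimately have "rad k * c k x * (1 / m x \<rho>) <= B k y * (CD / m y \<rho>)" using B0 by (intro mult_mono) auto
      thus ?thesis using True by (simp add: ennreal_leI mult.commute)
    qed simp
  qed
  also have "... = ennreal (CD * B k y / m y \<rho>) * ennreal (m y \<rho>)" by (simp add: nn_integral_cmult_indicator emeasure_ball)
  also have "... = ennreal (CD * B k y)" using mp B0 CD1 by (simp add: ennreal_mult'[symmetric])
  finally show ?thesis by (simp add: \<rho>_def)
qed

text \<open>If the Wolff series diverges at \<open>x\<close>, so does the sum of the
  \<open>\<Phi> k x\<close>, each of which dominates the next finer term, and some
  \<open>U K x\<close> equals 1. The two summands \<open>e\<close> bound the energies of the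
  supremum of the \<open>U K\<close> and of its gradient.\<close>

lemma capt_wolff:
  assumes fin: "!!K. En (%x. \<Sum>k<K. ennreal (c k x)) <= e" and e: "e < \<infinity>"
  shows "capt {x. \<not> summable (%k. wf x (rad k) (rad k))} (e + e)"
proof -
  define G where "G K x = (\<Sum>k<K. ennreal (c k x))" for K x
  have Gm[measurable]: "G K \<in> bmeas" for K unfolding G_def by measurable
  have "incseq (%K x. ennpowr (G K x) p)" unfolding G_def by (intro monoI le_funI ennpowr_mono sum_mono2 p0) auto
  hence "(\<integral>\<^sup>+x. (SUP K. ennpowr (G K x) p) \<partial>\<mu>) = (SUP K. En (G K))"
    unfolding En_def by (intro nn_integral_monotone_convergence_SUP) auto
  also have "... <= e" using fin unfolding G_def by (intro SUP_least)
  finally have "(\<integral>\<^sup>+x. (SUP K. ennpowr (G K x) p) \<partial>\<mu>) <= e" .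
  hence EG: "En (%x. SUP K. G K x) <= e" unfolding En_def by (rule order_trans[rotated]) (intro nn_integral_mono ennpowr_SUP_le p0)
  have GK: "G K = (%x. \<Sum>k<K. ennreal (c k x))" for K by (simp add: G_def fun_eq_iff)
  have npK: "npair (U K) (G K)" for K unfolding npair_def GK using U_range rwug_U[of K] le_less_trans[OF fin[of K] e] by simp
  have np: "npair (%x. SUP K. U K x) (%x. SUP K. G K x)" by (rule npair_SUP[OF npK le_less_trans[OF EG e]])
  have bdd: "bdd_above (range (%K. U K x))" for x using U_range by (intro bdd_aboveI[of _ 1]) auto
  have "ennreal (SUP K. U K x) <= (SUP K. G K x)" for x
  proof -
    have "(SUP K. U K x) <= t" if t: "(SUP K. G K x) = ennreal t" "0 <= t" for t
    proof (rule cSUP_least)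
      fix K
      have "ennreal (U K x) <= ennreal (\<Sum>k<K. c k x)" by (intro ennreal_leI U_le)
      also have "... = G K x" unfolding G_def using c by (simp add: sum_ennreal)
      also have "... <= ennreal t" unfolding t(1)[symmetric] by (rule SUP_upper) simp
      finally show "U K x <= t" using t(2) by simp
    qed simp
    thus ?thesis
    proof (cases "SUP K. G K x")
      case (real t)
      thus ?thesis using \<open>!!t. _ ==> _ ==> (SUP K. U K x) <= t\<close>[of t] by (simp only: ennreal_leI)
    qed (simp only: top_greatest)
  qed
  hence "En (%x. ennreal (SUP K. U K x)) <= En (%x. SUP K. G K x)" by (rule En_mono)
  hence "energy (%x. SUP K. U K x) (%x. SUP K. G K x) <= e + e" using EG by (intro add_mono) auto
  moreover have "(SUP K. U K x) = 1" if ns: "\<not> summable (%k. wf x (rad k) (rad k))" for x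
  proof -
    have "\<exists>K. U K x = 1"
    proof (rule ccontr)
      assume "\<nexists>K. U K x = 1"
      hence "U K x ~= 1" for K by blast
      hence "(\<Sum>k<K. \<Phi> k x) <= 1" for K by (rule contrapos_np[of "U K x = 1"]) (simp add: U_def)
      hence "summable (%k. \<Phi> k x)" by (intro summableI_nonneg_bounded \<Phi>_nonneg)
      hence s: "summable (%k. (CD ^ 2) powr (1 / (p - 1)) * \<Phi> k x)" by (rule summable_mult)
      have le: "wf x (rad (Suc k)) (rad (Suc k)) <= (CD ^ 2) powr (1 / (p - 1)) * \<Phi> k x" for k
      proof -
        obtain n where n: "d n \<in> ball x (rad (Suc k))" using dense[OF rad(1)] by blast
        have "wf x (rad (Suc k)) (rad (Suc k)) <= (CD ^ 2) powr (1 / (p - 1)) * wf (d n) (rad k) (rad k)"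
        proof (rule wf_le)
          show "ball x (rad (Suc k)) \<subseteq> ball (d n) (rad k)" "ball (d n) (rad k) \<subseteq> ball x (2 ^ 2 * rad (Suc k))"
            using n rad(1)[of k] by (auto intro!: ball_subsetI simp: dist_commute rad(3))
        qed (use rad(1)[of k] in \<open>auto simp: rad(3)\<close>)
        also have "... <= (CD ^ 2) powr (1 / (p - 1)) * \<Phi> k x"
          using \<Phi>_ge[of n x k] n rad(1)[of k] by (intro mult_left_mono) (auto simp: a_def rad(3))
        finally show ?thesis .
      qed
      have "summable (%k. wf x (rad (Suc k)) (rad (Suc k)))"
        using le by (intro summable_comparison_test'[OF s, of 0]) (simp add: wf_nonneg)
      thus False using ns summable_Suc_iff[of "%k. wf x (rad k) (rad k)"] by simp
    qed
    then obtain K where "U K x = 1" ..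
    hence "1 <= (SUP K. U K x)" using cSUP_upper[OF UNIV_I bdd, of K x] by simp
    moreover have "(SUP K. U K x) <= 1" by (rule cSUP_least) (auto simp: U_range)
    ultimately show ?thesis by simp
  qed
  ultimately show ?thesis unfolding capt_def using np by blast
qed

text \<open>Expanding the \<open>p\<close>-th power by \<open>powr_sum_le\<close> leaves a factor
  \<open>c k\<close> and a factor \<open>c j powr (p - 1)\<close>, the latter bounded linearly in
  \<open>\<nu>\<close>. Fubini turns the integral into one of the sum of the \<open>B k\<close>
  against \<open>\<nu>\<close>, and by \<open>sum_B\<close> the energy is at most a constant times
  the total mass.\<close>

lemma energy_le:
  assumes C0: "0 < C0" and C: "!!c K. (!!j. 0 <= c j) ==>
    (\<Sum>j<K. c j) powr p <= C0 * (\<Sum>k<K. \<Sum>j=k..<K. sqrt 2 ^ (j - k) * (c k * c j powr (p - 1)))"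
  shows "En (%x. \<Sum>k<K. ennreal (c k x)) <=
    ennreal (C0 * CD ^ 3 * (CD / (1 - sqrt 2 / 2) * ((CD ^ 4) powr (1 / (p - 1)) * (4 + (CD ^ 2) powr (1 / (p - 1))))) * measure \<nu> UNIV)"
proof -
  \<comment> \<open>The weight \<open>sqrt 2 ^ (j - k)\<close> is more than compensated by
    \<open>rad j = rad k / 2 ^ (j - k)\<close>, which leaves the summable factor
    \<open>\<beta> ^ (j - k)\<close>.\<close>
  define \<beta> where "\<beta> = sqrt 2 / 2"
  have \<beta>: "0 < \<beta>" "\<beta> < 1" using sqrt2_less_2 by (auto simp: \<beta>_def)
  define A where "A = C0 * CD ^ 3"
  have A: "0 < A" using C0 CD1 by (simp add: A_def)
  define C3 where "C3 = (CD ^ 4) powr (1 / (p - 1)) * (4 + (CD ^ 2) powr (1 / (p - 1)))"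
  define S where "S = (SIGMA k:{..<K}. {k..<K})"
  define e where "e z x = ennreal (rad (fst z) * c (fst z) x / m x (4 * rad (snd z)))" for z x
  define w where "w z = A * \<beta> ^ (snd z - fst z)" for z :: "nat \<times> nat"
  have w: "0 <= w z" for z using A \<beta> by (simp add: w_def)
  have em[measurable]: "e z \<in> bmeas" for z unfolding e_def by measurable
  have pt: "ennpowr (\<Sum>k<K. ennreal (c k x)) p <= (\<Sum>z\<in>S. ennreal (w z) * (e z x * emeasure \<nu> (ball x (4 * rad (snd z)))))" for x
  proof -
    have "(\<Sum>k<K. c k x) powr p <= C0 * (\<Sum>k<K. \<Sum>j=k..<K. sqrt 2 ^ (j - k) * (c k x * c j x powr (p - 1)))"
      by (rule C) (rule c)
    also have "... <= C0 * (\<Sum>k<K. \<Sum>j=k..<K. CD ^ 3 * \<beta> ^ (j - k) * (rad k * c k x / m x (4 * rad j) * measure \<nu> (ball x (4 * rad j))))"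
    proof (intro mult_left_mono sum_mono)
      fix k j assume j: "j \<in> {k..<K}"
      define V where "V = measure \<nu> (ball x (4 * rad j)) / m x (4 * rad j)"
      have "c j x powr (p - 1) <= hr j x powr (p - 1)" using c p1 by (intro powr_mono2) auto
      also have "... <= CD ^ 3 * (rad j * V)" unfolding V_def by (rule hr_powr)
      finally have "sqrt 2 ^ (j - k) * (c k x * c j x powr (p - 1)) <= sqrt 2 ^ (j - k) * (c k x * (CD ^ 3 * (rad j * V)))"
        using c by (intro mult_left_mono) auto
      also have "rad j = rad k / 2 ^ (j - k)" using j power_add[of 2 k "j - k"] by (simp add: rad_def)
      also have "sqrt 2 ^ (j - k) * (c k x * (CD ^ 3 * (rad k / 2 ^ (j - k) * V))) = CD ^ 3 * \<beta> ^ (j - k) * (rad k * c k x * V)"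
        by (simp add: \<beta>_def power_divide)
      finally show "sqrt 2 ^ (j - k) * (c k x * c j x powr (p - 1)) <= CD ^ 3 * \<beta> ^ (j - k) * (rad k * c k x / m x (4 * rad j) * measure \<nu> (ball x (4 * rad j)))"
        by (simp add: V_def)
    qed (use C0 in auto)
    also have "... = (\<Sum>k<K. \<Sum>j=k..<K. A * \<beta> ^ (j - k) * (rad k * c k x / m x (4 * rad j) * measure \<nu> (ball x (4 * rad j))))"
      by (simp add: sum_distrib_left A_def mult_ac)
    also have "... = (\<Sum>z\<in>S. w z * (rad (fst z) * c (fst z) x / m x (4 * rad (snd z)) * measure \<nu> (ball x (4 * rad (snd z)))))"
      unfolding S_def w_def by (simp add: sum.Sigma split_def)
    finally have "ennreal ((\<Sum>k<K. c k x) powr p) <= ennreal (\<Sum>z\<in>S. w z * (rad (fst z) * c (fst z) x / m x (4 * rad (snd z)) * measure \<nu> (ball x (4 * rad (snd z)))))"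
      by (rule ennreal_leI)
    also have "... = (\<Sum>z\<in>S. ennreal (w z * (rad (fst z) * c (fst z) x / m x (4 * rad (snd z)) * measure \<nu> (ball x (4 * rad (snd z))))))"
      using w c(1) rad(1) by (intro sum_ennreal[symmetric] mult_nonneg_nonneg divide_nonneg_nonneg) (auto intro: less_imp_le)
    also have "... = (\<Sum>z\<in>S. ennreal (w z) * (e z x * emeasure \<nu> (ball x (4 * rad (snd z)))))"
    proof (intro sum.cong refl)
      fix z
      have "0 <= rad (fst z) * c (fst z) x / m x (4 * rad (snd z))" using c(1) rad(1)[of "fst z"] by simp
      thus "ennreal (w z * (rad (fst z) * c (fst z) x / m x (4 * rad (snd z)) * measure \<nu> (ball x (4 * rad (snd z)))))
        = ennreal (w z) * (e z x * emeasure \<nu> (ball x (4 * rad (snd z))))"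
        unfolding e_def \<nu>.emeasure_eq_measure by (simp only: ennreal_mult'[OF w] ennreal_mult')
    qed
    finally show ?thesis using c by (simp add: sum_ennreal sum_nonneg ennpowr_ennreal)
  qed
  have \<nu>m: "(%x. emeasure \<nu> (ball x \<rho>)) \<in> bmeas" for \<rho>
    by (rule ball_measure_measurable[OF \<nu>.sigma_finite_measure_axioms sets_\<nu>])
  have "En (%x. \<Sum>k<K. ennreal (c k x)) <= (\<integral>\<^sup>+x. (\<Sum>z\<in>S. ennreal (w z) * (e z x * emeasure \<nu> (ball x (4 * rad (snd z))))) \<partial>\<mu>)"
    unfolding En_def by (intro nn_integral_mono pt)
  also have "... = (\<Sum>z\<in>S. ennreal (w z) * (\<integral>\<^sup>+x. e z x * emeasure \<nu> (ball x (4 * rad (snd z))) \<partial>\<mu>))"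
    using \<nu>m by (subst nn_integral_sum) (auto intro!: sum.cong nn_integral_cmult borel_measurable_times_ennreal)
  also have "... <= (\<Sum>z\<in>S. ennreal (w z) * (\<integral>\<^sup>+y. ennreal (CD * B (fst z) y) \<partial>\<nu>))"
    unfolding fubini_ball[OF em] unfolding e_def by (intro sum_mono mult_left_mono nn_integral_mono average_le_B) (auto simp: S_def)
  also have "... = (\<integral>\<^sup>+y. (\<Sum>z\<in>S. ennreal (w z) * ennreal (CD * B (fst z) y)) \<partial>\<nu>)"
    using B_measurable by (subst nn_integral_sum) (auto intro!: sum.cong nn_integral_cmult[symmetric])
  also have "... <= (\<integral>\<^sup>+y. ennreal (A * (CD / (1 - \<beta>) * C3)) \<partial>\<nu>)"
  proof (rule nn_integral_mono)
    fix y
    have B0: "0 <= B k y" for k by (simp add: B_def wf_nonneg)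
    have "(\<Sum>z\<in>S. w z * (CD * B (fst z) y)) = (\<Sum>k<K. \<Sum>j=k..<K. A * \<beta> ^ (j - k) * (CD * B k y))"
      unfolding S_def w_def by (simp add: sum.Sigma split_def)
    also have "... = (\<Sum>k<K. A * CD * B k y * (\<Sum>j=k..<K. \<beta> ^ (j - k)))" by (simp add: sum_distrib_left mult_ac)
    also have "... <= (\<Sum>k<K. A * CD * B k y * (1 / (1 - \<beta>)))" using A CD1 B0 by (intro sum_mono mult_left_mono geometric_tail_le[OF \<beta>]) auto
    also have "... = A * CD / (1 - \<beta>) * (\<Sum>k<K. B k y)" by (simp add: sum_distrib_left)
    also have "... <= A * CD / (1 - \<beta>) * C3" unfolding C3_def using A CD1 \<beta> by (intro mult_left_mono sum_B) auto
    finally have "ennreal (\<Sum>z\<in>S. w z * (CD * B (fst z) y)) <= ennreal (A * (CD / (1 - \<beta>) * C3))" by (simp add: ennreal_leI)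
    moreover have "ennreal (\<Sum>z\<in>S. w z * (CD * B (fst z) y)) = (\<Sum>z\<in>S. ennreal (w z) * ennreal (CD * B (fst z) y))"
      using w B0 CD1 by (subst sum_ennreal[symmetric]) (auto simp: ennreal_mult')
    ultimately show "(\<Sum>z\<in>S. ennreal (w z) * ennreal (CD * B (fst z) y)) <= ennreal (A * (CD / (1 - \<beta>) * C3))" by simp
  qed
  also have "... = ennreal (A * (CD / (1 - \<beta>) * C3) * measure \<nu> UNIV)"
  proof -
    have sp: "space \<nu> = UNIV" using sets_eq_imp_space_eq[OF sets_\<nu>] by simp
    show ?thesis by (simp only: nn_integral_const sp \<nu>.emeasure_eq_measure ennreal_mult''[OF measure_nonneg])
  qed
  finally show ?thesis by (simp only: A_def \<beta>_def C3_def)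
qed

end

section \<open>Finiteness quasieverywhere of the Wolff potential of an energy measure\<close>

context doubling_space
begin

lemma nug_cmult:
  assumes g: "g \<in> bmeas" "En g < \<infinity>" and t: "0 <= t" and S: "S \<in> sets \<mu>"
  shows "measure (nug (%x. ennreal t * g x)) S = t powr p * measure (nug g) S"
proof -
  note [measurable] = g(1) S
  have "emeasure (nug (%x. ennreal t * g x)) S = (\<integral>\<^sup>+x. ennreal (t powr p) * (ennpowr (g x) p * indicator S x) \<partial>\<mu>)"
    using p0 t by (subst emeasure_nug) (auto simp: ennpowr_cmult mult.assoc)
  also have "... = ennreal (t powr p) * emeasure (nug g) S" by (subst nn_integral_cmult) (auto simp: emeasure_nug)
  finally show ?thesis by (simp add: measure_def enn2real_mult)
qed

text \<open>The energy bound for the competitor is linear in the measure, while dividing the measure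
  by \<open>M\<close> does not change the set where the series diverges; so the capacity of this set
  is arbitrarily small. To have a concentrated measure, \<open>g\<close> is first set to 0 outside
  \<open>ball z0 N\<close>, which changes nothing on balls of radius at most 1 about points well
  inside.\<close>

lemma capnull_wolff:
  assumes g: "g \<in> bmeas" "En g < \<infinity>"
  shows "capnull {x. \<not> summable (%k. wolff g x k)}"
proof -
  obtain d :: "nat => 'a" where d: "!!x r. 0 < r ==> \<exists>n. d n \<in> ball x r" by (rule dense_sequence) blast
  define z0 where "z0 = d 0"
  have b: "1 < sqrt 2" by simp
  obtain C0 where C0: "0 < C0" "!!c K. (!!j. 0 <= c j) ==>
    (\<Sum>j<K. c j) powr p <= C0 * (\<Sum>k<K. \<Sum>j=k..<K. sqrt 2 ^ (j - k) * (c k * c j powr (p - 1)))"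
    by (rule powr_sum_le[OF p1 b]) blast
  define C where "C = C0 * CD ^ 3 * (CD / (1 - sqrt 2 / 2) * ((CD ^ 4) powr (1 / (p - 1)) * (4 + (CD ^ 2) powr (1 / (p - 1)))))"
  have C: "0 <= C" unfolding C_def using C0(1) CD1 sqrt2_less_2 by (intro mult_nonneg_nonneg divide_nonneg_nonneg) auto
  define s where "s = 1 / (p - 1)"
  define gN where "gN N x = (if x \<in> ball z0 (real N) then g x else 0)" for N :: nat and x
  note [measurable] = g(1) ball_sets
  have gNm[measurable]: "gN N \<in> bmeas" for N unfolding gN_def by measurable
  have gNE: "En (gN N) < \<infinity>" for N by (rule le_less_trans[OF En_mono g(2)]) (simp add: gN_def)
  define Z where "Z N = {x. \<not> summable (%k. wolff (gN N) x k)}" for N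
  have null: "capnull (Z N)" for N unfolding capnull_def
  proof (intro allI impI)
    fix e :: real assume e: "0 < e"
    have concN: "nugb (gN N) y r = 0" if "real N + r <= dist z0 y" for y r
    proof -
      have "gN N x = 0" if "x \<in> ball y r" for x
        using that \<open>real N + r <= dist z0 y\<close> dist_triangle[of z0 y x] by (simp add: gN_def dist_commute)
      hence "(\<integral>\<^sup>+x\<in>ball y r. ennpowr (gN N x) p \<partial>\<mu>) = (\<integral>\<^sup>+x. 0 \<partial>\<mu>)"
        using p0 by (intro nn_integral_cong) (auto split: split_indicator)
      thus ?thesis by (simp add: measure_def emeasure_nug)
    qed
    have "\<exists>A\<ge>0. \<forall>y. nugb (gN N) y (8 / 2 ^ i) <= A * m y (8 / 2 ^ i)" for i :: nat
      by (rule measure_ratio_bounded[OF finite_nug[OF gNm gNE] sets_nug concN, where \<rho> = "8 / 2 ^ i"]) auto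
    hence "\<forall>i::nat. \<exists>A\<ge>0. \<forall>y. nugb (gN N) y (8 / 2 ^ i) <= A * m y (8 / 2 ^ i)" by blast
    from choice[OF this] obtain A where A: "!!i. 0 <= A i" "!!i::nat. !!y. nugb (gN N) y (8 / 2 ^ i) <= A i * m y (8 / 2 ^ i)" by blast
    \<comment> \<open>The sum of the \<open>A i\<close> secures \<open>small\<close> on the four
      coarse scales, the last summand makes the capacity bound at most \<open>e\<close>, and the
      first gives \<open>1 <= M\<close>.\<close>
    define M where "M = 1 + (\<Sum>i<4. A i) + 2 * C * measure (nug (gN N)) UNIV / e"
    have M: "1 <= M" unfolding M_def using A(1) C e by (simp add: sum_nonneg)
    define t where "t = (1 / M) powr (1 / p)"
    have t: "0 < t" "t powr p = 1 / M" using M p0 by (auto simp: t_def powr_powr)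
    define \<nu> where "\<nu> = nug (%x. ennreal t * gN N x)"
    have tE: "En (%x. ennreal t * gN N x) < \<infinity>" using t gNE[of N] by (subst En_cmult) (auto simp: ennreal_mult_less_top)
    have \<nu>: "measure \<nu> S = 1 / M * measure (nug (gN N)) S" if "S \<in> sets \<mu>" for S
      unfolding \<nu>_def t(2)[symmetric] using t that by (intro nug_cmult gNE) auto
    have fin: "finite_measure \<nu>" unfolding \<nu>_def using tE by (intro finite_nug) auto
    interpret wolff_space p \<mu> \<nu> CD d z0 "real N"
    proof (intro wolff_space.intro doubling_space_axioms fin wolff_space_axioms.intro d)
      show "sets \<nu> = sets \<mu>" by (simp add: \<nu>_def)
      show "measure \<nu> (ball y r) = 0" if "real N + r <= dist z0 y" for y r using concN[OF that] \<nu> by simp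
      show "(1 / 2 ^ i) powr p * measure \<nu> (ball y (8 / 2 ^ i)) <= m y (8 / 2 ^ i)" if "i < 4" for i y
      proof -
        have "A i <= (\<Sum>i<4. A i)" using that A(1) by (intro member_le_sum) auto
        hence "A i <= M" unfolding M_def using C e by (simp add: add_increasing2)
        hence "nugb (gN N) y (8 / 2 ^ i) <= M * m y (8 / 2 ^ i)"
          using A(2)[of y i] mult_right_mono[of "A i" M "m y (8 / 2 ^ i)"] by simp
        hence "measure \<nu> (ball y (8 / 2 ^ i)) <= m y (8 / 2 ^ i)" using M by (simp add: \<nu> divide_le_eq mult.commute)
        moreover have "(1 / 2 ^ i) powr p <= 1" using p0 by (intro powr_le1) auto
        ultimately show ?thesis using mult_mono[of "(1 / 2 ^ i) powr p" 1 "measure \<nu> (ball y (8 / 2 ^ i))" "m y (8 / 2 ^ i)"] by simp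
      qed
    qed
    have "capt {x. \<not> summable (%k. wf x (rad k) (rad k))} (ennreal (C * measure \<nu> UNIV) + ennreal (C * measure \<nu> UNIV))"
      unfolding C_def by (rule capt_wolff[OF energy_le[OF C0]]) auto
    moreover have "wf x (rad k) (rad k) = (1 / M) powr s * wolff (gN N) x k" for x k
      unfolding wf_def rad_def s_def using M by (simp add: \<nu> powr_mult[symmetric])
    hence "{x. \<not> summable (%k. wf x (rad k) (rad k))} = Z N" using M by (simp add: Z_def summable_cmult_iff)
    moreover have "ennreal (C * measure \<nu> UNIV) + ennreal (C * measure \<nu> UNIV) <= ennreal e"
    proof -
      have "2 * C * measure (nug (gN N)) UNIV / e <= M" unfolding M_def using A(1) by (simp add: sum_nonneg)
      hence "2 * C * measure \<nu> UNIV <= e" using e M sets.top[of \<mu>] by (simp add: \<nu> field_simps)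
      thus ?thesis using C by (simp add: ennreal_plus[symmetric] ennreal_leI del: ennreal_plus)
    qed
    ultimately show "capt (Z N) (ennreal e)" using capt_mono by auto
  qed
  have "{x. \<not> summable (%k. wolff g x k)} \<subseteq> (\<Union>N. Z N)"
  proof
    fix x assume x: "x \<in> {x. \<not> summable (%k. wolff g x k)}"
    obtain N :: nat where N: "dist z0 x + 1 <= real N" using real_arch_simple by blast
    have "nugb (gN N) x (1 / 2 ^ k) = nugb g x (1 / 2 ^ k)" for k :: nat
    proof -
      have "(1 / 2 ^ k :: real) <= 1" by simp
      hence "dist z0 x + 1 / 2 ^ k <= real N" using N by linarith
      hence "ball x (1 / 2 ^ k) \<subseteq> ball z0 (real N)" by (rule ball_subsetI)
      hence "(\<integral>\<^sup>+y\<in>ball x (1 / 2 ^ k). ennpowr (gN N y) p \<partial>\<mu>) = (\<integral>\<^sup>+y\<in>ball x (1 / 2 ^ k). ennpowr (g y) p \<partial>\<mu>)"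
        by (intro nn_integral_cong) (auto simp: gN_def subset_eq split: split_indicator)
      thus ?thesis by (simp add: measure_def emeasure_nug)
    qed
    hence "x \<in> Z N" using x by (simp add: Z_def)
    thus "x \<in> (\<Union>N. Z N)" by blast
  qed
  thus ?thesis by (rule capnull_subset[OF capnull_UN[OF null]])
qed

end

section \<open>Capacity estimates and thinness\<close>

context pi_space
begin

text \<open>The function \<open>2 * v - 1\<close>, cut at 0, is still 1 on the set but vanishes
  where \<open>v <= 1/2\<close>. After cutting off in \<open>ball x (2 * r)\<close>, the slope
  \<open>1 / r\<close> of the cutoff is therefore charged only where \<open>v > 1/2\<close>.\<close>

lemma cap_cutoff:
  assumes np: "npair v g" and r: "0 < r" and one: "!!y. y \<in> A \<inter> ball x r ==> v y = 1"
  shows "vcap (A \<inter> ball x r) (ball x (2 * r)) <=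
    ennreal (2 powr p) * emeasure (nug g) (ball x (2 * r)) + ennreal (r powr (- p)) * emeasure \<mu> ({y. 1/2 < v y} \<inter> ball x (2 * r))"
proof -
  note [measurable] = npairD(1,6)[OF np] cutoff(2)[OF r]
  define k where "k y = max 0 (2 * v y - 1)" for y
  define f where "f y = min (k y) (cutoff x r y)" for y
  define G where "G y = (if f y = 0 then 0 else if k y <= cutoff x r y then ennreal 2 * g y
    else if cutoff x r y = 0 then 0 else ennreal (1 / r))" for y
  have km[measurable]: "k \<in> bmeas" unfolding k_def by measurable
  have fm[measurable]: "f \<in> bmeas" unfolding f_def by measurable
  have rk: "rwug k (%y. ennreal 2 * g y)" unfolding k_def by (rule rwug_lipschitz_comp[OF npairD(4)[OF np]]) (auto simp: max_def abs_if)
  have rf: "rwug f G" unfolding G_def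
    by (rule rwug_locality[OF _ fm]) (unfold f_def, rule rwug_min[OF rk cutoff(1)[OF r] km cutoff(2)[OF r]])
  define S where "S = {y. 1/2 < v y} \<inter> ball x (2 * r)"
  have "{y \<in> space \<mu>. 1/2 < v y} \<in> sets \<mu>" by measurable
  hence S[measurable]: "S \<in> sets \<mu>" unfolding S_def by (intro sets.Int ball_sets) simp
  have f0: "y \<in> ball x (2 * r)" "y \<in> S" if "f y ~= 0" for y
  proof -
    have "cutoff x r y ~= 0" using that by (auto simp: f_def k_def)
    thus "y \<in> ball x (2 * r)" by (rule cutoff(6)[OF r])
    moreover have "k y ~= 0" using that cutoff(3)[OF r, of x y] by (auto simp: f_def)
    ultimately show "y \<in> S" by (auto simp: S_def k_def)
  qed
  have "En G <= (\<integral>\<^sup>+y. ennreal (2 powr p) * (ennpowr (g y) p * indicator (ball x (2 * r)) y) + ennreal (r powr (- p)) * indicator S y \<partial>\<mu>)"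
    unfolding En_def
  proof (rule nn_integral_mono)
    fix y
    show "ennpowr (G y) p <= ennreal (2 powr p) * (ennpowr (g y) p * indicator (ball x (2 * r)) y) + ennreal (r powr (- p)) * indicator S y"
    proof (cases "f y = 0")
      case False
      have "ennpowr (2 * g y) p = ennreal (2 powr p) * ennpowr (g y) p" using ennpowr_cmult[of 2 "g y" p] by simp
      moreover have "ennpowr (ennreal (1 / r)) p = ennreal (r powr (- p))"
        using r by (simp add: ennpowr_ennreal powr_divide powr_minus_divide)
      ultimately show ?thesis using False f0[OF False] p0 by (simp add: G_def)
    qed (use p0 in \<open>simp add: G_def\<close>)
  qed
  also have "... = (\<integral>\<^sup>+y. ennreal (2 powr p) * (ennpowr (g y) p * indicator (ball x (2 * r)) y) \<partial>\<mu>) + (\<integral>\<^sup>+y. ennreal (r powr (- p)) * indicator S y \<partial>\<mu>)"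
    by (intro nn_integral_add borel_measurable_times_ennreal borel_measurable_indicator ball_sets S ennpowr_mu npairD(6)[OF np]) auto
  also have "... = ennreal (2 powr p) * emeasure (nug g) (ball x (2 * r)) + ennreal (r powr (- p)) * emeasure \<mu> S"
    by (simp add: nn_integral_cmult_indicator, subst nn_integral_cmult)
      (auto simp: emeasure_nug intro!: borel_measurable_times_ennreal borel_measurable_indicator)
  finally have EG: "En G <= ..." .
  have "emeasure \<mu> S < \<infinity>" by (rule emeasure_subset_ball[of _ x "2 * r"]) (auto simp: S_def)
  moreover have "emeasure (nug g) (ball x (2 * r)) < \<infinity>"
    using finite_measure.emeasure_finite[OF finite_nug[OF npairD(6,5)[OF np]], of "ball x (2 * r)"] by (simp add: less_top)
  ultimately have "ennreal (2 powr p) * emeasure (nug g) (ball x (2 * r)) + ennreal (r powr (- p)) * emeasure \<mu> S < \<infinity>"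
    by (simp add: ennreal_mult_less_top)
  hence "En G < \<infinity>" by (rule le_less_trans[OF EG])
  hence npf: "npair f G" unfolding npair_def using rf npairD(3)[OF np] cutoff(3,4)[OF r] by (auto simp: f_def k_def min_le_iff_disj)
  have "En (%y. ennreal (f y)) <= En (%y. ennreal 1 * indicator (ball x (2 * r)) y)"
  proof (rule En_mono)
    fix y
    show "ennreal (f y) <= ennreal 1 * indicator (ball x (2 * r)) y" using f0(1)[of y] npairD(3)[OF npf, of y] by (cases "f y = 0") auto
  qed
  also have "... < \<infinity>" by (subst En_const_ball) (auto simp: emeasure_ball)
  finally have "vcap (A \<inter> ball x r) (ball x (2 * r)) <= En G"
  proof (rule variational_capacity_le[OF npf])
    show "f y = 1" if "y \<in> A \<inter> ball x r" for y using one[OF that] cutoff(5)[OF r, of y x] that by (simp add: f_def k_def)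
    show "f y = 0" if "y \<notin> ball x (2 * r)" for y using f0(1)[of y] that by blast
  qed
  thus ?thesis using EG unfolding S_def by (rule order_trans)
qed

text \<open>With \<open>v = max 0 (1 - 2 * u)\<close>, the density hypothesis makes the mean of
  \<open>v\<close> at most \<open>1/4\<close>, so the weak Sobolev-Poincare inequality bounds the
  measure of \<open>{v > 1/2}\<close> by a multiple of \<open>r powr p\<close> times the energy,
  which suits the factor \<open>r powr (- p)\<close> in \<open>cap_cutoff\<close>. On
  \<open>N\<close>, where \<open>v\<close> need not be 1, the maximum with a function of tiny energy
  restores this value.\<close>

lemma cap_le:
  obtains C where "0 < C" "!!u g A N x r. npair u g ==> 0 < r ==> capnull N ==> (!!y. y \<in> A ==> y \<notin> N ==> u y = 0) ==>
    lev u (1/2) x (2 * r) <= 1/4 * m x (2 * r) ==>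
    vcap (A \<inter> ball x r) (ball x (2 * r)) <= ennreal (C * nugb g x (2 ^ (nL + 2) * r))"
proof -
  obtain K \<kappa> where K: "1 <= K" "1 < \<kappa>"
    and wsp': "wsp CP nL K \<kappa>" by (rule weak_sobolev_poincare[OF CP])
  note wsp = wsp'[unfolded wsp_def, rule_format]
  define C where "C = 2 powr p * 2 powr p + K * 16 powr p"
  have C: "0 < C" using K by (auto simp: C_def intro!: add_nonneg_pos)
  show thesis
  proof (rule that[OF C])
    fix u g A N x and r :: real
    assume np: "npair u g" and r: "0 < r" and N: "capnull N" and A: "!!y. y \<in> A ==> y \<notin> N ==> u y = 0"
      and dens: "lev u (1/2) x (2 * r) <= 1/4 * m x (2 * r)"
    note [measurable] = npairD(1,6)[OF np]
    define v where "v y = max 0 (1 - 2 * u y)" for y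
    define V where "V = nugb g x (2 ^ (nL + 2) * r)"
    interpret \<nu>: finite_measure "nug g" by (rule finite_nug[OF npairD(6,5)[OF np]])
    have r2: "0 < 2 * r" using r by simp
    have mp: "0 < m x (2 * r)" by (rule m_pos[OF r2])
    have vm[measurable]: "v \<in> bmeas" unfolding v_def by measurable
    have "rwug v (%y. ennreal 2 * g y)" unfolding v_def by (rule rwug_lipschitz_comp[OF npairD(4)[OF np]]) (auto simp: max_def abs_if)
    moreover have E2: "En (%y. ennreal 2 * g y) < \<infinity>" using npairD(5)[OF np] by (subst En_cmult) (auto simp: ennreal_mult_less_top)
    ultimately have npv: "npair v (%y. ennreal 2 * g y)" unfolding npair_def using npairD(2)[OF np] by (auto simp: v_def)
    have avg: "avg v x (2 * r) <= 1/4"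
    proof -
      have "avg v x (2 * r) = avg (%y. 2 * max 0 (1/2 - u y)) x (2 * r)" by (rule avg_cong) (auto simp: v_def max_def field_simps)
      also have "... = 2 * avg (%y. max 0 (1/2 - u y)) x (2 * r)" by (simp add: avg_def)
      also have "avg (%y. max 0 (1/2 - u y)) x (2 * r) * m x (2 * r) <= 1/2 * lev u (1/2) x (2 * r)"
        by (rule avg_le_level[OF npairD(1,2)[OF np] r2]) auto
      hence "avg (%y. max 0 (1/2 - u y)) x (2 * r) * m x (2 * r) <= 1/8 * m x (2 * r)" using dens by linarith
      hence "avg (%y. max 0 (1/2 - u y)) x (2 * r) <= 1/8" using mp by (simp only: mult_le_cancel_right_pos)
      hence "2 * avg (%y. max 0 (1/2 - u y)) x (2 * r) <= 1/4" by simp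
      finally show ?thesis .
    qed
    have a0: "0 <= avg v x (2 * r)" by (rule avg_nonneg) (simp add: v_def)
    define S where "S = {y. 1/2 < v y} \<inter> ball x (2 * r)"
    have "{y \<in> space \<mu>. 1/2 < v y} \<in> sets \<mu>" by measurable
    hence Sm[measurable]: "S \<in> sets \<mu>" unfolding S_def by (intro sets.Int ball_sets) simp
    have MS: "measure \<mu> S <= K * 16 powr p * r powr p * V"
    proof -
      define X where "X = K * ((2 * r / (1/4)) powr p * nugb (%y. ennreal 2 * g y) x (2 ^ (nL + 1) * (2 * r)) / m x (2 * r))"
      have X0: "0 <= X" using K by (simp add: X_def)
      have T: "{y \<in> ball x (2 * r). 1/4 < \<bar>v y - avg v x (2 * r)\<bar>} \<in> fmeasurable \<mu>" by (rule ball_Collect_fmeasurable) measurable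
      have "measure \<mu> S <= measure \<mu> {y \<in> ball x (2 * r). 1/4 < \<bar>v y - avg v x (2 * r)\<bar>}"
        using avg a0 by (intro measure_mono_fmeasurable T Sm) (auto simp: S_def)
      also have "... <= m x (2 * r) * X powr \<kappa>"
        using wsp[OF npairD(1-3)[OF npv] finite_nug[OF npairD(6,5)[OF npv]] sets_nug poincare[OF npv] r2, of "1/4" x]
        unfolding X_def by simp
      finally have 1: "measure \<mu> S <= m x (2 * r) * X powr \<kappa>" .
      have 2: "measure \<mu> S <= m x (2 * r)" by (intro measure_mono_fmeasurable Sm fmeasurableI ball_sets ball_finite) (auto simp: S_def)
      \<comment> \<open>Here the gain \<open>\<kappa>\<close> is given away: for
        \<open>X <= 1\<close> the power is at most \<open>X\<close>, and for larger \<open>X\<close>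
        the bound follows from the inclusion of \<open>S\<close> in the ball.\<close>
      have "measure \<mu> S <= m x (2 * r) * X"
      proof (cases "X <= 1")
        case True
        have "X powr \<kappa> <= X powr 1" using K True X0 by (intro powr_mono') auto
        hence "m x (2 * r) * X powr \<kappa> <= m x (2 * r) * X" using X0 by (intro mult_left_mono) auto
        thus ?thesis using 1 by linarith
      next
        case False
        hence "m x (2 * r) * 1 <= m x (2 * r) * X" by (intro mult_left_mono) auto
        thus ?thesis using 2 by linarith
      qed
      also have "... = K * ((8 * r) powr p * nugb (%y. ennreal 2 * g y) x (2 ^ (nL + 2) * r))" using mp by (simp add: X_def mult_ac)
      also have "nugb (%y. ennreal 2 * g y) x (2 ^ (nL + 2) * r) = 2 powr p * V"
        unfolding V_def by (rule nug_cmult[OF npairD(6,5)[OF np]]) auto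
      also have "K * ((8 * r) powr p * (2 powr p * V)) = K * (8 powr p * 2 powr p) * r powr p * V"
        using r by (simp add: powr_mult mult_ac)
      also have "8 powr p * 2 powr p = (16::real) powr p" by (simp add: powr_mult[symmetric])
      finally show ?thesis .
    qed
    have sub2: "ball x (2 * r) \<subseteq> ball x (2 ^ (nL + 2) * r)"
    proof (rule subset_ball)
      have "(2::real) ^ 1 <= 2 ^ (nL + 2)" by (intro power_increasing) auto
      thus "2 * r <= 2 ^ (nL + 2) * r" using r by (intro mult_right_mono) auto
    qed
    show "vcap (A \<inter> ball x r) (ball x (2 * r)) <= ennreal (C * nugb g x (2 ^ (nL + 2) * r))"
    proof (rule ennreal_le_epsilon)
      fix \<epsilon> :: real assume \<epsilon>: "0 < \<epsilon>"
      \<comment> \<open>The sum of the coefficients with which the energy of \<open>w\<close>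
        enters, so that its total contribution is \<open>\<epsilon>\<close>.\<close>
      define D where "D = 2 powr p + r powr (- p) * 2 powr p"
      have D: "0 < D" by (auto simp: D_def intro!: add_pos_nonneg)
      have "0 < \<epsilon> / D" using \<epsilon> D by simp
      hence "capt N (ennreal (\<epsilon> / D))" using N unfolding capnull_def by blast
      then obtain w gw where npw: "npair w gw" and w1: "\<forall>y\<in>N. w y = 1" and we: "energy w gw <= ennreal (\<epsilon> / D)"
        unfolding capt_def by blast
      note [measurable] = npairD(1,6)[OF npw]
      have ww: "En (%y. ennreal (w y)) <= ennreal (\<epsilon> / D)" "En gw <= ennreal (\<epsilon> / D)"
        by (rule order_trans[OF _ we], simp add: add_increasing add_increasing2)+
      define f where "f y = max (v y) (w y)" for y
      define F where "F y = (if w y <= v y then ennreal 2 * g y else gw y)" for y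
      have Fm[measurable]: "F \<in> bmeas" unfolding F_def by measurable
      have Fp: "ennpowr (F y) p <= ennpowr (ennreal 2 * g y) p + ennpowr (gw y) p" for y
        by (auto simp: F_def add_increasing add_increasing2)
      have "En F <= En (%y. ennreal 2 * g y) + En gw"
        unfolding En_def using Fp by (subst nn_integral_add[symmetric]) (auto intro!: nn_integral_mono)
      also have "... < \<infinity>" using E2 npairD(5)[OF npw] by simp
      finally have "En F < \<infinity>" .
      hence npf: "npair f F"
        unfolding npair_def f_def F_def using rwug_max[OF npairD(4)[OF npv] npairD(4)[OF npw]] npairD(2,3)[OF npv] npairD(2,3)[OF npw]
        by (auto simp: le_max_iff_disj)
      have "vcap (A \<inter> ball x r) (ball x (2 * r)) <=
        ennreal (2 powr p) * emeasure (nug F) (ball x (2 * r)) + ennreal (r powr (- p)) * emeasure \<mu> ({y. 1/2 < f y} \<inter> ball x (2 * r))"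
      proof (rule cap_cutoff[OF npf r])
        fix y assume y: "y \<in> A \<inter> ball x r"
        show "f y = 1"
        proof (cases "y \<in> N")
          case True
          thus ?thesis using w1 npairD(3)[OF npv, of y] by (simp add: f_def)
        next
          case False
          thus ?thesis using A[of y] y npairD(3)[OF npw, of y] by (simp add: f_def v_def)
        qed
      qed
      also have "... <= ennreal (2 powr p) * (ennreal (2 powr p * V) + ennreal (\<epsilon> / D))
        + ennreal (r powr (- p)) * (ennreal (K * 16 powr p * r powr p * V) + ennreal (2 powr p) * ennreal (\<epsilon> / D))"
      proof (intro add_mono mult_left_mono)
        have "emeasure (nug F) (ball x (2 * r)) <= (\<integral>\<^sup>+y. ennpowr (ennreal 2 * g y) p * indicator (ball x (2 * r)) y + ennpowr (gw y) p \<partial>\<mu>)"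
          using Fp by (subst emeasure_nug) (auto intro!: nn_integral_mono split: split_indicator)
        also have "... = emeasure (nug (%y. ennreal 2 * g y)) (ball x (2 * r)) + En gw"
          unfolding En_def by (subst nn_integral_add) (auto simp: emeasure_nug intro!: borel_measurable_times_ennreal borel_measurable_indicator)
        also have "emeasure (nug (%y. ennreal 2 * g y)) (ball x (2 * r)) = ennreal (2 powr p * nugb g x (2 * r))"
          using nug_cmult[OF npairD(6,5)[OF np], of 2 "ball x (2 * r)"] finite_measure.emeasure_eq_measure[OF finite_nug[OF npairD(6,5)[OF npv]]] by simp
        also have "... <= ennreal (2 powr p * V)"
          unfolding V_def by (intro ennreal_leI mult_left_mono \<nu>.finite_measure_mono sub2) auto
        finally show "emeasure (nug F) (ball x (2 * r)) <= ennreal (2 powr p * V) + ennreal (\<epsilon> / D)"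
          using ww(2) by (meson add_mono order_trans order_refl)
        have W: "{y \<in> space \<mu>. 1/2 < w y} \<in> sets \<mu>" by measurable
        have "emeasure \<mu> ({y. 1/2 < f y} \<inter> ball x (2 * r)) <= emeasure \<mu> (S \<union> {y \<in> space \<mu>. 1/2 < w y})"
          by (intro emeasure_mono sets.Un Sm W) (auto simp: S_def f_def)
        also have "... <= emeasure \<mu> S + emeasure \<mu> {y \<in> space \<mu>. 1/2 < w y}" using W by (intro emeasure_subadditive) auto
        also have "emeasure \<mu> S = ennreal (measure \<mu> S)"
          using emeasure_subset_ball[of S x "2 * r"] by (intro emeasure_eq_ennreal_measure) (auto simp: S_def)
        also have "... <= ennreal (K * 16 powr p * r powr p * V)" by (rule ennreal_leI[OF MS])
        also have "emeasure \<mu> {y \<in> space \<mu>. 1/2 < w y} <= En (%y. ennreal 2 * ennreal (w y))"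
        proof -
          have "emeasure \<mu> {y \<in> space \<mu>. 1/2 < w y} = (\<integral>\<^sup>+y. indicator {y \<in> space \<mu>. 1/2 < w y} y \<partial>\<mu>)" using W by simp
          also have "... <= En (%y. ennreal 2 * ennreal (w y))" unfolding En_def
          proof (rule nn_integral_mono)
            fix y
            show "indicator {y \<in> space \<mu>. 1/2 < w y} y <= ennpowr (ennreal 2 * ennreal (w y)) p"
            proof (cases "1/2 < w y")
              case True
              hence "1 <= (2 * w y) powr p" using p0 by (intro ge_one_powr_ge_zero) auto
              moreover have "ennpowr (ennreal 2 * ennreal (w y)) p = ennreal ((2 * w y) powr p)"
                using True by (subst ennreal_mult'[symmetric]) (auto intro!: ennpowr_ennreal)
              ultimately show ?thesis using True by simp
            qed simp
          qed
          finally show ?thesis .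
        qed
        also have "... = ennreal (2 powr p) * En (%y. ennreal (w y))" by (rule En_cmult) auto
        also have "... <= ennreal (2 powr p) * ennreal (\<epsilon> / D)" by (intro mult_left_mono ww) auto
        finally show "emeasure \<mu> ({y. 1/2 < f y} \<inter> ball x (2 * r)) <= ennreal (K * 16 powr p * r powr p * V) + ennreal (2 powr p) * ennreal (\<epsilon> / D)"
          by (simp add: add_mono)
      qed auto
      also have "... = ennreal (2 powr p * (2 powr p * V + \<epsilon> / D) + r powr (- p) * (K * 16 powr p * r powr p * V + 2 powr p * (\<epsilon> / D)))"
        using K \<epsilon> D by (simp add: ennreal_mult'[symmetric] ennreal_plus[symmetric] V_def del: ennreal_plus)
      also have "2 powr p * (2 powr p * V + \<epsilon> / D) + r powr (- p) * (K * 16 powr p * r powr p * V + 2 powr p * (\<epsilon> / D))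
        = C * V + D * (\<epsilon> / D)"
      proof -
        have "r powr (- p) * r powr p = 1" using r by (simp add: powr_add[symmetric])
        hence "r powr (- p) * (K * 16 powr p * r powr p * V) = K * 16 powr p * V"
          by (metis (no_types, lifting) mult.assoc mult.commute mult_1)
        thus ?thesis unfolding C_def D_def by (simp only: distrib_left distrib_right mult.assoc add.assoc)
      qed
      also have "ennreal (C * V + D * (\<epsilon> / D)) = ennreal (C * V) + ennreal \<epsilon>"
        using C \<epsilon> D by (simp add: V_def)
      finally show "vcap (A \<inter> ball x r) (ball x (2 * r)) <= ennreal (C * nugb g x (2 ^ (nL + 2) * r)) + ennreal \<epsilon>"
        by (simp add: V_def)
    qed
  qed
qed

text \<open>With mean value \<open>a\<close>, the deviation is \<open>1 - a\<close> on
  \<open>S\<close> and \<open>a\<close> on \<open>T\<close>, and these two numbers add up to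
  1.\<close>

lemma avg_dev_ge:
  assumes f: "f \<in> bmeas" "!!y. 0 <= f y" "!!y. f y <= 1" and R: "0 < R"
    and S: "S \<in> sets \<mu>" "S \<subseteq> ball x R" "!!y. y \<in> S ==> f y = 1"
    and T: "T \<in> sets \<mu>" "T \<subseteq> ball x R" "!!y. y \<in> T ==> f y = 0"
    and c: "c * m x R <= measure \<mu> S" "c * m x R <= measure \<mu> T" "0 <= c"
  shows "c <= 2 * avg (%y. \<bar>f y - avg f x R\<bar>) x R"
proof -
  define a where "a = avg f x R"
  have a0: "0 <= a" unfolding a_def by (rule avg_nonneg[OF f(2)])
  have "a <= avg (%_. 1) x R" unfolding a_def using f by (intro avg_mono[of _ _ 1]) auto
  hence a1: "a <= 1" by (simp add: avg_const[OF R])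
  note [measurable] = f(1)
  have w: "(%y. \<bar>f y - a\<bar>) \<in> bmeas" by measurable
  have mp: "0 < m x R" by (rule m_pos[OF R])
  have b: "\<bar>f y - a\<bar> <= 1" for y using f(2,3)[of y] a0 a1 by auto
  have D: "d <= avg (%y. \<bar>f y - a\<bar>) x R / c" if "Q \<in> sets \<mu>" "Q \<subseteq> ball x R" "!!y. y \<in> Q ==> d <= \<bar>f y - a\<bar>"
    "c * m x R <= measure \<mu> Q" "0 <= d" "0 < c" for Q d
  proof -
    have "d * (c * m x R) <= d * measure \<mu> Q" using that by (intro mult_left_mono) auto
    also have "... <= avg (%y. \<bar>f y - a\<bar>) x R * m x R" by (rule measure_le_avg[OF w]) (use that b R in auto)
    finally have "d * c <= avg (%y. \<bar>f y - a\<bar>) x R" using mp by (simp add: mult.assoc[symmetric])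
    thus ?thesis using \<open>0 < c\<close> by (simp add: pos_le_divide_eq)
  qed
  show ?thesis
  proof (cases "c = 0")
    case True
    thus ?thesis by (simp add: avg_nonneg)
  next
    case False
    hence c0: "0 < c" using c(3) by simp
    have "1 - a <= avg (%y. \<bar>f y - a\<bar>) x R / c" using S(3) a1 by (intro D[OF S(1,2)] c c0) auto
    moreover have "a <= avg (%y. \<bar>f y - a\<bar>) x R / c" using T(3) a0 by (intro D[OF T(1,2)] c c0) auto
    ultimately have "1 <= 2 * avg (%y. \<bar>f y - a\<bar>) x R / c" by simp
    thus ?thesis using c0 unfolding a_def by (simp add: pos_le_divide_eq)
  qed
qed

text \<open>If the annulus were empty, a cutoff function would have the upper gradient \<open>0\<close>.\<close>

lemma ex_annulus:
  fixes x z :: 'a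
  assumes \<rho>: "0 < \<rho>" and far: "2 * \<rho> <= dist x z"
  shows "\<exists>y. \<rho> <= dist x y \<and> dist x y < 2 * \<rho>"
proof (rule ccontr)
  assume no: "\<nexists>y. \<rho> <= dist x y \<and> dist x y < 2 * \<rho>"
  let ?f = "cutoff x \<rho>"
  have 01: "?f y = 1 \<or> ?f y = 0" for y
    using cutoff(5)[OF \<rho>, of y x] cutoff(6)[OF \<rho>, of x y] no by (cases "dist x y < \<rho>") (auto simp: not_less)
  have "rwug ?f (%y. if ?f y = 1 then 0 else if ?f y = 0 then 0 else ennreal (1 / \<rho>))"
    by (rule rwug_locality[OF cutoff(1,2)[OF \<rho>]])
  also have "(%y. if ?f y = 1 then 0 else if ?f y = 0 then 0 else ennreal (1 / \<rho>)) = (%_. 0)" by (rule ext) (use 01 in auto)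
  finally have np: "npair ?f (%_. 0)" unfolding npair_def using cutoff[OF \<rho>] p0 by (auto simp: En_def)
  define R where "R = dist x z + \<rho>"
  have R: "0 < R" "\<rho> <= R" using \<rho> by (auto simp: R_def add_nonneg_pos)
  define c where "c = min (m x \<rho>) (m z \<rho>) / m x R"
  have mp: "0 < m x \<rho>" "0 < m z \<rho>" "0 < m x R" using m_pos \<rho> R by auto
  have "c <= 2 * avg (%y. \<bar>?f y - avg ?f x R\<bar>) x R"
  proof (rule avg_dev_ge[where S = "ball x \<rho>" and T = "ball z \<rho>"])
    show "?f y = 0" if "y \<in> ball z \<rho>" for y
    proof -
      have "\<not> dist x y < \<rho>" using that far dist_triangle[of x z y] by (simp add: dist_commute)
      hence "\<not> dist x y < 2 * \<rho>" using no by (auto simp: not_less)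
      thus ?thesis using cutoff(6)[OF \<rho>, of x y] by auto
    qed
    show "ball z \<rho> \<subseteq> ball x R" by (rule ball_subsetI) (simp add: R_def)
  qed (use cutoff[OF \<rho>, where z = x] R mp in \<open>auto simp: c_def\<close>)
  also have "avg (%y. \<bar>?f y - avg ?f x R\<bar>) x R <= CP * R * (nugb (%_. 0) x (2 ^ nL * R) / m x (2 ^ nL * R)) powr (1 / p)"
    using poincare[OF np] R(1) unfolding PI_def by blast
  also have "nugb (%_. 0) x (2 ^ nL * R) = 0" using p0 by (simp add: measure_def emeasure_nug)
  finally have "c <= 0" by simp
  moreover have "0 < c" using mp by (auto simp: c_def min_def)
  ultimately show False by simp
qed

text \<open>By \<open>ex_annulus\<close> there is a point \<open>y\<close> such that
  \<open>ball y r\<close> is disjoint from \<open>ball x (2 * r)\<close> and lies in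
  \<open>ball x (8 * r)\<close>. A competitor is 1 on \<open>ball x r\<close> and 0 on
  \<open>ball y r\<close>, so the Poincare inequality on the ball of radius \<open>8 * r\<close>
  bounds its energy from below. The point \<open>z\<close> excludes a space that ends at scale
  \<open>r\<close>, where the capacity may vanish.\<close>

lemma cap_ge:
  obtains c where "0 < c" "!!x z r. 0 < r ==> 6 * r <= dist x z ==>
    ennreal (c * (m x r / r powr p)) <= vcap (ball x r) (ball x (2 * r))"
proof -
  define c0 where "c0 = (1 / CD ^ 4 / (2 * (CP * 8))) powr p"
  have c0: "0 < c0" using CD1 CP by (simp add: c0_def)
  show thesis
  proof (rule that[OF c0], rule variational_capacity_ge)
    fix x z :: 'a and r :: real and f g
    assume r: "0 < r" and z: "6 * r <= dist x z" and np: "npair f g"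
      and one: "!!y. y \<in> ball x r ==> f y = 1" and zero: "!!y. y \<notin> ball x (2 * r) ==> f y = 0"
    have "0 < 3 * r" "2 * (3 * r) <= dist x z" using r z by auto
    then obtain y where y: "3 * r <= dist x y" "dist x y < 6 * r" using ex_annulus[of "3 * r" x z] by auto
    interpret \<nu>: finite_measure "nug g" by (rule finite_nug[OF npairD(6,5)[OF np]])
    define R where "R = 8 * r"
    have R: "0 < R" using r by (simp add: R_def)
    have mp: "0 < m x R" "0 < m x r" "0 < m x (2 ^ nL * R)" using m_pos r R by auto
    have "1 / CD ^ 4 <= 2 * avg (%w. \<bar>f w - avg f x R\<bar>) x R"
    proof (rule avg_dev_ge[where S = "ball x r" and T = "ball y r"])
      have s: "ball x R \<subseteq> ball x (2 ^ 4 * r)" "ball x R \<subseteq> ball y (2 ^ 4 * r)"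
        using y r by (auto intro!: ball_subsetI simp: R_def dist_commute)
      have "m x R <= CD ^ 4 * m x r" "m x R <= CD ^ 4 * m y r" by (rule m_le[OF r s(1)], rule m_le[OF r s(2)])
      thus "1 / CD ^ 4 * m x R <= measure \<mu> (ball x r)" "1 / CD ^ 4 * m x R <= measure \<mu> (ball y r)"
        using CD1 by (auto simp: divide_le_eq mult.commute)
      show "ball x r \<subseteq> ball x R" "ball y r \<subseteq> ball x R" using y r by (auto intro!: ball_subsetI simp: R_def)
      show "f w = 0" if "w \<in> ball y r" for w using that y(1) dist_triangle[of x y w] by (intro zero) (simp add: dist_commute)
    qed (use npairD[OF np] one R CD1 in auto)
    also have "avg (%w. \<bar>f w - avg f x R\<bar>) x R <= CP * R * (nugb g x (2 ^ nL * R) / m x (2 ^ nL * R)) powr (1 / p)"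
      using poincare[OF np] R unfolding PI_def by blast
    finally have "1 / CD ^ 4 / (2 * (CP * 8)) / r <= (nugb g x (2 ^ nL * R) / m x (2 ^ nL * R)) powr (1 / p)"
      using CP r CD1 by (simp add: R_def field_simps)
    hence "(1 / CD ^ 4 / (2 * (CP * 8)) / r) powr p <= ((nugb g x (2 ^ nL * R) / m x (2 ^ nL * R)) powr (1 / p)) powr p"
      using CP r CD1 p0 by (intro powr_mono2) auto
    also have "(1 / CD ^ 4 / (2 * (CP * 8)) / r) powr p = c0 / r powr p" using CP r CD1 by (simp add: c0_def powr_divide powr_mult)
    also have "((nugb g x (2 ^ nL * R) / m x (2 ^ nL * R)) powr (1 / p)) powr p = nugb g x (2 ^ nL * R) / m x (2 ^ nL * R)"
      using p0 by (simp add: powr_powr)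
    finally have "c0 / r powr p * m x (2 ^ nL * R) <= nugb g x (2 ^ nL * R)" using mp by (simp add: pos_le_divide_eq)
    moreover have "m x r <= m x (2 ^ nL * R)"
    proof (intro m_mono subset_ball)
      have "1 * r <= 2 ^ nL * 8 * r" using r one_le_power[of "2::real" nL] by (intro mult_right_mono) linarith+
      thus "r <= 2 ^ nL * R" by (simp add: R_def)
    qed
    hence "c0 / r powr p * m x r <= c0 / r powr p * m x (2 ^ nL * R)" using c0 by (intro mult_left_mono) auto
    moreover have "nugb g x (2 ^ nL * R) <= measure (nug g) UNIV"
      using sets.top[of "nug g"] sets_eq_imp_space_eq[OF sets_nug[of g]] by (intro \<nu>.finite_measure_mono) auto
    ultimately have "c0 * (m x r / r powr p) <= measure (nug g) UNIV" by simp
    hence "ennreal (c0 * (m x r / r powr p)) <= ennreal (measure (nug g) UNIV)" by (rule ennreal_leI)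
    also have "... = En g" unfolding \<nu>.emeasure_eq_measure[symmetric] by (rule emeasure_nug_UNIV[OF npairD(6)[OF np]])
    finally show "ennreal (c0 * (m x r / r powr p)) <= En g" .
  qed
qed

section \<open>Thinness from dyadic sums, and the fine interior\<close>

lemma variational_capacity_mono: "A \<subseteq> A' ==> vcap A G <= vcap A' G"
  unfolding variational_capacity_def by (rule INF_superset_mono) auto

text \<open>Every ball is the whole space, so constants are competitors, all capacities in the
  denominator vanish, and the convention makes the integrand 1.\<close>

lemma thin_one_point:
  assumes one: "!!z::'a. z = x" shows "thin_at p \<mu> A x"
proof -
  have U: "ball x r = UNIV" if "0 < r" for r using one that by (metis UNIV_eq_I centre_in_ball)
  have "vcap (ball x r) (ball x (2 * r)) = 0" if r: "0 < r" for r
  proof -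
    have "npair (%_. 1) (%_. 0)" unfolding npair_def using rwug_const[of 1] p0 by (auto simp: En_def)
    moreover have "En (%_. ennreal 1) < \<infinity>" using ball_finite[of x r] p0 U[OF r] by (simp add: En_def ennpowr_def)
    ultimately have "vcap (ball x r) (ball x (2 * r)) <= En (%_. 0)" using U r by (intro variational_capacity_le) auto
    thus ?thesis using p0 by (simp add: En_def)
  qed
  thus ?thesis unfolding thin_at_def
    by - (rule le_less_trans[of _ "\<integral>\<^sup>+r. indicator {0<..<1::real} r \<partial>lebesgue"], rule nn_integral_mono, auto split: split_indicator)
qed

lemma ennreal_divide_le_one: "a <= b ==> b ~= 0 ==> a / b <= (1::ennreal)"
  by (metis divide_right_mono_ennreal ennreal_divide_self ennreal_divide_top order_refl top.not_eq_extremum zero_le)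

lemma dyadic_scale:
  assumes "0 < r" "r < (1::real)"
  obtains j where "1 / 2 ^ Suc j < r" "r <= 1 / 2 ^ j"
proof -
  have "\<exists>n. (1/2::real) ^ n < r" using assms by (intro real_arch_pow_inv) auto
  then obtain n where n: "(1/2::real) ^ n < r" "!!k. k < n ==> \<not> (1/2::real) ^ k < r"
    using exists_least_iff[of "%n. (1/2::real) ^ n < r"] by blast
  obtain j where j: "n = Suc j" using n(1) assms by (cases n) auto
  show thesis using that[of j] n(1) n(2)[of j] by (simp add: j power_one_over)
qed

lemma ennreal_divide_le:
  fixes v w :: ennreal
  assumes v: "v <= ennreal a" and w: "ennreal b <= w" and b: "0 < b"
  shows "v / w <= ennreal (a / b)"
proof (rule divide_le_posI_ennreal)
  have "0 < ennreal b" using b by simp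
  thus "0 < w" using w by (rule less_le_trans)
  have "ennreal a = ennreal b * ennreal (a / b)" using b ennreal_mult'[of b "a / b"] by simp
  also have "... <= w * ennreal (a / b)" by (intro mult_right_mono w) simp
  finally show "v <= w * ennreal (a / b)" by (rule order_trans[OF v])
qed

text \<open>For \<open>r\<close> between \<open>1 / 2 ^ Suc j\<close> and \<open>1 / 2 ^ j\<close>
  the integrand is at most \<open>2 ^ Suc j\<close> times a multiple of a Wolff term, and the length
  of this interval cancels the power of 2. So the integral over small \<open>r\<close> is bounded by
  the Wolff series, and away from 0 the capacity quotient is at most 1.\<close>

lemma thin_compl:
  assumes np: "npair u g" and N: "capnull N" and A: "!!y. y \<in> A ==> y \<notin> N ==> u y = 0"
    and dens: "!!j. i <= j ==> lev u (1/2) x (1 / 2 ^ j) <= 1 / (4 * CD) * m x (1 / 2 ^ j)"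
    and wolff: "summable (%k. wolff g x k)"
  shows "thin_at p \<mu> A x"
proof (cases "\<exists>z. z ~= x")
  case False
  thus ?thesis by (intro thin_one_point) blast
next
  case True
  then obtain z where z: "z ~= x" by blast
  obtain C where C: "0 < C" and cap: "!!u g A N x r. npair u g ==> 0 < r ==> capnull N ==> (!!y. y \<in> A ==> y \<notin> N ==> u y = 0) ==>
    lev u (1/2) x (2 * r) <= 1/4 * m x (2 * r) ==>
    vcap (A \<inter> ball x r) (ball x (2 * r)) <= ennreal (C * nugb g x (2 ^ (nL + 2) * r))" by (rule cap_le) blast
  obtain c where c: "0 < c" and cap': "!!x z r. 0 < r ==> 6 * r <= dist x z ==>
    ennreal (c * (m x r / r powr p)) <= vcap (ball x r) (ball x (2 * r))" by (rule cap_ge) blast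
  interpret \<nu>: finite_measure "nug g" by (rule finite_nug[OF npairD(6,5)[OF np]])
  define s where "s = 1 / (p - 1)"
  have s: "0 < s" using p1 by (simp add: s_def)
  \<comment> \<open>The energy in \<open>cap_le\<close> lives on the ball of radius
    \<open>2 ^ q * r\<close>, so the scale \<open>j\<close> of \<open>r\<close> is compared with the
    Wolff term at \<open>j - q\<close>.\<close>
  define q where "q = nL + 2"
  define C2 where "C2 = C / c * CD ^ (q + 1)"
  have C2: "0 < C2" using C c CD1 by (simp add: C2_def)
  define w where "w k = C2 powr s * wolff g x k" for k
  have w0: "0 <= w k" for k by (simp add: w_def)
  have sw: "summable w" using summable_mult[OF wolff] unfolding w_def .
  have "\<exists>n. (1/2::real) ^ n < dist x z / 6" using z by (intro real_arch_pow_inv) auto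
  then obtain n where n: "(1/2::real) ^ n < dist x z / 6" by blast
  \<comment> \<open>From \<open>J\<close> on, \<open>cap_ge\<close> applies because of
    \<open>n\<close>, the density bound because of \<open>i\<close> with one scale to spare, and
    \<open>j - q\<close> is a genuine difference.\<close>
  define J where "J = n + i + q + 1"
  define cr where "cr r = vcap (A \<inter> ball x r) (ball x (2 * r)) / vcap (ball x r) (ball x (2 * r))" for r
  define I where "I r = (if vcap (ball x r) (ball x (2 * r)) = 0 then 1 else ennpowr (cr r) s / ennreal r)" for r
  have large: "I r <= ennreal (2 ^ Suc J)" if r: "1 / 2 ^ Suc J < r" "r < 1" for r
  proof (cases "vcap (ball x r) (ball x (2 * r)) = 0")
    case True
    have "ennreal 1 <= ennreal (2 ^ Suc J)" by (intro ennreal_leI one_le_power) simp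
    thus ?thesis using True by (simp add: I_def)
  next
    case False
    have r0: "0 < r" using r(1) by (rule less_trans[rotated]) simp
    have "cr r <= 1" unfolding cr_def using False by (intro ennreal_divide_le_one variational_capacity_mono) auto
    hence "ennpowr (cr r) s <= ennpowr 1 s" using s by (intro ennpowr_mono) auto
    hence "I r <= 1 / ennreal r" using False unfolding I_def by (simp add: divide_right_mono_ennreal ennpowr_def)
    also have "... = ennreal (1 / r)" using r0 divide_ennreal[of 1 r] by simp
    also have "... <= ennreal (2 ^ Suc J)" using r r0 by (intro ennreal_leI) (simp add: field_simps)
    finally show ?thesis .
  qed
  have small: "I r <= ennreal (2 ^ Suc j * w (j - q))" if j: "J <= j" and r: "1 / 2 ^ Suc j < r" "r <= 1 / 2 ^ j" for r j
  proof -
    have r0: "0 < r" using r(1) by (rule less_trans[rotated]) simp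
    define \<rho> where "\<rho> = (1 / 2 ^ (j - q) :: real)"
    have jq: "(2::real) ^ j = 2 ^ (j - q) * 2 ^ q" using j by (simp add: J_def power_add[symmetric])
    have \<rho>: "0 < \<rho>" "2 ^ q * r <= \<rho>" "\<rho> <= 2 ^ (q + 1) * r" "r <= \<rho>"
    proof -
      show "0 < \<rho>" by (simp add: \<rho>_def)
      show 1: "2 ^ q * r <= \<rho>" using r(2) by (simp add: \<rho>_def jq field_simps)
      show "\<rho> <= 2 ^ (q + 1) * r" using r(1) by (simp add: \<rho>_def jq field_simps)
      have "1 * r <= 2 ^ q * r" using r0 by (intro mult_right_mono) auto
      thus "r <= \<rho>" using 1 by simp
    qed
    have mp: "0 < m x r" "0 < m x \<rho>" using m_pos r0 \<rho> by auto
    have far: "6 * r <= dist x z"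
    proof -
      have "(1/2::real) ^ j <= (1/2) ^ n" using j by (intro power_decreasing) (auto simp: J_def)
      thus ?thesis using n r(2) by (simp add: power_one_over)
    qed
    have low: "ennreal (c * (m x r / r powr p)) <= vcap (ball x r) (ball x (2 * r))" by (rule cap'[OF r0 far])
    have pos: "0 < c * (m x r / r powr p)" using c mp r0 by simp
    hence ne: "vcap (ball x r) (ball x (2 * r)) ~= 0" using low by (auto simp: ennreal_eq_0_iff)
    have "vcap (A \<inter> ball x r) (ball x (2 * r)) <= ennreal (C * nugb g x (2 ^ (nL + 2) * r))"
    proof (rule cap[OF np r0 N A])
      define j' where "j' = j - 1"
      have j': "j = Suc j'" "i <= j'" using j by (auto simp: J_def j'_def)
      have "lev u (1/2) x (2 * r) <= lev u (1/2) x (1 / 2 ^ j')"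
        using r(2) by (intro level_measure_le[OF npairD(1)[OF np]] subset_ball) (auto simp: j')
      also have "... <= 1 / (4 * CD) * m x (1 / 2 ^ j')" by (rule dens[OF j'(2)])
      \<comment> \<open>Passing from the dyadic ball to the ball of radius \<open>2 * r\<close>
        costs one factor \<open>CD\<close>; this is the origin of \<open>1 / (4 * CD)\<close> in the
        hypothesis.\<close>
      also have "... <= 1 / (4 * CD) * (CD ^ 1 * m x (2 * r))" using CD1 r r0 by (intro mult_left_mono m_le subset_ball) (auto simp: j')
      also have "... = 1/4 * m x (2 * r)" using CD1 by simp
      finally show "lev u (1/2) x (2 * r) <= 1/4 * m x (2 * r)" .
    qed
    also have "... <= ennreal (C * nugb g x \<rho>)"
      using C \<rho>(2) by (intro ennreal_leI mult_left_mono \<nu>.finite_measure_mono subset_ball) (auto simp: q_def)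
    finally have up: "vcap (A \<inter> ball x r) (ball x (2 * r)) <= ennreal (C * nugb g x \<rho>)" .
    have "cr r <= ennreal (C * nugb g x \<rho> / (c * (m x r / r powr p)))" unfolding cr_def by (rule ennreal_divide_le[OF up low pos])
    also have "... <= ennreal (C2 * (\<rho> powr p * nugb g x \<rho> / m x \<rho>))"
    proof (rule ennreal_leI)
      have "m x \<rho> <= CD ^ (q + 1) * m x r" using \<rho>(3) by (intro m_le r0 subset_ball)
      hence "1 / m x r <= CD ^ (q + 1) / m x \<rho>" using mp by (simp add: divide_simps mult.commute)
      moreover have "r powr p <= \<rho> powr p" using r0 \<rho> p0 by (intro powr_mono2) auto
      ultimately have "r powr p * (1 / m x r) <= \<rho> powr p * (CD ^ (q + 1) / m x \<rho>)" using mp by (intro mult_mono) auto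
      hence "C / c * nugb g x \<rho> * (r powr p * (1 / m x r)) <= C / c * nugb g x \<rho> * (\<rho> powr p * (CD ^ (q + 1) / m x \<rho>))"
        using C c by (intro mult_left_mono) auto
      thus "C * nugb g x \<rho> / (c * (m x r / r powr p)) <= C2 * (\<rho> powr p * nugb g x \<rho> / m x \<rho>)"
        by (simp add: C2_def mult_ac)
    qed
    finally have "ennpowr (cr r) s <= ennpowr (ennreal (C2 * (\<rho> powr p * nugb g x \<rho> / m x \<rho>))) s"
      using s by (intro ennpowr_mono) auto
    also have "... = ennreal (w (j - q))"
    proof -
      have "w (j - q) = (C2 * (\<rho> powr p * nugb g x \<rho> / m x \<rho>)) powr s"
        unfolding w_def \<rho>_def s_def using C2 by (subst powr_mult) auto
      thus ?thesis using C2 mp by (simp add: ennpowr_ennreal)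
    qed
    finally have "I r <= ennreal (w (j - q)) / ennreal r" using ne unfolding I_def by (simp add: divide_right_mono_ennreal)
    also have "... = ennreal (w (j - q) / r)" using r0 w0 by (intro divide_ennreal) auto
    also have "... <= ennreal (2 ^ Suc j * w (j - q))"
    proof (rule ennreal_leI)
      have "1 / r <= 2 ^ Suc j" using r(1) r0 by (simp add: field_simps)
      hence "w (j - q) * (1 / r) <= w (j - q) * 2 ^ Suc j" using w0 by (intro mult_left_mono) auto
      thus "w (j - q) / r <= 2 ^ Suc j * w (j - q)" by (simp add: mult.commute)
    qed
    finally show ?thesis .
  qed
  have leb: "S \<in> sets borel ==> S \<in> sets lebesgue" for S :: "real set" by (simp add: sets_completionI_sets)
  define F where "F j r = ennreal (2 ^ Suc (j + J) * w (j + J - q)) * indicator {1 / 2 ^ Suc (j + J)<..1 / 2 ^ (j + J)} r" for j and r :: real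
  have [measurable]: "F j \<in> borel_measurable lebesgue" for j unfolding F_def by (intro borel_measurable_times_ennreal borel_measurable_indicator leb) auto
  have pt: "I r * indicator {0<..<1} r <= ennreal (2 ^ Suc J) * indicator {0<..<1} r + (\<Sum>j. F j r)" for r
  proof (cases "r \<in> {0<..<1}")
    case True
    show ?thesis
    proof (cases "1 / 2 ^ Suc J < r")
      case t: True
      thus ?thesis using large[OF t] True by (simp add: add_increasing2)
    next
      case False
      obtain j where j: "1 / 2 ^ Suc j < r" "r <= 1 / 2 ^ j" using dyadic_scale[of r] True by auto
      have "J <= j"
      proof (rule ccontr)
        assume "\<not> J <= j"
        hence "(2::real) ^ Suc j <= 2 ^ Suc J" by (intro power_increasing) auto
        hence "1 / 2 ^ Suc J <= (1 / 2 ^ Suc j :: real)" by (intro divide_left_mono) auto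
        thus False using False j(1) by linarith
      qed
      then obtain l where l: "j = l + J" by (metis le_add_diff_inverse2)
      have "I r <= F l r" using small[OF \<open>J <= j\<close> j] j unfolding F_def l by simp
      also have "... <= (\<Sum>j. F j r)" using sum_le_suminf[of "%j. F j r" "{l}"] by simp
      finally show ?thesis using True by (simp add: add_increasing)
    qed
  qed simp
  have "(\<integral>\<^sup>+r\<in>{0<..<1}. I r \<partial>lebesgue) <= (\<integral>\<^sup>+r. ennreal (2 ^ Suc J) * indicator {0<..<1} r + (\<Sum>j. F j r) \<partial>lebesgue)"
    by (intro nn_integral_mono pt)
  also have "... = (\<integral>\<^sup>+r. ennreal (2 ^ Suc J) * indicator {0<..<1::real} r \<partial>lebesgue) + (\<integral>\<^sup>+r. (\<Sum>j. F j r) \<partial>lebesgue)"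
    by (intro nn_integral_add borel_measurable_times_ennreal borel_measurable_indicator leb borel_measurable_suminf) auto
  also have "(\<integral>\<^sup>+r. ennreal (2 ^ Suc J) * indicator {0<..<1::real} r \<partial>lebesgue) = ennreal (2 ^ Suc J)"
    by (subst nn_integral_cmult_indicator) auto
  also have "(\<integral>\<^sup>+r. (\<Sum>j. F j r) \<partial>lebesgue) = (\<Sum>j. \<integral>\<^sup>+r. F j r \<partial>lebesgue)" by (rule nn_integral_suminf) measurable
  also have "... = (\<Sum>j. ennreal (w (j + J - q)))"
  proof (intro suminf_cong)
    fix j
    have "(\<integral>\<^sup>+r. F j r \<partial>lebesgue) = ennreal (2 ^ Suc (j + J) * w (j + J - q)) * ennreal (1 / 2 ^ (j + J) - 1 / 2 ^ Suc (j + J))"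
      unfolding F_def by (subst nn_integral_cmult_indicator) (auto simp: divide_simps)
    also have "... = ennreal (2 ^ Suc (j + J) * w (j + J - q) * (1 / 2 ^ (j + J) - 1 / 2 ^ Suc (j + J)))"
      using w0 by (intro ennreal_mult'[symmetric]) simp
    also have "2 ^ Suc (j + J) * w (j + J - q) * (1 / 2 ^ (j + J) - 1 / 2 ^ Suc (j + J)) = w (j + J - q)" by (simp add: field_simps)
    finally show "(\<integral>\<^sup>+r. F j r \<partial>lebesgue) = ennreal (w (j + J - q))" .
  qed
  also have "... = ennreal (\<Sum>j. w (j + J - q))"
  proof (rule suminf_ennreal2)
    show "summable (%j. w (j + J - q))" using summable_ignore_initial_segment[OF sw, of "J - q"] by (simp add: J_def)
  qed (simp add: w0)
  finally have "(\<integral>\<^sup>+r\<in>{0<..<1}. I r \<partial>lebesgue) < \<infinity>" by (rule le_less_trans) simp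
  thus ?thesis unfolding thin_at_def I_def cr_def s_def .
qed

text \<open>Removing \<open>N\<close> from \<open>{h ~= 0}\<close> enlarges the complement by a set
  of capacity zero, which \<open>thin_compl\<close> tolerates. The rest \<open>V\<close> is finely
  open and contained in \<open>E\<close>, hence in the fine interior.\<close>

lemma capnull_diff_fine_interior:
  assumes h: "h \<in> newtonian p \<mu>" and N0: "capnull {x. x \<notin> E \<and> h x ~= 0}"
  shows "capnull {x. x \<notin> fine_interior p \<mu> E \<and> h x ~= 0}"
proof -
  define u where "u n x = real_of_ereal (min 1 (ereal (real n) * \<bar>h x\<bar>))" for n :: nat and x
  define g where "g n = (%x. ennreal (real n) * mug h x)" for n :: nat
  have np: "npair (u n) (g n)" for n unfolding u_def g_def by (rule newtonian_truncate(1)[OF h]) simp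
  define Z where "Z n = {x. u n x = 1 \<and> (\<forall>i. \<exists>j\<ge>i. 1 / (4 * CD) * m x (1 / 2 ^ j) <= lev (u n) (1/2) x (1 / 2 ^ j))}" for n
  define W where "W n = {x. \<not> summable (%k. wolff (g n) x k)}" for n
  have Z: "capnull (Z n)" for n unfolding Z_def using CD1 by (intro capnull_density[OF np]) simp
  have W: "capnull (W n)" for n unfolding W_def by (intro capnull_wolff npairD(6,5)[OF np])
  define N where "N = {x. x \<notin> E \<and> h x ~= 0} \<union> ((\<Union>n. Z n) \<union> (\<Union>n. W n))"
  have N: "capnull N" unfolding N_def by (intro capnull_Un capnull_UN N0 Z W)
  define V where "V = {x. h x ~= 0} - N"
  have "finely_open p \<mu> V" unfolding finely_open_def
  proof
    fix x assume x: "x \<in> V"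
    \<comment> \<open>The index depends on \<open>x\<close>: it has to satisfy
      \<open>n * |h x| >= 1\<close>, so that the truncation has the value 1 at \<open>x\<close>, as
      the density statement requires. This is why \<open>N\<close> contains the exceptional sets for
      all \<open>n\<close>.\<close>
    have "\<exists>n. u n x = 1"
    proof (cases "\<bar>h x\<bar>")
      case (real a)
      hence "0 < a" using x by (cases "h x") (auto simp: V_def)
      obtain n :: nat where n: "1 / a <= real n" using real_arch_simple by blast
      hence "1 <= real n * a" using \<open>0 < a\<close> by (simp add: field_simps)
      hence "min 1 (ereal (real n) * \<bar>h x\<bar>) = 1" unfolding real by (simp add: min_def one_ereal_def)
      thus ?thesis by (intro exI[of _ n]) (simp add: u_def)
    next
      case PInf
      thus ?thesis by (intro exI[of _ 1]) (simp add: u_def one_ereal_def[symmetric])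
    next
      case MInf
      thus ?thesis by (cases "h x") auto
    qed
    then obtain n where n: "u n x = 1" ..
    have "x \<notin> Z n" "x \<notin> W n" using x by (auto simp: V_def N_def)
    hence "\<exists>i. \<forall>j\<ge>i. \<not> 1 / (4 * CD) * m x (1 / 2 ^ j) <= lev (u n) (1/2) x (1 / 2 ^ j)"
      using n unfolding Z_def by blast
    then obtain i where i: "\<forall>j\<ge>i. \<not> 1 / (4 * CD) * m x (1 / 2 ^ j) <= lev (u n) (1/2) x (1 / 2 ^ j)" ..
    show "thin_at p \<mu> (- V) x"
    proof (rule thin_compl[OF np N])
      show "u n y = 0" if "y \<in> - V" "y \<notin> N" for y using that by (simp add: V_def u_def)
      show "lev (u n) (1/2) x (1 / 2 ^ j) <= 1 / (4 * CD) * m x (1 / 2 ^ j)" if "i <= j" for j using i[rule_format, OF that] by linarith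
      show "summable (%k. wolff (g n) x k)" using \<open>x \<notin> W n\<close> by (simp add: W_def)
    qed
  qed
  moreover have "V \<subseteq> E" by (auto simp: V_def N_def)
  ultimately have "V \<subseteq> fine_interior p \<mu> E" unfolding fine_interior_def by blast
  thus ?thesis by (intro capnull_subset[OF N]) (auto simp: V_def)
qed

end

theorem theorem7p3:
  fixes p :: real and \<mu> :: "'a::metric_space measure" and E :: "'a set"
  assumes "p > 1"
    and "metric_measure_space \<mu>"
    and "complete (UNIV :: 'a set)"
    and "doubling \<mu>"
    and "supports_poincare p \<mu>"
  shows "newtonian0_qe p \<mu> E = newtonian0_qe p \<mu> (fine_interior p \<mu> E)"
proof -
  interpret newtonian_space p \<mu> by unfold_locales (fact assms)+
  obtain C where C: "!!x r. 0 < r ==> emeasure \<mu> (ball x (2 * r)) <= ennreal C * emeasure \<mu> (ball x r)"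
    using assms(4) unfolding doubling_def by blast
  \<comment> \<open>The maximum with 1 makes the powers of the doubling constant increase with the
    exponent.\<close>
  interpret doubling_space p \<mu> "max 1 C"
  proof unfold_locales
    fix x and r :: real assume r: "0 < r"
    have "ennreal (m x (2 * r)) <= ennreal C * ennreal (m x r)" using C[OF r] by (simp add: emeasure_ball)
    also have "... <= ennreal (max 1 C) * ennreal (m x r)" by (intro mult_right_mono ennreal_leI) auto
    also have "... = ennreal (max 1 C * m x r)" by (rule ennreal_mult'[symmetric]) simp
    finally show "m x (2 * r) <= max 1 C * m x r" by (subst (asm) ennreal_le_iff) auto
  qed simp
  have "\<exists>CP \<Lambda>. 0 < CP \<and> 1 <= \<Lambda> \<and> poincare_const CP \<Lambda>"
    using assms(5) unfolding supports_poincare_def poincare_const_def .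
  then obtain CP \<Lambda> where CP: "0 < CP" "1 <= \<Lambda>" and raw: "poincare_const CP \<Lambda>" by blast
  obtain n where "\<Lambda> < 2 ^ n" using real_arch_pow[of 2 \<Lambda>] by auto
  hence n: "\<Lambda> <= 2 ^ n" by simp
  interpret pi_space p \<mu> "max 1 C" "2 * CP * max 1 C ^ n" n
  proof unfold_locales
    show "0 < 2 * CP * max 1 C ^ n" using CP(1) by simp
    show "PI u (nug g) (2 * CP * max 1 C ^ n) n" if "npair u g" for u g by (rule poincare_npair[OF CP raw that n])
  qed
  have qe: "quasieverywhere p \<mu> (%x. x \<notin> S --> h x = 0) \<longleftrightarrow> capnull {x. x \<notin> S \<and> h x ~= 0}" for S h
    unfolding quasieverywhere_def sobolev_capacity_0_iff by simp
  have "fine_interior p \<mu> E \<subseteq> E" unfolding fine_interior_def by blast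
  hence "capnull {x. x \<notin> E \<and> h x ~= 0}" if "capnull {x. x \<notin> fine_interior p \<mu> E \<and> h x ~= 0}" for h
    by (intro capnull_subset[OF that]) auto
  thus ?thesis unfolding newtonian0_qe_def qe using capnull_diff_fine_interior by blast
qed

end
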